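(* There is an algorithm which, given a rooted tree $T$ with $n$ nodes and nonnegative real node weights, an integer $K \ge 1$ and $\epsilon > 0$, produces for the requested $k \le K$ a $k$-node summary tree of $T$ whose entropy is within an additive $\epsilon$ of the maximum entropy of a $k$-node summary tree of $T$, and runs in time $O(n + W_0 \cdot K^3)$, where $W_0 = O((K/\epsilon)\log(K/\epsilon))$ (in a real-arithmetic model where arithmetic operations and logarithms take unit time).
   Context: Let $T$ have weights $w_v\ge 0$ and total weight $W>0$. For a node $v$, $T_v$ is the subtree rooted at $v$ and $V(T_v)$ its node set. Summary trees are trees whose nodes are labeled by sets of nodes of $T$, defined recursively. If $T_v$ has one node, the only summary tree for $T_v$ is $\{v\}$. Otherwise a summary tree for $T_v$ is one of: (1) the one-node tree $V(T_v)$; (2) a root $\{v\}$ together with, for each child $x$ of $v$, a summary tree for $T_x$ whose root is made a child of $\{v\}$; (3) a root $\{v\}$, a child node $other_v$ representing a non-empty subset $U_v$ of the children of $v$ together with all their descendants (the node $\bigcup_{x\in U_v} V(T_x)$), and for each child $x\notin U_v$ a summary tree for $T_x$ whose root is made a child of $\{v\}$. A summary tree of $T$ is a summary tree for $T_r$, $r$ the root; a $k$-node summary tree has exactly $k$ nodes. The weight of a summary-tree node is the total weight of the $T$-nodes it represents, and the entropy of a summary tree with node weights $W_1,\ldots,W_k$ is $-\sum_i p_i\lg p_i$, $p_i=W_i/W$ (with $0\lg 0 = 0$). *)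

theory Defs
  imports Complex_Main
begin

section \<open>Weighted rooted trees\<close>

text \<open>The nodes are \<open>0, \<dots>, node_count T - 1\<close>. The values \<open>parent T (tree_root T)\<close>, and
  \<open>parent T v\<close> and \<open>weight T v\<close> for \<open>v \<ge> node_count T\<close>, carry no meaning.\<close>

record wtree =
  node_count :: nat
  tree_root :: nat
  parent :: "nat \<Rightarrow> nat"
  weight :: "nat \<Rightarrow> real"

definition child_rel :: "wtree \<Rightarrow> (nat \<times> nat) set" where
  "child_rel T = {(x, parent T x) | x. x < node_count T \<and> x \<noteq> tree_root T}"

definition children :: "wtree \<Rightarrow> nat \<Rightarrow> nat set" where
  "children T v = {x. (x, v) \<in> child_rel T}"

definition subtree_nodes :: "wtree \<Rightarrow> nat \<Rightarrow> nat set" where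
  "subtree_nodes T v = {u. u < node_count T \<and> (u, v) \<in> (child_rel T)\<^sup>*}"

text \<open>Cycles are excluded because the parent is a function and every node reaches the root,
  which has no outgoing pair in \<open>child_rel\<close>.\<close>

definition rooted_tree :: "wtree \<Rightarrow> bool" where
  "rooted_tree T \<longleftrightarrow>
     tree_root T < node_count T \<and>
     (\<forall>v < node_count T. v \<noteq> tree_root T \<longrightarrow> parent T v < node_count T) \<and>
     (\<forall>v < node_count T. (v, tree_root T) \<in> (child_rel T)\<^sup>*)"

definition total_weight :: "wtree \<Rightarrow> real" where
  "total_weight T = (\<Sum>v < node_count T. weight T v)"


section \<open>Summary trees\<close>

text \<open>The labels in a summary tree are nonempty and pairwise disjoint, so its nodes are
  identified with their labels. Edges are directed from parent to child.\<close>

record summary =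
  sroot :: "nat set"
  snodes :: "nat set set"
  sedges :: "(nat set \<times> nat set) set"

text \<open>If \<open>T\<^sub>v\<close> has the single node \<open>v\<close>, then \<open>collapse\<close> and \<open>expand\<close> both yield the one-node
  tree with label \<open>{v}\<close>, and \<open>other\<close> does not apply.\<close>

inductive summary_tree_at :: "wtree \<Rightarrow> nat \<Rightarrow> summary \<Rightarrow> bool" for T :: wtree where
  collapse:
    "v < node_count T \<Longrightarrow>
     summary_tree_at T v
       \<lparr>sroot = subtree_nodes T v, snodes = {subtree_nodes T v}, sedges = {}\<rparr>"
| expand:
    "v < node_count T \<Longrightarrow>
     (\<And>x. x \<in> children T v \<Longrightarrow> summary_tree_at T x (S x)) \<Longrightarrow>
     summary_tree_at T v
       \<lparr>sroot = {v},
        snodes = {{v}} \<union> (\<Union>x \<in> children T v. snodes (S x)),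
        sedges = (\<Union>x \<in> children T v. {({v}, sroot (S x))} \<union> sedges (S x))\<rparr>"
| other:
    "v < node_count T \<Longrightarrow>
     U \<subseteq> children T v \<Longrightarrow> U \<noteq> {} \<Longrightarrow>
     other_v = (\<Union>x \<in> U. subtree_nodes T x) \<Longrightarrow>
     (\<And>x. x \<in> children T v - U \<Longrightarrow> summary_tree_at T x (S x)) \<Longrightarrow>
     summary_tree_at T v
       \<lparr>sroot = {v},
        snodes = {{v}, other_v} \<union> (\<Union>x \<in> children T v - U. snodes (S x)),
        sedges = {({v}, other_v)} \<union>
                 (\<Union>x \<in> children T v - U. {({v}, sroot (S x))} \<union> sedges (S x))\<rparr>"

definition summary_tree :: "wtree \<Rightarrow> summary \<Rightarrow> bool" where
  "summary_tree T S \<longleftrightarrow> summary_tree_at T (tree_root T) S"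

definition k_summary_trees :: "wtree \<Rightarrow> nat \<Rightarrow> summary set" where
  "k_summary_trees T k = {S. summary_tree T S \<and> card (snodes S) = k}"

definition node_prob :: "wtree \<Rightarrow> nat set \<Rightarrow> real" where
  "node_prob T L = (\<Sum>v \<in> L. weight T v) / total_weight T"

definition entropy :: "wtree \<Rightarrow> summary \<Rightarrow> real" where
  "entropy T S = - (\<Sum>L \<in> snodes S. node_prob T L * log 2 (node_prob T L))"

definition max_entropy :: "wtree \<Rightarrow> nat \<Rightarrow> real" where
  "max_entropy T k = Max (entropy T ` k_summary_trees T k)"

lemma summary_tree_at_bounded:
  assumes "summary_tree_at T v S"
  shows "sroot S \<in> Pow {..<node_count T} \<and> snodes S \<subseteq> Pow {..<node_count T} \<and>
         sedges S \<subseteq> Pow {..<node_count T} \<times> Pow {..<node_count T}"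
  using assms
proof induction
  case (collapse v)
  then show ?case by (auto simp: subtree_nodes_def)
next
  case (expand v S)
  then show ?case by fastforce
next
  case (other v U other_v S)
  have "other_v \<subseteq> {..<node_count T}"
    using other by (auto simp: subtree_nodes_def)
  with other show ?case by fastforce
qed

text \<open>The set under \<open>Max\<close> in \<open>max_entropy\<close> is finite.\<close>

lemma finite_k_summary_trees: "finite (k_summary_trees T k)"
proof -
  let ?P = "Pow {..<node_count T}"
  have "k_summary_trees T k \<subseteq>
      (\<lambda>(r, N, E). \<lparr>sroot = r, snodes = N, sedges = E\<rparr>) ` (?P \<times> Pow ?P \<times> Pow (?P \<times> ?P))"
  proof
    fix S assume "S \<in> k_summary_trees T k"
    then have "(sroot S, snodes S, sedges S) \<in> ?P \<times> Pow ?P \<times> Pow (?P \<times> ?P)"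
      using summary_tree_at_bounded[of T "tree_root T" S]
      by (simp add: k_summary_trees_def summary_tree_def)
    then show "S \<in> (\<lambda>(r, N, E). \<lparr>sroot = r, snodes = N, sedges = E\<rparr>) `
        (?P \<times> Pow ?P \<times> Pow (?P \<times> ?P))"
      by (rule rev_image_eqI) simp
  qed
  then show ?thesis by (rule finite_subset) simp
qed


section \<open>Real-arithmetic machine\<close>

text \<open>A store consists of named arrays of natural numbers and named arrays of reals, all
  unbounded; a scalar is the cell of index 0. Array indices are natural numbers. A natural number
  can be converted to a real, but there is no conversion back (no floor), no integer
  division, and no real literal other than a converted natural number.\<close>

record store =
  nats :: "string \<Rightarrow> nat \<Rightarrow> nat"
  reals :: "string \<Rightarrow> nat \<Rightarrow> real"

datatype nexp =
    NConst nat
  | NCell string nexp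
  | NAdd nexp nexp
  | NSub nexp nexp
  | NMul nexp nexp

datatype rexp =
    ROfNat nexp
  | RCell string nexp
  | RAdd rexp rexp
  | RSub rexp rexp
  | RMul rexp rexp
  | RDiv rexp rexp
  | RLog rexp

datatype bexp =
    NLess nexp nexp
  | RLess rexp rexp
  | BNot bexp
  | BAnd bexp bexp

datatype com =
    Skip
  | NAssign string nexp nexp
  | RAssign string nexp rexp
  | Seq com com
  | If bexp com com
  | While bexp com

primrec nval :: "store \<Rightarrow> nexp \<Rightarrow> nat" where
  "nval s (NConst c) = c"
| "nval s (NCell a i) = nats s a (nval s i)"
| "nval s (NAdd e f) = nval s e + nval s f"
| "nval s (NSub e f) = nval s e - nval s f"
| "nval s (NMul e f) = nval s e * nval s f"

primrec rval :: "store \<Rightarrow> rexp \<Rightarrow> real" where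
  "rval s (ROfNat e) = real (nval s e)"
| "rval s (RCell a i) = reals s a (nval s i)"
| "rval s (RAdd e f) = rval s e + rval s f"
| "rval s (RSub e f) = rval s e - rval s f"
| "rval s (RMul e f) = rval s e * rval s f"
| "rval s (RDiv e f) = rval s e / rval s f"
| "rval s (RLog e) = log 2 (rval s e)"

primrec bval :: "store \<Rightarrow> bexp \<Rightarrow> bool" where
  "bval s (NLess e f) \<longleftrightarrow> nval s e < nval s f"
| "bval s (RLess e f) \<longleftrightarrow> rval s e < rval s f"
| "bval s (BNot b) \<longleftrightarrow> \<not> bval s b"
| "bval s (BAnd b c) \<longleftrightarrow> bval s b \<and> bval s c"

primrec ncost :: "nexp \<Rightarrow> nat" where
  "ncost (NConst c) = 1"
| "ncost (NCell a i) = 1 + ncost i"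
| "ncost (NAdd e f) = 1 + ncost e + ncost f"
| "ncost (NSub e f) = 1 + ncost e + ncost f"
| "ncost (NMul e f) = 1 + ncost e + ncost f"

primrec rcost :: "rexp \<Rightarrow> nat" where
  "rcost (ROfNat e) = 1 + ncost e"
| "rcost (RCell a i) = 1 + ncost i"
| "rcost (RAdd e f) = 1 + rcost e + rcost f"
| "rcost (RSub e f) = 1 + rcost e + rcost f"
| "rcost (RMul e f) = 1 + rcost e + rcost f"
| "rcost (RDiv e f) = 1 + rcost e + rcost f"
| "rcost (RLog e) = 1 + rcost e"

primrec bcost :: "bexp \<Rightarrow> nat" where
  "bcost (NLess e f) = 1 + ncost e + ncost f"
| "bcost (RLess e f) = 1 + rcost e + rcost f"
| "bcost (BNot b) = 1 + bcost b"
| "bcost (BAnd b c) = 1 + bcost b + bcost c"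

text \<open>\<open>exec c s t s'\<close>: started in store \<open>s\<close>, the program \<open>c\<close> halts after exactly \<open>t\<close> unit-cost
  operations in store \<open>s'\<close>.\<close>

inductive exec :: "com \<Rightarrow> store \<Rightarrow> nat \<Rightarrow> store \<Rightarrow> bool" where
  exec_Skip: "exec Skip s 1 s"
| exec_NAssign:
    "exec (NAssign a i e) s (1 + ncost i + ncost e)
       (s\<lparr>nats := (nats s)(a := (nats s a)(nval s i := nval s e))\<rparr>)"
| exec_RAssign:
    "exec (RAssign a i e) s (1 + ncost i + rcost e)
       (s\<lparr>reals := (reals s)(a := (reals s a)(nval s i := rval s e))\<rparr>)"
| exec_Seq: "exec c s t s' \<Longrightarrow> exec d s' u s'' \<Longrightarrow> exec (Seq c d) s (t + u) s''"
| exec_IfTrue: "bval s b \<Longrightarrow> exec c s t s' \<Longrightarrow> exec (If b c d) s (1 + bcost b + t) s'"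
| exec_IfFalse: "\<not> bval s b \<Longrightarrow> exec d s t s' \<Longrightarrow> exec (If b c d) s (1 + bcost b + t) s'"
| exec_WhileFalse: "\<not> bval s b \<Longrightarrow> exec (While b c) s (1 + bcost b) s"
| exec_WhileTrue:
    "bval s b \<Longrightarrow> exec c s t s' \<Longrightarrow> exec (While b c) s' u s'' \<Longrightarrow>
     exec (While b c) s (1 + bcost b + t + u) s''"

inductive_cases exec_SkipE: "exec Skip s t s'"
inductive_cases exec_NAssignE: "exec (NAssign a i e) s t s'"
inductive_cases exec_RAssignE: "exec (RAssign a i e) s t s'"
inductive_cases exec_SeqE: "exec (Seq c d) s t s'"
inductive_cases exec_IfE: "exec (If b c d) s t s'"
inductive_cases exec_WhileE: "exec (While b c) s t s'"

lemma exec_deterministic: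
  "exec c s t s' \<Longrightarrow> exec c s u s'' \<Longrightarrow> u = t \<and> s'' = s'"
proof (induction arbitrary: u s'' rule: exec.induct)
  case (exec_Seq c s t s' d u' s2)
  from exec_Seq.prems show ?case
    by (rule exec_SeqE) (use exec_Seq.IH in metis)
next
  case (exec_IfTrue s b c t s' d)
  from exec_IfTrue.prems show ?case
    by (rule exec_IfE) (use exec_IfTrue.hyps in \<open>auto dest: exec_IfTrue.IH\<close>)
next
  case (exec_IfFalse s b d t s' c)
  from exec_IfFalse.prems show ?case
    by (rule exec_IfE) (use exec_IfFalse.hyps in \<open>auto dest: exec_IfFalse.IH\<close>)
next
  case (exec_WhileFalse s b c)
  from exec_WhileFalse.prems show ?case
    by (rule exec_WhileE) (use exec_WhileFalse.hyps in simp_all)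
next
  case (exec_WhileTrue s b c t s' u' s2)
  from exec_WhileTrue.prems show ?case
    by (rule exec_WhileE) (use exec_WhileTrue.hyps in \<open>auto dest: exec_WhileTrue.IH\<close>)
qed (erule exec_SkipE exec_NAssignE exec_RAssignE, simp)+


section \<open>Input and output encoding\<close>

text \<open>The tree is given by an array of parents, with the root stored as its own parent, and an
  array of weights. All cells not used by the input are 0.\<close>

definition input_store :: "wtree \<Rightarrow> nat \<Rightarrow> nat \<Rightarrow> real \<Rightarrow> store" where
  "input_store T K k \<epsilon> =
     \<lparr>nats = (\<lambda>_ _. 0)
        (''n'' := (\<lambda>_. 0)(0 := node_count T),
         ''root'' := (\<lambda>_. 0)(0 := tree_root T),
         ''parent'' := (\<lambda>v. if v = tree_root T then tree_root T
                            else if v < node_count T then parent T v else 0),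
         ''K'' := (\<lambda>_. 0)(0 := K),
         ''k'' := (\<lambda>_. 0)(0 := k)),
      reals = (\<lambda>_ _. 0)
        (''weight'' := (\<lambda>v. if v < node_count T then weight T v else 0),
         ''eps'' := (\<lambda>_. 0)(0 := \<epsilon>))\<rparr>"

text \<open>The nodes of the output summary tree are numbered \<open>0, \<dots>, k - 1\<close>, its root being 0. The array
  \<open>label\<close> maps each of the \<open>n\<close> nodes of the input tree to the number of the summary-tree node
  representing it; the array \<open>sparent\<close> holds the parents of the nodes \<open>1, \<dots>, k - 1\<close>.\<close>

definition output_label :: "nat \<Rightarrow> store \<Rightarrow> nat \<Rightarrow> nat set" where
  "output_label n s j = {v. v < n \<and> nats s ''label'' v = j}"

definition output_summary :: "nat \<Rightarrow> nat \<Rightarrow> store \<Rightarrow> summary" where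
  "output_summary n k s =
     \<lparr>sroot = output_label n s 0,
      snodes = output_label n s ` {..<k},
      sedges = {(output_label n s (nats s ''sparent'' j), output_label n s j) | j.
                  1 \<le> j \<and> j < k}\<rparr>"

end

theory Submission
  imports Defs
begin

text \<open>Entropy is measured by the values \<open>plogp p = - p lg p\<close> of the parts. Merging a part of
  probability \<open>p\<close> into another one costs at most \<open>lose p = plogp p + 2 p\<close>. So a subtree with
  \<open>lose p < \<epsilon> / k\<close> may always be collapsed or put into \<open>other\<close>: in a \<open>k\<close>-node tree this costs less than
  \<open>\<epsilon>\<close> altogether. The remaining heavy nodes have probability at least \<open>1 / W\<^sub>0\<close>; on each of the
  \<open>k\<close> relevant levels there are at most \<open>W\<^sub>0\<close> of them, and only these (active) nodes get a table \<open>D v j\<close>,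
  the best value obtainable from the subtree of \<open>v\<close> with at most \<open>j\<close> nodes.

  One more node increases the value of a subtree of probability \<open>p\<close> by at most \<open>2 p\<close>
  (\<open>D v (j + 1) \<le> D v j + 2 p\<close>), whereas taking one of two heavier siblings out of \<open>other\<close> gains at least
  that much. Exchanging along these lines, the children of \<open>v\<close> outside \<open>other\<close> may be assumed to be the
  heaviest ones, a prefix of the sorted list with at most one element left out. So a node with
  \<open>m \<le> k\<close> sorted active children costs \<open>O((m + 1)\<^sup>2 k\<^sup>2)\<close>. Nodes with \<open>m \<ge> 2\<close> are charged to the at most
  \<open>W\<^sub>0\<close> lowest heavy nodes, which bounds the sum of \<open>(m + 1)\<^sup>2\<close> by \<open>O(k W\<^sub>0)\<close>. Backtracking yields
  a near-optimal tree with at most \<open>k\<close> nodes, and refining it to exactly \<open>k\<close> nodes never decreases the entropy.\<close>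

section \<open>Running times\<close>

text \<open>The loss of a merge, \<open>gain a b\<close>, is \<open>a + b\<close> times a binary
  entropy. Three facts about it carry the exchange argument: it is at most \<open>a + b\<close>, it
  increases in both arguments, and \<open>gain x x = 2 * x\<close>. The first limits what a row can
  win by one more node. The other two show that two siblings in \<open>other\<close>, both at least
  as heavy as \<open>x\<close>, repay a node taken from \<open>x\<close>; as one of the two has to
  stay behind, one gap may remain.

  The obstacle is a circle. That prefixes with one gap suffice at \<open>v\<close> rests on slow
  growth of the children's rows, while slow growth at \<open>v\<close> rests on optimality at
  \<open>v\<close> among all options. \<open>active_upper_slow\<close> proves both together from the
  leaves upwards. The table has to supply just two properties: it dominates every candidate tried,
  and each entry is the collapsed value or attained by an option. Domination bounds all
  \<open>k\<close>-node summary trees, attainment guides the backtracking.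

  Depths from \<open>k\<close> on cannot matter, because a kept node needs all its proper ancestors
  as singletons.\<close>

definition upn :: "store \<Rightarrow> string \<Rightarrow> nat \<Rightarrow> nat \<Rightarrow> store" where
  "upn s a i x = s\<lparr>nats := (nats s)(a := (nats s a)(i := x))\<rparr>"

definition upr :: "store \<Rightarrow> string \<Rightarrow> nat \<Rightarrow> real \<Rightarrow> store" where
  "upr s a i x = s\<lparr>reals := (reals s)(a := (reals s a)(i := x))\<rparr>"

lemma up_simps [simp]:
  "nats (upn s a i x) b = (if b = a then (nats s a)(i := x) else nats s b)"
  "reals (upn s a i x) = reals s"
  "reals (upr s a i y) b = (if b = a then (reals s a)(i := y) else reals s b)"
  "nats (upr s a i y) = nats s"
  by (simp_all add: upn_def upr_def)

fun loopfree :: "com \<Rightarrow> bool" where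
  "loopfree (Seq c d) = (loopfree c \<and> loopfree d)"
| "loopfree (If b c d) = (loopfree c \<and> loopfree d)"
| "loopfree (While b c) = False"
| "loopfree _ = True"

text \<open>On loop-free code the relation \<open>exec\<close> is a function, so straight-line code
  is verified by simplification. The value for \<open>While\<close> is a dummy that
  \<open>exec_sem\<close> excludes.\<close>

primrec sem :: "com \<Rightarrow> store \<Rightarrow> store" where
  "sem Skip s = s"
| "sem (NAssign a i e) s = upn s a (nval s i) (nval s e)"
| "sem (RAssign a i e) s = upr s a (nval s i) (rval s e)"
| "sem (Seq c d) s = sem d (sem c s)"
| "sem (If b c d) s = (if bval s b then sem c s else sem d s)"
| "sem (While b c) s = s"

text \<open>Adding both branches of an \<open>If\<close> avoids a maximum. A \<open>While\<close>
  counts as one round: this bounds no execution, but time constants such as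
  \<open>T_inc_step\<close> use it to cover the loop-free pieces around a loop.\<close>

primrec maxcost :: "com \<Rightarrow> nat" where
  "maxcost Skip = 1"
| "maxcost (NAssign a i e) = 1 + ncost i + ncost e"
| "maxcost (RAssign a i e) = 1 + ncost i + rcost e"
| "maxcost (Seq c d) = maxcost c + maxcost d"
| "maxcost (If b c d) = 1 + bcost b + maxcost c + maxcost d"
| "maxcost (While b c) = 1 + bcost b + maxcost c"

lemma exec_sem: "loopfree c \<Longrightarrow> \<exists>t \<le> maxcost c. exec c s t (sem c s)"
proof (induction c arbitrary: s)
  case Skip
  then show ?case using exec_Skip by auto
next
  case (NAssign a i e)
  then show ?case using exec_NAssign by (auto simp: upn_def)
next
  case (RAssign a i e)
  then show ?case using exec_RAssign by (auto simp: upr_def)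
next
  case (Seq c d)
  then obtain t u where "t \<le> maxcost c" "exec c s t (sem c s)"
    "u \<le> maxcost d" "exec d (sem c s) u (sem d (sem c s))" by fastforce
  then show ?case by (auto intro!: exI[of _ "t + u"] exec_Seq)
next
  case (If b c d)
  then obtain t u where "t \<le> maxcost c" "exec c s t (sem c s)"
    "u \<le> maxcost d" "exec d s u (sem d s)" by fastforce
  show ?case
    proof (cases "bval s b")
      case True
      then show ?thesis using exec_IfTrue[OF True \<open>exec c s t (sem c s)\<close>] \<open>t \<le> maxcost c\<close>
        by (intro exI[of _ "1 + bcost b + t"]) simp
    next
      case False
      then show ?thesis using exec_IfFalse[OF False \<open>exec d s u (sem d s)\<close>] \<open>u \<le> maxcost d\<close>
        by (intro exI[of _ "1 + bcost b + u"]) simp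
    qed
qed auto

section \<open>Preservation of unwritten arrays and timed total correctness\<close>

primrec nwrites :: "com \<Rightarrow> string set" where
  "nwrites Skip = {}"
| "nwrites (NAssign a i e) = {a}"
| "nwrites (RAssign a i e) = {}"
| "nwrites (Seq c d) = nwrites c \<union> nwrites d"
| "nwrites (If b c d) = nwrites c \<union> nwrites d"
| "nwrites (While b c) = nwrites c"

primrec rwrites :: "com \<Rightarrow> string set" where
  "rwrites Skip = {}"
| "rwrites (NAssign a i e) = {}"
| "rwrites (RAssign a i e) = {a}"
| "rwrites (Seq c d) = rwrites c \<union> rwrites d"
| "rwrites (If b c d) = rwrites c \<union> rwrites d"
| "rwrites (While b c) = rwrites c"

text \<open>Preservation is read off the syntax, so a loop invariant has to mention only arrays that
  the body writes; the rest is recovered through \<open>frame_nats\<close> and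
  \<open>frame_reals\<close>.\<close>

definition frame :: "com \<Rightarrow> store \<Rightarrow> store \<Rightarrow> bool" where
  "frame c s s' \<longleftrightarrow> (\<forall>a. a \<notin> nwrites c \<longrightarrow> nats s' a = nats s a) \<and>
     (\<forall>a. a \<notin> rwrites c \<longrightarrow> reals s' a = reals s a)"

lemma frame_nats: "frame c s s' \<Longrightarrow> a \<notin> nwrites c \<Longrightarrow> nats s' a = nats s a"
  and frame_reals: "frame c s s' \<Longrightarrow> a \<notin> rwrites c \<Longrightarrow> reals s' a = reals s a"
  by (auto simp: frame_def)

lemma frame_trans: "frame c s s' \<Longrightarrow> frame c s' s'' \<Longrightarrow> frame c s s''"
  by (auto simp: frame_def)

lemma frame_refl [simp]: "frame c s s"
  by (auto simp: frame_def)

lemma exec_frame: "exec c s t s' \<Longrightarrow> frame c s s'"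
  by (induction rule: exec.induct) (auto simp: frame_def)

text \<open>A total-correctness triple with an upper bound for the time. The bound need not be
  exact, so that costs of branches can be rounded up to a common value.\<close>

definition runs :: "com \<Rightarrow> store \<Rightarrow> nat \<Rightarrow> (store \<Rightarrow> bool) \<Rightarrow> bool" where
  "runs c s t Q \<longleftrightarrow> (\<exists>t' s'. exec c s t' s' \<and> t' \<le> t \<and> Q s')"

lemma runs_conseq: "runs c s t Q \<Longrightarrow> t \<le> t' \<Longrightarrow> (\<And>s'. frame c s s' \<Longrightarrow> Q s' \<Longrightarrow> R s') \<Longrightarrow> runs c s t' R"
  unfolding runs_def by (meson exec_frame order_trans)

lemma runs_loopfree: "loopfree c \<Longrightarrow> Q (sem c s) \<Longrightarrow> maxcost c \<le> t \<Longrightarrow> runs c s t Q"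
  unfolding runs_def by (meson exec_sem order_trans)

lemma runs_Seq:
  "runs c s t Q \<Longrightarrow> (\<And>s'. frame c s s' \<Longrightarrow> Q s' \<Longrightarrow> runs d s' u R) \<Longrightarrow> t + u \<le> m \<Longrightarrow> runs (Seq c d) s m R"
  unfolding runs_def by (meson exec_frame exec_Seq add_mono order_trans)

lemma runs_If:
  "(bval s b \<Longrightarrow> runs c s t Q) \<Longrightarrow> (\<not> bval s b \<Longrightarrow> runs d s t Q) \<Longrightarrow> 1 + bcost b + t \<le> u \<Longrightarrow>
   runs (If b c d) s u Q"
  unfolding runs_def
  by (cases "bval s b") (metis exec_IfTrue exec_IfFalse add_mono_thms_linordered_semiring(2) order_trans)+

text \<open>The number of rounds is fixed in advance and the invariant is indexed by the rounds
  done; hence termination needs no separate measure and the time is a finite sum with a bound for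
  each round.\<close>

lemma runs_While:
  assumes init: "I 0 s0"
    and step: "\<And>i s. i < N \<Longrightarrow> I i s \<Longrightarrow> frame c s0 s \<Longrightarrow> bval s b \<and> runs c s (t i) (I (Suc i))"
    and final: "\<And>s. I N s \<Longrightarrow> frame c s0 s \<Longrightarrow> \<not> bval s b"
    and time: "(\<Sum>i<N. 1 + bcost b + t i) + (1 + bcost b) \<le> u"
  shows "runs (While b c) s0 u (I N)"
proof -
  \<comment> \<open>Generalised to runs that enter at round \<open>M\<close>, so that the induction
    can go downwards from the exit at \<open>N\<close>.\<close>
  have "\<exists>v s'. exec (While b c) s v s' \<and> v \<le> (\<Sum>i=M..<N. 1 + bcost b + t i) + (1 + bcost b) \<and> I N s'"
    if "M \<le> N" "I M s" "frame c s0 s" for M s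
    using that
  proof (induction M arbitrary: s rule: inc_induct)
    case base
    then show ?case using exec_WhileFalse[OF final] by (intro exI[of _ "1 + bcost b"] exI[of _ s]) simp
  next
    case (step M)
    obtain t' s' where s': "exec c s t' s'" "t' \<le> t M" "I (Suc M) s'" "bval s b"
      using assms(2)[OF step.hyps(2) step.prems] unfolding runs_def by auto
    obtain v s'' where "exec (While b c) s' v s''"
      "v \<le> (\<Sum>i=Suc M..<N. 1 + bcost b + t i) + (1 + bcost b)" "I N s''"
      using step.IH[OF s'(3) frame_trans[OF step.prems(2) exec_frame[OF s'(1)]]] by auto
    moreover have "(\<Sum>i=M..<N. 1 + bcost b + t i) = 1 + bcost b + t M + (\<Sum>i=Suc M..<N. 1 + bcost b + t i)"
      using step.hyps by (simp add: sum.atLeast_Suc_lessThan)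
    ultimately show ?case
      using exec_WhileTrue[OF s'(4,1)] s'(2)
      by (intro exI[of _ "1 + bcost b + t' + v"] exI[of _ s'']) (simp del: sum.op_ivl_Suc)
  qed
  from this[of 0, OF _ init] show ?thesis
    using time unfolding runs_def by (force simp: atLeast0LessThan)
qed

section \<open>Entropy of splitting and merging\<close>

text \<open>The convention for 0 holds by itself: the factor \<open>p\<close> vanishes whatever
  \<open>log 2 0\<close> is.\<close>

definition plogp :: "real \<Rightarrow> real" where
  "plogp p = - (p * log 2 p)"

text \<open>The entropy lost when parts \<open>a\<close> and \<open>b\<close> are merged, which is
  \<open>a + b\<close> times the binary entropy of \<open>a / (a + b)\<close>.\<close>

definition gain :: "real \<Rightarrow> real \<Rightarrow> real" where
  "gain a b = plogp a + plogp b - plogp (a + b)"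

lemma plogp_0 [simp]: "plogp 0 = 0"
  by (simp add: plogp_def)

lemma plogp_nonneg: "0 \<le> p \<Longrightarrow> p \<le> 1 \<Longrightarrow> 0 \<le> plogp p"
  by (cases "p = 0") (simp_all add: plogp_def mult_nonneg_nonpos)

lemma gain_commute: "gain a b = gain b a"
  by (simp add: gain_def add.commute)

lemma gain_0 [simp]: "gain 0 b = 0" "gain a 0 = 0"
  by (simp_all add: gain_def)

lemma gain_pos: "0 < a \<Longrightarrow> 0 < b \<Longrightarrow> gain a b = a * log 2 ((a + b) / a) + b * log 2 ((a + b) / b)"
  by (simp add: gain_def plogp_def log_divide algebra_simps)

lemma gain_nonneg: "0 \<le> a \<Longrightarrow> 0 \<le> b \<Longrightarrow> 0 \<le> gain a b"
  by (cases "a = 0"; cases "b = 0") (auto simp: gain_pos intro!: add_nonneg_nonneg mult_nonneg_nonneg)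

lemma gain_double: "0 \<le> x \<Longrightarrow> gain x x = 2 * x"
  by (cases "x = 0") (auto simp: gain_pos)

lemma log2_le: "0 < x \<Longrightarrow> log 2 x \<le> (x - 1) / ln 2"
  unfolding log_def by (intro divide_right_mono ln_le_minus_one) auto

text \<open>Gibbs' inequality against a fair coin: halving the arguments of the logarithms takes out
  the summand \<open>a + b\<close>, and the linear bounds from \<open>log2_le\<close> for the
  remaining terms add up to 0.\<close>

lemma gain_le_sum:
  assumes "0 \<le> a" "0 \<le> b"
  shows "gain a b \<le> a + b"
proof (cases "a = 0 \<or> b = 0")
  case False
  with assms have ab: "0 < a" "0 < b" by auto
  have "a * log 2 ((a + b) / (2 * a)) + b * log 2 ((a + b) / (2 * b)) \<le>
      a * (((a + b) / (2 * a) - 1) / ln 2) + b * (((a + b) / (2 * b) - 1) / ln 2)"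
    using ab by (intro add_mono mult_left_mono log2_le) auto
  also have "\<dots> = (a * ((a + b) / (2 * a) - 1) + b * ((a + b) / (2 * b) - 1)) / ln 2"
    by (simp add: add_divide_distrib)
  also have "a * ((a + b) / (2 * a) - 1) + b * ((a + b) / (2 * b) - 1) = 0"
    using ab by (simp add: field_simps)
  finally show ?thesis
    using ab by (simp add: gain_pos log_divide log_mult algebra_simps)
qed (use assms in auto)

lemma plogp_has_derivative:
  "0 < x \<Longrightarrow> (plogp has_real_derivative (- log 2 x - 1 / ln 2)) (at x)"
  unfolding plogp_def log_def
  by (rule derivative_eq_intros refl | force simp: field_simps)+

text \<open>The derivative in \<open>a\<close> is \<open>log 2 (a + b) - log 2 a\<close>, as the
  constants \<open>1 / ln 2\<close> cancel. At \<open>a = 0\<close>, where \<open>plogp\<close> has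
  no derivative, nonnegativity of \<open>gain\<close> takes over.\<close>

lemma gain_mono_left:
  assumes "0 \<le> a" "a \<le> a'" "0 \<le> b"
  shows "gain a b \<le> gain a' b"
proof (cases "a = 0 \<or> b = 0")
  case False
  with assms have "0 < a" "0 < b" by auto
  have "\<exists>y. ((\<lambda>a. gain a b) has_real_derivative y) (at x) \<and> 0 \<le> y" if "a \<le> x" for x
  proof -
    have "0 < x" using that \<open>0 < a\<close> by simp
    have "((\<lambda>a. plogp (a + b)) has_real_derivative (- log 2 (x + b) - 1 / ln 2)) (at x)"
      using plogp_has_derivative[of "x + b"] \<open>0 < x\<close> \<open>0 < b\<close> by (simp add: DERIV_shift)
    then have "((\<lambda>a. gain a b) has_real_derivative (log 2 (x + b) - log 2 x)) (at x)"
      unfolding gain_def using plogp_has_derivative[OF \<open>0 < x\<close>]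
      by (auto intro!: derivative_eq_intros)
    moreover have "0 \<le> log 2 (x + b) - log 2 x"
      using \<open>0 < x\<close> \<open>0 < b\<close> by simp
    ultimately show ?thesis by blast
  qed
  then show ?thesis
    using DERIV_nonneg_imp_nondecreasing[of a a' "\<lambda>a. gain a b"] assms by auto
qed (use assms gain_nonneg[of a' b] in auto)

lemma gain_mono: "0 \<le> a \<Longrightarrow> a \<le> a' \<Longrightarrow> 0 \<le> b \<Longrightarrow> b \<le> b' \<Longrightarrow> gain a b \<le> gain a' b'"
  using gain_mono_left[of a a' b] gain_mono_left[of b b' a'] by (simp add: gain_commute)

text \<open>With \<open>z - y\<close> as the common second part this is \<open>gain_mono\<close>. It
  is applied with \<open>z\<close> the weight of \<open>other\<close>: a kept child of weight
  \<open>x\<close> changes places with a child of weight \<open>y\<close> inside.\<close>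

lemma plogp_swap:
  assumes "0 \<le> x" "x \<le> y" "y \<le> z"
  shows "plogp x + plogp z \<le> plogp y + plogp (z - y + x)"
  using gain_mono[of x y "z - y" "z - y"] assms by (simp add: gain_def add.commute)

text \<open>The linear term does two jobs. It bounds what the receiving part loses in a merge, via
  \<open>inverse_ln2_le\<close>; and it keeps the derivative nonnegative up to 1, where
  \<open>plogp\<close> alone decreases, so that a light node has only light descendants.\<close>

definition lose :: "real \<Rightarrow> real" where
  "lose p = plogp p + 2 * p"

lemma inverse_ln2_le: "1 / ln 2 \<le> (2 :: real)"
proof -
  have "1 / 2 \<le> ln (2 :: real)"
    using exp_half_le2 by (subst ln_ge_iff) auto
  then show ?thesis by (simp add: field_simps)
qed

text \<open>The part \<open>p\<close> contributes at most \<open>plogp p\<close> because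
  \<open>p + q \<le> 1\<close>. The receiver contributes at most \<open>p / ln 2\<close> by
  linearising the logarithm, a bound in which \<open>q\<close> has cancelled.\<close>

lemma gain_le_lose:
  assumes "0 \<le> p" "0 \<le> q" "p + q \<le> 1"
  shows "gain p q \<le> lose p"
proof (cases "p = 0 \<or> q = 0")
  case False
  with assms have pq: "0 < p" "0 < q" by auto
  have "log 2 ((p + q) / p) \<le> - log 2 p"
    using pq assms by (simp add: log_divide)
  moreover have "log 2 ((p + q) / q) \<le> p / q * 2"
  proof -
    have "log 2 ((p + q) / q) \<le> ((p + q) / q - 1) / ln 2"
      using pq by (intro log2_le) auto
    also have "\<dots> = p / q * (1 / ln 2)" using pq by (simp add: field_simps)
    also have "\<dots> \<le> p / q * 2" using pq inverse_ln2_le by (intro mult_left_mono) auto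
    finally show ?thesis .
  qed
  ultimately have "p * log 2 ((p + q) / p) + q * log 2 ((p + q) / q) \<le> p * (- log 2 p) + q * (p / q * 2)"
    using pq by (intro add_mono mult_left_mono) auto
  then show ?thesis using pq by (simp add: gain_pos lose_def plogp_def)
qed (use assms plogp_nonneg[of p] in \<open>auto simp: lose_def\<close>)

lemma lose_mono:
  assumes "0 \<le> p" "p \<le> q" "q \<le> 1"
  shows "lose p \<le> lose q"
proof (cases "p = 0")
  case True
  then show ?thesis using assms plogp_nonneg[of q] by (simp add: lose_def)
next
  case False
  with assms have "0 < p" by simp
  have "\<exists>y. (lose has_real_derivative y) (at x) \<and> 0 \<le> y" if "p \<le> x" "x \<le> q" for x
  proof -
    have "0 < x" using that \<open>0 < p\<close> by simp
    have "(lose has_real_derivative (- log 2 x - 1 / ln 2 + 2)) (at x)"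
      unfolding lose_def using plogp_has_derivative[OF \<open>0 < x\<close>]
      by (auto intro!: derivative_eq_intros)
    moreover have "log 2 x \<le> 0" using \<open>0 < x\<close> that assms by simp
    ultimately show ?thesis using inverse_ln2_le by force
  qed
  then show ?thesis
    using DERIV_nonneg_imp_nondecreasing[of p q lose] assms by auto
qed

text \<open>The parts are absorbed one at a time. Since \<open>gain_le_lose\<close> depends only on
  the part absorbed, the mass accumulated so far does not spoil the bound.\<close>

lemma merge_plogp:
  assumes "finite I" "0 \<le> a" "\<And>i. i \<in> I \<Longrightarrow> 0 \<le> p i" "a + sum p I \<le> 1" "\<And>i. i \<in> I \<Longrightarrow> lose (p i) \<le> c"
  shows "plogp a + (\<Sum>i\<in>I. plogp (p i)) \<le> plogp (a + sum p I) + c * card I"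
  using assms
proof (induction I)
  case (insert i I)
  have s: "0 \<le> sum p I" using insert by (intro sum_nonneg) auto
  have "gain (p i) (a + sum p I) \<le> c"
    using gain_le_lose[of "p i" "a + sum p I"] insert.prems insert.hyps s
      insert.prems(4)[of i] order_trans[OF _ insert.prems(4)[of i]] by (auto simp: algebra_simps)
  moreover have "plogp a + (\<Sum>i\<in>I. plogp (p i)) \<le> plogp (a + sum p I) + c * card I"
    using insert.prems insert.hyps by (intro insert.IH) (auto simp: add.left_commute intro: order_trans[rotated])
  ultimately show ?case
    using insert.hyps by (simp add: gain_def algebra_simps)
qed simp

text \<open>With \<open>X = K / \<epsilon>\<close>: the weight \<open>1 / heavy_bound X\<close> is below the threshold of light nodes.\<close>

definition heavy_bound :: "real \<Rightarrow> real" where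
  "heavy_bound X = 16 * max 1 (X * log 2 X)"

lemma heavy_bound_ge: "16 \<le> heavy_bound X"
  by (simp add: heavy_bound_def)

text \<open>With \<open>H = heavy_bound X\<close> the claim is \<open>X * (log 2 H + 2) < H\<close>.
  The factor 16 is a power of two with enough room: for \<open>X \<le> 2\<close> the left side is at
  most 14, and for \<open>X > 2\<close> the bracket is at most \<open>7 * log 2 X\<close>.\<close>

lemma lose_heavy_bound:
  assumes "0 < X"
  shows "lose (1 / heavy_bound X) < 1 / X"
proof -
  have pos: "0 < heavy_bound X" using heavy_bound_ge[of X] by simp
  have main: "X * (log 2 (heavy_bound X) + 2) < heavy_bound X"
  proof (cases "X \<le> 2")
    case True
    have "X * log 2 X \<le> 2"
    proof (cases "X \<le> 1")
      case True
      then have "X * log 2 X \<le> 0" using assms by (intro mult_nonneg_nonpos) auto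
      then show ?thesis by simp
    next
      case False
      then have "X * log 2 X \<le> 2 * log 2 2" using \<open>X \<le> 2\<close> by (intro mult_mono) auto
      then show ?thesis by simp
    qed
    then have "heavy_bound X \<le> 2 ^ 5" by (simp add: heavy_bound_def)
    then have "log 2 (heavy_bound X) \<le> log 2 (2 ^ 5)" using pos by simp
    also have "log 2 (2 ^ 5 :: real) = 5" by (subst log_nat_power) auto
    finally have "X * (log 2 (heavy_bound X) + 2) \<le> 2 * 7" 
      using True assms heavy_bound_ge[of X] by (intro mult_mono) auto
    then show ?thesis using heavy_bound_ge[of X] by simp
  next
    case False
    then have X: "2 < X" by simp
    then have l1: "1 \<le> log 2 X" by simp
    have hb: "heavy_bound X = 2 ^ 4 * (X * log 2 X)"
      using mult_mono[of 1 X 1 "log 2 X"] X l1 by (simp add: heavy_bound_def)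
    have "log 2 (2 ^ 4 :: real) = 4" by (subst log_nat_power) auto
    then have "log 2 (heavy_bound X) = 4 + (log 2 X + log 2 (log 2 X))"
      using X l1 unfolding hb by (simp only: log_mult_pos mult_pos_pos zero_less_power zero_less_numeral less_trans[OF zero_less_one] order.strict_trans2[OF zero_less_one] order.strict_trans[OF zero_less_two])
    also have "log 2 (log 2 X) \<le> (log 2 X - 1) / ln 2"
      using l1 by (intro log2_le) auto
    also have "\<dots> \<le> (log 2 X - 1) * 2"
      using l1 inverse_ln2_le mult_left_mono[of "1 / ln 2" 2 "log 2 X - 1"] by simp
    finally have "log 2 (heavy_bound X) + 2 < 16 * log 2 X" using l1 by simp
    then have "X * (log 2 (heavy_bound X) + 2) < X * (16 * log 2 X)" using X by (intro mult_strict_left_mono) auto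
    then show ?thesis by (simp add: hb)
  qed
  have "lose (1 / heavy_bound X) = (log 2 (heavy_bound X) + 2) / heavy_bound X"
    using pos by (simp add: lose_def plogp_def log_divide add_divide_distrib)
  also have "\<dots> < 1 / X" using main pos assms by (simp add: field_simps)
  finally show ?thesis .
qed

lemma heavy_weight:
  assumes "0 < X" "1 / X \<le> lose p" "0 \<le> p" "p \<le> 1"
  shows "1 \<le> p * heavy_bound X"
proof (rule ccontr)
  assume "\<not> ?thesis"
  then have lt: "p < 1 / heavy_bound X" using heavy_bound_ge[of X] by (simp add: field_simps)
  then have "lose p \<le> lose (1 / heavy_bound X)"
    using assms heavy_bound_ge[of X] by (intro lose_mono) auto
  with lose_heavy_bound[OF assms(1)] assms(2) show False by simp
qed

section \<open>Node probabilities\<close>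

locale weighted_tree =
  fixes T :: wtree
  assumes rooted: "rooted_tree T"
    and weight_nonneg: "v < node_count T \<Longrightarrow> 0 \<le> weight T v"
    and total_pos: "0 < total_weight T"
begin

abbreviation n :: nat where "n \<equiv> node_count T"
abbreviation rt :: nat where "rt \<equiv> tree_root T"
abbreviation par :: "nat \<Rightarrow> nat" where "par \<equiv> parent T"
abbreviation ch :: "nat \<Rightarrow> nat set" where "ch \<equiv> children T"
abbreviation sub :: "nat \<Rightarrow> nat set" where "sub \<equiv> subtree_nodes T"

definition pw :: "nat \<Rightarrow> real" where "pw v = weight T v / total_weight T"
definition ps :: "nat \<Rightarrow> real" where "ps v = (\<Sum>u\<in>sub v. pw u)"

lemma child_rel_iff: "(x, v) \<in> child_rel T \<longleftrightarrow> x < n \<and> x \<noteq> rt \<and> par x = v"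
  by (auto simp: child_rel_def)

lemma ch_iff: "x \<in> ch v \<longleftrightarrow> x < n \<and> x \<noteq> rt \<and> par x = v"
  by (simp add: children_def child_rel_iff)

lemma ch_lt: "x \<in> ch v \<Longrightarrow> x < n"
  and ch_not_root: "x \<in> ch v \<Longrightarrow> x \<noteq> rt"
  and ch_par: "x \<in> ch v \<Longrightarrow> par x = v"
  by (auto simp: ch_iff)

lemma finite_ch [simp]: "finite (ch v)"
  by (rule finite_subset[of _ "{..<n}"]) (auto simp: ch_iff)

lemma root_lt [simp]: "rt < n"
  and par_lt: "v < n \<Longrightarrow> v \<noteq> rt \<Longrightarrow> par v < n"
  and reach_root: "v < n \<Longrightarrow> (v, rt) \<in> (child_rel T)\<^sup>*"
  using rooted by (auto simp: rooted_tree_def)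

lemma ch_parent_lt: "x \<in> ch v \<Longrightarrow> v < n"
  using par_lt by (auto simp: ch_iff)

lemma single_valued_child_rel: "single_valued (child_rel T)"
  by (auto simp: single_valued_def child_rel_iff)

definition depth :: "nat \<Rightarrow> nat" where
  "depth v = (LEAST m. (v, rt) \<in> child_rel T ^^ m)"

lemma depth_root [simp]: "depth rt = 0"
  unfolding depth_def by (rule Least_equality) auto

lemma depth_par: "v < n \<Longrightarrow> v \<noteq> rt \<Longrightarrow> depth v = Suc (depth (par v))"
proof -
  assume v: "v < n" "v \<noteq> rt"
  obtain m where "(v, rt) \<in> child_rel T ^^ m"
    using reach_root[OF v(1)] rtrancl_imp_relpow by blast
  then have "depth v = Suc (LEAST m. (v, rt) \<in> child_rel T ^^ Suc m)"
    unfolding depth_def by (rule Least_Suc) (use v in auto)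
  also have "(\<lambda>m. (v, rt) \<in> child_rel T ^^ Suc m) = (\<lambda>m. (par v, rt) \<in> child_rel T ^^ m)"
    using v relpow_Suc_D2[of v rt _ "child_rel T"] relpow_Suc_I2[of v "par v" "child_rel T" rt]
    by (fastforce simp: child_rel_iff simp del: relpow.simps)
  finally show ?thesis by (simp add: depth_def)
qed

lemma depth_ch: "x \<in> ch v \<Longrightarrow> depth x = Suc (depth v)"
  using depth_par by (auto simp: ch_iff)

text \<open>\<open>child_rel\<close> leads from a child to its parent, so \<open>v\<close> is the
  ancestor here. This serves as acyclicity of the tree.\<close>

lemma depth_reach: "(u, v) \<in> (child_rel T)\<^sup>* \<Longrightarrow> u = v \<or> depth v < depth u"
  by (induction rule: rtrancl_induct) (auto simp: child_rel_iff dest: depth_par)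

lemma top_down [consumes 1, case_names root child]:
  assumes "v < n" "P rt" "\<And>v. v < n \<Longrightarrow> v \<noteq> rt \<Longrightarrow> P (par v) \<Longrightarrow> P v"
  shows "P v"
  using assms(1)
proof (induction "depth v" arbitrary: v rule: less_induct)
  case less
  then show ?case using assms(2,3) par_lt depth_par by (cases "v = rt") auto
qed

text \<open>The measure is the gap between a node and the deepest level.\<close>

lemma bottom_up [consumes 1, case_names node]:
  assumes "v < n" "\<And>v. v < n \<Longrightarrow> (\<And>x. x \<in> ch v \<Longrightarrow> P x) \<Longrightarrow> P v"
  shows "P v"
  using assms(1)
proof (induction "Max (depth ` {..<n}) - depth v" arbitrary: v rule: less_induct)
  case less
  show ?case
  proof (rule assms(2)[OF \<open>v < n\<close>])
    fix x assume x: "x \<in> ch v"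
    have "depth x \<le> Max (depth ` {..<n})" using ch_lt[OF x] by (intro Max_ge) auto
    then show "P x" using less.hyps[of x] depth_ch[OF x] ch_lt[OF x] by auto
  qed
qed

lemma sub_iff: "u \<in> sub v \<longleftrightarrow> u < n \<and> (u, v) \<in> (child_rel T)\<^sup>*"
  by (simp add: subtree_nodes_def)

lemma finite_sub [simp]: "finite (sub v)"
  by (rule finite_subset[of _ "{..<n}"]) (auto simp: sub_iff)

lemma sub_self: "v < n \<Longrightarrow> v \<in> sub v"
  by (simp add: sub_iff)

lemma sub_lt: "u \<in> sub v \<Longrightarrow> u < n"
  by (simp add: sub_iff)

lemma sub_root: "sub rt = {..<n}"
  using reach_root by (auto simp: sub_iff)

lemma sub_par: "u < n \<Longrightarrow> u \<noteq> rt \<Longrightarrow> par u \<in> sub v \<Longrightarrow> u \<in> sub v"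
  by (auto simp: sub_iff child_rel_iff intro: converse_rtrancl_into_rtrancl)

lemma subtree_step:
  assumes "u \<in> sub v"
  obtains "u = v" | y where "(u, y) \<in> child_rel T" "(y, v) \<in> (child_rel T)\<^sup>*" "u < n"
  using assms unfolding sub_iff by (metis converse_rtranclE)

lemma sub_unfold: "v < n \<Longrightarrow> sub v = insert v (\<Union>x\<in>ch v. sub x)"
proof (intro equalityI subsetI)
  fix u assume "u \<in> sub v" 
  then have "(u, v) \<in> (child_rel T)\<^sup>*" "u < n" by (auto simp: sub_iff)
  then show "u \<in> insert v (\<Union>x\<in>ch v. sub x)"
    by (cases rule: rtranclE) (auto simp: children_def sub_iff)
next
  fix u assume "v < n" "u \<in> insert v (\<Union>x\<in>ch v. sub x)"
  then show "u \<in> sub v"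
    by (auto simp: sub_iff children_def intro: rtrancl_into_rtrancl)
qed

text \<open>Parents are unique, so the ancestors of \<open>u\<close> form a chain.\<close>

lemma sub_comparable:
  assumes "u \<in> sub a" "u \<in> sub b"
  shows "(a, b) \<in> (child_rel T)\<^sup>* \<or> (b, a) \<in> (child_rel T)\<^sup>*"
  using assms single_valued_confluent[OF single_valued_child_rel] by (auto simp: sub_iff)

lemma sub_disjoint_depth: "depth a = depth b \<Longrightarrow> a \<noteq> b \<Longrightarrow> sub a \<inter> sub b = {}"
  using sub_comparable[of _ a b] depth_reach[of a b] depth_reach[of b a] by auto

lemma sub_disjoint_ch: "x \<in> ch v \<Longrightarrow> y \<in> ch v \<Longrightarrow> x \<noteq> y \<Longrightarrow> sub x \<inter> sub y = {}"
  by (intro sub_disjoint_depth) (auto simp: depth_ch)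

lemma not_in_sub_ch: "x \<in> ch v \<Longrightarrow> v \<notin> sub x"
  using depth_reach[of v x] depth_ch[of x v] by (auto simp: sub_iff)

lemma pw_nonneg: "v < n \<Longrightarrow> 0 \<le> pw v"
  using weight_nonneg total_pos by (simp add: pw_def)

lemma ps_nonneg: "0 \<le> ps v"
  unfolding ps_def by (intro sum_nonneg pw_nonneg) (auto simp: sub_iff)

lemma ps_unfold: "v < n \<Longrightarrow> ps v = pw v + (\<Sum>x\<in>ch v. ps x)"
  unfolding ps_def
  by (subst sub_unfold, simp, subst sum.insert)
    (auto simp: not_in_sub_ch dest: sub_disjoint_ch[THEN equalityD1] intro!: sum.UNION_disjoint)

lemma ps_root: "ps rt = 1"
proof -
  have "ps rt = (\<Sum>v<n. weight T v) / total_weight T"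
    by (simp add: ps_def sub_root pw_def sum_divide_distrib)
  then show ?thesis using total_pos by (simp add: total_weight_def)
qed

text \<open>Both counts of heavy nodes come from this: it is applied to the nodes of one level and
  to the lowest active nodes.\<close>

lemma ps_antichain:
  assumes "A \<subseteq> {..<n}" "\<And>u v. u \<in> A \<Longrightarrow> v \<in> A \<Longrightarrow> u \<noteq> v \<Longrightarrow> sub u \<inter> sub v = {}"
  shows "sum ps A \<le> 1"
proof -
  have fin: "finite A" using assms(1) finite_subset by auto
  have "sum ps A = sum pw (\<Union>v\<in>A. sub v)"
    unfolding ps_def using assms fin by (subst sum.UNION_disjoint) auto
  also have "\<dots> \<le> sum pw (sub rt)"
    by (rule sum_mono2) (auto simp: sub_root sub_iff intro: pw_nonneg)
  finally show ?thesis using ps_root by (simp add: ps_def)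
qed

lemma ps_le_1: "v < n \<Longrightarrow> ps v \<le> 1"
  using ps_antichain[of "{v}"] by simp

lemma pw_le_ps: "v < n \<Longrightarrow> pw v \<le> ps v"
  by (simp add: ps_unfold ps_nonneg sum_nonneg)

lemma sum_ch_le_ps: "v < n \<Longrightarrow> A \<subseteq> ch v \<Longrightarrow> pw v + sum ps A \<le> ps v"
  using sum_mono2[of "ch v" A ps] by (simp add: ps_unfold ps_nonneg)

lemma ps_ch_le: "x \<in> ch v \<Longrightarrow> ps x \<le> ps v"
  using sum_ch_le_ps[of v "{x}"] pw_nonneg[of v] ch_parent_lt[of x v] by simp

lemma node_prob_sum: "node_prob T L = sum pw L"
  by (simp add: node_prob_def pw_def sum_divide_distrib)

lemma node_prob_sub: "node_prob T (sub v) = ps v"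
  by (simp add: node_prob_sum ps_def)

end

section \<open>Exchanging children\<close>

locale summary_dp = weighted_tree +
  fixes k :: nat and \<epsilon> :: real
  assumes k_pos: "1 \<le> k" and eps_pos: "0 < \<epsilon>"
begin

text \<open>The threshold is a negated \<open><\<close> because this is the comparison that the
  machine makes. The depth bound is harmless for trees with \<open>k\<close> nodes: a node below
  split ancestors has as many singletons above it as its depth.\<close>

definition active :: "nat \<Rightarrow> bool" where
  "active v \<longleftrightarrow> v < n \<and> depth v < k \<and> \<not> lose (ps v) < \<epsilon> / k"

definition achs :: "nat \<Rightarrow> nat set" where
  "achs v = {x \<in> ch v. active x}"

text \<open>The value of splitting \<open>v\<close> off, keeping the children \<open>I\<close> and
  putting the rest into \<open>other\<close>. If all children are kept, the middle term is
  \<open>plogp 0\<close>, so the missing \<open>other\<close> node needs no separate case.\<close>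

definition optval :: "(nat \<Rightarrow> nat \<Rightarrow> real) \<Rightarrow> nat \<Rightarrow> nat set \<Rightarrow> (nat \<Rightarrow> nat) \<Rightarrow> real" where
  "optval D v I b = plogp (pw v) + plogp (ps v - pw v - sum ps I) + (\<Sum>x\<in>I. D x (b x))"

definition optcost :: "nat \<Rightarrow> nat set \<Rightarrow> (nat \<Rightarrow> nat) \<Rightarrow> nat" where
  "optcost v I b = (if I = ch v then 1 else 2) + sum b I"

definition option_of :: "nat \<Rightarrow> nat \<Rightarrow> nat set \<Rightarrow> (nat \<Rightarrow> nat) \<Rightarrow> bool" where
  "option_of v j I b \<longleftrightarrow> I \<subseteq> achs v \<and> (\<forall>x\<in>I. 1 \<le> b x) \<and> optcost v I b \<le> j"

definition desc_list :: "nat set \<Rightarrow> nat list \<Rightarrow> bool" where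
  "desc_list X ys \<longleftrightarrow> distinct ys \<and> set ys = X \<and> sorted_wrt (\<lambda>x y. ps y \<le> ps x) ys"

text \<open>For \<open>e \<ge> r\<close> nothing is left out: the set consists of the first \<open>r\<close> elements of \<open>ys\<close>.\<close>

definition skipset :: "nat list \<Rightarrow> nat \<Rightarrow> nat \<Rightarrow> nat set" where
  "skipset ys e r = {ys ! u | u. u < r \<and> u \<noteq> e}"

text \<open>What the search of the program establishes directly; \<open>node_upper\<close> extends
  it to all options.\<close>

definition near_upper :: "(nat \<Rightarrow> nat \<Rightarrow> real) \<Rightarrow> nat \<Rightarrow> nat list \<Rightarrow> bool" where
  "near_upper D v ys \<longleftrightarrow> (\<forall>j\<le>k. plogp (ps v) \<le> D v j \<and>
     (\<forall>e r b. r \<le> length ys \<and> r \<le> k \<and> option_of v j (skipset ys e r) b \<longrightarrow>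
        optval D v (skipset ys e r) b \<le> D v j))"

definition node_upper :: "(nat \<Rightarrow> nat \<Rightarrow> real) \<Rightarrow> nat \<Rightarrow> bool" where
  "node_upper D v \<longleftrightarrow> (\<forall>j\<le>k. plogp (ps v) \<le> D v j \<and>
     (\<forall>I b. option_of v j I b \<longrightarrow> optval D v I b \<le> D v j))"

definition node_attained :: "(nat \<Rightarrow> nat \<Rightarrow> real) \<Rightarrow> nat \<Rightarrow> bool" where
  "node_attained D v \<longleftrightarrow> (\<forall>j\<le>k. D v j = plogp (ps v) \<or>
     (\<exists>I b. option_of v j I b \<and> D v j = optval D v I b))"

text \<open>The factor 2 is the one that \<open>gain_double\<close> repays in
  \<open>exchange_split\<close>. The first entry is pinned down because exchanged children are
  granted a single node.\<close>

definition slow :: "(nat \<Rightarrow> nat \<Rightarrow> real) \<Rightarrow> nat \<Rightarrow> bool" where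
  "slow D v \<longleftrightarrow> D v 1 = plogp (ps v) \<and> (\<forall>j. 1 \<le> j \<and> j < k \<longrightarrow> D v (Suc j) \<le> D v j + 2 * ps v)"

lemma achs_subset: "achs v \<subseteq> ch v"
  and finite_achs [simp]: "finite (achs v)"
  by (auto simp: achs_def)

text \<open>Neither the old nor the new set is all of \<open>ch v\<close>, so the price 2 for
  \<open>v\<close> and \<open>other\<close> stays and the cost is unchanged; the value does not fall
  by \<open>plogp_swap\<close>.\<close>

lemma exchange_swap:
  assumes "v < n" and opt: "option_of v j I b" and x: "x \<in> I" "b x = 1" and y: "y \<in> achs v" "y \<notin> I"
    and le: "ps x \<le> ps y" and D: "D x 1 = plogp (ps x)" "D y 1 = plogp (ps y)"
  shows "option_of v j (insert y (I - {x})) (b(y := 1))"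
    and "optval D v I b \<le> optval D v (insert y (I - {x})) (b(y := 1))"
proof -
  have I: "I \<subseteq> achs v" and fin: "finite I" using opt by (auto simp: option_of_def intro: finite_subset)
  define J where "J = I - {x}"
  have J: "I = insert x J" "x \<notin> J" "finite J" "y \<notin> J" "y \<noteq> x" using x fin y by (auto simp: J_def)
  have ne: "I \<noteq> ch v" "insert y J \<noteq> ch v" using subsetD[OF achs_subset y(1)] subsetD[OF subset_trans[OF I achs_subset] x(1)] y(2) J by auto
  have s: "sum (b(y := 1)) J = sum b J" "(\<Sum>x\<in>J. D x ((b(y := 1)) x)) = (\<Sum>x\<in>J. D x (b x))"
    by (rule sum.cong; use J(4) in auto)+
  show "option_of v j (insert y (I - {x})) (b(y := 1))"
    using opt y ne s x J unfolding J_def[symmetric] by (auto simp: option_of_def optcost_def)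
  have "pw v + sum ps (insert y I) \<le> ps v"
    using I y achs_subset by (intro sum_ch_le_ps[OF \<open>v < n\<close>]) auto
  then have "ps y \<le> ps v - pw v - sum ps I" using y fin by simp
  from plogp_swap[OF ps_nonneg le this]
  show "optval D v I b \<le> optval D v (insert y (I - {x})) (b(y := 1))"
    unfolding J_def[symmetric] optval_def using J s x D by (simp add: algebra_simps)
qed

text \<open>A node is taken from \<open>x\<close> at a loss of at most \<open>2 * ps x\<close> and
  spent on taking \<open>y\<close> out of \<open>other\<close>. Since \<open>z\<close> stays inside,
  both resulting parts weigh at least \<open>ps x\<close>, and \<open>gain_mono\<close> with
  \<open>gain_double\<close> covers the loss. That a second sibling must remain is the origin of the
  one possible gap in the prefix.\<close>

lemma exchange_split:
  assumes "v < n" and opt: "option_of v j I b" and x: "x \<in> I" "2 \<le> b x"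
    and y: "y \<in> achs v" "y \<notin> I" "z \<in> achs v" "z \<notin> I" "y \<noteq> z"
    and le: "ps x \<le> ps y" "ps x \<le> ps z"
    and D: "D x (b x) \<le> D x (b x - 1) + 2 * ps x" "D y 1 = plogp (ps y)"
  shows "option_of v j (insert y I) (b(x := b x - 1, y := 1))"
    and "optval D v I b \<le> optval D v (insert y I) (b(x := b x - 1, y := 1))"
proof -
  have I: "I \<subseteq> achs v" and fin: "finite I" using opt by (auto simp: option_of_def intro: finite_subset)
  define J where "J = I - {x}"
  have J: "I = insert x J" "x \<notin> J" "finite J" "y \<notin> J" "y \<noteq> x" using x fin y by (auto simp: J_def)
  have ne: "I \<noteq> ch v" "insert y I \<noteq> ch v" using subsetD[OF achs_subset y(1)] subsetD[OF achs_subset y(3)] y by auto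
  let ?b = "b(x := b x - 1, y := 1)"
  have s: "sum ?b J = sum b J" "(\<Sum>x\<in>J. D x (?b x)) = (\<Sum>x\<in>J. D x (b x))"
    by (rule sum.cong; use J(2,4) in auto)+
  show "option_of v j (insert y I) ?b"
    using opt y ne s x J by (auto simp: option_of_def optcost_def)
  have "pw v + sum ps (insert z (insert y I)) \<le> ps v"
    using I y achs_subset by (intro sum_ch_le_ps[OF \<open>v < n\<close>]) auto
  then have "ps z \<le> ps v - pw v - sum ps I - ps y" using y fin by simp
  then have "gain (ps x) (ps x) \<le> gain (ps y) (ps v - pw v - sum ps I - ps y)"
    using le ps_nonneg by (intro gain_mono) auto
  then have "2 * ps x \<le> gain (ps y) (ps v - pw v - sum ps I - ps y)"
    by (simp add: gain_double ps_nonneg)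
  then show "optval D v I b \<le> optval D v (insert y I) ?b"
    unfolding optval_def using J s x D by (simp add: algebra_simps gain_def)
qed

lemma card_le_sum: "finite I \<Longrightarrow> \<forall>x\<in>I. (1::nat) \<le> b x \<Longrightarrow> card I \<le> sum b I"
  using sum_mono[of I "\<lambda>_. 1" b] by simp

text \<open>Exchanging until no step applies: the children kept out of the node \<open>other\<close> are then the
  heaviest ones, with at most one exception.\<close>

lemma near_upper_imp_node_upper:
  assumes "v < n" and ys: "desc_list (achs v) ys" and near: "near_upper D v ys"
    and slow: "\<And>x. x \<in> achs v \<Longrightarrow> slow D x"
  shows "node_upper D v"
proof -
  have "\<forall>x\<in>achs v. \<exists>u<length ys. ys ! u = x"
    using ys in_set_conv_nth[of _ ys] unfolding desc_list_def by metis
  then obtain rk where rk: "\<And>x. x \<in> achs v \<Longrightarrow> rk x < length ys \<and> ys ! rk x = x"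
    by metis
  have le: "ps x \<le> ps y" if "x \<in> achs v" "y \<in> achs v" "rk y < rk x" for x y
    using sorted_wrt_nth_less[of "\<lambda>x y. ps y \<le> ps x" ys "rk y" "rk x"] ys rk that
    by (auto simp: desc_list_def)
  have "optval D v I b \<le> D v j" if "j \<le> k" "option_of v j I b" for j I b
    using that(2)
  \<comment> \<open>Each exchange moves one granted node to a child of smaller rank, so this
    weighted sum of ranks falls.\<close>
  proof (induction "\<Sum>x\<in>I. b x * Suc (rk x)" arbitrary: I b rule: less_induct)
    case less
    have I: "I \<subseteq> achs v" and fin: "finite I" and b: "\<forall>x\<in>I. 1 \<le> b x" and cost: "optcost v I b \<le> j"
      using less.prems finite_subset[OF _ finite_achs] unfolding option_of_def by blast+
    have D1: "D x 1 = plogp (ps x)" if "x \<in> achs v" for x using slow[OF that] by (simp add: slow_def)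
    show ?case
    proof (cases "\<exists>x\<in>I. \<exists>y\<in>achs v - I. b x = 1 \<and> rk y < rk x")
      case True
      then obtain x y where xy: "x \<in> I" "y \<in> achs v" "y \<notin> I" "b x = 1" "rk y < rk x" by auto
      define J where "J = I - {x}"
      have J: "I = insert x J" "x \<notin> J" "finite J" "y \<notin> J" "y \<noteq> x" using xy fin by (auto simp: J_def)
      have "(\<Sum>x\<in>J. (b(y := 1)) x * Suc (rk x)) = (\<Sum>x\<in>J. b x * Suc (rk x))"
        by (rule sum.cong) (use J(4) in auto)
      then have meas: "(\<Sum>x\<in>insert y (I - {x}). (b(y := 1)) x * Suc (rk x)) < (\<Sum>x\<in>I. b x * Suc (rk x))"
        using J xy unfolding J_def[symmetric] by simp
      have "x \<in> achs v" using xy I by auto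
      note sw = exchange_swap[where D = D, OF \<open>v < n\<close> less.prems xy(1,4,2,3) le[OF this xy(2,5)] D1[OF this] D1[OF xy(2)]]
      show ?thesis using sw(2) less.hyps[OF meas sw(1)] by simp
    next
      case no1: False
      show ?thesis
      proof (cases "\<exists>x\<in>I. \<exists>y\<in>achs v - I. \<exists>z\<in>achs v - I. 2 \<le> b x \<and> y \<noteq> z \<and> rk y < rk x \<and> rk z < rk x")
        case True
        then obtain x y z where xy: "x \<in> I" "2 \<le> b x" "y \<in> achs v" "y \<notin> I" "z \<in> achs v" "z \<notin> I" "y \<noteq> z"
          "rk y < rk x" "rk z < rk x" by blast
        define J where "J = I - {x}"
        have J: "I = insert x J" "x \<notin> J" "finite J" "y \<notin> J" "y \<noteq> x" using xy fin by (auto simp: J_def)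
        let ?b = "b(x := b x - 1, y := 1)"
        have "(\<Sum>x\<in>J. ?b x * Suc (rk x)) = (\<Sum>x\<in>J. b x * Suc (rk x))"
          by (rule sum.cong) (use J(2,4) in auto)
        moreover have "(b x - 1) * Suc (rk x) + Suc (rk y) < b x * Suc (rk x)"
          using xy(2,8) by (cases "b x") auto
        ultimately have meas: "(\<Sum>x\<in>insert y I. ?b x * Suc (rk x)) < (\<Sum>x\<in>I. b x * Suc (rk x))"
          using J xy by simp
        have x: "x \<in> achs v" using xy I by auto
        have "b x \<le> sum b I" using xy(1) fin by (auto intro: member_le_sum)
        then have "b x - 1 < k" using cost \<open>j \<le> k\<close> xy(2) by (simp add: optcost_def split: if_splits)
        then have "D x (b x) \<le> D x (b x - 1) + 2 * ps x"
          using slow[OF x] xy(2) unfolding slow_def by (auto dest!: spec[of _ "b x - 1"])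
        note sp = exchange_split[where D = D, OF \<open>v < n\<close> less.prems xy(1-7) le[OF x xy(3,8)] le[OF x xy(5,9)] this D1[OF xy(3)]]
        show ?thesis using sp(2) less.hyps[OF meas sp(1)] by simp
      next
        case no2: False
        \<comment> \<open>With both exchanges exhausted, the last kept child tolerates no gap before
          it if it has one node, and at most one gap if it has more.\<close>
        have "\<exists>e r. r \<le> length ys \<and> r \<le> Suc (card I) \<and> I = skipset ys e r"
        proof (cases "I = {}")
          case True
          then show ?thesis by (intro exI[of _ 0]) (auto simp: skipset_def)
        next
          case False
          then have "Max (rk ` I) \<in> rk ` I" using fin by (intro Max_in) auto
          then obtain z where z: "z \<in> I" "\<And>x. x \<in> I \<Longrightarrow> rk x \<le> rk z"
            using Max_ge[of "rk ` I"] fin by fastforce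
          have zl: "rk z < length ys" using rk[of z] z(1) I by blast
          have rkys: "rk (ys ! u) = u" "ys ! u \<in> achs v" if "u < length ys" for u
          proof -
            show "ys ! u \<in> achs v" using ys nth_mem[OF that] unfolding desc_list_def by blast
            then show "rk (ys ! u) = u" using rk ys that nth_eq_iff_index_eq unfolding desc_list_def by metis
          qed
          have one: "u = u'" if "u < rk z" "u' < rk z" "ys ! u \<notin> I" "ys ! u' \<notin> I" for u u'
          proof (rule ccontr)
            assume "u \<noteq> u'"
            have l: "u < length ys" "u' < length ys" using that zl by auto
            have neq: "ys ! u \<noteq> ys ! u'" using \<open>u \<noteq> u'\<close> rkys(1)[OF l(1)] rkys(1)[OF l(2)] by metis
            consider "b z = 1" | "2 \<le> b z" using b z(1) by fastforce
            then show False
            proof cases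
              case 1
              then have "\<not> rk (ys ! u) < rk z" using no1 z(1) rkys(2)[OF l(1)] that(3) by blast
              then show False using rkys(1)[OF l(1)] that(1) by simp
            next
              case 2
              then have "\<not> (rk (ys ! u) < rk z \<and> rk (ys ! u') < rk z)"
                using no2 z(1) rkys(2)[OF l(1)] rkys(2)[OF l(2)] that(3,4) neq by blast
              then show False using rkys(1)[OF l(1)] rkys(1)[OF l(2)] that(1,2) by simp
            qed
          qed
          have sub: "x \<in> skipset ys e (Suc (rk z))" if "x \<in> I" "\<And>u. u < rk z \<Longrightarrow> ys ! u \<notin> I \<Longrightarrow> u = e" "e = Suc (rk z) \<or> ys ! e \<notin> I" for x e
          proof -
            have x: "rk x < length ys" "ys ! rk x = x" "rk x \<le> rk z" using rk z(2) that(1) I by blast+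
            then have "rk x \<noteq> e" using that by auto
            with x show ?thesis unfolding skipset_def by (metis (mono_tags, lifting) less_Suc_eq_le mem_Collect_eq)
          qed
          \<comment> \<open>If there is no gap, the index just beyond the prefix is taken, with
            which \<open>skipset\<close> leaves nothing out.\<close>
          obtain e where e: "\<And>u. u < rk z \<Longrightarrow> ys ! u \<notin> I \<Longrightarrow> u = e" "e = Suc (rk z) \<or> ys ! e \<notin> I"
            using one by (metis)
          have eq: "I = skipset ys e (Suc (rk z))"
          proof (intro equalityI subsetI)
            fix x assume "x \<in> I" then show "x \<in> skipset ys e (Suc (rk z))" using sub e by blast
          next
            fix x assume "x \<in> skipset ys e (Suc (rk z))"
            then obtain u where u: "x = ys ! u" "u \<le> rk z" "u \<noteq> e" by (auto simp: skipset_def)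
            show "x \<in> I"
            proof (cases "u = rk z")
              case True
              then show ?thesis using u z(1) rk[of z] I by auto
            next
              case False
              then show ?thesis using u e(1)[of u] by auto
            qed
          qed
          have "card ({..<Suc (rk z)} - {e}) \<le> card I"
          proof (rule card_inj_on_le)
            show "inj_on (\<lambda>u. ys ! u) ({..<Suc (rk z)} - {e})"
              using rkys(1) zl by (intro inj_on_inverseI[of _ rk]) auto
            show "(\<lambda>u. ys ! u) ` ({..<Suc (rk z)} - {e}) \<subseteq> I" by (subst eq) (auto simp: skipset_def)
          qed (rule fin)
          then have "Suc (rk z) \<le> Suc (card I)" by (auto simp: card_Diff_singleton_if split: if_splits)
          then show ?thesis using eq zl by (intro exI[of _ e] exI[of _ "Suc (rk z)"]) auto
        qed
        then obtain e r where er: "r \<le> length ys" "r \<le> Suc (card I)" "I = skipset ys e r" by blast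
        \<comment> \<open>Every kept child takes at least one node and \<open>v\<close> itself
          another one, so prefixes of length at most \<open>k\<close> are enough.\<close>
        have "Suc (card I) \<le> k" using card_le_sum[OF fin b] cost \<open>j \<le> k\<close> by (auto simp: optcost_def split: if_splits)
        then show ?thesis using near er less.prems \<open>j \<le> k\<close> unfolding near_upper_def by (metis order_trans)
      qed
    qed
  qed
  then show ?thesis using near by (auto simp: node_upper_def near_upper_def)
qed

end

section \<open>Slow growth of the optimal values\<close>

lemma gain_diff: "gain x (z - x) = plogp x + plogp (z - x) - plogp z"
  by (simp add: gain_def)

context summary_dp begin

lemma optval_remove:
  assumes "finite J" "x \<notin> J" "b x = 1" "D x 1 = plogp (ps x)"
  shows "optval D v (insert x J) b =
    plogp (pw v) + plogp (ps v - pw v - sum ps J - ps x) + plogp (ps x) + (\<Sum>x\<in>J. D x (b x))"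
  using assms by (simp add: optval_def algebra_simps)

text \<open>An option for \<open>j + 1\<close> nodes is turned into one for \<open>j\<close> nodes
  by giving up one node: inside a child that has at least two, by dropping a one-node child into
  \<open>other\<close>, or, if there is no \<open>other\<close>, by merging two children. If none of
  this is possible, collapsing \<open>v\<close> is close enough. \<open>node_upper\<close> then
  compares the poorer option with \<open>D v j\<close>.\<close>

lemma node_upper_imp_slow:
  assumes v: "active v" and up: "node_upper D v" and att: "node_attained D v"
    and sl: "\<And>x. x \<in> achs v \<Longrightarrow> slow D x"
  shows "slow D v"
proof -
  have vn: "v < n" using v by (simp add: active_def)
  have pw0: "0 \<le> pw v" using pw_nonneg[OF vn] .
  have step: "D v (Suc j) \<le> D v j + 2 * ps v" if j: "1 \<le> j" "j < k" for j
  proof -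
    have upj: "option_of v j I b \<Longrightarrow> optval D v I b \<le> D v j" for I b
      using up j by (auto simp: node_upper_def)
    have coll: "plogp (ps v) \<le> D v j" using up j by (auto simp: node_upper_def)
    have "D v (Suc j) = plogp (ps v) \<or> (\<exists>I b. option_of v (Suc j) I b \<and> D v (Suc j) = optval D v I b)"
      using att j unfolding node_attained_def by (meson Suc_leI)
    then show ?thesis
    proof
      assume "D v (Suc j) = plogp (ps v)" then show ?thesis using coll ps_nonneg[of v] by simp
    next
      assume "\<exists>I b. option_of v (Suc j) I b \<and> D v (Suc j) = optval D v I b"
      then obtain I b where opt: "option_of v (Suc j) I b" and val: "D v (Suc j) = optval D v I b" by blast
      have I: "I \<subseteq> achs v" "finite I" and b: "\<forall>x\<in>I. 1 \<le> b x" and cost: "optcost v I b \<le> Suc j"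
        using opt finite_subset[OF _ finite_achs] unfolding option_of_def by blast+
      have Ich: "I \<subseteq> ch v" using I achs_subset by blast
      have o: "pw v + sum ps I \<le> ps v" using sum_ch_le_ps[OF vn Ich] .
      have D1: "D x 1 = plogp (ps x)" if "x \<in> I" for x using sl[of x] that I by (auto simp: slow_def)
      show ?thesis
      proof (cases "\<exists>x\<in>I. 2 \<le> b x")
        case True
        then obtain x where x: "x \<in> I" "2 \<le> b x" by blast
        define J where "J = I - {x}"
        have J: "I = insert x J" "x \<notin> J" "finite J" using x I by (auto simp: J_def)
        let ?b = "b(x := b x - 1)"
        have s: "sum ?b J = sum b J" "(\<Sum>x\<in>J. D x (?b x)) = (\<Sum>x\<in>J. D x (b x))"
          by (rule sum.cong; use J(2) in auto)+
        have "sum ?b I + 1 = sum b I" unfolding J(1) using J(2,3) s(1) x(2) by simp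
        then have "optcost v I ?b + 1 = optcost v I b" by (simp add: optcost_def)
        then have "option_of v j I ?b"
          using I(1) b cost x(2) by (auto simp: option_of_def)
        then have le: "optval D v I ?b \<le> D v j" by (rule upj)
        have "b x \<le> sum b I" using x(1) I(2) by (auto intro: member_le_sum)
        then have "b x - 1 < k" using cost j x(2) by (simp add: optcost_def split: if_splits)
        then have "D x (Suc (b x - 1)) \<le> D x (b x - 1) + 2 * ps x"
          using sl[OF subsetD[OF I(1) x(1)], unfolded slow_def, THEN conjunct2, rule_format, of "b x - 1"] x(2)
          by simp
        then have "optval D v I b \<le> optval D v I ?b + 2 * ps x"
          using x(2) s J by (simp add: optval_def)
        moreover have "ps x \<le> ps v" using ps_ch_le x(1) Ich by blast
        ultimately show ?thesis using val le by simp
      next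
        case False
        then have b1: "\<forall>x\<in>I. b x = 1" using b by force
        have sumb: "sum b I = card I" using b1 by simp
        have D: "(\<Sum>x\<in>I. D x (b x)) = (\<Sum>x\<in>I. plogp (ps x))" using b1 D1 by (auto intro!: sum.cong)
        show ?thesis
        proof (cases "I = ch v")
          case False
          show ?thesis
          proof (cases "I = {}")
            case True
            then have "optval D v I b = plogp (pw v) + plogp (ps v - pw v)" by (simp add: optval_def)
            also have "\<dots> \<le> plogp (ps v) + ps v"
              using gain_le_sum[of "pw v" "ps v - pw v"] pw0 pw_le_ps[OF vn] by (simp add: gain_def)
            finally show ?thesis using val coll ps_nonneg[of v] by simp
          next
            case False
            then obtain x where x: "x \<in> I" by blast
            define J where "J = I - {x}"
            have J: "I = insert x J" "x \<notin> J" "finite J" using x I by (auto simp: J_def)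
            have "J \<noteq> ch v" using J(2) x Ich by blast
            then have "option_of v j J b"
              using I(1) b cost J \<open>I \<noteq> ch v\<close> b1 by (auto simp: option_of_def optcost_def)
            then have le: "optval D v J b \<le> D v j" by (rule upj)
            have "gain (ps x) (ps v - pw v - sum ps J - ps x) \<le> ps x + (ps v - pw v - sum ps J - ps x)"
              using o J ps_nonneg by (intro gain_le_sum) auto
            also have "\<dots> \<le> ps v" using pw0 sum_nonneg[of J ps] ps_nonneg by simp
            finally have "plogp (ps x) + plogp (ps v - pw v - sum ps J - ps x) \<le> plogp (ps v - pw v - sum ps J) + ps v"
              unfolding gain_diff by simp
            moreover have "optval D v I b = plogp (pw v) + plogp (ps v - pw v - sum ps J - ps x) + plogp (ps x) + (\<Sum>x\<in>J. D x (b x))"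
              unfolding J(1) using b1 D1 x by (intro optval_remove[OF J(3,2)]) auto
            ultimately show ?thesis using val le ps_nonneg[of v] unfolding optval_def[of D v J b] by simp
          qed
        next
          \<comment> \<open>Moving a single child into a new \<open>other\<close> node would save
            nothing, so two children have to be merged.\<close>
          case eq: True
          show ?thesis
          proof (cases "\<exists>x\<in>I. \<exists>y\<in>I. x \<noteq> y")
            case True
            then obtain x y where xy: "x \<in> I" "y \<in> I" "x \<noteq> y" by blast
            define J where "J = I - {x, y}"
            have J: "I = insert x (insert y J)" "x \<notin> J" "y \<notin> J" "finite J" using xy I by (auto simp: J_def)
            have "J \<noteq> ch v" using J xy eq by blast
            then have "option_of v j J b"
              using I(1) b cost J eq b1 xy by (auto simp: option_of_def optcost_def)
            then have le: "optval D v J b \<le> D v j" by (rule upj)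
            have z: "ps v - pw v = sum ps I" using ps_unfold[OF vn] eq by simp
            have "gain (ps x) (ps y) \<le> ps x + ps y" using ps_nonneg by (intro gain_le_sum)
            also have "\<dots> \<le> ps v" using z pw0 sum_nonneg[of J ps] ps_nonneg J xy by simp
            finally show ?thesis using val le z D1 J xy b1 ps_nonneg[of v]
              by (simp add: gain_def optval_def)
          next
            case False
            then have "I = {} \<or> (\<exists>x. I = {x})" by blast
            then show ?thesis
            proof
              assume "I = {}"
              then show ?thesis using ps_unfold[OF vn] eq val coll ps_nonneg[of v] by (simp add: optval_def)
            next
              assume "\<exists>x. I = {x}"
              then obtain x where x: "I = {x}" by blast
              have z: "ps v - pw v = ps x" using ps_unfold[OF vn, folded eq] x by simp
              have "gain (pw v) (ps x) \<le> ps v" using gain_le_sum[of "pw v" "ps x"] pw0 ps_nonneg z by simp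
              moreover have "pw v + ps x = ps v" using z by simp
              ultimately show ?thesis using val coll z D1 x b1 ps_nonneg[of v] by (simp add: gain_def optval_def)
            qed
          qed
        qed
      qed
    qed
  qed
  have "D v 1 = plogp (ps v)"
  proof -
    have "D v 1 = plogp (ps v) \<or> (\<exists>I b. option_of v 1 I b \<and> D v 1 = optval D v I b)"
      using att k_pos by (auto simp: node_attained_def)
    \<comment> \<open>A budget of 1 leaves only the option of a childless \<open>v\<close>, where
      splitting off and collapsing coincide.\<close>
    moreover have "optval D v I b = plogp (ps v)" if "option_of v 1 I b" for I b
    proof -
      have "I = ch v" "sum b I = 0" "finite I" "\<forall>x\<in>I. 1 \<le> b x"
        using that finite_subset[OF _ finite_achs] by (auto simp: option_of_def optcost_def split: if_splits)
      then have "ch v = {}" "I = {}" by auto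
      then show ?thesis using ps_unfold[OF vn] by (simp add: optval_def)
    qed
    ultimately show ?thesis by auto
  qed
  with step show ?thesis by (simp add: slow_def)
qed

lemma active_upper_slow:
  assumes "\<And>v. active v \<Longrightarrow> node_attained D v \<and> (\<exists>ys. desc_list (achs v) ys \<and> near_upper D v ys)"
  shows "v < n \<Longrightarrow> active v \<longrightarrow> node_upper D v \<and> slow D v"
proof (induction rule: bottom_up)
  case (node v)
  show ?case
  proof
    assume a: "active v"
    have sl: "slow D x" if "x \<in> achs v" for x using node that by (auto simp: achs_def)
    have up: "node_upper D v" using assms[OF a] near_upper_imp_node_upper node.hyps sl by blast
    then show "node_upper D v \<and> slow D v" using node_upper_imp_slow[OF a up] assms[OF a] sl by blast
  qed
qed

section \<open>Collapsing light subtrees\<close>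

definition DX :: "(nat \<Rightarrow> nat \<Rightarrow> real) \<Rightarrow> nat \<Rightarrow> nat \<Rightarrow> real" where
  "DX D v j = (if active v then D v j else plogp (ps v))"

definition value_of :: "summary \<Rightarrow> real" where
  "value_of S = (\<Sum>L\<in>snodes S. plogp (node_prob T L))"

lemma entropy_eq: "entropy T S = value_of S"
  by (simp add: entropy_def value_of_def plogp_def sum_negf)

lemma summary_nodes:
  assumes "summary_tree_at T v S"
  shows "finite (snodes S) \<and> snodes S \<noteq> {} \<and> v < n \<and> (\<forall>L\<in>snodes S. L \<noteq> {} \<and> L \<subseteq> sub v)"
  using assms
proof induction
  case (collapse v)
  then show ?case using sub_self by auto
next
  case (expand v S)
  have "{v} \<noteq> {} \<and> {v} \<subseteq> sub v" using sub_unfold[OF expand.hyps(1)] by auto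
  moreover have "L \<noteq> {} \<and> L \<subseteq> sub v" if "x \<in> ch v" "L \<in> snodes (S x)" for L x
    using expand.IH[OF that(1)] that sub_unfold[OF expand.hyps(1)] by auto
  ultimately show ?case using expand by auto
next
  case (other v U other_v S)
  obtain y where y: "y \<in> U" "y \<in> ch v" using other.hyps by blast
  have "other_v \<noteq> {}" using y sub_self[OF ch_lt[OF y(2)]] other.hyps by blast
  moreover have "other_v \<subseteq> sub v" using other.hyps sub_unfold[OF other.hyps(1)] by auto
  moreover have "{v} \<noteq> {} \<and> {v} \<subseteq> sub v" using sub_unfold[OF other.hyps(1)] by auto
  moreover have "L \<noteq> {} \<and> L \<subseteq> sub v" if "x \<in> ch v - U" "L \<in> snodes (S x)" for L x
    using other.IH[OF that(1)] that sub_unfold[OF other.hyps(1)] by auto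
  ultimately show ?case using other.hyps(1) other.IH by auto
qed

text \<open>Stated for general \<open>f\<close>: with \<open>plogp\<close> of the probabilities it
  yields values, with the constant 1 it counts nodes. The case \<open>U = {}\<close> belongs to the
  rule \<open>expand\<close>, the other case to the rule \<open>other\<close>.\<close>

lemma node_sum:
  assumes v: "v < n" and U: "U \<subseteq> ch v" and S: "\<And>x. x \<in> ch v - U \<Longrightarrow> summary_tree_at T x (S x)"
    and N: "N = {{v}} \<union> (if U = {} then {} else {\<Union>x\<in>U. sub x}) \<union> (\<Union>x\<in>ch v - U. snodes (S x))"
  shows "sum f N = f {v} + (if U = {} then 0 else f (\<Union>x\<in>U. sub x)) + (\<Sum>x\<in>ch v - U. sum f (snodes (S x)))"
proof -
  note sn = summary_nodes[OF S]
  let ?B = "\<Union>x\<in>ch v - U. snodes (S x)"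
  have B: "L \<noteq> {} \<and> v \<notin> L \<and> (\<exists>x\<in>ch v - U. L \<subseteq> sub x)" if LB: "L \<in> ?B" for L
  proof -
    obtain x where x: "x \<in> ch v - U" "L \<in> snodes (S x)" using LB by blast
    then show ?thesis using sn[OF x(1)] not_in_sub_ch[of x v] by blast
  qed
  have vB: "{v} \<notin> ?B" using B by blast
  have ov: "v \<notin> (\<Union>x\<in>U. sub x)" using U not_in_sub_ch by blast
  have oB: "(\<Union>x\<in>U. sub x) \<notin> ?B"
  proof
    assume "(\<Union>x\<in>U. sub x) \<in> ?B"
    from B[OF this] obtain x y where x: "x \<in> ch v - U" "y \<in> U" "sub y \<subseteq> sub x"
      by blast
    moreover have "y \<in> sub y" using x U ch_lt sub_self by blast
    ultimately show False using sub_disjoint_ch[of x v y] U by blast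
  qed
  have sB: "sum f ?B = (\<Sum>x\<in>ch v - U. sum f (snodes (S x)))"
  proof (rule sum.UNION_disjoint)
    show "\<forall>x\<in>ch v - U. \<forall>y\<in>ch v - U. x \<noteq> y \<longrightarrow> snodes (S x) \<inter> snodes (S y) = {}"
    proof (intro ballI impI)
      fix x y assume xy: "x \<in> ch v - U" "y \<in> ch v - U" "x \<noteq> y"
      then have "sub x \<inter> sub y = {}" using sub_disjoint_ch by blast
      moreover have "L \<noteq> {} \<and> L \<subseteq> sub x \<inter> sub y" if "L \<in> snodes (S x)" "L \<in> snodes (S y)" for L
        using sn[OF xy(1)] sn[OF xy(2)] that by simp
      ultimately show "snodes (S x) \<inter> snodes (S y) = {}" by fastforce
    qed
  qed (simp_all add: sn)
  have finB: "finite ?B" by (simp add: sn)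
  have vo: "{v} \<noteq> (\<Union>x\<in>U. sub x)" using ov by blast
  show ?thesis
  proof (cases "U = {}")
    case True
    then have "N = insert {v} ?B" using N by simp
    then show ?thesis using vB finB sB True by simp
  next
    case False
    then have "N = insert {v} (insert (\<Union>x\<in>U. sub x) ?B)" using N by auto
    then show ?thesis using vB oB vo finB sB False by (simp add: add.assoc)
  qed
qed


abbreviation thr :: real where "thr \<equiv> \<epsilon> / k"

lemma thr_pos: "0 < thr" using eps_pos k_pos by simp

lemma light_child: "x \<in> ch v \<Longrightarrow> lose (ps v) < thr \<Longrightarrow> lose (ps x) < thr"
  using lose_mono[of "ps x" "ps v"] ps_nonneg ps_ch_le[of x v] ps_le_1[of v] ch_parent_lt[of x v] by fastforce

lemma active_par: "active x \<Longrightarrow> x \<noteq> rt \<Longrightarrow> active (par x)"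
  using light_child[of x "par x"] depth_par[of x] par_lt[of x] by (auto simp: active_def ch_iff)

text \<open>Every node of the summary tree except its root pays for at most one merge, hence the
  factor \<open>card N - 1\<close>. The depth assumption ensures that a kept child that is not
  active is light and not merely deep.\<close>

lemma node_value_le:
  assumes up: "\<And>v. active v \<Longrightarrow> node_upper D v"
    and v: "v < n" and U: "U \<subseteq> ch v" and S: "\<And>x. x \<in> ch v - U \<Longrightarrow> summary_tree_at T x (S x)"
    and N: "N = {{v}} \<union> (if U = {} then {} else {\<Union>x\<in>U. sub x}) \<union> (\<Union>x\<in>ch v - U. snodes (S x))"
    and IH: "\<And>x. x \<in> ch v - U \<Longrightarrow> depth x + card (snodes (S x)) \<le> k \<Longrightarrow>
       value_of (S x) \<le> DX D x (card (snodes (S x))) + thr * (real (card (snodes (S x))) - 1)"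
    and dk: "depth v + card N \<le> k"
  shows "(\<Sum>L\<in>N. plogp (node_prob T L)) \<le> DX D v (card N) + thr * (real (card N) - 1)"
proof -
  define j where "j = (\<lambda>x. card (snodes (S x)))"
  let ?X = "ch v - U"
  have j1: "1 \<le> j x" if "x \<in> ?X" for x
    using summary_nodes[OF S[OF that]] by (auto simp: j_def Suc_le_eq card_gt_0_iff)
  have cardN: "card N = 1 + (if U = {} then 0 else 1) + (\<Sum>x\<in>?X. j x)"
    using node_sum[OF v U S N, of "\<lambda>_. 1::nat"] by (simp add: j_def)
  define u where "u = (\<Sum>x\<in>U. ps x)"
  have finU: "finite U" using finite_subset[OF U finite_ch] .
  have prU: "node_prob T (\<Union>x\<in>U. sub x) = u"
    unfolding node_prob_sum u_def ps_def
  proof (rule sum.UNION_disjoint[OF finU])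
    show "\<forall>x\<in>U. \<forall>y\<in>U. x \<noteq> y \<longrightarrow> sub x \<inter> sub y = {}"
      using sub_disjoint_ch[OF subsetD[OF U] subsetD[OF U]] by simp
  qed simp
  have prv: "node_prob T {v} = pw v" by (simp add: node_prob_sum)
  have val: "(\<Sum>L\<in>N. plogp (node_prob T L)) = plogp (pw v) + (if U = {} then 0 else plogp u) + (\<Sum>x\<in>?X. value_of (S x))"
    using node_sum[OF v U S N, of "\<lambda>L. plogp (node_prob T L)"] by (simp only: prU prv value_of_def)
  have dx: "depth x < k \<and> depth x + j x \<le> k" if "x \<in> ?X" for x
  proof -
    have "j x \<le> (\<Sum>x\<in>?X. j x)" using that by (intro member_le_sum) auto
    then have "depth x + j x \<le> k" using dk cardN depth_ch[of x v] that by auto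
    then show ?thesis using j1[OF that] by simp
  qed
  have IH': "value_of (S x) \<le> DX D x (j x) + thr * (real (j x) - 1)" if "x \<in> ?X" for x
    using IH[OF that] dx[OF that] by (simp add: j_def)
  have psv: "ps v = pw v + u + sum ps ?X"
    using ps_unfold[OF v] sum.subset_diff[OF U, of ps] by (simp add: u_def)
  have nn: "0 \<le> pw v" "0 \<le> u" "ps v \<le> 1" using pw_nonneg[OF v] ps_le_1[OF v] ps_nonneg by (auto simp: u_def sum_nonneg)
  show ?thesis
  proof (cases "active v")
    case True
    define I where "I = {x\<in>?X. active x}"
    define L where "L = {x\<in>?X. \<not> active x}"
    have IL: "?X = I \<union> L" "I \<inter> L = {}" "finite I" "finite L" by (auto simp: I_def L_def)
    have sIL: "sum f ?X = sum f I + sum f L" for f :: "nat \<Rightarrow> real" unfolding IL(1) using IL by (simp add: sum.union_disjoint)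
    have sILn: "sum f ?X = sum f I + sum f L" for f :: "nat \<Rightarrow> nat" unfolding IL(1) using IL by (simp add: sum.union_disjoint)
    have light: "lose (ps x) \<le> thr" if "x \<in> L" for x
    proof -
      have "x \<in> ?X" "\<not> active x" using that by (auto simp: L_def)
      then show ?thesis using dx[of x] ch_lt[of x v] by (auto simp: active_def)
    qed
    \<comment> \<open>The light children kept by the summary tree are moved into
      \<open>other\<close>. Each move costs a threshold; together with the slack
      \<open>j x - 1\<close> from the induction this is paid by the \<open>j x\<close> nodes below
      that child.\<close>
    have mg: "plogp u + (\<Sum>x\<in>L. plogp (ps x)) \<le> plogp (u + sum ps L) + thr * card L"
      using IL nn ps_nonneg light psv sIL[of ps] sum_nonneg[of I ps] by (intro merge_plogp) auto
    have ne: "I = ch v \<Longrightarrow> U = {} \<and> L = {}" using U by (auto simp: I_def L_def)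
    have jL: "1 \<le> sum j L" if "L \<noteq> {}"
    proof -
      have "card L \<le> sum j L" using IL j1 by (intro card_le_sum) auto
      moreover have "card L \<noteq> 0" using that IL by simp
      ultimately show ?thesis by simp
    qed
    \<comment> \<open>If \<open>U\<close> is empty, moving light children creates an
      \<open>other\<close> node; they free at least one node for it.\<close>
    have cost: "optcost v I j \<le> card N"
    proof (cases "U = {} \<and> L = {}")
      case True
      then have "I = ch v" using IL(1) by simp
      then show ?thesis using cardN sILn[of j] True by (simp add: optcost_def)
    next
      case False
      then have "I \<noteq> ch v" using ne by blast
      moreover have "2 + sum j I \<le> card N"
        using False jL cardN sILn[of j] by (cases "U = {}") simp_all
      ultimately show ?thesis by (simp add: optcost_def)
    qed
    have "option_of v (card N) I j"
      using cost j1 by (auto simp: option_of_def I_def achs_def)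
    then have le: "optval D v I j \<le> D v (card N)"
      using up[OF True] dk by (auto simp: node_upper_def)
    have o: "ps v - pw v - sum ps I = u + sum ps L" using psv sIL[of ps] by simp
    have "(\<Sum>x\<in>?X. value_of (S x)) \<le> (\<Sum>x\<in>I. D x (j x) + thr * (real (j x) - 1)) + (\<Sum>x\<in>L. plogp (ps x) + thr * (real (j x) - 1))"
      unfolding sIL
    proof (intro add_mono sum_mono)
      fix x assume "x \<in> I"
      then have "x \<in> ?X" "active x" by (simp_all add: I_def)
      then show "value_of (S x) \<le> D x (j x) + thr * (real (j x) - 1)" using IH'[of x] by (simp add: DX_def)
    next
      fix x assume "x \<in> L"
      then have "x \<in> ?X" "\<not> active x" by (simp_all add: L_def)
      then show "value_of (S x) \<le> plogp (ps x) + thr * (real (j x) - 1)" using IH'[of x] by (simp add: DX_def)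
    qed
    also have "\<dots> = (\<Sum>x\<in>I. D x (j x)) + (\<Sum>x\<in>L. plogp (ps x)) + thr * (real (sum j ?X) - card I - card L)"
      unfolding sILn by (simp add: sum.distrib sum_subtractf algebra_simps sum_distrib_left sum_divide_distrib)
    finally have "plogp (pw v) + plogp u + (\<Sum>x\<in>?X. value_of (S x)) \<le>
        optval D v I j + thr * (real (sum j ?X) - card I - card L) + thr * card L"
      using mg by (simp add: optval_def o)
    also have "\<dots> \<le> D v (card N) + thr * (real (sum j ?X) - card I)"
      using le by (simp add: algebra_simps)
    also have "thr * (real (sum j ?X) - card I) \<le> thr * (real (card N) - 1)"
      using cardN thr_pos by (intro mult_left_mono) auto
    finally show ?thesis unfolding val using True plogp_nonneg[of u] nn psv sum_nonneg[of ?X ps] ps_nonneg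
      by (auto simp: DX_def u_def split: if_splits)
  next
    \<comment> \<open>Here \<open>v\<close> is light, and the comparison is with its collapsed
      subtree: the children and the \<open>other\<close> part are all merged into
      \<open>v\<close>.\<close>
    case False
    then have lv: "lose (ps v) < thr" using v dk cardN by (auto simp: active_def)
    have na: "\<not> active x" if "x \<in> ch v" for x using light_child[OF that lv] by (simp add: active_def)
    have mg: "plogp (pw v) + (\<Sum>x\<in>?X. plogp (ps x)) \<le> plogp (pw v + sum ps ?X) + thr * card ?X"
    proof (rule merge_plogp)
      show "lose (ps x) \<le> thr" if "x \<in> ?X" for x using light_child[of x v] that lv by auto
    qed (use nn psv ps_nonneg in auto)
    have "lose u \<le> thr" using lose_mono[of u "ps v"] nn psv sum_nonneg[of ?X ps] ps_nonneg lv by auto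
    then have gu: "gain u (pw v + sum ps ?X) \<le> thr"
      using gain_le_lose[of u "pw v + sum ps ?X"] nn psv sum_nonneg[of ?X ps] ps_nonneg by auto
    have "(\<Sum>x\<in>?X. value_of (S x)) \<le> (\<Sum>x\<in>?X. plogp (ps x) + thr * (real (j x) - 1))"
      using IH' na by (intro sum_mono) (auto simp: DX_def)
    also have "\<dots> = (\<Sum>x\<in>?X. plogp (ps x)) + thr * (real (sum j ?X) - card ?X)"
      by (simp add: sum.distrib sum_subtractf algebra_simps sum_distrib_left sum_divide_distrib)
    finally have a: "plogp (pw v) + (\<Sum>x\<in>?X. value_of (S x)) \<le> plogp (pw v + sum ps ?X) + thr * real (sum j ?X)"
      using mg by (simp add: algebra_simps)
    show ?thesis
    proof (cases "U = {}")
      case True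
      then show ?thesis unfolding val cardN using a \<open>\<not> active v\<close> psv by (simp add: DX_def u_def)
    next
      case False
      then show ?thesis unfolding val cardN using a \<open>\<not> active v\<close> psv gu
        by (simp add: DX_def gain_def algebra_simps)
    qed
  qed
qed

lemma value_le_DX:
  assumes up: "\<And>v. active v \<Longrightarrow> node_upper D v"
  shows "summary_tree_at T v S \<Longrightarrow> depth v + card (snodes S) \<le> k \<Longrightarrow>
    value_of S \<le> DX D v (card (snodes S)) + thr * (real (card (snodes S)) - 1)"
proof (induction rule: summary_tree_at.induct)
  case (collapse v)
  then show ?case using up[of v] by (auto simp: value_of_def node_prob_sub DX_def node_upper_def)
next
  case (expand v S)
  then show ?case
    using node_value_le[OF up expand.hyps(1), of "{}" S "{{v}} \<union> (\<Union>x \<in> ch v. snodes (S x))"]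
    by (simp add: value_of_def)
next
  case (other v U other_v S)
  have "{{v}, other_v} \<union> (\<Union>x\<in>ch v - U. snodes (S x)) =
     {{v}} \<union> (if U = {} then {} else {\<Union>x\<in>U. sub x}) \<union> (\<Union>x\<in>ch v - U. snodes (S x))"
    using other.hyps by auto
  then show ?case
    using node_value_le[OF up other.hyps(1,2) other.hyps(5), of "{{v}, other_v} \<union> (\<Union>x\<in>ch v - U. snodes (S x))"] other
    by (simp add: value_of_def)
qed

lemma entropy_le_DX:
  assumes "\<And>v. active v \<Longrightarrow> node_attained D v \<and> (\<exists>ys. desc_list (achs v) ys \<and> near_upper D v ys)"
    and S: "S \<in> k_summary_trees T k"
  shows "entropy T S \<le> DX D rt k + \<epsilon>"
proof -
  have "node_upper D v" if "active v" for v
    using active_upper_slow[OF assms(1), of v] that by (auto simp: active_def)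
  then have "entropy T S \<le> DX D rt k + thr * (real k - 1)"
    using value_le_DX[of D rt S] S by (simp add: k_summary_trees_def summary_tree_def entropy_eq)
  also have "thr * (real k - 1) \<le> thr * real k" using thr_pos by (intro mult_left_mono) auto
  also have "thr * real k = \<epsilon>" using k_pos by simp
  finally show ?thesis by simp
qed


section \<open>Weight of the active nodes\<close>

lemma active_lt: "active v \<Longrightarrow> v < n"
  by (simp add: active_def)

lemma finite_active [simp]: "finite (Collect active)"
  by (rule finite_subset[of _ "{..<n}"]) (auto simp: active_lt)

text \<open>The program compares with \<open>\<epsilon> / k\<close>. By \<open>k \<le> K\<close>
  this is at least \<open>\<epsilon> / K\<close>, so the bound can be stated in terms of
  \<open>K\<close>.\<close>

lemma active_heavy:
  assumes "active v" "k \<le> K"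
  shows "1 \<le> ps v * heavy_bound (K / \<epsilon>)"
proof (rule heavy_weight)
  show "1 / (K / \<epsilon>) \<le> lose (ps v)"
  proof -
    have "1 / (K / \<epsilon>) = \<epsilon> / K" by simp
    also have "\<dots> \<le> \<epsilon> / k" using assms(2) k_pos eps_pos by (intro divide_left_mono) auto
    finally show ?thesis using assms(1) by (simp add: active_def)
  qed
qed (use assms k_pos eps_pos ps_nonneg ps_le_1 active_lt in auto)

text \<open>The subtrees rooted on one level are disjoint, so each of the \<open>k\<close> levels
  contributes at most 1.\<close>

lemma sum_active_ps: "sum ps (Collect active) \<le> k"
proof -
  have "sum ps (Collect active) \<le> sum ps (\<Union>d<k. {v. v < n \<and> depth v = d})"
    by (rule sum_mono2) (auto simp: active_def ps_nonneg)
  also have "\<dots> = (\<Sum>d<k. sum ps {v. v < n \<and> depth v = d})"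
    by (rule sum.UNION_disjoint) auto
  also have "\<dots> \<le> (\<Sum>d<k. 1)"
    by (intro sum_mono ps_antichain) (auto dest: sub_disjoint_depth[THEN equalityD1])
  finally show ?thesis by simp
qed

section \<open>Number of active nodes\<close>

definition leaves :: "nat set" where "leaves = {v. active v \<and> achs v = {}}"

lemma active_up: "(u, v) \<in> (child_rel T)\<^sup>* \<Longrightarrow> active u \<Longrightarrow> active v"
  by (induction rule: rtrancl_induct) (auto simp: child_rel_iff dest: active_par)

text \<open>If one of these nodes lay below another, all nodes on the path between them would be
  active, and the upper one would have an active child.\<close>

lemma sum_leaves_ps: "sum ps leaves \<le> 1"
proof (rule ps_antichain)
  fix u v assume uv: "u \<in> leaves" "v \<in> leaves" "u \<noteq> v"
  have no: False if ab: "(a, b) \<in> (child_rel T)\<^sup>*" "a \<noteq> b" "a \<in> leaves" "b \<in> leaves" for a b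
  proof -
    obtain y where y: "(a, y) \<in> (child_rel T)\<^sup>*" "(y, b) \<in> child_rel T"
      using ab(1,2) by (metis rtranclE)
    have "active y" using active_up[OF y(1)] ab(3) by (simp add: leaves_def)
    then have "y \<in> achs b" using y(2) by (simp add: achs_def ch_iff child_rel_iff)
    then show False using ab(4) by (auto simp: leaves_def)
  qed
  then show "sub u \<inter> sub v = {}" using sub_comparable[of _ u v] uv by blast
qed (auto simp: leaves_def active_lt)

lemma card_heavy:
  assumes "k \<le> K" "A \<subseteq> Collect active"
  shows "card A \<le> sum ps A * heavy_bound (K / \<epsilon>)"
proof -
  have "real (card A) = (\<Sum>v\<in>A. 1)" by simp
  also have "\<dots> \<le> (\<Sum>v\<in>A. ps v * heavy_bound (K / \<epsilon>))"
    using assms active_heavy by (intro sum_mono) auto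
  finally show ?thesis by (simp add: sum_distrib_right)
qed

lemma card_active: "k \<le> K \<Longrightarrow> card (Collect active) \<le> k * heavy_bound (K / \<epsilon>)"
  by (rule order_trans[OF card_heavy[of K, OF _ subset_refl] mult_right_mono[OF sum_active_ps]])
    (use heavy_bound_ge[of "K / \<epsilon>"] in auto)

lemma card_leaves:
  assumes "k \<le> K"
  shows "card leaves \<le> heavy_bound (K / \<epsilon>)"
proof -
  have "leaves \<subseteq> Collect active" by (auto simp: leaves_def)
  from card_heavy[OF assms this] mult_right_mono[OF sum_leaves_ps, of "heavy_bound (K / \<epsilon>)"]
  show ?thesis using heavy_bound_ge[of "K / \<epsilon>"] by linarith
qed

lemma sum_card_achs: "(\<Sum>v\<in>Collect active. card (achs v)) \<le> card (Collect active)"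
proof -
  have "(\<Sum>v\<in>Collect active. card (achs v)) = card (\<Union>v\<in>Collect active. achs v)"
    by (rule card_UN_disjoint[symmetric]) (auto simp: achs_def ch_iff)
  also have "\<dots> \<le> card (Collect active)"
    by (rule card_mono) (auto simp: achs_def)
  finally show ?thesis .
qed

text \<open>The bracket is the number of children beyond the first, and 0 for \<open>h = 0\<close>.
  For \<open>h \<le> 1\<close> the constant 4 suffices; for \<open>h \<ge> 2\<close> the chain is
  \<open>(k + 1) * (h + 1) \<le> 4 * k * h \<le> 8 * k * (h - 1)\<close>.\<close>

lemma square_bound:
  assumes "m \<le> k" "m \<le> h"
  shows "real ((m + 1)\<^sup>2) \<le> 4 + 8 * real k * (real h - 1 + (if h = 0 then 1 else 0))"
proof -
  consider "h = 0" | "h = 1" | "2 \<le> h" by linarith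
  then show ?thesis
  proof cases
    case 2
    then have "real (m + 1) ^ 2 \<le> 2 ^ 2" using assms by (intro power_mono) auto
    then show ?thesis using 2 by (simp only: of_nat_power) simp
  next
    case 3
    have "(m + 1)\<^sup>2 \<le> (k + 1) * (h + 1)" unfolding power2_eq_square using assms by (intro mult_mono) auto
    also have "\<dots> \<le> (2 * k) * (2 * h)" using 3 k_pos by (intro mult_mono) auto
    finally have "real ((m + 1)\<^sup>2) \<le> 4 * real k * real h"
      using of_nat_mono[where 'a = real, of "(m + 1)\<^sup>2" "(2 * k) * (2 * h)"] by simp
    also have "\<dots> \<le> 4 * real k * (2 * (real h - 1))" using 3 by (intro mult_left_mono) auto
    finally show ?thesis using 3 by (simp add: algebra_simps)
  qed (use assms in auto)
qed

text \<open>The children beyond the first number at most as many as the lowest active nodes, which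
  \<open>card_leaves\<close> bounds without a factor \<open>k\<close>. Only the constant 4 is
  charged to all active nodes, of which there may be \<open>k\<close> times as many; so both
  contributions are of order \<open>k * heavy_bound (K / \<epsilon>)\<close>.\<close>

lemma sum_square_bound:
  assumes "k \<le> K" "\<And>v. active v \<Longrightarrow> m v \<le> k \<and> m v \<le> card (achs v)"
  shows "real (\<Sum>v\<in>Collect active. (m v + 1)\<^sup>2) \<le> 12 * real k * heavy_bound (K / \<epsilon>)"
proof -
  let ?A = "Collect active"
  have l: "(\<Sum>v\<in>?A. if achs v = {} then 1 else 0) = real (card leaves)"
    by (simp add: leaves_def sum.If_cases Collect_conj_eq Int_commute)
  have "real (\<Sum>v\<in>?A. (m v + 1)\<^sup>2) \<le>
      (\<Sum>v\<in>?A. 4 + 8 * real k * (real (card (achs v)) - 1 + (if achs v = {} then 1 else 0)))"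
    unfolding of_nat_sum
  proof (rule sum_mono)
    fix v assume "v \<in> ?A"
    then show "real ((m v + 1)\<^sup>2) \<le> 4 + 8 * real k * (real (card (achs v)) - 1 + (if achs v = {} then 1 else 0))"
      using square_bound[of "m v" "card (achs v)"] assms(2)[of v] by simp
  qed
  also have "\<dots> = 4 * real (card ?A) + 8 * real k * (real (\<Sum>v\<in>?A. card (achs v)) - real (card ?A) + real (card leaves))"
    unfolding l[symmetric] by (simp add: sum.distrib sum_subtractf sum_distrib_left algebra_simps)
  also have "\<dots> \<le> 4 * (real k * heavy_bound (K / \<epsilon>)) + 8 * real k * heavy_bound (K / \<epsilon>)"
  proof (intro add_mono mult_left_mono)
    show "real (card ?A) \<le> real k * heavy_bound (K / \<epsilon>)" by (rule card_active[OF assms(1)])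
    have "real (\<Sum>v\<in>?A. card (achs v)) \<le> card ?A" using sum_card_achs by (rule of_nat_mono)
    then show "real (\<Sum>v\<in>?A. card (achs v)) - real (card ?A) + real (card leaves) \<le> heavy_bound (K / \<epsilon>)"
      using card_leaves[OF assms(1)] by linarith
  qed auto
  finally show ?thesis by simp
qed

end

section \<open>Configurations\<close>

lemma image_const: "x \<in> A \<Longrightarrow> (\<And>u. u \<in> A \<Longrightarrow> f u = f x) \<Longrightarrow> f ` A = {f x}"
  by blast

context weighted_tree begin

text \<open>A summary tree is encoded by the set \<open>own\<close> of nodes that are not inside an \<open>other\<close> node and whose
  proper ancestors are all split off as singletons, and the set \<open>ex \<subseteq> own\<close> of nodes split off themselves.\<close>

definition config :: "nat set \<Rightarrow> nat set \<Rightarrow> bool" where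
  "config ex own \<longleftrightarrow> rt \<in> own \<and> own \<subseteq> {..<n} \<and> ex \<subseteq> own \<and> (\<forall>v\<in>own. v \<noteq> rt \<longrightarrow> par v \<in> ex)"

definition config_value :: "nat set \<Rightarrow> nat set \<Rightarrow> real" where
  "config_value ex own = (\<Sum>v\<in>own. plogp (if v \<in> ex then pw v else ps v)) +
     (\<Sum>p\<in>ex. plogp (\<Sum>x\<in>ch p - own. ps x))"

definition config_count :: "nat set \<Rightarrow> nat set \<Rightarrow> nat" where
  "config_count ex own = card own + card {p \<in> ex. ch p - own \<noteq> {}}"

text \<open>Tops are the nodes where a label is decided; any other node inherits the label of its
  parent.\<close>

definition is_top :: "nat set \<Rightarrow> nat \<Rightarrow> bool" where
  "is_top ex t \<longleftrightarrow> t < n \<and> (t = rt \<or> par t \<in> ex)"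

text \<open>Identifies the summary-tree node of a top before numbers are chosen: all children of
  \<open>p\<close> outside \<open>own\<close> share the one \<open>other\<close> node of
  \<open>p\<close>.\<close>

definition key :: "nat set \<Rightarrow> nat \<Rightarrow> nat + nat" where
  "key own t = (if t \<in> own then Inl t else Inr (par t))"

text \<open>The requirement on the two output arrays. Note that \<open>sp\<close> is indexed by
  labels and not by nodes of the input tree.\<close>

definition labelling :: "nat set \<Rightarrow> nat set \<Rightarrow> nat \<Rightarrow> (nat \<Rightarrow> nat) \<Rightarrow> (nat \<Rightarrow> nat) \<Rightarrow> bool" where
  "labelling ex own k lab sp \<longleftrightarrow> lab rt = 0 \<and> lab ` {..<n} = {..<k} \<and>
     (\<forall>v<n. v \<noteq> rt \<longrightarrow> (if par v \<in> ex then sp (lab v) = lab (par v) else lab v = lab (par v))) \<and>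
     (\<forall>t u. is_top ex t \<longrightarrow> is_top ex u \<longrightarrow> (lab t = lab u \<longleftrightarrow> key own t = key own u))"

end

section \<open>From a labelled configuration to a summary tree\<close>

locale labelled_config = weighted_tree +
  fixes ex own :: "nat set" and k :: nat and lab sp :: "nat \<Rightarrow> nat"
  assumes config: "config ex own" and labelling: "labelling ex own k lab sp"
begin

lemma root_own: "rt \<in> own" and own_lt: "v \<in> own \<Longrightarrow> v < n" and ex_own: "v \<in> ex \<Longrightarrow> v \<in> own"
  and own_par: "v \<in> own \<Longrightarrow> v \<noteq> rt \<Longrightarrow> par v \<in> ex"
  using config by (auto simp: config_def)

lemma lab_root: "lab rt = 0" and lab_image: "lab ` {..<n} = {..<k}"
  and lab_merged: "v < n \<Longrightarrow> v \<noteq> rt \<Longrightarrow> par v \<notin> ex \<Longrightarrow> lab v = lab (par v)"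
  and sp_lab: "v < n \<Longrightarrow> v \<noteq> rt \<Longrightarrow> par v \<in> ex \<Longrightarrow> sp (lab v) = lab (par v)"
  and lab_eq_iff: "is_top ex t \<Longrightarrow> is_top ex u \<Longrightarrow> lab t = lab u \<longleftrightarrow> key own t = key own u"
  using labelling by (auto simp: labelling_def)

lemma own_top: "v \<in> own \<Longrightarrow> is_top ex v"
  using own_lt own_par by (auto simp: is_top_def)

text \<open>On the way down the label can change only below a node that is split off. The last
  disjunct distinguishes split tops, whose labels belong to no further node.\<close>

lemma top_above:
  "v < n \<Longrightarrow> \<exists>t. is_top ex t \<and> v \<in> sub t \<and> lab v = lab t \<and> (v = t \<or> t \<notin> ex)"
proof (induction rule: top_down)
  case root
  show ?case using own_top[OF root_own] sub_self by auto
next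
  case (child v)
  show ?case
  proof (cases "par v \<in> ex")
    case True
    then show ?thesis using child sub_self by (auto simp: is_top_def)
  next
    case False
    obtain t where t: "is_top ex t" "par v \<in> sub t" "lab (par v) = lab t" "par v = t \<or> t \<notin> ex"
      using child by blast
    then have "v \<in> sub t" using sub_par child by blast
    then show ?thesis using t False lab_merged[OF child(1,2) False] by auto
  qed
qed

lemma ex_up: "(u, t) \<in> (child_rel T)\<^sup>* \<Longrightarrow> u \<in> ex \<Longrightarrow> t \<in> ex"
  by (induction rule: rtrancl_induct) (auto simp: child_rel_iff dest: ex_own own_par)

lemma lab_sub: 
  assumes "t \<notin> ex" "u \<in> sub t"
  shows "lab u = lab t"
proof -
  have "(u, t) \<in> (child_rel T)\<^sup>*" using assms(2) by (simp add: sub_iff)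
  then show ?thesis
  proof (induction rule: converse_rtrancl_induct)
    case (step y z)
    have "z \<notin> ex" using ex_up[OF step(2)] assms(1) by blast
    then show ?case using step lab_merged[of y] by (auto simp: child_rel_iff)
  qed simp
qed

definition fib :: "nat \<Rightarrow> nat set" where "fib j = {v. v < n \<and> lab v = j}"

lemma fib_collapse: "v \<in> own \<Longrightarrow> v \<notin> ex \<Longrightarrow> fib (lab v) = sub v"
proof (intro equalityI subsetI)
  fix u assume v: "v \<in> own" and u: "u \<in> fib (lab v)"
  then obtain t where t: "is_top ex t" "u \<in> sub t" "lab v = lab t" using top_above[of u] by (auto simp: fib_def)
  then have "t = v" using lab_eq_iff[OF own_top[OF v] t(1)] v by (auto simp: key_def split: if_splits)
  then show "u \<in> sub v" using t by simp
qed (auto simp: fib_def lab_sub sub_lt)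

lemma fib_expand: "v \<in> ex \<Longrightarrow> fib (lab v) = {v}"
proof (intro equalityI subsetI)
  fix u assume v: "v \<in> ex" and u: "u \<in> fib (lab v)"
  then obtain t where t: "is_top ex t" "u = t \<or> t \<notin> ex" "lab v = lab t" using top_above[of u] by (auto simp: fib_def)
  then have "t = v" using lab_eq_iff[OF own_top[OF ex_own[OF v]] t(1)] ex_own[OF v] by (auto simp: key_def split: if_splits)
  then show "u \<in> {v}" using t v by simp
qed (auto simp: fib_def own_lt ex_own)

lemma fib_other:
  assumes p: "p \<in> ex" and x: "x \<in> ch p - own"
  shows "fib (lab x) = (\<Union>y\<in>ch p - own. sub y)"
proof (intro equalityI subsetI)
  have xt: "is_top ex x" using assms by (auto simp: is_top_def ch_iff)
  {
    fix u assume u: "u \<in> fib (lab x)"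
    then obtain t where t: "is_top ex t" "u \<in> sub t" "lab x = lab t" using top_above[of u] by (auto simp: fib_def)
    then have k: "t \<notin> own" "par t = p" using lab_eq_iff[OF xt t(1)] x by (auto simp: key_def ch_iff split: if_splits)
    then have "t \<in> ch p" using t(1) root_own by (auto simp: ch_iff is_top_def)
    then show "u \<in> (\<Union>y\<in>ch p - own. sub y)" using t k by auto
  }
  fix u assume "u \<in> (\<Union>y\<in>ch p - own. sub y)"
  then obtain y where y: "y \<in> ch p - own" "u \<in> sub y" by blast
  then have "is_top ex y" using p by (auto simp: is_top_def ch_iff)
  then have "lab y = lab x" using lab_eq_iff[OF _ xt] x y by (auto simp: key_def ch_iff)
  moreover have "lab u = lab y" using lab_sub[OF _ y(2)] y ex_own by blast
  ultimately show "u \<in> fib (lab x)" using y sub_lt by (simp add: fib_def)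
qed

text \<open>The output restricted to the subtree of \<open>v\<close>, which follows the recursion of
  \<open>summary_tree_at\<close>; at the root it is the whole output by
  \<open>summ_root\<close>.\<close>

definition summ :: "nat \<Rightarrow> summary" where
  "summ v = \<lparr>sroot = fib (lab v), snodes = fib ` lab ` sub v,
     sedges = (\<lambda>j. (fib (sp j), fib j)) ` (lab ` sub v - {lab v})\<rparr>"

lemma lab_other_image: "x \<notin> own \<Longrightarrow> x < n \<Longrightarrow> lab ` sub x = {lab x}"
proof -
  assume x: "x \<notin> own" "x < n"
  then have "lab u = lab x" if "u \<in> sub x" for u using lab_sub[OF _ that] ex_own by blast
  moreover have "x \<in> sub x" using sub_self[OF x(2)] .
  ultimately show ?thesis by (rule image_const[rotated])
qed

text \<open>From the leaves upwards each node of \<open>own\<close> is matched with a rule: outside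
  \<open>ex\<close> with \<open>collapse\<close>, inside \<open>ex\<close> with
  \<open>expand\<close> or \<open>other\<close>, depending on whether all its children are in
  \<open>own\<close>.\<close>

lemma summary_summ: "v < n \<Longrightarrow> v \<in> own \<longrightarrow> summary_tree_at T v (summ v)"
proof (induction rule: bottom_up)
  case (node v)
  show ?case
  proof
    assume v: "v \<in> own"
    show "summary_tree_at T v (summ v)"
    proof (cases "v \<in> ex")
      case False
      have "lab ` sub v = {lab v}" by (rule image_const[OF sub_self[OF node.hyps]]) (rule lab_sub[OF False])
      then have "summ v = \<lparr>sroot = sub v, snodes = {sub v}, sedges = {}\<rparr>"
        using fib_collapse[OF v False] by (simp add: summ_def)
      then show ?thesis using summary_tree_at.collapse[OF node.hyps] by simp
    next
      case True
      define U where "U = ch v - own"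
      have fv: "fib (lab v) = {v}" using fib_expand[OF True] .
      have notv: "lab v \<notin> lab ` sub x" if "x \<in> ch v" for x
      proof
        assume "lab v \<in> lab ` sub x"
        then obtain u where u: "u \<in> sub x" "lab u = lab v" by auto
        then have "u \<in> fib (lab v)" using sub_lt by (simp add: fib_def)
        then show False using fv u not_in_sub_ch[OF that] by simp
      qed
      have spx: "sp (lab x) = lab v" if "x \<in> ch v" for x using sp_lab[of x] that True by (auto simp: ch_iff)
      have own_ch: "ch v - U = ch v \<inter> own" by (auto simp: U_def)
      have S: "summary_tree_at T x (summ x)" if "x \<in> ch v - U" for x using node.IH[of x] that by (auto simp: U_def)
      have img: "lab ` sub v = insert (lab v) ((\<Union>x\<in>U. {lab x}) \<union> (\<Union>x\<in>ch v - U. lab ` sub x))"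
      proof -
        have "(\<Union>x\<in>ch v. lab ` sub x) = (\<Union>x\<in>U. lab ` sub x) \<union> (\<Union>x\<in>ch v - U. lab ` sub x)"
          by (auto simp: U_def)
        also have "(\<Union>x\<in>U. lab ` sub x) = (\<Union>x\<in>U. {lab x})"
          using lab_other_image ch_lt by (intro SUP_cong) (auto simp: U_def)
        finally show ?thesis by (subst sub_unfold[OF node.hyps]) (simp only: image_insert image_UN)
      qed
      have img': "lab ` sub v - {lab v} = (\<Union>x\<in>U. {lab x}) \<union> (\<Union>x\<in>ch v - U. insert (lab x) (lab ` sub x - {lab x}))"
      proof -
        have "lab x \<in> lab ` sub x \<and> lab v \<noteq> lab x" if "x \<in> ch v" for x
          using notv[OF that] sub_self[OF ch_lt[OF that]] by auto
        then show ?thesis unfolding img using notv unfolding U_def by blast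
      qed
      have sx: "sroot (summ x) = fib (lab x)" "snodes (summ x) = fib ` lab ` sub x"
        "sedges (summ x) = (\<lambda>j. (fib (sp j), fib j)) ` (lab ` sub x - {lab x})" for x
        by (simp_all add: summ_def)
      have nodes: "snodes (summ v) = insert {v} ((\<Union>x\<in>U. {fib (lab x)}) \<union> (\<Union>x\<in>ch v - U. snodes (summ x)))"
        unfolding sx img image_insert image_Un image_UN fv by auto
      have edges: "sedges (summ v) = (\<Union>x\<in>U. {({v}, fib (lab x))}) \<union> (\<Union>x\<in>ch v - U. {({v}, sroot (summ x))} \<union> sedges (summ x))"
        unfolding sx img' image_insert image_Un image_UN using spx fv by (auto simp: U_def)
      show ?thesis
      proof (cases "U = {}")
        case True
        have "summ v = \<lparr>sroot = {v}, snodes = {{v}} \<union> (\<Union>x \<in> ch v. snodes (summ x)),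
          sedges = (\<Union>x \<in> ch v. {({v}, sroot (summ x))} \<union> sedges (summ x))\<rparr>"
          by (rule summary.equality) (use nodes edges True fv sx in auto)
        then show ?thesis using summary_tree_at.expand[OF node.hyps, of summ] S True by simp
      next
        case False
        define w where "w = (\<Union>x\<in>U. sub x)"
        have fw: "fib (lab x) = w" if "x \<in> U" for x
          using fib_other[OF \<open>v \<in> ex\<close>] that by (simp add: w_def U_def)
        have "summ v = \<lparr>sroot = {v}, snodes = {{v}, w} \<union> (\<Union>x \<in> ch v - U. snodes (summ x)),
          sedges = {({v}, w)} \<union> (\<Union>x \<in> ch v - U. {({v}, sroot (summ x))} \<union> sedges (summ x))\<rparr>"
          by (rule summary.equality) (use nodes edges False fv fw in \<open>auto simp: sx(1)\<close>)
        then show ?thesis using summary_tree_at.other[OF node.hyps _ False w_def, of summ] S by (auto simp: U_def)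
      qed
    qed
  qed
qed

lemma summ_root: "output_summary n k s = summ rt" if "\<And>v. v < n \<Longrightarrow> nats s ''label'' v = lab v" "nats s ''sparent'' = sp"
proof -
  have l: "output_label n s = fib" using that(1) by (auto simp: output_label_def fib_def fun_eq_iff)
  have "{..<k} - {0} = {j. 1 \<le> j \<and> j < k}" by auto
  then have e: "(\<lambda>j. (fib (sp j), fib j)) ` ({..<k} - {0}) = {(fib (sp j), fib j) | j. 1 \<le> j \<and> j < k}"
    by (simp only:) blast
  show ?thesis
    unfolding output_summary_def l summ_def sub_root lab_image lab_root that(2) e ..
qed

text \<open>Every label below \<open>k\<close> occurs, so the fibres are nonempty as well as
  disjoint.\<close>

lemma fib_inj: "inj_on fib {..<k}"
proof (rule inj_onI)
  fix i j assume i: "i \<in> {..<k}" and eq: "fib i = fib j"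
  from i have "i \<in> lab ` {..<n}" unfolding lab_image .
  then obtain v where "v \<in> fib i" by (auto simp: fib_def)
  moreover from this have "v \<in> fib j" unfolding eq .
  ultimately show "i = j" by (simp add: fib_def)
qed

lemma card_summ: "card (snodes (summ rt)) = k"
  using card_image[OF fib_inj] by (simp add: summ_def sub_root lab_image)

lemma entropy_summ: "entropy T (summ rt) = config_value ex own"
proof -
  let ?f = "\<lambda>j. plogp (node_prob T (fib j))"
  let ?P = "{p \<in> ex. ch p - own \<noteq> {}}"
  \<comment> \<open>A representative child gives access to the label of each nonempty
    \<open>other\<close> node.\<close>
  define rep where "rep p = (SOME x. x \<in> ch p - own)" for p
  have rep: "rep p \<in> ch p - own" if "p \<in> ?P" for p
    using that some_in_eq[of "ch p - own"] by (simp add: rep_def)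
  have rt: "is_top ex (rep p)" if "p \<in> ?P" for p using rep[OF that] that by (auto simp: is_top_def ch_iff)
  have fo: "finite own" using own_lt by (intro finite_subset[of own "{..<n}"]) auto
  then have fe: "finite ex" using ex_own finite_subset[of ex own] by auto
  have split: "{..<k} = lab ` own \<union> (\<lambda>p. lab (rep p)) ` ?P"
  proof (intro equalityI subsetI)
    fix j assume "j \<in> {..<k}"
    then obtain v where v: "v < n" "lab v = j" using lab_image by (metis image_iff lessThan_iff)
    then obtain t where t: "is_top ex t" "lab t = j" using top_above[of v] by auto
    show "j \<in> lab ` own \<union> (\<lambda>p. lab (rep p)) ` ?P"
    proof (cases "t \<in> own")
      case False
      then have "t \<in> ch (par t) - own" "par t \<in> ex" using t root_own by (auto simp: is_top_def ch_iff)
      then have p: "par t \<in> ?P" by auto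
      have "key own (rep (par t)) = key own t" using rep[OF p] False by (auto simp: key_def ch_iff)
      then have "lab (rep (par t)) = j" using lab_eq_iff[OF rt[OF p] t(1)] t by simp
      then show ?thesis using p by blast
    qed (use t in auto)
  next
    fix j assume "j \<in> lab ` own \<union> (\<lambda>p. lab (rep p)) ` ?P"
    then have "j \<in> lab ` {..<n}" using own_lt rt by (fastforce simp: is_top_def)
    then show "j \<in> {..<k}" using lab_image by simp
  qed
  have inj1: "inj_on lab own"
    using lab_eq_iff[OF own_top own_top] by (intro inj_onI) (auto simp: key_def split: if_splits)
  have inj2: "inj_on (\<lambda>p. lab (rep p)) ?P"
    using lab_eq_iff[OF rt rt] rep by (intro inj_onI) (force simp: key_def ch_iff split: if_splits)
  have disj: "lab ` own \<inter> (\<lambda>p. lab (rep p)) ` ?P = {}"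
    using lab_eq_iff[OF own_top rt] rep by (force simp: key_def split: if_splits)
  have pr: "node_prob T (\<Union>x\<in>ch p - own. sub x) = (\<Sum>x\<in>ch p - own. ps x)" for p
    unfolding node_prob_sum ps_def
    by (rule sum.UNION_disjoint) (auto dest: sub_disjoint_ch[THEN equalityD1])
  have "entropy T (summ rt) = (\<Sum>j<k. ?f j)"
    by (simp add: entropy_def plogp_def sum_negf summ_def sub_root lab_image sum.reindex[OF fib_inj])
  also have "\<dots> = (\<Sum>v\<in>own. ?f (lab v)) + (\<Sum>p\<in>?P. ?f (lab (rep p)))"
  proof -
    have "(\<Sum>j<k. ?f j) = sum ?f (lab ` own) + sum ?f ((\<lambda>p. lab (rep p)) ` ?P)"
      unfolding split using fo fe disj by (intro sum.union_disjoint) auto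
    then show ?thesis using sum.reindex[OF inj1, of ?f] sum.reindex[OF inj2, of ?f] by (simp add: o_def)
  qed
  also have "(\<Sum>v\<in>own. ?f (lab v)) = (\<Sum>v\<in>own. plogp (if v \<in> ex then pw v else ps v))"
    by (intro sum.cong) (auto simp: fib_expand fib_collapse node_prob_sum ps_def)
  also have "(\<Sum>p\<in>?P. ?f (lab (rep p))) = (\<Sum>p\<in>?P. plogp (\<Sum>x\<in>ch p - own. ps x))"
  proof (intro sum.cong refl)
    fix p assume p: "p \<in> ?P"
    then show "?f (lab (rep p)) = plogp (\<Sum>x\<in>ch p - own. ps x)"
      using fib_other[OF _ rep[OF p]] pr[of p] by simp
  qed
  \<comment> \<open>Empty \<open>other\<close> nodes contribute \<open>plogp 0\<close>, so the sum
    may run over all of \<open>ex\<close>.\<close>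
  also have "\<dots> = (\<Sum>p\<in>ex. plogp (\<Sum>x\<in>ch p - own. ps x))"
  proof (rule sum.mono_neutral_left[OF fe])
    show "\<forall>p\<in>ex - ?P. plogp (\<Sum>x\<in>ch p - own. ps x) = 0"
    proof
      fix p assume "p \<in> ex - ?P"
      then have "ch p - own = {}" by blast
      then show "plogp (\<Sum>x\<in>ch p - own. ps x) = 0" by (simp only: sum.empty plogp_0)
    qed
  qed auto
  finally show ?thesis by (simp add: config_value_def)
qed

end

section \<open>Changes of configurations: refinement and backtracking\<close>

context summary_dp begin

lemma finite_config: "config ex own \<Longrightarrow> finite ex \<and> finite own"
  unfolding config_def by (meson finite_lessThan finite_subset)

text \<open>Splitting a part in two cannot lower the value by \<open>gain_nonneg\<close>; the terms
  of other parents are untouched because \<open>v\<close> has only one parent.\<close>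

lemma other_value_split:
  assumes "config ex own" "v \<in> ch p - own" "p \<in> ex"
  shows "(\<Sum>q\<in>ex. plogp (\<Sum>x\<in>ch q - own. ps x)) \<le>
    plogp (ps v) + (\<Sum>q\<in>ex. plogp (\<Sum>x\<in>ch q - insert v own. ps x))"
proof -
  have fin: "finite ex" using finite_config[OF assms(1)] by simp
  have eq: "ch q - insert v own = ch q - own" if "q \<noteq> p" for q using assms(2) that by (auto simp: ch_iff)
  have "(\<Sum>x\<in>ch p - own. ps x) = ps v + (\<Sum>x\<in>ch p - insert v own. ps x)"
  proof -
    have "ch p - own = insert v (ch p - insert v own)" using assms(2) by blast
    then show ?thesis by (metis DiffD2 finite_Diff finite_ch insertI1 sum.insert)
  qed
  moreover have "0 \<le> gain (ps v) (\<Sum>x\<in>ch p - insert v own. ps x)"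
    using ps_nonneg by (intro gain_nonneg sum_nonneg) auto
  ultimately have "plogp (\<Sum>x\<in>ch p - own. ps x) \<le> plogp (ps v) + plogp (\<Sum>x\<in>ch p - insert v own. ps x)"
    by (simp add: gain_def)
  then show ?thesis
    using sum.remove[OF fin assms(3), of "\<lambda>q. plogp (\<Sum>x\<in>ch q - own. ps x)"]
      sum.remove[OF fin assms(3), of "\<lambda>q. plogp (\<Sum>x\<in>ch q - insert v own. ps x)"]
      sum.cong[of "ex - {p}" "ex - {p}" "\<lambda>q. plogp (\<Sum>x\<in>ch q - own. ps x)" "\<lambda>q. plogp (\<Sum>x\<in>ch q - insert v own. ps x)"] eq
    by simp
qed

text \<open>If \<open>v\<close> was alone in \<open>other\<close>, that node merely changes its kind
  and becomes the collapsed subtree of \<open>v\<close>, so the count stays the same.\<close>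

lemma split_other:
  assumes cf: "config ex own" and v: "v \<in> ch p - own" and p: "p \<in> ex"
  shows "config ex (insert v own)"
    and "config_value ex own \<le> config_value ex (insert v own)"
    and "config_count ex (insert v own) = config_count ex own + (if ch p - own = {v} then 0 else 1)"
proof -
  have fin: "finite ex" "finite own" using finite_config[OF cf] by auto
  show "config ex (insert v own)" using cf v p by (auto simp: config_def ch_iff)
  have vex: "v \<notin> ex" using cf v by (auto simp: config_def)
  show "config_value ex own \<le> config_value ex (insert v own)"
    using other_value_split[OF cf v p] v vex fin by (simp add: config_value_def)
  have eq: "ch q - insert v own = ch q - own" if "q \<noteq> p" for q using v that by (auto simp: ch_iff)
  have "{q \<in> ex. ch q - own \<noteq> {}} = insert p {q \<in> ex - {p}. ch q - own \<noteq> {}}" using v p by blast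
  moreover have "{q \<in> ex. ch q - insert v own \<noteq> {}} = 
     (if ch p - own = {v} then {} else {p}) \<union> {q \<in> ex - {p}. ch q - own \<noteq> {}}"
  proof -
    have "(ch p - insert v own = {}) = (ch p - own = {v})" using v by blast
    then have "q \<in> {q \<in> ex. ch q - insert v own \<noteq> {}} \<longleftrightarrow>
       q \<in> (if ch p - own = {v} then {} else {p}) \<union> {q \<in> ex - {p}. ch q - own \<noteq> {}}" for q
      using arg_cong[OF eq[of q], of "\<lambda>A. A = {}"] p by (cases "q = p") simp_all
    then show ?thesis by (rule set_eqI)
  qed
  ultimately show "config_count ex (insert v own) = config_count ex own + (if ch p - own = {v} then 0 else 1)"
    using fin v by (simp add: config_count_def)
qed

lemma ch_disjoint_own: "config ex own \<Longrightarrow> v \<notin> ex \<Longrightarrow> ch v \<inter> own = {}"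
  by (auto simp: config_def ch_iff)

lemma count_expand:
  assumes cf: "config ex own" and v: "v \<in> own - ex" and I: "I \<subseteq> ch v"
  shows "config (insert v ex) (own \<union> I)"
    and "card {p \<in> insert v ex. ch p - (own \<union> I) \<noteq> {}} = card {p \<in> ex. ch p - own \<noteq> {}} + (if I = ch v then 0 else 1)"
    and "ch v - (own \<union> I) = ch v - I"
    and "p \<in> ex \<Longrightarrow> ch p - (own \<union> I) = ch p - own"
    and "own \<inter> I = {}"
proof -
  have fin: "finite ex" "finite own" using finite_config[OF cf] by auto
  show "config (insert v ex) (own \<union> I)"
    using cf v I by (auto simp: config_def ch_iff)
  have dis: "ch v \<inter> own = {}" using ch_disjoint_own[OF cf] v by blast
  then show 1: "ch v - (own \<union> I) = ch v - I" and "own \<inter> I = {}" using I by blast+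
  show 2: "ch p - (own \<union> I) = ch p - own" if "p \<in> ex" for p
    using I v that by (auto simp: ch_iff)
  have "{p \<in> insert v ex. ch p - (own \<union> I) \<noteq> {}} =
      (if I = ch v then {} else {v}) \<union> {p \<in> ex. ch p - own \<noteq> {}}"
  proof (rule set_eqI)
    fix p
    have "(ch v - I = {}) = (I = ch v)" using I by blast
    then show "p \<in> {p \<in> insert v ex. ch p - (own \<union> I) \<noteq> {}} \<longleftrightarrow>
        p \<in> (if I = ch v then {} else {v}) \<union> {p \<in> ex. ch p - own \<noteq> {}}"
      using arg_cong[OF 1, of "\<lambda>A. A = {}"] arg_cong[OF 2[of p], of "\<lambda>A. A = {}"] v
      by (cases "p = v"; cases "p \<in> ex") auto
  qed
  then show "card {p \<in> insert v ex. ch p - (own \<union> I) \<noteq> {}} = card {p \<in> ex. ch p - own \<noteq> {}} + (if I = ch v then 0 else 1)"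
    using v fin by simp
qed

lemma config_count_expand:
  assumes "config ex own" "v \<in> own - ex" "I \<subseteq> ch v"
  shows "config_count (insert v ex) (own \<union> I) = config_count ex own + card I + (if I = ch v then 0 else 1)"
  using count_expand(2,5)[OF assms] finite_config[OF assms(1)] finite_subset[OF assms(3) finite_ch]
  by (simp add: config_count_def card_Un_disjoint)

text \<open>After the split all children of \<open>v\<close> form its \<open>other\<close> node. A
  leaf has none, so nothing is added there.\<close>

lemma expand_own:
  assumes cf: "config ex own" and v: "v \<in> own - ex"
  shows "config (insert v ex) own"
    and "config_value ex own \<le> config_value (insert v ex) own"
    and "config_count (insert v ex) own = config_count ex own + (if ch v = {} then 0 else 1)"
    and "ch v - own = ch v"
proof -
  note ce = count_expand[OF cf v, of "{}", simplified]
  have fin: "finite ex" "finite own" using finite_config[OF cf] by auto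
  show "config (insert v ex) own" "ch v - own = ch v" using ce by auto
  show "config_count (insert v ex) own = config_count ex own + (if ch v = {} then 0 else 1)"
    using config_count_expand[OF cf v, of "{}"] by auto
  have vn: "v < n" using cf v by (auto simp: config_def)
  have "0 \<le> gain (pw v) (\<Sum>x\<in>ch v. ps x)"
    using ps_nonneg pw_nonneg[OF vn] by (intro gain_nonneg sum_nonneg) auto
  then have g: "plogp (ps v) \<le> plogp (pw v) + plogp (\<Sum>x\<in>ch v. ps x)"
    using ps_unfold[OF vn] by (simp add: gain_def)
  have "(\<Sum>u\<in>own - {v}. plogp (if u \<in> insert v ex then pw u else ps u)) = (\<Sum>u\<in>own - {v}. plogp (if u \<in> ex then pw u else ps u))"
    by (intro sum.cong) auto
  then show "config_value ex own \<le> config_value (insert v ex) own"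
    using g v fin ce sum.remove[of own v "\<lambda>u. plogp (if u \<in> insert v ex then pw u else ps u)"]
      sum.remove[of own v "\<lambda>u. plogp (if u \<in> ex then pw u else ps u)"]
    by (simp add: config_value_def)
qed

lemma full_count: "config ex {..<n} \<Longrightarrow> n \<le> config_count ex {..<n}"
  by (simp add: config_count_def)

text \<open>During backtracking, a node outside \<open>done\<close> stands for an optimal summary tree
  of its subtree with at most \<open>J v\<close> nodes.\<close>

definition mixed_value :: "(nat \<Rightarrow> nat \<Rightarrow> real) \<Rightarrow> nat set \<Rightarrow> nat set \<Rightarrow> nat set \<Rightarrow> (nat \<Rightarrow> nat) \<Rightarrow> real" where
  "mixed_value D dn ex own J =
     (\<Sum>v\<in>own. if v \<in> dn then plogp (if v \<in> ex then pw v else ps v) else DX D v (J v)) +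
     (\<Sum>p\<in>ex. plogp (\<Sum>x\<in>ch p - own. ps x))"

definition mixed_count :: "nat set \<Rightarrow> nat set \<Rightarrow> nat set \<Rightarrow> (nat \<Rightarrow> nat) \<Rightarrow> nat" where
  "mixed_count dn ex own J = (\<Sum>v\<in>own. if v \<in> dn then 1 else J v) + card {p \<in> ex. ch p - own \<noteq> {}}"

lemma mixed_done:
  assumes "own \<subseteq> dn"
  shows "mixed_value D dn ex own J = config_value ex own" "mixed_count dn ex own J = config_count ex own"
proof -
  have "(if v \<in> dn then a else b) = a" if "v \<in> own" for v and a b :: 'x using assms that by auto
  then show "mixed_value D dn ex own J = config_value ex own" "mixed_count dn ex own J = config_count ex own"
    using assms unfolding mixed_value_def config_value_def mixed_count_def config_count_def
    by (auto intro!: sum.cong arg_cong2[of _ _ _ _ "(+)"] simp: subset_iff)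
qed

lemma mixed_skip:
  assumes "v \<notin> own"
  shows "mixed_value D (insert v dn) ex own J = mixed_value D dn ex own J"
    "mixed_count (insert v dn) ex own J = mixed_count dn ex own J"
  using assms unfolding mixed_value_def mixed_count_def
  by (auto intro!: sum.cong arg_cong2[of _ _ _ _ "(+)"])

lemma mixed_collapse:
  assumes cf: "config ex own" and v: "v \<in> own" "v \<notin> dn" "v \<notin> ex" "1 \<le> J v" "DX D v (J v) = plogp (ps v)"
  shows "mixed_value D (insert v dn) ex own J = mixed_value D dn ex own J"
    "mixed_count (insert v dn) ex own J \<le> mixed_count dn ex own J"
proof -
  show "mixed_value D (insert v dn) ex own J = mixed_value D dn ex own J"
    unfolding mixed_value_def using v by (intro arg_cong2[of _ _ _ _ "(+)"] sum.cong) auto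
  show "mixed_count (insert v dn) ex own J \<le> mixed_count dn ex own J"
    unfolding mixed_count_def using v by (intro add_mono sum_mono) auto
qed

text \<open>The entry of \<open>v\<close> is exchanged for the option that attains it, hence
  equality for the value. An option may leave part of its budget unspent, hence only an inequality
  for the count.\<close>

lemma mixed_expand:
  assumes cf: "config ex own" and v: "v \<in> own" "v \<notin> dn" "active v" and ex: "ex \<subseteq> dn"
    and opt: "option_of v (J v) I b" and val: "D v (J v) = optval D v I b"
    and dn: "\<And>x. x \<in> I \<Longrightarrow> x \<notin> insert v dn" and b: "\<And>x. x \<in> I \<Longrightarrow> J' x = b x"
    and J: "\<And>x. x \<in> own \<Longrightarrow> J' x = J x"
  shows "mixed_value D (insert v dn) (insert v ex) (own \<union> I) J' = mixed_value D dn ex own J"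
    "mixed_count (insert v dn) (insert v ex) (own \<union> I) J' \<le> mixed_count dn ex own J"
proof -
  have I: "I \<subseteq> achs v" "I \<subseteq> ch v" "finite I"
    using opt achs_subset finite_subset[OF _ finite_achs] unfolding option_of_def by blast+
  have act: "active x" if "x \<in> I" for x using I(1) that by (auto simp: achs_def)
  have vn: "v < n" using active_lt v by simp
  have vex: "v \<in> own - ex" using v ex by blast
  note ce = count_expand[OF cf vex I(2)]
  have fin: "finite ex" "finite own" using finite_config[OF cf] by auto
  let ?g = "\<lambda>u. if u \<in> dn then plogp (if u \<in> ex then pw u else ps u) else DX D u (J u)"
  let ?h = "\<lambda>u. if u \<in> insert v dn then plogp (if u \<in> insert v ex then pw u else ps u) else DX D u (J' u)"
  have 1: "sum ?h (own - {v}) = sum ?g (own - {v})"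
    using ex J by (intro sum.cong) auto
  have 2: "sum ?h I = (\<Sum>x\<in>I. D x (b x))"
    using dn b act by (intro sum.cong) (auto simp: DX_def)
  have 3: "(\<Sum>p\<in>insert v ex. plogp (\<Sum>x\<in>ch p - (own \<union> I). ps x)) =
    plogp (ps v - pw v - sum ps I) + (\<Sum>p\<in>ex. plogp (\<Sum>x\<in>ch p - own. ps x))"
  proof -
    have "sum ps (ch v - I) = ps v - pw v - sum ps I"
      using ps_unfold[OF vn] sum_diff[OF finite_ch I(2), of ps] by simp
    then show ?thesis using vex fin ce(3,4) by simp
  qed
  have "sum ?h (own \<union> I) = plogp (pw v) + sum ?g (own - {v}) + (\<Sum>x\<in>I. D x (b x))"
    using fin I(3) ce(5) sum.remove[OF fin(2) v(1), of ?h] 1 2 by (simp add: sum.union_disjoint)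
  moreover have "sum ?g own = D v (J v) + sum ?g (own - {v})"
    using sum.remove[OF fin(2) v(1), of ?g] v by (simp add: DX_def)
  ultimately show "mixed_value D (insert v dn) (insert v ex) (own \<union> I) J' = mixed_value D dn ex own J"
    unfolding mixed_value_def 3 val by (simp add: optval_def)
  let ?g = "\<lambda>u. if u \<in> dn then 1 else J u"
  let ?h = "\<lambda>u. if u \<in> insert v dn then 1 else J' u"
  have 1: "sum ?h (own - {v}) = sum ?g (own - {v})"
    using J by (intro sum.cong) auto
  have 2: "sum ?h I = sum b I"
    using dn b act by (intro sum.cong) auto
  have "sum ?h (own \<union> I) = 1 + sum ?g (own - {v}) + sum b I"
    using fin I(3) ce(5) sum.remove[OF fin(2) v(1), of ?h] 1 2 by (simp add: sum.union_disjoint)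
  moreover have "sum ?g own = J v + sum ?g (own - {v})"
    using sum.remove[OF fin(2) v(1), of ?g] v by simp
  moreover have "(if I = ch v then 1 else 2) + sum b I \<le> J v" using opt by (simp add: option_of_def optcost_def)
  ultimately show "mixed_count (insert v dn) (insert v ex) (own \<union> I) J' \<le> mixed_count dn ex own J"
    unfolding mixed_count_def ce(2) by (auto split: if_splits)
qed

end

section \<open>Counting loops and two-dimensional arrays\<close>

abbreviation N :: "string \<Rightarrow> nexp" where "N a \<equiv> NCell a (NConst 0)"
abbreviation R :: "string \<Rightarrow> rexp" where "R a \<equiv> RCell a (NConst 0)"
abbreviation seq (infixr ";;" 60) where "c ;; d \<equiv> Seq c d"
abbreviation nset :: "string \<Rightarrow> nexp \<Rightarrow> com" where "nset a e \<equiv> NAssign a (NConst 0) e"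
abbreviation rset :: "string \<Rightarrow> rexp \<Rightarrow> com" where "rset a e \<equiv> RAssign a (NConst 0) e"

definition Neq :: "nexp \<Rightarrow> nexp \<Rightarrow> bexp" where
  "Neq e f = BAnd (BNot (NLess e f)) (BNot (NLess f e))"

lemma bval_Neq [simp]: "bval s (Neq e f) \<longleftrightarrow> nval s e = nval s f"
  by (auto simp: Neq_def)

text \<open>The stride \<open>k + 1\<close> gives each row the columns 0 to \<open>k\<close>.
  Nesting it, as in \<open>ix k (ix k x e) j\<close>, yields three-dimensional arrays.\<close>

definition ix :: "nat \<Rightarrow> nat \<Rightarrow> nat \<Rightarrow> nat" where
  "ix k a b = a * (k + 1) + b"

lemma ix_eq_iff:
  assumes "b \<le> k" "b' \<le> k"
  shows "ix k a b = ix k a' b' \<longleftrightarrow> a = a' \<and> b = b'"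
proof
  assume eq: "ix k a b = ix k a' b'"
  have div: "ix k a b div (k + 1) = a" if "b \<le> k" for a b
    using div_mult_self1[of "k + 1" b a] that by (simp add: ix_def add.commute)
  have "a = ix k a b div (k + 1)" using div[OF assms(1)] by simp
  also have "\<dots> = a'" unfolding eq using div[OF assms(2)] by simp
  finally show "a = a' \<and> b = b'" using eq by (simp add: ix_def)
qed simp

definition IX :: "nexp \<Rightarrow> nexp \<Rightarrow> nexp" where
  "IX e f = NAdd (NMul e (NAdd (N ''k'') (NConst 1))) f"

lemma nval_IX [simp]: "nval s (IX e f) = ix (nats s ''k'' 0) (nval s e) (nval s f)"
  by (simp add: IX_def ix_def)

definition PL :: "rexp \<Rightarrow> rexp" where
  "PL e = RMul (RSub (ROfNat (NConst 0)) e) (RLog e)"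

lemma rval_PL [simp]: "rval s (PL e) = plogp (rval s e)"
  by (simp add: PL_def plogp_def)

definition FOR :: "string \<Rightarrow> nexp \<Rightarrow> com \<Rightarrow> com" where
  "FOR x e c = nset x (NConst 0) ;; While (NLess (N x) e) (c ;; nset x (NAdd (N x) (NConst 1)))"

lemma FOR_writes [simp]:
  "nwrites (FOR x e c) = insert x (nwrites c)" "rwrites (FOR x e c) = rwrites c"
  by (auto simp: FOR_def)

text \<open>The counter is overwritten between rounds, hence \<open>stable\<close>; the limit is
  evaluated anew in each round, hence \<open>bound\<close>. The 10 is 6 for the increment and 4 for
  the guard; the extra round of \<open>m + 1\<close> covers the initialisation and the final
  guard.\<close>

lemma runs_FOR:
  assumes init: "I 0 s0"
    and stable: "\<And>i s v. I i s \<Longrightarrow> I i (upn s x 0 v)"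
    and bound: "\<And>i s. i \<le> m \<Longrightarrow> I i s \<Longrightarrow> frame (FOR x e c) s0 s \<Longrightarrow> nval s e = m"
    and step: "\<And>i s. i < m \<Longrightarrow> I i s \<Longrightarrow> nats s x 0 = i \<Longrightarrow> frame (FOR x e c) s0 s \<Longrightarrow> runs c s (t i) (I (Suc i))"
    and x: "x \<notin> nwrites c"
    and time: "(\<Sum>i<m. t i) + (10 + ncost e) * (m + 1) \<le> u"
  shows "runs (FOR x e c) s0 u (I m)"
  unfolding FOR_def
proof (rule runs_Seq)
  show "runs (nset x (NConst 0)) s0 3 (\<lambda>s. I 0 s \<and> nats s x 0 = 0)"
    using stable[OF init, of 0] by (intro runs_loopfree) auto
next
  fix s1 assume s1: "frame (nset x (NConst 0)) s0 s1" "I 0 s1 \<and> nats s1 x 0 = 0"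
  let ?w = "c ;; nset x (NAdd (N x) (NConst 1))"
  have fr: "frame (FOR x e c) s0 s" if "frame ?w s1 s" for s
    using that s1(1) by (auto simp: frame_def)
  have "runs (While (NLess (N x) e) ?w) s1 ((\<Sum>i<m. t i) + (10 + ncost e) * m + 4 + ncost e) (\<lambda>s. I m s \<and> nats s x 0 = m)"
  proof (rule runs_While)
    fix i s assume i: "i < m" and s: "I i s \<and> nats s x 0 = i" "frame ?w s1 s"
    have "nval s e = m" using bound[of i s] i s fr by auto
    moreover have "runs ?w s (t i + 6) (\<lambda>s. I (Suc i) s \<and> nats s x 0 = Suc i)"
    proof (rule runs_Seq)
      show "runs c s (t i) (I (Suc i))" using step[OF i] s fr by auto
      fix s' assume s': "frame c s s'" "I (Suc i) s'"
      have "nats s' x 0 = i" using frame_nats[OF s'(1) x] s(1) by simp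
      then show "runs (nset x (NAdd (N x) (NConst 1))) s' 6 (\<lambda>s. I (Suc i) s \<and> nats s x 0 = Suc i)"
        using stable[OF s'(2)] by (intro runs_loopfree) auto
    qed simp
    ultimately show "bval s (NLess (N x) e) \<and> runs ?w s (t i + 6) (\<lambda>s. I (Suc i) s \<and> nats s x 0 = Suc i)"
      using s i by simp
  next
    fix s assume "I m s \<and> nats s x 0 = m" "frame ?w s1 s"
    then show "\<not> bval s (NLess (N x) e)" using bound[of m s] fr by simp
  qed (use s1 in \<open>simp_all add: sum.distrib algebra_simps\<close>)
  then show "runs (While (NLess (N x) e) ?w) s1 ((\<Sum>i<m. t i) + (10 + ncost e) * m + 4 + ncost e) (I m)"
    by (rule runs_conseq) auto
qed (use time in \<open>simp add: algebra_simps\<close>)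

definition for_cost :: "nexp \<Rightarrow> com \<Rightarrow> nat" where
  "for_cost e c = maxcost c + 10 + ncost e"

lemma runs_FOR_loopfree:
  assumes "I 0 s0"
    and "\<And>i s v. I i s \<Longrightarrow> I i (upn s x 0 v)"
    and "\<And>i s. i \<le> m \<Longrightarrow> I i s \<Longrightarrow> frame (FOR x e c) s0 s \<Longrightarrow> nval s e = m"
    and "\<And>i s. i < m \<Longrightarrow> I i s \<Longrightarrow> nats s x 0 = i \<Longrightarrow> frame (FOR x e c) s0 s \<Longrightarrow> I (Suc i) (sem c s)"
    and "x \<notin> nwrites c" "loopfree c"
  shows "runs (FOR x e c) s0 (for_cost e c * (m + 1)) (I m)"
  by (rule runs_FOR[where t = "\<lambda>_. maxcost c"])
    (use assms in \<open>auto intro: runs_loopfree simp: algebra_simps for_cost_def\<close>)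

section \<open>Topological order\<close>

text \<open>Arrays indexed by nodes: \<open>d\<close> is the number of children and \<open>g\<close> the number of those already
  visited, \<open>w\<close> and \<open>s\<close> are the probabilities of the node and of its subtree, \<open>h\<close> is the depth, and
  \<open>a\<close> marks the active nodes. The queue \<open>q\<close> with tail \<open>t\<close> lists children before their parents.\<close>

definition "count_body =
   If (Neq (N ''i'') (N ''root'')) Skip
     (NAssign ''d'' (NCell ''parent'' (N ''i''))
       (NAdd (NCell ''d'' (NCell ''parent'' (N ''i''))) (NConst 1))) ;;
   rset ''W'' (RAdd (R ''W'') (RCell ''weight'' (N ''i'')))"

definition "leaf_body =
   RAssign ''w'' (N ''i'') (RDiv (RCell ''weight'' (N ''i'')) (R ''W'')) ;;
   RAssign ''s'' (N ''i'') (RDiv (RCell ''weight'' (N ''i'')) (R ''W'')) ;;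
   If (Neq (NCell ''d'' (N ''i'')) (NConst 0))
     (NAssign ''q'' (N ''t'') (N ''i'') ;; nset ''t'' (NAdd (N ''t'') (NConst 1))) Skip"

text \<open>Kahn's algorithm from the leaves: a node is queued when \<open>g\<close> reaches
  \<open>d\<close>, and at this moment its entry in \<open>s\<close> has received all its
  children.\<close>

definition "peel_body =
   nset ''v'' (NCell ''q'' (N ''i'')) ;;
   If (Neq (N ''v'') (N ''root'')) Skip
    (nset ''p'' (NCell ''parent'' (N ''v'')) ;;
     RAssign ''s'' (N ''p'') (RAdd (RCell ''s'' (N ''p'')) (RCell ''s'' (N ''v''))) ;;
     NAssign ''g'' (N ''p'') (NAdd (NCell ''g'' (N ''p'')) (NConst 1)) ;;
     If (NLess (NCell ''g'' (N ''p'')) (NCell ''d'' (N ''p''))) Skip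
       (NAssign ''q'' (N ''t'') (N ''p'') ;; nset ''t'' (NAdd (N ''t'') (NConst 1))))"

context summary_dp begin

definition input_ok :: "store \<Rightarrow> bool" where
  "input_ok s \<longleftrightarrow> nats s ''n'' 0 = n \<and> nats s ''root'' 0 = rt \<and> nats s ''k'' 0 = k \<and>
     (\<forall>v<n. nats s ''parent'' v = (if v = rt then rt else par v)) \<and>
     (\<forall>v<n. reals s ''weight'' v = weight T v) \<and> reals s ''eps'' 0 = \<epsilon>"

lemma input_okD:
  assumes "input_ok s"
  shows "nats s ''n'' 0 = n" "nats s ''root'' 0 = rt" "nats s ''k'' 0 = k"
    "v < n \<Longrightarrow> v \<noteq> rt \<Longrightarrow> nats s ''parent'' v = par v" "nats s ''parent'' rt = rt"
    "v < n \<Longrightarrow> reals s ''weight'' v = weight T v" "reals s ''eps'' 0 = \<epsilon>"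
  using assms by (auto simp: input_ok_def)

lemma root_not_ch: "rt \<notin> ch p"
  by (simp add: ch_iff)

lemma card_ch_Suc: "card {x \<in> ch p. x < Suc i} = card {x \<in> ch p. x < i} + (if i \<in> ch p then 1 else 0)"
proof -
  have "{x \<in> ch p. x < Suc i} = (if i \<in> ch p then insert i {x \<in> ch p. x < i} else {x \<in> ch p. x < i})"
    by (auto simp: less_Suc_eq)
  then show ?thesis by simp
qed

lemma runs_count:
  assumes inp: "input_ok s0" and z: "\<And>p. nats s0 ''d'' p = 0" "reals s0 ''W'' 0 = 0"
  shows "runs (FOR ''i'' (N ''n'') count_body) s0 (for_cost (N ''n'') count_body * (n + 1))
    (\<lambda>s. (\<forall>p. nats s ''d'' p = card (ch p)) \<and> reals s ''W'' 0 = total_weight T)"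
proof -
  note inpD = input_okD[OF inp]
  let ?I = "\<lambda>i s. (\<forall>p. nats s ''d'' p = card {x \<in> ch p. x < i}) \<and> reals s ''W'' 0 = (\<Sum>v<i. weight T v)"
  have "runs (FOR ''i'' (N ''n'') count_body) s0 (for_cost (N ''n'') count_body * (n + 1)) (?I n)"
  proof (rule runs_FOR_loopfree)
    fix i s assume i: "i < n" and I: "?I i s" and si: "nats s ''i'' 0 = i"
      and fr: "frame (FOR ''i'' (N ''n'') count_body) s0 s"
    have ich: "i \<in> ch p \<longleftrightarrow> i \<noteq> rt \<and> par i = p" for p using i by (simp add: ch_iff)
    show "?I (Suc i) (sem count_body s)"
      by (cases "i = rt")
       (use I in \<open>simp_all add: i si inpD frame_nats[OF fr] frame_reals[OF fr] card_ch_Suc ich[simplified] count_body_def root_not_ch\<close>)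
  qed (use z inpD in \<open>auto simp: frame_nats frame_reals count_body_def\<close>)
  then show ?thesis
  proof (rule runs_conseq)
    have "{x \<in> ch p. x < n} = ch p" for p using ch_lt by blast
    then show "?I n s \<Longrightarrow> (\<forall>p. nats s ''d'' p = card (ch p)) \<and> reals s ''W'' 0 = total_weight T" for s
      by (simp add: total_weight_def)
  qed simp
qed

lemma runs_leaf:
  assumes inp: "input_ok s0" and d: "\<And>p. nats s0 ''d'' p = card (ch p)" and W: "reals s0 ''W'' 0 = total_weight T"
    and z: "nats s0 ''t'' 0 = 0"
  shows "runs (FOR ''i'' (N ''n'') leaf_body) s0 (for_cost (N ''n'') leaf_body * (n + 1))
    (\<lambda>s. \<exists>t\<le>n. nats s ''t'' 0 = t \<and> inj_on (nats s ''q'') {..<t} \<and> nats s ''q'' ` {..<t} = {v. v < n \<and> ch v = {}} \<and>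
      (\<forall>v<n. reals s ''w'' v = pw v \<and> reals s ''s'' v = pw v))"
proof -
  note inpD = input_okD[OF inp]
  let ?I = "\<lambda>i s. \<exists>t\<le>i. nats s ''t'' 0 = t \<and> inj_on (nats s ''q'') {..<t} \<and> nats s ''q'' ` {..<t} = {v. v < i \<and> ch v = {}} \<and>
      (\<forall>v<i. reals s ''w'' v = pw v \<and> reals s ''s'' v = pw v)"
  show ?thesis
  proof (rule runs_FOR_loopfree[where I = ?I and m = n])
    fix i s assume i: "i < n" and I: "?I i s" and si: "nats s ''i'' 0 = i"
      and fr: "frame (FOR ''i'' (N ''n'') leaf_body) s0 s"
    obtain t where t: "t \<le> i" "nats s ''t'' 0 = t" "inj_on (nats s ''q'') {..<t}"
      "nats s ''q'' ` {..<t} = {v. v < i \<and> ch v = {}}" "\<forall>v<i. reals s ''w'' v = pw v \<and> reals s ''s'' v = pw v"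
      using I by blast
    have im: "(\<lambda>x. if x = t then i else nats s ''q'' x) ` {..<t} = nats s ''q'' ` {..<t}"
      by (intro image_cong) auto
    have inj: "inj_on (\<lambda>x. if x = t then i else nats s ''q'' x) {..<t}"
      using t(3) by (auto simp: inj_on_def)
    show "?I (Suc i) (sem leaf_body s)"
    proof (cases "ch i = {}")
      case True
      then have "i \<notin> nats s ''q'' ` {..<t}" unfolding t(4) by simp
      then show ?thesis using True t i
        by (intro exI[of _ "Suc t"])
          (auto simp: si inpD d W frame_nats[OF fr] frame_reals[OF fr] leaf_body_def less_Suc_eq lessThan_Suc im inj pw_def
            fun_upd_def)
    next
      case False
      then show ?thesis using t i
        by (intro exI[of _ t])
          (auto simp: si inpD d W frame_nats[OF fr] frame_reals[OF fr] leaf_body_def less_Suc_eq pw_def)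
    qed
  qed (use z inpD in \<open>auto simp: frame_nats frame_reals leaf_body_def\<close>)
qed

text \<open>\<open>i\<close> nodes have been taken out. That the queue holds exactly the nodes all
  of whose children are out is what guarantees progress.\<close>

definition peel_inv :: "nat \<Rightarrow> store \<Rightarrow> bool" where
  "peel_inv i s \<longleftrightarrow> (\<exists>t. i \<le> t \<and> t \<le> n \<and> nats s ''t'' 0 = t \<and> inj_on (nats s ''q'') {..<t} \<and>
     nats s ''q'' ` {..<t} = {u. u < n \<and> ch u \<subseteq> nats s ''q'' ` {..<i}} \<and>
     (\<forall>a<t. ch (nats s ''q'' a) \<subseteq> nats s ''q'' ` {..<a}) \<and>
     (\<forall>p<n. reals s ''s'' p = pw p + (\<Sum>x\<in>ch p \<inter> nats s ''q'' ` {..<i}. ps x)) \<and>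
     (\<forall>p<n. nats s ''g'' p = card (ch p \<inter> nats s ''q'' ` {..<i})))"

lemma peel_step:
  assumes inp: "input_ok s" and d: "\<And>p. nats s ''d'' p = card (ch p)"
    and i: "i < n" "nats s ''i'' 0 = i" and I: "peel_inv i s"
  shows "peel_inv (Suc i) (sem peel_body s)"
proof -
  note inpD = input_okD[OF inp]
  define q where "q = nats s ''q''"
  obtain t where t: "i \<le> t" "t \<le> n" "nats s ''t'' 0 = t" "inj_on q {..<t}"
    "q ` {..<t} = {u. u < n \<and> ch u \<subseteq> q ` {..<i}}" "\<forall>a<t. ch (q a) \<subseteq> q ` {..<a}"
    "\<forall>p<n. reals s ''s'' p = pw p + (\<Sum>x\<in>ch p \<inter> q ` {..<i}. ps x)"
    "\<forall>p<n. nats s ''g'' p = card (ch p \<inter> q ` {..<i})"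
    using I unfolding peel_inv_def q_def by blast
  \<comment> \<open>The queue cannot run dry: otherwise every node whose children are all out would
    be out itself, so by \<open>bottom_up\<close> all \<open>n\<close> nodes would be out, against
    \<open>i < n\<close>.\<close>
  have "t \<noteq> i"
  proof
    assume "t = i"
    then have eq: "q ` {..<i} = {u. u < n \<and> ch u \<subseteq> q ` {..<i}}" using t(5) by simp
    have "v \<in> q ` {..<i}" if "v < n" for v
      using that
    proof (induction rule: bottom_up)
      case (node v)
      then show ?case by (subst eq) blast
    qed
    then have "n \<le> card (q ` {..<i})" using card_mono[of "q ` {..<i}" "{..<n}"] by auto
    then show False using card_image_le[of "{..<i}" q] i by simp
  qed
  then have it: "i < t" using t(1) by simp
  define v where "v = q i"
  have "v \<in> q ` {..<t}" using it by (simp add: v_def)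
  then have v: "v < n" "ch v \<subseteq> q ` {..<i}" using t(5) by auto
  have vnew: "v \<notin> q ` {..<i}" using inj_onD[OF t(4)] it unfolding v_def by (force simp: image_iff)
  have sv: "reals s ''s'' v = ps v" using t(7) v ps_unfold[OF v(1)] by (simp add: Int_absorb2)
  have qSuc: "q ` {..<Suc i} = insert v (q ` {..<i})" by (simp add: lessThan_Suc v_def)
  show ?thesis
  proof (cases "v = rt")
    case True
    have no: "v \<notin> ch p" for p using True root_not_ch by simp
    have sem: "sem peel_body s = upn s ''v'' 0 v"
      by (simp add: peel_body_def i inpD True v_def[symmetric] q_def[symmetric])
    show ?thesis unfolding peel_inv_def sem using t it no
      by (intro exI[of _ t]) (auto simp: q_def[symmetric] qSuc subset_insert Int_insert_right)
  next
    case False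
    define p where "p = par v"
    have p: "p < n" "v \<in> ch p" using v False par_lt by (auto simp: p_def ch_iff)
    have no: "v \<in> ch u \<longleftrightarrow> u = p" for u using p by (auto simp: ch_iff)
    have pt: "p \<notin> q ` {..<t}" using t(5) p vnew by auto
    have cg: "card (ch p \<inter> insert v (q ` {..<i})) = Suc (card (ch p \<inter> q ` {..<i}))"
      using p vnew by (simp add: Int_insert_right)
    have sg: "(\<Sum>x\<in>ch p \<inter> insert v (q ` {..<i}). ps x) = ps v + (\<Sum>x\<in>ch p \<inter> q ` {..<i}. ps x)"
      using p vnew by (simp add: Int_insert_right)
    have other: "ch u \<inter> insert v (q ` {..<i}) = ch u \<inter> q ` {..<i}" "ch u \<subseteq> insert v (q ` {..<i}) \<longleftrightarrow> ch u \<subseteq> q ` {..<i}" if "u \<noteq> p" for u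
      using no that by (auto simp: Int_insert_right subset_insert)
    have full: "card (ch p \<inter> insert v (q ` {..<i})) < card (ch p) \<longleftrightarrow> \<not> ch p \<subseteq> insert v (q ` {..<i})"
    proof -
      have "ch p \<inter> insert v (q ` {..<i}) = ch p \<longleftrightarrow> ch p \<subseteq> insert v (q ` {..<i})" by blast
      moreover have "card (ch p \<inter> insert v (q ` {..<i})) < card (ch p) \<longleftrightarrow> ch p \<inter> insert v (q ` {..<i}) \<noteq> ch p"
        by (metis Int_lower1 finite_ch less_irrefl psubsetI psubset_card_mono)
      ultimately show ?thesis by simp
    qed
    define s1 where "s1 = upn (upr (upn (upn s ''v'' 0 v) ''p'' 0 p) ''s'' p (reals s ''s'' p + ps v)) ''g'' p (Suc (nats s ''g'' p))"
    have vp: "p \<noteq> v" using p not_in_sub_ch[OF p(2)] sub_self[OF v(1)] by auto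
    have sem: "sem peel_body s = (if ch p \<subseteq> insert v (q ` {..<i}) then upn (upn s1 ''q'' t p) ''t'' 0 (Suc t) else s1)"
      using full t(8) p(1) cg inpD(4)[OF v(1) False]
      by (simp add: peel_body_def i inpD False v_def[symmetric] q_def[symmetric] p_def[symmetric] s1_def d sv t(3))
    have arr: "\<forall>u<n. reals s1 ''s'' u = pw u + (\<Sum>x\<in>ch u \<inter> insert v (q ` {..<i}). ps x)"
      "\<forall>u<n. nats s1 ''g'' u = card (ch u \<inter> insert v (q ` {..<i}))"
      using t(7,8) p cg sg other by (simp_all add: s1_def)
    show ?thesis
    proof (cases "ch p \<subseteq> insert v (q ` {..<i})")
      case c: True
      have tn: "t < n"
      proof -
        have "insert p (q ` {..<t}) \<subseteq> {..<n}" using t(5) p by auto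
        then have "card (insert p (q ` {..<t})) \<le> n" using card_mono[of "{..<n}"] by fastforce
        then show ?thesis using pt card_image[OF t(4)] by simp
      qed
      define q' where "q' = q(t := p)"
      have q': "q' ` {..<a} = q ` {..<a}" if "a \<le> t" for a
        unfolding q'_def using that by (intro image_cong) auto
      have "inj_on q' {..<Suc t}" using t(4) pt by (auto simp: q'_def inj_on_def lessThan_Suc)
      moreover have "q' ` {..<Suc t} = insert p (q ` {..<t})" 
      proof -
        have "q' ` {..<Suc t} = insert (q' t) (q' ` {..<t})" by (simp add: lessThan_Suc)
        moreover have "q' t = p" by (simp add: q'_def)
        ultimately show ?thesis using q'[of t] by simp
      qed
      moreover have "insert p (q ` {..<t}) = {u. u < n \<and> ch u \<subseteq> insert v (q ` {..<i})}"
      proof (rule set_eqI)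
        fix u show "u \<in> insert p (q ` {..<t}) \<longleftrightarrow> u \<in> {u. u < n \<and> ch u \<subseteq> insert v (q ` {..<i})}"
          using c p(1) other(2)[of u] t(5) by (cases "u = p") auto
      qed
      moreover have "\<forall>a<Suc t. ch (q' a) \<subseteq> q' ` {..<a}"
      proof (intro allI impI)
        fix a assume a: "a < Suc t"
        show "ch (q' a) \<subseteq> q' ` {..<a}"
        proof (cases "a = t")
          case True
          have "insert v (q ` {..<i}) \<subseteq> q ` {..<t}" using it by (auto simp: v_def)
          then have "ch p \<subseteq> q ` {..<t}" using c by (rule subset_trans[rotated])
          then show ?thesis using True q'[of t] by (simp add: q'_def)
        next
          case False
          then show ?thesis using a t(6) q'[of a] by (simp add: q'_def)
        qed
      qed
      moreover have "q' ` {..<Suc i} = insert v (q ` {..<i})" using q'[of "Suc i"] it qSuc by simp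
      moreover have "nats s1 ''q'' = q" by (simp add: s1_def q_def)
      ultimately show ?thesis unfolding peel_inv_def sem if_P[OF c]
        using it tn arr by (intro exI[of _ "Suc t"]) (simp add: q'_def)
    next
      case c: False
      have "q ` {..<t} = {u. u < n \<and> ch u \<subseteq> insert v (q ` {..<i})}"
      proof (rule set_eqI)
        fix u show "u \<in> q ` {..<t} \<longleftrightarrow> u \<in> {u. u < n \<and> ch u \<subseteq> insert v (q ` {..<i})}"
          using c pt other(2)[of u] t(5) by (cases "u = p") auto
      qed
      moreover have "nats s1 ''q'' = q" "nats s1 ''t'' 0 = t" by (simp_all add: s1_def q_def t)
      ultimately show ?thesis unfolding peel_inv_def sem if_not_P[OF c]
        using it t arr by (intro exI[of _ t]) (simp add: qSuc)
    qed
  qed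
qed

definition topo :: "(nat \<Rightarrow> nat) \<Rightarrow> bool" where
  "topo q \<longleftrightarrow> inj_on q {..<n} \<and> q ` {..<n} = {..<n} \<and> (\<forall>a<n. ch (q a) \<subseteq> q ` {..<a})"

lemma runs_peel:
  assumes inp: "input_ok s0" and d: "\<And>p. nats s0 ''d'' p = card (ch p)" and z: "\<And>p. nats s0 ''g'' p = 0"
    and q: "t \<le> n" "nats s0 ''t'' 0 = t" "inj_on (nats s0 ''q'') {..<t}"
      "nats s0 ''q'' ` {..<t} = {v. v < n \<and> ch v = {}}"
    and ps: "\<And>v. v < n \<Longrightarrow> reals s0 ''s'' v = pw v"
  shows "runs (FOR ''i'' (N ''n'') peel_body) s0 (for_cost (N ''n'') peel_body * (n + 1))
    (\<lambda>s. topo (nats s ''q'') \<and> (\<forall>v<n. reals s ''s'' v = ps v))"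
proof (rule runs_conseq)
  show "runs (FOR ''i'' (N ''n'') peel_body) s0 (for_cost (N ''n'') peel_body * (n + 1)) (peel_inv n)"
  proof (rule runs_FOR_loopfree)
    show "peel_inv 0 s0" unfolding peel_inv_def
      using q ps z by (intro exI[of _ t]) auto
    show "peel_inv i (upn s ''i'' 0 v)" if "peel_inv i s" for i s v
      using that by (simp add: peel_inv_def)
    fix i s assume fr: "frame (FOR ''i'' (N ''n'') peel_body) s0 s"
    have inp': "input_ok s" using inp
      by (simp add: input_ok_def frame_nats[OF fr] frame_reals[OF fr] peel_body_def)
    then show "nval s (N ''n'') = n" by (simp add: input_ok_def)
    have "nats s ''d'' p = card (ch p)" for p using d by (simp add: frame_nats[OF fr] peel_body_def)
    then show "peel_inv i s \<Longrightarrow> i < n \<Longrightarrow> nats s ''i'' 0 = i \<Longrightarrow> peel_inv (Suc i) (sem peel_body s)"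
      using peel_step[OF inp'] by blast
  qed (simp_all add: peel_body_def)
next
  fix s assume "peel_inv n s"
  then obtain t where "n \<le> t" "t \<le> n" and t: "inj_on (nats s ''q'') {..<t}"
     "nats s ''q'' ` {..<t} = {u. u < n \<and> ch u \<subseteq> nats s ''q'' ` {..<n}}"
     "\<forall>a<t. ch (nats s ''q'' a) \<subseteq> nats s ''q'' ` {..<a}"
     "\<forall>p<n. reals s ''s'' p = pw p + (\<Sum>x\<in>ch p \<inter> nats s ''q'' ` {..<n}. ps x)"
    unfolding peel_inv_def by blast
  then have "t = n" by simp
  have im: "nats s ''q'' ` {..<n} = {..<n}"
  proof (rule card_subset_eq)
    show "nats s ''q'' ` {..<n} \<subseteq> {..<n}" using t(2) \<open>t = n\<close> by auto
    show "card (nats s ''q'' ` {..<n}) = card {..<n}" using card_image[OF t(1)] \<open>t = n\<close> by simp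
  qed simp
  have "ch p \<inter> {..<n} = ch p" for p using ch_lt by blast
  then show "topo (nats s ''q'') \<and> (\<forall>v<n. reals s ''s'' v = ps v)"
    using t \<open>t = n\<close> im by (simp add: topo_def ps_unfold)
qed simp

end

section \<open>Depths and active nodes, parents first\<close>

definition "depth_body =
   nset ''v'' (NCell ''q'' (NSub (NSub (N ''n'') (NConst 1)) (N ''i''))) ;;
   If (Neq (N ''v'') (N ''root'')) Skip
     (NAssign ''h'' (N ''v'') (NAdd (NCell ''h'' (NCell ''parent'' (N ''v''))) (NConst 1))) ;;
   If (BAnd (NLess (NCell ''h'' (N ''v'')) (N ''k''))
        (BNot (RLess (RAdd (PL (RCell ''s'' (N ''v''))) (RMul (ROfNat (NConst 2)) (RCell ''s'' (N ''v''))))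
                     (RDiv (R ''eps'') (ROfNat (N ''k''))))))
     (NAssign ''a'' (N ''v'') (NConst 1)) Skip"

context summary_dp begin

text \<open>The queue read backwards lists parents before children. Every pass that starts at the
  root uses this order.\<close>

definition rev_order :: "(nat \<Rightarrow> nat) \<Rightarrow> nat \<Rightarrow> nat" where
  "rev_order q a = q (n - 1 - a)"

lemma topo_rev:
  assumes "topo q"
  shows "inj_on (rev_order q) {..<n}" and "rev_order q ` {..<n} = {..<n}"
    and "a < n \<Longrightarrow> rev_order q a \<noteq> rt \<Longrightarrow> par (rev_order q a) \<in> rev_order q ` {..<a}"
proof -
  have q: "inj_on q {..<n}" "q ` {..<n} = {..<n}" "\<And>a. a < n \<Longrightarrow> ch (q a) \<subseteq> q ` {..<a}"
    using assms by (auto simp: topo_def)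
  have "bij_betw (\<lambda>a. n - 1 - a) {..<n} {..<n}"
    by (rule bij_betw_byWitness[of _ "\<lambda>a. n - 1 - a"]) auto
  then have b: "bij_betw (q \<circ> (\<lambda>a. n - 1 - a)) {..<n} {..<n}"
    using q by (intro bij_betw_trans) (auto simp: bij_betw_def)
  have e: "q \<circ> (\<lambda>a. n - 1 - a) = rev_order q" by (auto simp: rev_order_def)
  show "inj_on (rev_order q) {..<n}" "rev_order q ` {..<n} = {..<n}"
    using b unfolding e by (auto simp: bij_betw_def)
  assume a: "a < n" "rev_order q a \<noteq> rt"
  have lt: "rev_order q a < n" using q(2) a(1) by (auto simp: rev_order_def)
  then have "par (rev_order q a) \<in> q ` {..<n}" using q(2) par_lt a by auto
  then obtain b where b: "b < n" "q b = par (rev_order q a)" by auto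
  then have "rev_order q a \<in> ch (q b)" using lt a by (simp add: ch_iff)
  then have "rev_order q a \<in> q ` {..<b}" using q(3)[OF b(1)] by blast
  then obtain c where c: "c < b" "rev_order q a = q c" by blast
  then have "q c = q (n - 1 - a)" by (simp add: rev_order_def)
  then have "c = n - 1 - a" by (rule inj_onD[OF q(1)]) (use a b c in auto)
  then have "n - 1 - b < a" using c(1) b(1) a(1) by linarith
  moreover have "par (rev_order q a) = rev_order q (n - 1 - b)" using b by (simp add: rev_order_def)
  ultimately show "par (rev_order q a) \<in> rev_order q ` {..<a}" by blast
qed

lemma rev_order_lt: "topo q \<Longrightarrow> a < n \<Longrightarrow> rev_order q a < n"
  using topo_rev(2)[of q] by auto

lemma rev_order_new: "topo q \<Longrightarrow> a < n \<Longrightarrow> rev_order q a \<notin> rev_order q ` {..<a}"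
  using inj_onD[OF topo_rev(1)[of q]] by (force simp: image_iff)

lemma rev_order_ch_later:
  assumes "topo q" "a < n" "x \<in> ch (rev_order q a)"
  shows "x \<notin> insert (rev_order q a) (rev_order q ` {..<a})"
proof
  assume "x \<in> insert (rev_order q a) (rev_order q ` {..<a})"
  then have "x \<in> rev_order q ` {..a}" by (auto simp: lessThan_Suc_atMost[symmetric] lessThan_Suc)
  then obtain b where b: "b \<le> a" "x = rev_order q b" by blast
  have "par x \<in> rev_order q ` {..<b}"
    using topo_rev(3)[OF assms(1), of b] b assms ch_not_root[OF assms(3)] by simp
  then have "rev_order q a \<in> rev_order q ` {..<a}" using ch_par[OF assms(3)] b(1) by auto
  then show False using rev_order_new[OF assms(1,2)] by simp
qed

lemma image_lessThan_Suc: "f ` {..<Suc i} = insert (f i) (f ` {..<i})"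
  by (simp add: lessThan_Suc)

lemma runs_depth:
  assumes inp: "input_ok s0" and q: "topo (nats s0 ''q'')" and ps: "\<forall>v<n. reals s0 ''s'' v = ps v"
    and z: "\<And>v. nats s0 ''h'' v = 0" "\<And>v. nats s0 ''a'' v = 0"
  shows "runs (FOR ''i'' (N ''n'') depth_body) s0 (for_cost (N ''n'') depth_body * (n + 1))
    (\<lambda>s. \<forall>v<n. 0 < nats s ''a'' v \<longleftrightarrow> active v)"
proof -
  note inpD = input_okD[OF inp]
  let ?q = "rev_order (nats s0 ''q'')"
  let ?I = "\<lambda>i s. (\<forall>v\<in>?q ` {..<i}. nats s ''h'' v = depth v \<and> (0 < nats s ''a'' v \<longleftrightarrow> active v)) \<and>
     (\<forall>v. v \<notin> ?q ` {..<i} \<longrightarrow> nats s ''h'' v = 0 \<and> nats s ''a'' v = 0)"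
  have "runs (FOR ''i'' (N ''n'') depth_body) s0 (for_cost (N ''n'') depth_body * (n + 1)) (?I n)"
  proof (rule runs_FOR_loopfree)
    fix i s assume i: "i < n" and I: "?I i s" and si: "nats s ''i'' 0 = i"
      and fr: "frame (FOR ''i'' (N ''n'') depth_body) s0 s"
    define v where "v = ?q i"
    have v: "v < n" using rev_order_lt[OF q i] by (simp add: v_def)
    have new: "v \<notin> ?q ` {..<i}" using rev_order_new[OF q i] by (simp add: v_def)
    have act: "active v \<longleftrightarrow> depth v < k \<and> \<not> plogp (ps v) + 2 * ps v < \<epsilon> / k"
      using v by (simp add: active_def lose_def)
    have par: "nats s ''h'' (par v) + 1 = depth v" if "v \<noteq> rt"
    proof -
      have "nats s ''h'' (par v) = depth (par v)"
        using topo_rev(3)[OF q i, folded v_def, OF that] I by blast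
      then show ?thesis using depth_par[OF v that] by simp
    qed
    have qv: "nats s0 ''q'' (n - Suc i) = v" by (simp add: v_def rev_order_def)
    have hr: "nats s ''h'' v = 0" "nats s ''a'' v = 0" using I new by blast+
    have inp': "input_ok s" using inp
      by (simp add: input_ok_def frame_nats[OF fr] frame_reals[OF fr] depth_body_def)
    have psv: "reals s ''s'' v = ps v" and qs: "nats s ''q'' = nats s0 ''q''"
      using ps v by (simp_all add: frame_nats[OF fr] frame_reals[OF fr] depth_body_def)
    define s1 where "s1 = upn (upn s ''v'' 0 v) ''h'' v (depth v)"
    \<comment> \<open>The second alternative is the root, where \<open>h\<close> is not written
      because its initial 0 is already the depth.\<close>
    have "sem depth_body s = (if active v then upn s1 ''a'' v 1 else s1) \<or>
       sem depth_body s = (if active v then upn (upn s ''v'' 0 v) ''a'' v 1 else upn s ''v'' 0 v) \<and> v = rt"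
    proof (cases "v = rt")
      case True
      then have "depth v = 0" by simp
      then show ?thesis using hr
        by (simp add: depth_body_def si qs qv input_okD[OF inp'] psv act True[symmetric])
    next
      case False
      then show ?thesis using par[OF False] input_okD(4)[OF inp' v False]
        by (simp add: depth_body_def si qs qv input_okD(1,2,3,7)[OF inp'] psv act s1_def)
    qed
    then have s': "nats (sem depth_body s) ''h'' = (nats s ''h'')(v := depth v) \<and>
      nats (sem depth_body s) ''a'' = (nats s ''a'')(v := (if active v then 1 else 0))"
      using hr by (auto simp: s1_def fun_eq_iff)
    show "?I (Suc i) (sem depth_body s)"
      using I new unfolding s'[THEN conjunct1] s'[THEN conjunct2] image_lessThan_Suc v_def[symmetric] by auto
  qed (use inpD z in \<open>auto simp: frame_nats frame_reals depth_body_def\<close>)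
  then show ?thesis
    by (rule runs_conseq) (simp_all add: topo_rev(2)[OF q])
qed

section \<open>The knapsack table of one node\<close>

definition included :: "nat \<Rightarrow> nat \<Rightarrow> nat set" where
  "included e r = {u. u < r \<and> u \<noteq> e}"

definition inc :: "nat \<Rightarrow> nat \<Rightarrow> nat" where
  "inc e r = (if e < r then r - 1 else r)"

lemma included_0 [simp]: "included e 0 = {}"
  and included_Suc: "included e (Suc r) = (if r = e then included e r else insert r (included e r))"
  and not_included [simp]: "r \<notin> included e r"
  and finite_included [simp]: "finite (included e r)"
  by (auto simp: included_def less_Suc_eq)

lemma inc_0 [simp]: "inc e 0 = 0"
  and inc_Suc: "inc e (Suc r) = (if r = e then inc e r else Suc (inc e r))"
  by (auto simp: inc_def)

lemma card_included: "card (included e r) = inc e r"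
  by (induction r) (auto simp: included_Suc inc_Suc)

text \<open>Best value of the ranks below \<open>r\<close> except \<open>e\<close>, with
  \<open>j\<close> nodes in all. The limit \<open>j - inc e r\<close> reserves one node for each
  kept sibling of smaller rank. The value is meaningful only for \<open>inc e r \<le> j\<close>;
  otherwise a maximum over the empty set can occur.\<close>

primrec knap :: "(nat \<Rightarrow> nat \<Rightarrow> real) \<Rightarrow> (nat \<Rightarrow> nat) \<Rightarrow> nat \<Rightarrow> nat \<Rightarrow> nat \<Rightarrow> real" where
  "knap D X e 0 j = 0"
| "knap D X e (Suc r) j = (if r = e then knap D X e r j
     else Max ((\<lambda>b. knap D X e r (j - b) + D (X r) b) ` {1..j - inc e r}))"

lemma knap_lower:
  "\<forall>u\<in>included e r. 1 \<le> b u \<Longrightarrow> sum b (included e r) \<le> j \<Longrightarrow>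
    (\<Sum>u\<in>included e r. D (X u) (b u)) \<le> knap D X e r j"
proof (induction r arbitrary: j)
  case (Suc r)
  show ?case
  proof (cases "r = e")
    case False
    have le: "sum b (included e r) + b r \<le> j" "1 \<le> b r" using Suc.prems False by (auto simp: included_Suc)
    have "inc e r \<le> sum b (included e r)"
      using card_le_sum[of "included e r" b] Suc.prems False by (simp add: card_included included_Suc)
    then have b: "b r \<in> {1..j - inc e r}" using le by auto
    have "(\<Sum>u\<in>included e r. D (X u) (b u)) \<le> knap D X e r (j - b r)"
      using Suc.prems False le by (intro Suc.IH) (auto simp: included_Suc)
    then have "(\<Sum>u\<in>included e (Suc r). D (X u) (b u)) \<le> knap D X e r (j - b r) + D (X r) (b r)"
      using False by (simp add: included_Suc)
    also have "\<dots> \<le> knap D X e (Suc r) j"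
      using False b by (auto intro!: Max_ge)
    finally show ?thesis .
  qed (use Suc in \<open>simp add: included_Suc\<close>)
qed simp

lemma knap_attained:
  "inc e r \<le> j \<Longrightarrow> \<exists>b. (\<forall>u\<in>included e r. 1 \<le> b u) \<and> sum b (included e r) \<le> j \<and>
    knap D X e r j = (\<Sum>u\<in>included e r. D (X u) (b u))"
proof (induction r arbitrary: j)
  case (Suc r)
  show ?case
  proof (cases "r = e")
    case False
    let ?M = "(\<lambda>b. knap D X e r (j - b) + D (X r) b) ` {1..j - inc e r}"
    have "inc e r < j" using Suc.prems False by (simp add: inc_Suc)
    then have "?M \<noteq> {}" by auto
    then have "Max ?M \<in> ?M" by (intro Max_in) auto
    then obtain c where c: "1 \<le> c" "c \<le> j - inc e r" "Max ?M = knap D X e r (j - c) + D (X r) c" by auto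
    then have "inc e r \<le> j - c" using \<open>inc e r < j\<close> by linarith
    then obtain b where b: "\<forall>u\<in>included e r. 1 \<le> b u" "sum b (included e r) \<le> j - c"
      "knap D X e r (j - c) = (\<Sum>u\<in>included e r. D (X u) (b u))" using Suc.IH by blast
    have eq: "(\<Sum>u\<in>included e r. f u ((b(r := c)) u)) = (\<Sum>u\<in>included e r. f u (b u))" for f :: "nat \<Rightarrow> nat \<Rightarrow> 'x::comm_monoid_add"
      by (rule sum.cong) auto
    show ?thesis
      using b c False \<open>inc e r < j\<close> eq[of "\<lambda>_ x. x"] eq[of "\<lambda>u. D (X u)"]
      by (intro exI[of _ "b(r := c)"]) (auto simp: included_Suc)
  qed (use Suc in \<open>simp add: included_Suc inc_Suc\<close>)
qed simp

definition base :: "nat \<Rightarrow> nat \<Rightarrow> nat" where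
  "base v c = (if c < card (ch v) then 2 else 1)"

definition cand :: "(nat \<Rightarrow> nat \<Rightarrow> real) \<Rightarrow> (nat \<Rightarrow> nat) \<Rightarrow> nat \<Rightarrow> nat \<Rightarrow> nat \<Rightarrow> nat \<Rightarrow> real" where
  "cand D X v e r j = plogp (pw v) + plogp (ps v - pw v - (\<Sum>u\<in>included e r. ps (X u))) +
     knap D X e r (j - base v (inc e r))"

text \<open>The complete specification of a finished node. \<open>cr\<close> stores a prefix length
  plus one, so that 0 can mean collapsing, and \<open>P\<close> records a maximising share for each
  step of \<open>knap\<close>. \<open>D\<close> supplies the rows of \<open>v\<close> and of its
  children alike.\<close>

definition node_ok ::
  "nat \<Rightarrow> nat \<Rightarrow> (nat \<Rightarrow> nat) \<Rightarrow> (nat \<Rightarrow> nat \<Rightarrow> real) \<Rightarrow> (nat \<Rightarrow> nat) \<Rightarrow> (nat \<Rightarrow> nat) \<Rightarrow> (nat \<Rightarrow> nat \<Rightarrow> nat \<Rightarrow> nat) \<Rightarrow> bool"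
where
  "node_ok v m X D cr ce P \<longleftrightarrow>
    (\<forall>j\<le>k. plogp (ps v) \<le> D v j \<and>
      (\<forall>e\<le>m. \<forall>r\<le>m. base v (inc e r) + inc e r \<le> j \<longrightarrow> cand D X v e r j \<le> D v j) \<and>
      (cr j = 0 \<and> D v j = plogp (ps v) \<or>
       (\<exists>r\<le>m. cr j = Suc r \<and> ce j \<le> m \<and> base v (inc (ce j) r) + inc (ce j) r \<le> j \<and> D v j = cand D X v (ce j) r j)) \<and>
      (\<forall>e\<le>m. \<forall>r<m. r \<noteq> e \<longrightarrow> inc e r < j \<longrightarrow>
        1 \<le> P (X r) e j \<and> P (X r) e j \<le> j - inc e r \<and>
        knap D X e (Suc r) j = knap D X e r (j - P (X r) e j) + D (X r) (P (X r) e j)))"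

section \<open>The \<open>k\<close> heaviest active children\<close>

definition topk :: "nat set \<Rightarrow> nat list \<Rightarrow> bool" where
  "topk A l \<longleftrightarrow> distinct l \<and> set l \<subseteq> A \<and> sorted_wrt (\<lambda>x y. ps y \<le> ps x) l \<and> length l \<le> k \<and>
     (length l = k \<or> set l = A) \<and> (\<forall>x\<in>A - set l. \<forall>y\<in>set l. ps x \<le> ps y)"

text \<open>The computed list is the beginning of some complete sorted list. Choosing its tail
  afterwards makes the exchange argument applicable however ties were broken.\<close>

lemma topk_desc:
  assumes "topk A l" "finite A"
  shows "\<exists>ys. desc_list A ys \<and> l = take k ys"
proof -
  define r where "r = sort_key (\<lambda>x. - ps x) (sorted_list_of_set (A - set l))"
  have r: "set r = A - set l" "distinct r" using assms(2) by (auto simp: r_def)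
  have "sorted (map (\<lambda>x. - ps x) r)" by (simp add: r_def)
  then have sr: "sorted_wrt (\<lambda>x y. ps y \<le> ps x) r" by (simp add: sorted_map)
  have "length l = k \<or> r = []" using assms(1) r by (auto simp: topk_def)
  then have "l = take k (l @ r)" using assms(1) by (auto simp: topk_def)
  moreover have "desc_list A (l @ r)"
    using assms(1) r sr by (auto simp: desc_list_def topk_def sorted_wrt_append)
  ultimately show ?thesis by blast
qed

text \<open>If the list is full, only the last element \<open>z\<close> of \<open>w\<close> drops
  out. Elements dropped earlier stay below a newly kept \<open>v\<close>, because they are below the
  old element \<open>z\<close> that gives way to it.\<close>

lemma topk_insert:
  assumes "topk A l" "v \<notin> A" "distinct w" "set w = insert v (set l)" "sorted_wrt (\<lambda>x y. ps y \<le> ps x) w"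
  shows "topk (insert v A) (take k w)"
proof -
  have lw: "length w = Suc (length l)"
    using assms by (metis card_insert_disjoint distinct_card finite_set subsetD topk_def)
  show ?thesis
  proof (cases "length l < k")
    case True
    then have "set l = A" "take k w = w" using assms(1) lw by (auto simp: topk_def)
    then show ?thesis using assms lw True by (auto simp: topk_def)
  next
    case False
    then have lk: "length l = k" using assms(1) by (simp add: topk_def)
    define z where "z = last w"
    have w: "w = take k w @ [z]" 
    proof -
      have "w \<noteq> []" using lw by auto
      then show ?thesis using append_butlast_last_id[of w] lw lk by (simp add: z_def butlast_conv_take)
    qed
    have d: "z \<notin> set (take k w)" using assms(3) by (subst (asm) w) auto
    have zle: "ps z \<le> ps y" if "y \<in> set (take k w)" for y
      using assms(5) that by (subst (asm) w) (auto simp: sorted_wrt_append)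
    have sw: "set (take k w) = insert v (set l) - {z}" using assms(4) d by (subst (asm) w) auto
    have "ps x \<le> ps y" if x: "x \<in> insert v A - set (take k w)" and y: "y \<in> set (take k w)" for x y
    proof (cases "x = z")
      case False
      then have xl: "x \<in> A - set l" using x sw by auto
      then have lx: "\<And>u. u \<in> set l \<Longrightarrow> ps x \<le> ps u" using assms(1) by (auto simp: topk_def)
      show ?thesis
      proof (cases "y \<in> set l")
        case False
        then have "y = v" using y sw by auto
        then have "z \<in> set l" using y sw w assms(4) by (metis Diff_iff in_set_conv_decomp insert_iff singletonI)
        then show ?thesis using lx zle[OF y] by force
      qed (use lx in auto)
    qed (use zle y in auto)
    then show ?thesis using assms lk lw sw
      by (auto simp: topk_def sorted_wrt_take)
  qed
qed

text \<open>\<open>X\<close> is injective on the ranks, so costs and values computed with ranks are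
  those of sets of children; this connects the table with the exchange argument.\<close>

lemma node_ok_spec:
  assumes v: "v < n" and ok: "node_ok v m X D cr ce P" and top: "topk (achs v) (map X [0..<m])"
  shows "node_attained D v" and "\<exists>ys. desc_list (achs v) ys \<and> near_upper D v ys"
proof -
  have inj: "inj_on X {..<m}"
  proof -
    have "distinct (map X [0..<m])" using top by (simp add: topk_def)
    then show ?thesis by (simp add: distinct_map atLeast0LessThan)
  qed
  have sub: "X ` {..<m} \<subseteq> achs v" using top by (auto simp: topk_def atLeast0LessThan)
  have inji: "inj_on X (included e r)" if "r \<le> m" for e r
    using that by (intro inj_on_subset[OF inj]) (auto simp: included_def)
  have subi: "X ` included e r \<subseteq> achs v" if "r \<le> m" for e r
    using that by (intro subset_trans[OF _ sub]) (auto simp: included_def)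
  have ic: "X ` included e r = ch v \<longleftrightarrow> \<not> inc e r < card (ch v)" if "r \<le> m" for e r
  proof -
    have "card (X ` included e r) = inc e r" using card_image[OF inji[OF that]] card_included by simp
    moreover have "X ` included e r \<subseteq> ch v" using subi[OF that] achs_subset by blast
    ultimately show ?thesis by (metis card_mono card_subset_eq finite_ch le_antisym linorder_not_less less_irrefl)
  qed
  have cost: "optcost v (X ` included e r) b = base v (inc e r) + (\<Sum>u\<in>included e r. b (X u))" if "r \<le> m" for e r b
    using ic[OF that] sum.reindex[OF inji[OF that], of b] by (simp add: optcost_def base_def)
  have val: "optval D v (X ` included e r) b = plogp (pw v) + plogp (ps v - pw v - (\<Sum>u\<in>included e r. ps (X u))) +
      (\<Sum>u\<in>included e r. D (X u) (b (X u)))" if "r \<le> m" for e r b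
    using sum.reindex[OF inji[OF that], of ps] sum.reindex[OF inji[OF that], of "\<lambda>x. D x (b x)"] by (simp add: optval_def)
  show "node_attained D v"
    unfolding node_attained_def
  proof (intro allI impI)
    fix j assume "j \<le> k"
    then have "D v j = plogp (ps v) \<or> (\<exists>r\<le>m. base v (inc (ce j) r) + inc (ce j) r \<le> j \<and> D v j = cand D X v (ce j) r j)"
      using ok unfolding node_ok_def by blast
    then show "D v j = plogp (ps v) \<or> (\<exists>I b. option_of v j I b \<and> D v j = optval D v I b)"
    proof
      assume "\<exists>r\<le>m. base v (inc (ce j) r) + inc (ce j) r \<le> j \<and> D v j = cand D X v (ce j) r j"
      then obtain r where r: "r \<le> m" "base v (inc (ce j) r) + inc (ce j) r \<le> j" "D v j = cand D X v (ce j) r j" by blast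
      let ?e = "ce j" and ?t = "j - base v (inc (ce j) r)"
      have "inc ?e r \<le> ?t" using r(2) by simp
      from knap_attained[OF this, of D X] obtain b where b: "\<forall>u\<in>included ?e r. 1 \<le> b u" "sum b (included ?e r) \<le> ?t"
        "knap D X ?e r ?t = (\<Sum>u\<in>included ?e r. D (X u) (b u))" by blast
      \<comment> \<open>\<open>knap\<close> grants nodes to ranks, \<open>option_of\<close> to
        children.\<close>
      define b' where "b' x = b (the_inv_into (included ?e r) X x)" for x
      have b': "b' (X u) = b u" if "u \<in> included ?e r" for u
        using the_inv_into_f_f[OF inji[OF r(1)] that] by (simp add: b'_def)
      have "option_of v j (X ` included ?e r) b'"
        unfolding option_of_def cost[OF r(1)] using b b' subi[OF r(1)] r(2) by auto
      moreover have "D v j = optval D v (X ` included ?e r) b'"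
        unfolding val[OF r(1)] r(3) cand_def b(3) using b' by simp
      ultimately show ?thesis by blast
    qed simp
  qed
  obtain ys where ys: "desc_list (achs v) ys" "map X [0..<m] = take k ys"
    using topk_desc[OF top] by auto
  have m: "m = min k (length ys)" using arg_cong[OF ys(2), of length] by (simp add: min.commute)
  have "near_upper D v ys"
    unfolding near_upper_def
  proof (intro allI impI conjI)
    fix j assume j: "j \<le> k"
    then show "plogp (ps v) \<le> D v j" using ok by (simp add: node_ok_def)
    fix e r b assume a: "r \<le> length ys \<and> r \<le> k \<and> option_of v j (skipset ys e r) b"
    then have r: "r \<le> m" using m by simp
    have nth: "ys ! u = X u" if "u < r" for u
      using arg_cong[OF ys(2), of "\<lambda>l. l ! u"] that r a by simp
    \<comment> \<open>All indices beyond the list leave nothing out; the program represents them by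
      the single index \<open>m\<close>.\<close>
    have sk: "skipset ys e r = X ` included (min e m) r"
    proof -
      have "included (min e m) r = {u. u < r \<and> u \<noteq> e}" using r by (auto simp: included_def)
      then have "skipset ys e r = (\<lambda>u. ys ! u) ` included (min e m) r" by (auto simp: skipset_def)
      also have "\<dots> = X ` included (min e m) r" using nth by (intro image_cong) (auto simp: included_def)
      finally show ?thesis .
    qed
    let ?e = "min e m"
    have o: "option_of v j (X ` included ?e r) b" using a sk by simp
    then have c: "base v (inc ?e r) + (\<Sum>u\<in>included ?e r. b (X u)) \<le> j" and b: "\<forall>u\<in>included ?e r. 1 \<le> b (X u)"
      unfolding option_of_def cost[OF r] by auto
    have "inc ?e r \<le> (\<Sum>u\<in>included ?e r. b (X u))"
      using card_le_sum[of "included ?e r" "\<lambda>u. b (X u)"] b by (simp add: card_included)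
    then have feas: "base v (inc ?e r) + inc ?e r \<le> j" using c by simp
    have "(\<Sum>u\<in>included ?e r. D (X u) (b (X u))) \<le> knap D X ?e r (j - base v (inc ?e r))"
      using b c by (intro knap_lower) auto
    then have "optval D v (X ` included ?e r) b \<le> cand D X v ?e r j"
      unfolding val[OF r] cand_def by simp
    also have "\<dots> \<le> D v j" using ok j r feas unfolding node_ok_def by simp
    finally show "optval D v (skipset ys e r) b \<le> D v j" using sk by simp
  qed
  then show "\<exists>ys. desc_list (achs v) ys \<and> near_upper D v ys" using ys by blast
qed

end

section \<open>Filling the table of one node\<close>

text \<open>\<open>T(v, r)\<close> with \<open>r < l(v)\<close> is the active child of \<open>v\<close> of rank \<open>r\<close> and \<open>D(v, j)\<close> the largest value of a
  summary tree with at most \<open>j\<close> nodes. It is attained by collapsing if \<open>r(v, j) = 0\<close>, and otherwise by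
  keeping the first \<open>r(v, j) - 1\<close> children except that of rank \<open>e(v, j)\<close> out of \<open>other\<close>. \<open>P(x, e, u)\<close> is the
  number of nodes given to \<open>x\<close> when \<open>u\<close> nodes are shared with its kept siblings of smaller rank.\<close>

definition "best_body =
   If (RLess (R ''y'') (RAdd (RCell ''A'' (NSub (N ''u'') (NAdd (N ''b'') (NConst 1))))
                             (RCell ''D'' (IX (N ''X'') (NAdd (N ''b'') (NConst 1))))))
     (rset ''y'' (RAdd (RCell ''A'' (NSub (N ''u'') (NAdd (N ''b'') (NConst 1))))
                       (RCell ''D'' (IX (N ''X'') (NAdd (N ''b'') (NConst 1))))) ;;
      NAssign ''P'' (IX (IX (N ''X'') (N ''E'')) (N ''u'')) (NAdd (N ''b'') (NConst 1))) Skip"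

definition "inc_init =
   rset ''y'' (RAdd (RCell ''A'' (NSub (N ''u'') (NConst 1))) (RCell ''D'' (IX (N ''X'') (NConst 1)))) ;;
   NAssign ''P'' (IX (IX (N ''X'') (N ''E'')) (N ''u'')) (NConst 1)"

text \<open>The total \<open>u = k - j\<close> runs downwards, so \<open>A\<close> can be updated in
  place: entry \<open>u\<close> uses only smaller entries, which still belong to the previous rank.
  Totals up to \<open>C\<close> cannot serve one more child and keep their cells.\<close>

definition "inc_step =
   nset ''u'' (NSub (N ''k'') (N ''j'')) ;;
   If (NLess (N ''C'') (N ''u''))
     (inc_init ;; FOR ''b'' (NSub (N ''u'') (N ''C'')) best_body ;;
      RAssign ''A'' (N ''u'') (R ''y'')) Skip"

definition "include_prog =
   nset ''X'' (NCell ''T'' (IX (N ''v'') (N ''R''))) ;;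
   FOR ''j'' (NAdd (N ''k'') (NConst 1)) inc_step ;;
   nset ''C'' (NAdd (N ''C'') (NConst 1)) ;;
   rset ''o'' (RSub (R ''o'') (RCell ''s'' (N ''X'')))"

definition "cand_body =
   If (BAnd (BNot (NLess (N ''j'') (NAdd (N ''B'') (N ''C''))))
            (RLess (RCell ''D'' (IX (N ''v'') (N ''j''))) (RAdd (R ''z'') (RCell ''A'' (NSub (N ''j'') (N ''B''))))))
     (RAssign ''D'' (IX (N ''v'') (N ''j'')) (RAdd (R ''z'') (RCell ''A'' (NSub (N ''j'') (N ''B'')))) ;;
      NAssign ''r'' (IX (N ''v'') (N ''j'')) (NAdd (N ''R'') (NConst 1)) ;;
      NAssign ''e'' (IX (N ''v'') (N ''j'')) (N ''E'')) Skip"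

definition "cand_init =
   If (NLess (N ''C'') (NCell ''d'' (N ''v''))) (nset ''B'' (NConst 2)) (nset ''B'' (NConst 1)) ;;
   rset ''z'' (RAdd (PL (RCell ''w'' (N ''v''))) (PL (R ''o'')))"

text \<open>The candidate with the first \<open>R\<close> ranks is evaluated before rank
  \<open>R\<close> is included, so the loop over \<open>R\<close> makes \<open>m + 1\<close> rounds
  and the last one includes nothing.\<close>

definition "rank_body =
   cand_init ;; FOR ''j'' (NAdd (N ''k'') (NConst 1)) cand_body ;;
   If (BAnd (NLess (N ''R'') (N ''m'')) (BNot (Neq (N ''R'') (N ''E'')))) include_prog Skip"

definition "skip_init =
   nset ''C'' (NConst 0) ;; rset ''o'' (RSub (RCell ''s'' (N ''v'')) (RCell ''w'' (N ''v'')))"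

definition "skip_body =
   FOR ''j'' (NAdd (N ''k'') (NConst 1)) (RAssign ''A'' (N ''j'') (ROfNat (NConst 0))) ;;
   skip_init ;; FOR ''R'' (NAdd (N ''m'') (NConst 1)) rank_body"

definition "node_table =
   nset ''m'' (NCell ''l'' (N ''v'')) ;;
   FOR ''j'' (NAdd (N ''k'') (NConst 1)) (RAssign ''D'' (IX (N ''v'') (N ''j'')) (PL (RCell ''s'' (N ''v'')))) ;;
   FOR ''E'' (NAdd (N ''m'') (NConst 1)) skip_body"

lemmas node_defs = best_body_def inc_init_def inc_step_def include_prog_def cand_body_def cand_init_def rank_body_def
  skip_init_def skip_body_def node_table_def

context summary_dp begin

definition row :: "store \<Rightarrow> nat \<Rightarrow> nat \<Rightarrow> real" where
  "row s x j = reals s ''D'' (ix k x j)"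

definition ptr :: "store \<Rightarrow> nat \<Rightarrow> nat \<Rightarrow> nat \<Rightarrow> nat" where
  "ptr s x e j = nats s ''P'' (ix k (ix k x e) j)"

definition good_ptr :: "(nat \<Rightarrow> nat \<Rightarrow> real) \<Rightarrow> (nat \<Rightarrow> nat) \<Rightarrow> nat \<Rightarrow> nat \<Rightarrow> nat \<Rightarrow> nat \<Rightarrow> bool" where
  "good_ptr D X e r j p \<longleftrightarrow> 1 \<le> p \<and> p \<le> j - inc e r \<and>
     knap D X e (Suc r) j = knap D X e r (j - p) + D (X r) p"

text \<open>The share tried is the counter plus one, and \<open>y\<close> starts with share 1, so
  value and pointer agree already before the first round.\<close>

lemma runs_best:
  assumes k: "nats s0 ''k'' 0 = k" and X: "nats s0 ''X'' 0 = x" and u: "nats s0 ''u'' 0 = u" "u \<le> k"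
    and C: "nats s0 ''C'' 0 = c" "c < u" and E: "nats s0 ''E'' 0 = e"
    and f: "f = (\<lambda>b. reals s0 ''A'' (u - b) + row s0 x b)"
    and y: "reals s0 ''y'' 0 = f 1" "ptr s0 x e u = 1"
  shows "runs (FOR ''b'' (NSub (N ''u'') (N ''C'')) best_body) s0 (for_cost (NSub (N ''u'') (N ''C'')) best_body * (k + 1))
    (\<lambda>s. \<exists>p. 1 \<le> p \<and> p \<le> u - c \<and> nats s ''P'' = (nats s0 ''P'')(ix k (ix k x e) u := p) \<and>
      reals s ''y'' 0 = f p \<and> (\<forall>b\<in>{1..u - c}. f b \<le> f p))"
proof -
  let ?I = "\<lambda>i s. \<exists>p. 1 \<le> p \<and> p \<le> u - c \<and> nats s ''P'' = (nats s0 ''P'')(ix k (ix k x e) u := p) \<and>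
      reals s ''y'' 0 = f p \<and> (\<forall>b\<in>{1..i}. f b \<le> f p)"
  have "runs (FOR ''b'' (NSub (N ''u'') (N ''C'')) best_body) s0
     (for_cost (NSub (N ''u'') (N ''C'')) best_body * ((u - c) + 1)) (?I (u - c))"
  proof (rule runs_FOR_loopfree[where I = ?I and m = "u - c"])
    show "?I 0 s0" using y C by (intro exI[of _ 1]) (auto simp: ptr_def fun_eq_iff)
    fix i s assume i: "i < u - c" and I: "?I i s" and si: "nats s ''b'' 0 = i"
      and fr: "frame (FOR ''b'' (NSub (N ''u'') (N ''C'')) best_body) s0 s"
    obtain p where p: "1 \<le> p" "p \<le> u - c" "nats s ''P'' = (nats s0 ''P'')(ix k (ix k x e) u := p)"
      "reals s ''y'' 0 = f p" "\<forall>b\<in>{1..i}. f b \<le> f p" using I by blast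
    have fb: "reals s0 ''A'' (u - Suc i) + reals s0 ''D'' (ix k x (Suc i)) = f (Suc i)" by (simp add: f row_def)
    have st: "nats s ''k'' = nats s0 ''k''" "nats s ''X'' = nats s0 ''X''" "nats s ''u'' = nats s0 ''u''" "nats s ''E'' = nats s0 ''E''"
      "reals s ''A'' = reals s0 ''A''" "reals s ''D'' = reals s0 ''D''"
      by (simp_all add: frame_nats[OF fr] frame_reals[OF fr] best_body_def)
    have sem: "sem best_body s = (if f p < f (Suc i) then upn (upr s ''y'' 0 (f (Suc i))) ''P'' (ix k (ix k x e) u) (Suc i) else s)"
      by (simp add: best_body_def si st k X u E fb p(4))
    show "?I (Suc i) (sem best_body s)"
    proof (cases "f p < f (Suc i)")
      case True
      then show ?thesis unfolding sem if_P[OF True] using p i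
        by (intro exI[of _ "Suc i"]) (auto simp: atLeastAtMostSuc_conv)
    next
      case False
      then show ?thesis unfolding sem if_not_P[OF False] using p
        by (intro exI[of _ p]) (auto simp: atLeastAtMostSuc_conv)
    qed
  next
    fix i s assume fr: "frame (FOR ''b'' (NSub (N ''u'') (N ''C'')) best_body) s0 s"
    show "nval s (NSub (N ''u'') (N ''C'')) = u - c" using u C
      by (simp add: frame_nats[OF fr] best_body_def)
  qed (auto simp: best_body_def)
  then show ?thesis by (rule runs_conseq) (use u in auto)
qed

definition T_inc_step :: nat where
  "T_inc_step = maxcost inc_step + for_cost (NSub (N ''u'') (N ''C'')) best_body"

lemma runs_inc_step:
  assumes k: "nats s0 ''k'' 0 = k" and X: "nats s0 ''X'' 0 = x" and j: "nats s0 ''j'' 0 = k - u" "u \<le> k"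
    and C: "nats s0 ''C'' 0 = c" and E: "nats s0 ''E'' 0 = e"
    and f: "f = (\<lambda>b. reals s0 ''A'' (u - b) + row s0 x b)"
  shows "runs inc_step s0 (T_inc_step * (k + 1))
    (\<lambda>s. if c < u then \<exists>p. 1 \<le> p \<and> p \<le> u - c \<and> nats s ''P'' = (nats s0 ''P'')(ix k (ix k x e) u := p) \<and>
      reals s ''A'' = (reals s0 ''A'')(u := f p) \<and> (\<forall>b\<in>{1..u - c}. f b \<le> f p)
     else nats s ''P'' = nats s0 ''P'' \<and> reals s ''A'' = reals s0 ''A'')"
  unfolding inc_step_def
proof (rule runs_Seq)
  show "runs (nset ''u'' (NSub (N ''k'') (N ''j''))) s0 7 (\<lambda>s. s = upn s0 ''u'' 0 u)"
    by (rule runs_loopfree) (simp_all add: j k)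
  fix s1 assume s1: "s1 = upn s0 ''u'' 0 u"
  show "runs (If (NLess (N ''C'') (N ''u''))
     (inc_init ;; FOR ''b'' (NSub (N ''u'') (N ''C'')) best_body ;;
      RAssign ''A'' (N ''u'') (R ''y'')) Skip) s1
      (1 + bcost (NLess (N ''C'') (N ''u'')) + (maxcost inc_init + (for_cost (NSub (N ''u'') (N ''C'')) best_body * (k + 1) + maxcost (RAssign ''A'' (N ''u'') (R ''y'')))))
    (\<lambda>s. if c < u then \<exists>p. 1 \<le> p \<and> p \<le> u - c \<and> nats s ''P'' = (nats s0 ''P'')(ix k (ix k x e) u := p) \<and>
      reals s ''A'' = (reals s0 ''A'')(u := f p) \<and> (\<forall>b\<in>{1..u - c}. f b \<le> f p)
     else nats s ''P'' = nats s0 ''P'' \<and> reals s ''A'' = reals s0 ''A'')" (is "runs _ _ _ ?Q")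
  proof (rule runs_If)
    assume "bval s1 (NLess (N ''C'') (N ''u''))"
    then have cu: "c < u" using s1 C by simp
    show "runs (inc_init ;; FOR ''b'' (NSub (N ''u'') (N ''C'')) best_body ;; RAssign ''A'' (N ''u'') (R ''y'')) s1
       (maxcost inc_init + (for_cost (NSub (N ''u'') (N ''C'')) best_body * (k + 1) + maxcost (RAssign ''A'' (N ''u'') (R ''y'')))) ?Q"
    proof (rule runs_Seq)
      define s2 where "s2 = upn (upr s1 ''y'' 0 (f 1)) ''P'' (ix k (ix k x e) u) 1"
      show "runs inc_init s1 (maxcost inc_init) (\<lambda>s. s = s2)"
        using k X C E j
        by (intro runs_loopfree) (simp_all add: inc_init_def s1 s2_def f row_def)
      fix s assume "s = s2"
      then have s: "s = upn (upr s1 ''y'' 0 (f 1)) ''P'' (ix k (ix k x e) u) 1" by (simp add: s2_def)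
      have fs: "f = (\<lambda>b. reals s ''A'' (u - b) + row s x b)" by (simp add: f s s1 row_def)
      show "runs (FOR ''b'' (NSub (N ''u'') (N ''C'')) best_body ;; RAssign ''A'' (N ''u'') (R ''y'')) s
         (for_cost (NSub (N ''u'') (N ''C'')) best_body * (k + 1) + maxcost (RAssign ''A'' (N ''u'') (R ''y''))) ?Q"
      proof (rule runs_Seq[OF runs_best[where x = x and u = u and c = c and e = e, OF _ _ _ j(2) _ cu _ fs]])
        fix s3 assume fr: "frame (FOR ''b'' (NSub (N ''u'') (N ''C'')) best_body) s s3" and
          p: "\<exists>p. 1 \<le> p \<and> p \<le> u - c \<and> nats s3 ''P'' = (nats s ''P'')(ix k (ix k x e) u := p) \<and>
            reals s3 ''y'' 0 = f p \<and> (\<forall>b\<in>{1..u - c}. f b \<le> f p)"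
        have "nats s3 ''u'' 0 = u" "reals s3 ''A'' = reals s0 ''A''"
          by (simp_all add: frame_nats[OF fr] frame_reals[OF fr] best_body_def s s1)
        then show "runs (RAssign ''A'' (N ''u'') (R ''y'')) s3 (maxcost (RAssign ''A'' (N ''u'') (R ''y''))) ?Q"
          using p cu by (intro runs_loopfree) (auto simp: s s1)
      qed (use k X C E in \<open>auto simp: s s1 ptr_def\<close>)
    qed simp
  next
    assume "\<not> bval s1 (NLess (N ''C'') (N ''u''))"
    then have "\<not> c < u" using s1 C by simp
    then show "runs Skip s1 (maxcost inc_init + (for_cost (NSub (N ''u'') (N ''C'')) best_body * (k + 1) + maxcost (RAssign ''A'' (N ''u'') (R ''y'')))) ?Q"
      using s1 by (intro runs_loopfree) (auto simp: inc_init_def)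
  qed simp
qed (simp add: T_inc_step_def inc_step_def inc_init_def add_mult_distrib)

end

lemma loop_time:
  assumes "1 \<le> (x::nat)"
  shows "x * (a * x) + w * (x + 1) \<le> (a + 2 * w) * (x * x)"
proof -
  have "x + 1 \<le> 2 * (x * x)" using mult_le_mono1[OF assms, of x] assms by linarith
  then have "w * (x + 1) \<le> w * (2 * (x * x))" by (rule mult_le_mono2)
  then show ?thesis by (simp add: algebra_simps)
qed

context summary_dp begin

text \<open>The data that the table computation of \<open>v\<close> only reads, bundled so that
  \<open>env_frame\<close> preserves them at once.\<close>

definition env :: "nat \<Rightarrow> nat \<Rightarrow> (nat \<Rightarrow> nat) \<Rightarrow> store \<Rightarrow> bool" where
  "env v m X s \<longleftrightarrow> nats s ''k'' 0 = k \<and> nats s ''v'' 0 = v \<and> nats s ''m'' 0 = m \<and> nats s ''d'' v = card (ch v) \<and>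
     reals s ''w'' v = pw v \<and> reals s ''s'' v = ps v \<and>
     (\<forall>u<m. nats s ''T'' (ix k v u) = X u \<and> reals s ''s'' (X u) = ps (X u))"

lemma env_frame:
  "env v m X s \<Longrightarrow> frame c s s' \<Longrightarrow> {''k'', ''v'', ''m'', ''d'', ''T''} \<inter> nwrites c = {} \<Longrightarrow>
   {''w'', ''s''} \<inter> rwrites c = {} \<Longrightarrow> env v m X s'"
  by (simp add: env_def frame_nats frame_reals)

lemma envD:
  assumes "env v m X s"
  shows "nats s ''k'' 0 = k" "nats s ''v'' 0 = v" "nats s ''m'' 0 = m" "nats s ''d'' v = card (ch v)"
    "reals s ''w'' v = pw v" "reals s ''s'' v = ps v" "u < m \<Longrightarrow> nats s ''T'' (ix k v u) = X u"
    "u < m \<Longrightarrow> reals s ''s'' (X u) = ps (X u)"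
  using assms by (auto simp: env_def)

definition T_include :: nat where
  "T_include = 2 * maxcost include_prog + T_inc_step + 40"

lemma runs_inc_loop:
  assumes k: "nats s0 ''k'' 0 = k" and x: "nats s0 ''X'' 0 = X r" and E: "nats s0 ''E'' 0 = e"
    and re: "r \<noteq> e" and C: "nats s0 ''C'' 0 = inc e r"
    and A: "\<And>j. inc e r \<le> j \<Longrightarrow> j \<le> k \<Longrightarrow> reals s0 ''A'' j = knap D X e r j"
    and D: "\<And>j. j \<le> k \<Longrightarrow> row s0 (X r) j = D (X r) j"
  shows "runs (FOR ''j'' (NAdd (N ''k'') (NConst 1)) inc_step) s0 ((T_inc_step + 40) * ((k + 1) * (k + 1)))
    (\<lambda>s. (\<forall>j\<le>k. inc e r < j \<longrightarrow> reals s ''A'' j = knap D X e (Suc r) j \<and> good_ptr D X e r j (ptr s (X r) e j)) \<and>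
      (\<forall>z. (\<forall>j\<le>k. z \<noteq> ix k (ix k (X r) e) j) \<longrightarrow> nats s ''P'' z = nats s0 ''P'' z))"
proof -
  let ?c = "inc e r"
  let ?I = "\<lambda>i s. (\<forall>j\<le>k. if k < j + i \<and> ?c < j
       then reals s ''A'' j = knap D X e (Suc r) j \<and> good_ptr D X e r j (ptr s (X r) e j)
       else reals s ''A'' j = reals s0 ''A'' j) \<and>
      (\<forall>z. (\<forall>j\<le>k. z \<noteq> ix k (ix k (X r) e) j) \<longrightarrow> nats s ''P'' z = nats s0 ''P'' z)"
  have "runs (FOR ''j'' (NAdd (N ''k'') (NConst 1)) inc_step) s0 ((T_inc_step + 40) * ((k + 1) * (k + 1))) (?I (k + 1))"
  proof (rule runs_FOR[where I = ?I and m = "k + 1" and t = "\<lambda>_. T_inc_step * (k + 1)"])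
    fix i s assume i: "i < k + 1" and I: "?I i s" and si: "nats s ''j'' 0 = i"
      and fr: "frame (FOR ''j'' (NAdd (N ''k'') (NConst 1)) inc_step) s0 s"
    define u where "u = k - i"
    have u: "u \<le> k" "i = k - u" using i by (auto simp: u_def)
    have st: "nats s ''k'' 0 = k" "nats s ''X'' 0 = X r" "nats s ''C'' 0 = ?c" "nats s ''E'' 0 = e" "row s = row s0"
      using k x E C by (simp_all add: row_def fun_eq_iff frame_nats[OF fr] frame_reals[OF fr] node_defs)
    define f where "f = (\<lambda>b. reals s ''A'' (u - b) + row s (X r) b)"
    \<comment> \<open>As the share is at least 1, only entries below \<open>u\<close> are read, and
      the downward order has not reached them yet.\<close>
    have f: "f b = knap D X e r (u - b) + D (X r) b" if "1 \<le> b" "b \<le> u - ?c" for b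
    proof -
      have "?c \<le> u - b" "u - b \<le> k" "\<not> k < u - b + i" using that u by auto
      then have "reals s ''A'' (u - b) = knap D X e r (u - b)" using I A by auto
      then show ?thesis using D[of b] that u st by (simp add: f_def)
    qed
    have step: "runs inc_step s (T_inc_step * (k + 1))
      (\<lambda>s'. if ?c < u then \<exists>p. 1 \<le> p \<and> p \<le> u - ?c \<and> nats s' ''P'' = (nats s ''P'')(ix k (ix k (X r) e) u := p) \<and>
        reals s' ''A'' = (reals s ''A'')(u := f p) \<and> (\<forall>b\<in>{1..u - ?c}. f b \<le> f p)
       else nats s' ''P'' = nats s ''P'' \<and> reals s' ''A'' = reals s ''A'')"
      using si u by (intro runs_inc_step[OF st(1,2) _ u(1) st(3,4) f_def]) simp
    then show "runs inc_step s (T_inc_step * (k + 1)) (?I (Suc i))"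
    proof (rule runs_conseq)
      fix s' :: store assume s': "if ?c < u then \<exists>p. 1 \<le> p \<and> p \<le> u - ?c \<and> nats s' ''P'' = (nats s ''P'')(ix k (ix k (X r) e) u := p) \<and>
        reals s' ''A'' = (reals s ''A'')(u := f p) \<and> (\<forall>b\<in>{1..u - ?c}. f b \<le> f p)
       else nats s' ''P'' = nats s ''P'' \<and> reals s' ''A'' = reals s ''A''"
      have lt: "k < j + Suc i \<longleftrightarrow> k < j + i \<or> j = u" if "j \<le> k" for j using u that by auto
      have nu: "\<not> k < u + i" using u by simp
      show "?I (Suc i) s'"
      proof (cases "?c < u")
        case False
        then have eq: "nats s' ''P'' = nats s ''P''" "reals s' ''A'' = reals s ''A''" using s' by simp_all
        have "k < j + Suc i \<and> ?c < j \<longleftrightarrow> k < j + i \<and> ?c < j" for j using False u by auto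
        moreover have "ptr s' x e j = ptr s x e j" for x e j by (simp add: ptr_def eq)
        ultimately show ?thesis using I by (simp only: eq)
      next
        case True
        then obtain p where p: "1 \<le> p" "p \<le> u - ?c" "nats s' ''P'' = (nats s ''P'')(ix k (ix k (X r) e) u := p)"
          "reals s' ''A'' = (reals s ''A'')(u := f p)" "\<forall>b\<in>{1..u - ?c}. f b \<le> f p" using s' by auto
        have "knap D X e (Suc r) u = Max ((\<lambda>b. knap D X e r (u - b) + D (X r) b) ` {1..u - ?c})"
          using re by simp
        also have "\<dots> = f p"
          using p f by (intro Max_eqI) auto
        finally have kn: "knap D X e (Suc r) u = f p" .
        have pt: "ptr s' (X r) e u = p" by (simp add: ptr_def p)
        have po: "ptr s' (X r) e j = ptr s (X r) e j" if "j \<noteq> u" "j \<le> k" for j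
          using that u by (simp add: ptr_def p ix_eq_iff)
        have "if k < j + Suc i \<and> ?c < j
           then reals s' ''A'' j = knap D X e (Suc r) j \<and> good_ptr D X e r j (ptr s' (X r) e j)
           else reals s' ''A'' j = reals s0 ''A'' j" if j: "j \<le> k" for j
        proof (cases "j = u")
          case True
          then show ?thesis using kn pt p f[of p] \<open>?c < u\<close> lt[OF j] by (simp add: good_ptr_def del: knap.simps)
        next
          case False
          have Aj: "reals s' ''A'' j = reals s ''A'' j" using False by (simp add: p)
          have "k < j + Suc i \<longleftrightarrow> k < j + i" using lt[OF j] False by blast
          then show ?thesis using I[THEN conjunct1, rule_format, OF j] unfolding Aj po[OF False j] by (simp only:)
        qed
        moreover have "nats s' ''P'' z = nats s0 ''P'' z" if "\<forall>j\<le>k. z \<noteq> ix k (ix k (X r) e) j" for z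
          using I that u by (simp add: p)
        ultimately show ?thesis by blast
      qed
    qed simp
  next
    fix i s assume "frame (FOR ''j'' (NAdd (N ''k'') (NConst 1)) inc_step) s0 s"
    then show "nval s (NAdd (N ''k'') (NConst 1)) = k + 1" using k by (simp add: frame_nats node_defs)
  next
    show "(\<Sum>i<k + 1. T_inc_step * (k + 1)) + (10 + ncost (NAdd (N ''k'') (NConst 1))) * (k + 1 + 1) \<le> (T_inc_step + 40) * ((k + 1) * (k + 1))"
      using loop_time[of "k + 1" T_inc_step 14] by (simp add: algebra_simps)
  qed (auto simp: node_defs ptr_def)
  then show ?thesis by (rule runs_conseq) auto
qed

lemma runs_include:
  assumes env: "env v m X s0" and R: "nats s0 ''R'' 0 = r" "r < m" and E: "nats s0 ''E'' 0 = e"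
    and re: "r \<noteq> e" and C: "nats s0 ''C'' 0 = inc e r"
    and A: "\<And>j. inc e r \<le> j \<Longrightarrow> j \<le> k \<Longrightarrow> reals s0 ''A'' j = knap D X e r j"
    and D: "\<And>j. j \<le> k \<Longrightarrow> row s0 (X r) j = D (X r) j"
  shows "runs include_prog s0 (T_include * ((k + 1) * (k + 1)))
    (\<lambda>s. nats s ''C'' 0 = Suc (inc e r) \<and> reals s ''o'' 0 = reals s0 ''o'' 0 - ps (X r) \<and>
      (\<forall>j\<le>k. inc e r < j \<longrightarrow> reals s ''A'' j = knap D X e (Suc r) j \<and> good_ptr D X e r j (ptr s (X r) e j)) \<and>
      (\<forall>z. (\<forall>j\<le>k. z \<noteq> ix k (ix k (X r) e) j) \<longrightarrow> nats s ''P'' z = nats s0 ''P'' z))"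
  unfolding include_prog_def
proof (rule runs_Seq)
  note ev = envD[OF env]
  define s1 where "s1 = upn s0 ''X'' 0 (X r)"
  show "runs (nset ''X'' (NCell ''T'' (IX (N ''v'') (N ''R'')))) s0 (maxcost (nset ''X'' (NCell ''T'' (IX (N ''v'') (N ''R''))))) (\<lambda>s. s = s1)"
    by (rule runs_loopfree) (simp_all add: ev R s1_def)
  fix s assume "s = s1"
  then have s: "s = upn s0 ''X'' 0 (X r)" by (simp add: s1_def)
  have rs: "row s = row s0" by (simp add: s row_def fun_eq_iff)
  show "runs (FOR ''j'' (NAdd (N ''k'') (NConst 1)) inc_step ;; nset ''C'' (NAdd (N ''C'') (NConst 1)) ;;
     rset ''o'' (RSub (R ''o'') (RCell ''s'' (N ''X'')))) s
     ((T_inc_step + 40) * ((k + 1) * (k + 1)) + maxcost (nset ''C'' (NAdd (N ''C'') (NConst 1)) ;; rset ''o'' (RSub (R ''o'') (RCell ''s'' (N ''X'')))))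
    (\<lambda>s. nats s ''C'' 0 = Suc (inc e r) \<and> reals s ''o'' 0 = reals s0 ''o'' 0 - ps (X r) \<and>
      (\<forall>j\<le>k. inc e r < j \<longrightarrow> reals s ''A'' j = knap D X e (Suc r) j \<and> good_ptr D X e r j (ptr s (X r) e j)) \<and>
      (\<forall>z. (\<forall>j\<le>k. z \<noteq> ix k (ix k (X r) e) j) \<longrightarrow> nats s ''P'' z = nats s0 ''P'' z))"
  proof (rule runs_Seq[OF runs_inc_loop[where X = X and r = r and e = e and D = D]])
    fix s2 assume fr: "frame (FOR ''j'' (NAdd (N ''k'') (NConst 1)) inc_step) s s2"
      and Q: "(\<forall>j\<le>k. inc e r < j \<longrightarrow> reals s2 ''A'' j = knap D X e (Suc r) j \<and> good_ptr D X e r j (ptr s2 (X r) e j)) \<and>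
      (\<forall>z. (\<forall>j\<le>k. z \<noteq> ix k (ix k (X r) e) j) \<longrightarrow> nats s2 ''P'' z = nats s ''P'' z)"
    have "nats s2 ''C'' 0 = inc e r" "nats s2 ''X'' 0 = X r" "reals s2 ''o'' = reals s0 ''o''" "reals s2 ''s'' = reals s0 ''s''"
      using C by (simp_all add: frame_nats[OF fr] frame_reals[OF fr] node_defs s)
    then show "runs (nset ''C'' (NAdd (N ''C'') (NConst 1)) ;; rset ''o'' (RSub (R ''o'') (RCell ''s'' (N ''X'')))) s2
      (maxcost (nset ''C'' (NAdd (N ''C'') (NConst 1)) ;; rset ''o'' (RSub (R ''o'') (RCell ''s'' (N ''X'')))))
      (\<lambda>s. nats s ''C'' 0 = Suc (inc e r) \<and> reals s ''o'' 0 = reals s0 ''o'' 0 - ps (X r) \<and>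
      (\<forall>j\<le>k. inc e r < j \<longrightarrow> reals s ''A'' j = knap D X e (Suc r) j \<and> good_ptr D X e r j (ptr s (X r) e j)) \<and>
      (\<forall>z. (\<forall>j\<le>k. z \<noteq> ix k (ix k (X r) e) j) \<longrightarrow> nats s ''P'' z = nats s0 ''P'' z))"
      using Q ev(8)[OF R(2)] by (intro runs_loopfree) (simp_all add: ptr_def s del: knap.simps)
  qed (use ev C E A D re in \<open>simp_all add: s rs row_def\<close>)
next
  have "maxcost include_prog * 1 \<le> maxcost include_prog * ((k + 1) * (k + 1))" by (rule mult_le_mono2) simp
  then show "maxcost (nset ''X'' (NCell ''T'' (IX (N ''v'') (N ''R'')))) + ((T_inc_step + 40) * ((k + 1) * (k + 1)) +
    maxcost (nset ''C'' (NAdd (N ''C'') (NConst 1)) ;; rset ''o'' (RSub (R ''o'') (RCell ''s'' (N ''X'')))))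
    \<le> T_include * ((k + 1) * (k + 1))"
    unfolding T_include_def distrib_right by (simp add: include_prog_def IX_def FOR_def)
qed

definition feas :: "nat \<Rightarrow> nat \<Rightarrow> nat \<Rightarrow> nat \<Rightarrow> bool" where
  "feas v e r j \<longleftrightarrow> base v (inc e r) + inc e r \<le> j"

text \<open>\<open>S\<close> holds the pairs tried so far; the row is the maximum over them and the
  collapsed value, together with a pair that attains it.\<close>

definition row_ok :: "(nat \<Rightarrow> nat \<Rightarrow> real) \<Rightarrow> (nat \<Rightarrow> nat) \<Rightarrow> nat \<Rightarrow> (nat \<times> nat) set \<Rightarrow> store \<Rightarrow> bool" where
  "row_ok D X v S s \<longleftrightarrow> (\<forall>j\<le>k. plogp (ps v) \<le> row s v j \<and>
    (\<forall>(e, r)\<in>S. feas v e r j \<longrightarrow> cand D X v e r j \<le> row s v j) \<and>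
    (nats s ''r'' (ix k v j) = 0 \<and> row s v j = plogp (ps v) \<or>
     (\<exists>(e, r)\<in>S. nats s ''r'' (ix k v j) = Suc r \<and> nats s ''e'' (ix k v j) = e \<and> feas v e r j \<and>
        row s v j = cand D X v e r j)))"

definition outside :: "nat \<Rightarrow> store \<Rightarrow> store \<Rightarrow> bool" where
  "outside v s0 s \<longleftrightarrow> (\<forall>z. (\<forall>j\<le>k. z \<noteq> ix k v j) \<longrightarrow>
     reals s ''D'' z = reals s0 ''D'' z \<and> nats s ''r'' z = nats s0 ''r'' z \<and> nats s ''e'' z = nats s0 ''e'' z)"

lemma outside_refl [simp]: "outside v s s"
  and outside_trans: "outside v s s' \<Longrightarrow> outside v s' s'' \<Longrightarrow> outside v s s''"
  by (auto simp: outside_def)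

lemma outside_row: "outside v s0 s \<Longrightarrow> x \<noteq> v \<Longrightarrow> j \<le> k \<Longrightarrow> row s x j = row s0 x j"
  by (simp add: outside_def row_def ix_eq_iff)

lemma runs_cand:
  assumes env: "env v m X s0" and R: "nats s0 ''R'' 0 = r" and E: "nats s0 ''E'' 0 = e"
    and C: "nats s0 ''C'' 0 = inc e r" and B: "nats s0 ''B'' 0 = base v (inc e r)"
    and z: "reals s0 ''z'' 0 = plogp (pw v) + plogp (ps v - pw v - (\<Sum>u\<in>included e r. ps (X u)))"
    and A: "\<And>j. inc e r \<le> j \<Longrightarrow> j \<le> k \<Longrightarrow> reals s0 ''A'' j = knap D X e r j"
    and ok: "row_ok D X v S s0"
  shows "runs (FOR ''j'' (NAdd (N ''k'') (NConst 1)) cand_body) s0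
     (for_cost (NAdd (N ''k'') (NConst 1)) cand_body * (k + 1 + 1))
    (\<lambda>s. row_ok D X v (insert (e, r) S) s \<and> outside v s0 s)"
proof -
  let ?P = "\<lambda>S s j. plogp (ps v) \<le> row s v j \<and>
    (\<forall>(e, r)\<in>S. feas v e r j \<longrightarrow> cand D X v e r j \<le> row s v j) \<and>
    (nats s ''r'' (ix k v j) = 0 \<and> row s v j = plogp (ps v) \<or>
     (\<exists>(e, r)\<in>S. nats s ''r'' (ix k v j) = Suc r \<and> nats s ''e'' (ix k v j) = e \<and> feas v e r j \<and>
        row s v j = cand D X v e r j))"
  let ?I = "\<lambda>i s. (\<forall>j\<le>k. ?P (if j < i then insert (e, r) S else S) s j) \<and> outside v s0 s"
  have "runs (FOR ''j'' (NAdd (N ''k'') (NConst 1)) cand_body) s0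
     (for_cost (NAdd (N ''k'') (NConst 1)) cand_body * (k + 1 + 1)) (?I (k + 1))"
  proof (rule runs_FOR_loopfree[where I = ?I and m = "k + 1"])
    show "?I 0 s0" using ok by (simp add: row_ok_def)
    show "?I i (upn s ''j'' 0 a)" if "?I i s" for i s a
      using that by (simp add: row_def outside_def)
    fix i s assume fr: "frame (FOR ''j'' (NAdd (N ''k'') (NConst 1)) cand_body) s0 s"
    show "nval s (NAdd (N ''k'') (NConst 1)) = k + 1" using envD(1)[OF env] by (simp add: frame_nats[OF fr] cand_body_def)
    assume i: "i < k + 1" and I: "?I i s" and si: "nats s ''j'' 0 = i"
    have st: "nats s ''k'' = nats s0 ''k''" "nats s ''v'' = nats s0 ''v''" "nats s ''B'' = nats s0 ''B''" "nats s ''C'' = nats s0 ''C''"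
      "nats s ''R'' = nats s0 ''R''" "nats s ''E'' = nats s0 ''E''" "reals s ''z'' = reals s0 ''z''" "reals s ''A'' = reals s0 ''A''"
      by (simp_all add: frame_nats[OF fr] frame_reals[OF fr] cand_body_def)
    define y where "y = cand D X v e r i"
    have yA: "reals s0 ''z'' 0 + reals s0 ''A'' (i - base v (inc e r)) = y" if "feas v e r i"
      using that A[of "i - base v (inc e r)"] i z by (simp add: y_def cand_def feas_def)
    define s2 where "s2 = upn (upn (upr s ''D'' (ix k v i) y) ''r'' (ix k v i) (Suc r)) ''e'' (ix k v i) e"
    have sem: "sem cand_body s = (if feas v e r i \<and> row s v i < y then s2 else s)"
    proof (cases "feas v e r i")
      case True
      show ?thesis using True
        by (simp add: cand_body_def si st R E C B envD(1,2)[OF env] yA[OF True] row_def s2_def) (simp add: feas_def)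
    next
      case False
      then show ?thesis by (simp add: cand_body_def si st C B feas_def)
    qed
    have oth: "row s2 v j = row s v j" "nats s2 ''r'' (ix k v j) = nats s ''r'' (ix k v j)" "nats s2 ''e'' (ix k v j) = nats s ''e'' (ix k v j)"
      if "j \<noteq> i" "j \<le> k" for j
      using that i by (simp_all add: s2_def row_def ix_eq_iff)
    show "?I (Suc i) (sem cand_body s)"
    proof (cases "feas v e r i \<and> row s v i < y")
      case True
      have "?P (if j < Suc i then insert (e, r) S else S) s2 j" if j: "j \<le> k" for j
      proof (cases "j = i")
        case True
        have "?P S s i" using I[THEN conjunct1, rule_format, of i] i by simp
        moreover have "row s2 v i = y" "nats s2 ''r'' (ix k v i) = Suc r" "nats s2 ''e'' (ix k v i) = e"
          by (simp_all add: s2_def row_def)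
        ultimately show ?thesis using \<open>feas v e r i \<and> row s v i < y\<close> True by (force simp: y_def)
      next
        case False
        have lt: "j < Suc i \<longleftrightarrow> j < i" using False by auto
        show ?thesis unfolding oth[OF False j] lt by (rule I[THEN conjunct1, rule_format, OF j])
      qed
      moreover have "outside v s s2" using i by (auto simp: outside_def s2_def)
      then have "outside v s0 s2" using I outside_trans by blast
      ultimately show ?thesis unfolding sem if_P[OF True] by blast
    next
      case False
      have "?P (if j < Suc i then insert (e, r) S else S) s j" if j: "j \<le> k" for j
      proof (cases "j = i")
        case True
        have "?P S s i" using I[THEN conjunct1, rule_format, of i] i by simp
        then show ?thesis using True False by (auto simp: y_def not_less)
      next
        case False
        have lt: "j < Suc i \<longleftrightarrow> j < i" using False by auto
        show ?thesis unfolding lt by (rule I[THEN conjunct1, rule_format, OF j])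
      qed
      then show ?thesis unfolding sem if_not_P[OF False] using I by blast
    qed
  qed (auto simp: cand_body_def)
  then show ?thesis by (rule runs_conseq) (auto simp: row_ok_def)
qed


lemma knap_cong:
  assumes "\<And>u b. u < r \<Longrightarrow> b \<le> k \<Longrightarrow> D (X u) b = D' (X' u) b" "j \<le> k"
  shows "knap D X e r j = knap D' X' e r j"
  using assms
proof (induction r arbitrary: j)
  case (Suc r)
  have "(\<lambda>b. knap D X e r (j - b) + D (X r) b) ` {1..j - inc e r} = (\<lambda>b. knap D' X' e r (j - b) + D' (X' r) b) ` {1..j - inc e r}"
    using Suc by (intro image_cong) auto
  moreover have "knap D X e r j = knap D' X' e r j" using Suc by simp
  ultimately show ?case by (cases "r = e") simp_all
qed simp

text \<open>The loops over \<open>E\<close> and \<open>R\<close> run through the pairs in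
  lexicographic order.\<close>

definition tried :: "nat \<Rightarrow> nat \<Rightarrow> nat \<Rightarrow> (nat \<times> nat) set" where
  "tried m e i = {(e', r). r \<le> m \<and> (e' < e \<or> e' = e \<and> r < i)}"

lemma tried_Suc: "i \<le> m \<Longrightarrow> tried m e (Suc i) = insert (e, i) (tried m e i)"
  and tried_next: "tried m e (Suc m) = tried m (Suc e) 0"
  and tried_0 [simp]: "tried m 0 0 = {}"
  by (auto simp: tried_def)

definition ptrs_ok :: "(nat \<Rightarrow> nat \<Rightarrow> real) \<Rightarrow> (nat \<Rightarrow> nat) \<Rightarrow> nat \<Rightarrow> nat \<Rightarrow> nat \<Rightarrow> store \<Rightarrow> bool" where
  "ptrs_ok D X m e i s \<longleftrightarrow> (\<forall>e'\<le>m. \<forall>u<m. u \<noteq> e' \<longrightarrow> (e' < e \<or> e' = e \<and> u < i) \<longrightarrow>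
     (\<forall>j\<le>k. inc e' u < j \<longrightarrow> good_ptr D X e' u j (ptr s (X u) e' j)))"

definition ptr_outside :: "(nat \<Rightarrow> nat) \<Rightarrow> nat \<Rightarrow> store \<Rightarrow> store \<Rightarrow> bool" where
  "ptr_outside X m s0 s \<longleftrightarrow> (\<forall>z. (\<forall>u<m. \<forall>e\<le>m. \<forall>j\<le>k. z \<noteq> ix k (ix k (X u) e) j) \<longrightarrow> nats s ''P'' z = nats s0 ''P'' z)"

text \<open>\<open>min i m\<close> accounts for the last round, which includes no child.\<close>

definition rank_inv :: "(nat \<Rightarrow> nat \<Rightarrow> real) \<Rightarrow> (nat \<Rightarrow> nat) \<Rightarrow> nat \<Rightarrow> nat \<Rightarrow> store \<Rightarrow> nat \<Rightarrow> nat \<Rightarrow> store \<Rightarrow> bool" where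
  "rank_inv D X v m s0 e i s \<longleftrightarrow>
    nats s ''C'' 0 = inc e (min i m) \<and>
    reals s ''o'' 0 = ps v - pw v - (\<Sum>u\<in>included e (min i m). ps (X u)) \<and>
    (\<forall>j. inc e (min i m) \<le> j \<longrightarrow> j \<le> k \<longrightarrow> reals s ''A'' j = knap D X e (min i m) j) \<and>
    row_ok D X v (tried m e i) s \<and> outside v s0 s \<and> ptrs_ok D X m e i s \<and> ptr_outside X m s0 s"

definition T_rank :: nat where
  "T_rank = maxcost rank_body + 2 * for_cost (NAdd (N ''k'') (NConst 1)) cand_body + T_include + 10"

lemma row_ok_cong:
  "reals s' ''D'' = reals s ''D'' \<Longrightarrow> nats s' ''r'' = nats s ''r'' \<Longrightarrow> nats s' ''e'' = nats s ''e'' \<Longrightarrow>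
   row_ok D X v S s' = row_ok D X v S s"
  by (simp add: row_ok_def row_def)

lemma outside_cong:
  "reals s' ''D'' = reals s ''D'' \<Longrightarrow> nats s' ''r'' = nats s ''r'' \<Longrightarrow> nats s' ''e'' = nats s ''e'' \<Longrightarrow>
   outside v s0 s' = outside v s0 s"
  by (simp add: outside_def)

lemma ptrs_cong:
  "nats s' ''P'' = nats s ''P'' \<Longrightarrow> ptrs_ok D X m e i s' = ptrs_ok D X m e i s"
  "nats s' ''P'' = nats s ''P'' \<Longrightarrow> ptr_outside X m s0 s' = ptr_outside X m s0 s"
  by (simp_all add: ptrs_ok_def ptr_outside_def ptr_def)

lemma runs_rank:
  assumes env: "env v m X s" and m: "m \<le> k" and inj: "inj_on X {..<m}" and Xv: "\<And>u. u < m \<Longrightarrow> X u \<noteq> v"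
    and D: "\<And>u j. u < m \<Longrightarrow> j \<le> k \<Longrightarrow> row s0 (X u) j = D (X u) j"
    and e: "nats s ''E'' 0 = e" "e \<le> m" and i: "nats s ''R'' 0 = i" "i \<le> m"
    and I: "rank_inv D X v m s0 e i s"
  shows "runs rank_body s (T_rank * ((k + 1) * (k + 1))) (rank_inv D X v m s0 e (Suc i))"
  unfolding rank_body_def
proof (rule runs_Seq)
  note ev = envD[OF env]
  define b where "b = base v (inc e i)"
  define zz where "zz = plogp (pw v) + plogp (ps v - pw v - (\<Sum>u\<in>included e i. ps (X u)))"
  have mi: "min i m = i" using i by simp
  have I': "nats s ''C'' 0 = inc e i" "reals s ''o'' 0 = ps v - pw v - (\<Sum>u\<in>included e i. ps (X u))"
    "\<And>j. inc e i \<le> j \<Longrightarrow> j \<le> k \<Longrightarrow> reals s ''A'' j = knap D X e i j"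
    "row_ok D X v (tried m e i) s" "outside v s0 s" "ptrs_ok D X m e i s" "ptr_outside X m s0 s"
    using I unfolding rank_inv_def mi by auto
  show "runs cand_init s (maxcost cand_init) (\<lambda>s'. s' = upr (upn s ''B'' 0 b) ''z'' 0 zz)"
    by (rule runs_loopfree) (simp_all add: cand_init_def ev I' b_def zz_def base_def)
  fix s1 assume s1: "s1 = upr (upn s ''B'' 0 b) ''z'' 0 zz"
  have env1: "env v m X s1" using env by (simp add: env_def s1)
  show "runs (FOR ''j'' (NAdd (N ''k'') (NConst 1)) cand_body ;;
     If (BAnd (NLess (N ''R'') (N ''m'')) (BNot (Neq (N ''R'') (N ''E'')))) include_prog Skip) s1
     (for_cost (NAdd (N ''k'') (NConst 1)) cand_body * (k + 1 + 1) +
      (1 + bcost (BAnd (NLess (N ''R'') (N ''m'')) (BNot (Neq (N ''R'') (N ''E'')))) + (T_include * ((k + 1) * (k + 1)) + 1)))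
     (rank_inv D X v m s0 e (Suc i))"
  proof (rule runs_Seq[OF runs_cand[where D = D and S = "tried m e i", OF env1]])
    show "row_ok D X v (tried m e i) s1" using I'(4) by (subst row_ok_cong[of s1 s]) (simp_all add: s1)
    fix s2 assume fr: "frame (FOR ''j'' (NAdd (N ''k'') (NConst 1)) cand_body) s1 s2"
      and Q: "row_ok D X v (insert (e, i) (tried m e i)) s2 \<and> outside v s1 s2"
    have env2: "env v m X s2" by (rule env_frame[OF env1 fr]) (simp_all add: cand_body_def)
    have st: "nats s2 ''R'' 0 = i" "nats s2 ''E'' 0 = e" "nats s2 ''C'' 0 = inc e i" "reals s2 ''o'' = reals s ''o''"
      "reals s2 ''A'' = reals s ''A''" "nats s2 ''P'' = nats s ''P''"
      using i e I' by (simp_all add: frame_nats[OF fr] frame_reals[OF fr] cand_body_def s1)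
    have row2: "row_ok D X v (tried m e (Suc i)) s2" using Q tried_Suc[OF i(2)] by simp
    have "outside v s s1" by (simp add: outside_def s1)
    then have out2: "outside v s0 s2" using I'(5) Q outside_trans by blast
    have P2: "ptrs_ok D X m e i s2" "ptr_outside X m s0 s2" using I'(6,7) st(6) ptrs_cong by blast+
    have D2: "row s2 (X u) j = D (X u) j" if "u < m" "j \<le> k" for u j
      using outside_row[OF out2 Xv[OF that(1)] that(2)] D[OF that] by simp
    show "runs (If (BAnd (NLess (N ''R'') (N ''m'')) (BNot (Neq (N ''R'') (N ''E'')))) include_prog Skip) s2
      (1 + bcost (BAnd (NLess (N ''R'') (N ''m'')) (BNot (Neq (N ''R'') (N ''E'')))) + (T_include * ((k + 1) * (k + 1)) + 1))
      (rank_inv D X v m s0 e (Suc i))"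
    proof (rule runs_If)
      assume "bval s2 (BAnd (NLess (N ''R'') (N ''m'')) (BNot (Neq (N ''R'') (N ''E''))))"
      then have im: "i < m" "i \<noteq> e" using st envD[OF env2] by simp_all
      have "runs include_prog s2 (T_include * ((k + 1) * (k + 1)))
        (\<lambda>s. nats s ''C'' 0 = Suc (inc e i) \<and> reals s ''o'' 0 = reals s2 ''o'' 0 - ps (X i) \<and>
        (\<forall>j\<le>k. inc e i < j \<longrightarrow> reals s ''A'' j = knap D X e (Suc i) j \<and> good_ptr D X e i j (ptr s (X i) e j)) \<and>
        (\<forall>z. (\<forall>j\<le>k. z \<noteq> ix k (ix k (X i) e) j) \<longrightarrow> nats s ''P'' z = nats s2 ''P'' z))"
        by (rule runs_include[OF env2]) (use st im I' D2 in auto)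
      then show "runs include_prog s2 (T_include * ((k + 1) * (k + 1)) + 1) (rank_inv D X v m s0 e (Suc i))"
      proof (rule runs_conseq)
        fix s3 assume fr3: "frame include_prog s2 s3" and Q: "nats s3 ''C'' 0 = Suc (inc e i) \<and> reals s3 ''o'' 0 = reals s2 ''o'' 0 - ps (X i) \<and>
        (\<forall>j\<le>k. inc e i < j \<longrightarrow> reals s3 ''A'' j = knap D X e (Suc i) j \<and> good_ptr D X e i j (ptr s3 (X i) e j)) \<and>
        (\<forall>z. (\<forall>j\<le>k. z \<noteq> ix k (ix k (X i) e) j) \<longrightarrow> nats s3 ''P'' z = nats s2 ''P'' z)"
        have eqs: "reals s3 ''D'' = reals s2 ''D''" "nats s3 ''r'' = nats s2 ''r''" "nats s3 ''e'' = nats s2 ''e''"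
          by (simp_all add: frame_nats[OF fr3] frame_reals[OF fr3] node_defs)
        have "row_ok D X v (tried m e (Suc i)) s3" "outside v s0 s3"
          using row2 out2 row_ok_cong[OF eqs] outside_cong[OF eqs] by blast+
        moreover have "ptrs_ok D X m e (Suc i) s3"
          unfolding ptrs_ok_def
        proof (intro allI impI)
          fix e' u j assume a: "e' \<le> m" "u < m" "u \<noteq> e'" "e' < e \<or> e' = e \<and> u < Suc i" "j \<le> k" "inc e' u < j"
          show "good_ptr D X e' u j (ptr s3 (X u) e' j)"
          proof (cases "e' = e \<and> u = i")
            case True
            then show ?thesis using Q a by simp
          next
            case False
            \<comment> \<open>Pointers for another child or another gap lie in other cells, so those
              written earlier survive.\<close>
            have "ix k (ix k (X u) e') j \<noteq> ix k (ix k (X i) e) j'" if "j' \<le> k" for j'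
              using False that a m e inj_onD[OF inj, of u i] im by (auto simp: ix_eq_iff)
            then have "ptr s3 (X u) e' j = ptr s2 (X u) e' j" using Q by (simp add: ptr_def)
            moreover have "e' < e \<or> e' = e \<and> u < i" using a(4) False by auto
            ultimately show ?thesis using P2(1) a unfolding ptrs_ok_def by metis
          qed
        qed
        moreover have "ptr_outside X m s0 s3"
          using P2(2) Q im e unfolding ptr_outside_def by auto
        moreover have "min (Suc i) m = Suc i" using im by simp
        ultimately show "rank_inv D X v m s0 e (Suc i) s3"
          unfolding rank_inv_def using Q st I'(2) im
          by (simp add: inc_Suc included_Suc algebra_simps del: knap.simps)
      qed simp
    next
      assume "\<not> bval s2 (BAnd (NLess (N ''R'') (N ''m'')) (BNot (Neq (N ''R'') (N ''E''))))"
      then have im: "i = m \<or> i < m \<and> i = e" using st envD[OF env2] i by auto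
      have "min (Suc i) m = i \<or> min (Suc i) m = Suc e \<and> i = e" using im by auto
      moreover have "ptrs_ok D X m e (Suc i) s2"
        using P2(1) im unfolding ptrs_ok_def by (auto simp: less_Suc_eq)
      ultimately have "rank_inv D X v m s0 e (Suc i) s2"
        unfolding rank_inv_def using row2 out2 P2(2) st I'(1-3)
        by (auto simp: inc_Suc included_Suc)
      then show "runs Skip s2 (T_include * ((k + 1) * (k + 1)) + 1) (rank_inv D X v m s0 e (Suc i))"
        by (intro runs_loopfree) auto
    qed simp
  qed (use i e I' in \<open>simp_all add: s1 b_def zz_def\<close>)
next
  define y where "y = (k + 1) * (k + 1)"
  let ?f = "for_cost (NAdd (N ''k'') (NConst 1)) cand_body"
  have y: "1 \<le> y" "k + 1 + 1 \<le> 2 * y" by (simp_all add: y_def)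
  have "maxcost rank_body * 1 \<le> maxcost rank_body * y" "?f * (k + 1 + 1) \<le> ?f * (2 * y)"
    using y by (intro mult_le_mono2; simp)+
  moreover have "maxcost cand_init + (1 + bcost (BAnd (NLess (N ''R'') (N ''m'')) (BNot (Neq (N ''R'') (N ''E'')))) + 1) \<le> maxcost rank_body + 1"
    by (simp add: rank_body_def)
  moreover have "T_rank * y = maxcost rank_body * y + ?f * (2 * y) + T_include * y + 10 * y"
    by (simp add: T_rank_def add_mult_distrib)
  ultimately have "maxcost cand_init + (?f * (k + 1 + 1) +
      (1 + bcost (BAnd (NLess (N ''R'') (N ''m'')) (BNot (Neq (N ''R'') (N ''E'')))) + (T_include * y + 1))) \<le> T_rank * y"
    using y(1) by linarith
  then show "maxcost cand_init + (?f * (k + 1 + 1) +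
      (1 + bcost (BAnd (NLess (N ''R'') (N ''m'')) (BNot (Neq (N ''R'') (N ''E'')))) + (T_include * ((k + 1) * (k + 1)) + 1)))
     \<le> T_rank * ((k + 1) * (k + 1))"
    unfolding y_def .
qed

definition T_skip :: nat where
  "T_skip = for_cost (NAdd (N ''k'') (NConst 1)) (RAssign ''A'' (N ''j'') (ROfNat (NConst 0))) * 2 + maxcost skip_init + 2 * T_rank + 28"

lemma runs_skip:
  assumes env: "env v m X s" and m: "m \<le> k" and inj: "inj_on X {..<m}" and Xv: "\<And>u. u < m \<Longrightarrow> X u \<noteq> v"
    and D: "\<And>u j. u < m \<Longrightarrow> j \<le> k \<Longrightarrow> row s0 (X u) j = D (X u) j"
    and e: "nats s ''E'' 0 = e" "e \<le> m"
    and I: "row_ok D X v (tried m e 0) s \<and> outside v s0 s \<and> ptrs_ok D X m e 0 s \<and> ptr_outside X m s0 s"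
  shows "runs skip_body s (T_skip * ((m + 1) * ((k + 1) * (k + 1))))
    (\<lambda>s. row_ok D X v (tried m (Suc e) 0) s \<and> outside v s0 s \<and> ptrs_ok D X m (Suc e) 0 s \<and> ptr_outside X m s0 s)"
  unfolding skip_body_def
proof (rule runs_Seq)
  note ev = envD[OF env]
  let ?z = "RAssign ''A'' (N ''j'') (ROfNat (NConst 0))"
  show "runs (FOR ''j'' (NAdd (N ''k'') (NConst 1)) ?z) s (for_cost (NAdd (N ''k'') (NConst 1)) ?z * (k + 1 + 1)) (\<lambda>s. \<forall>j<k + 1. reals s ''A'' j = 0)"
    by (rule runs_FOR_loopfree[where I = "\<lambda>i s. \<forall>j<i. reals s ''A'' j = 0"])
      (auto simp: frame_nats ev less_Suc_eq)
  fix s1 assume fr: "frame (FOR ''j'' (NAdd (N ''k'') (NConst 1)) ?z) s s1" and A: "\<forall>j<k + 1. reals s1 ''A'' j = 0"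
  have env1: "env v m X s1" by (rule env_frame[OF env fr]) simp_all
  define s2 where "s2 = upr (upn s1 ''C'' 0 0) ''o'' 0 (ps v - pw v)"
  show "runs (skip_init ;; FOR ''R'' (NAdd (N ''m'') (NConst 1)) rank_body) s1
    (maxcost skip_init + ((\<Sum>i<m + 1. T_rank * ((k + 1) * (k + 1))) + (10 + ncost (NAdd (N ''m'') (NConst 1))) * (m + 1 + 1)))
    (\<lambda>s. row_ok D X v (tried m (Suc e) 0) s \<and> outside v s0 s \<and> ptrs_ok D X m (Suc e) 0 s \<and> ptr_outside X m s0 s)"
  proof (rule runs_Seq)
    show "runs skip_init s1 (maxcost skip_init) (\<lambda>s. s = s2)"
      by (rule runs_loopfree) (simp_all add: skip_init_def envD[OF env1] s2_def)
    fix s' assume "s' = s2"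
    have eqs2: "reals s2 ''D'' = reals s ''D''" "nats s2 ''r'' = nats s ''r''" "nats s2 ''e'' = nats s ''e''" "nats s2 ''P'' = nats s ''P''"
      by (simp_all add: s2_def frame_nats[OF fr] frame_reals[OF fr])
    have env2: "env v m X s2" using env1 by (simp add: env_def s2_def)
    have E2: "nats s2 ''E'' 0 = e" using e by (simp add: s2_def frame_nats[OF fr])
    have "runs (FOR ''R'' (NAdd (N ''m'') (NConst 1)) rank_body) s2 ((\<Sum>i<m + 1. T_rank * ((k + 1) * (k + 1))) + (10 + ncost (NAdd (N ''m'') (NConst 1))) * (m + 1 + 1))
      (rank_inv D X v m s0 e (m + 1))"
    proof (rule runs_FOR[where I = "rank_inv D X v m s0 e" and m = "m + 1" and t = "\<lambda>_. T_rank * ((k + 1) * (k + 1))"])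
      show "rank_inv D X v m s0 e 0 s2"
        unfolding rank_inv_def row_ok_cong[OF eqs2(1-3)] outside_cong[OF eqs2(1-3)] ptrs_cong[OF eqs2(4)]
        using I A by (simp add: s2_def)
      show "rank_inv D X v m s0 e i (upn s ''R'' 0 a)" if "rank_inv D X v m s0 e i s" for i s a
        using that unfolding rank_inv_def row_ok_def outside_def ptrs_ok_def ptr_outside_def ptr_def row_def by simp
    next
      fix i s assume fr: "frame (FOR ''R'' (NAdd (N ''m'') (NConst 1)) rank_body) s2 s"
      have env3: "env v m X s" by (rule env_frame[OF env2 fr]) (simp_all add: node_defs)
      then show "nval s (NAdd (N ''m'') (NConst 1)) = m + 1" by (simp add: env_def)
      assume a: "i < m + 1" "rank_inv D X v m s0 e i s" "nats s ''R'' 0 = i"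
      have "nats s ''E'' 0 = e" using E2 by (simp add: frame_nats[OF fr] node_defs)
      then show "runs rank_body s (T_rank * ((k + 1) * (k + 1))) (rank_inv D X v m s0 e (Suc i))"
        using runs_rank[OF env3 m inj Xv D _ e(2) a(3) _ a(2)] a(1) by auto
    qed (simp_all add: node_defs)
    then show "runs (FOR ''R'' (NAdd (N ''m'') (NConst 1)) rank_body) s' ((\<Sum>i<m + 1. T_rank * ((k + 1) * (k + 1))) + (10 + ncost (NAdd (N ''m'') (NConst 1))) * (m + 1 + 1))
      (\<lambda>s. row_ok D X v (tried m (Suc e) 0) s \<and> outside v s0 s \<and> ptrs_ok D X m (Suc e) 0 s \<and> ptr_outside X m s0 s)"
      unfolding \<open>s' = s2\<close>
    proof (rule runs_conseq)
      fix s assume "rank_inv D X v m s0 e (m + 1) s"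
      then have "row_ok D X v (tried m e (Suc m)) s" "outside v s0 s" "ptrs_ok D X m e (Suc m) s" "ptr_outside X m s0 s"
        by (simp_all add: rank_inv_def)
      then show "row_ok D X v (tried m (Suc e) 0) s \<and> outside v s0 s \<and> ptrs_ok D X m (Suc e) 0 s \<and> ptr_outside X m s0 s"
        unfolding tried_next ptrs_ok_def by (auto simp: less_Suc_eq)
    qed simp
  qed simp
next
  let ?z = "RAssign ''A'' (N ''j'') (ROfNat (NConst 0))"
  let ?x = "(m + 1) * ((k + 1) * (k + 1))"
  have x: "1 \<le> ?x" "k + 2 \<le> 2 * ?x" "m + 2 \<le> 2 * ?x" by (auto simp: algebra_simps)
  have "for_cost (NAdd (N ''k'') (NConst 1)) ?z * (k + 1 + 1) \<le> for_cost (NAdd (N ''k'') (NConst 1)) ?z * (2 * ?x)"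
    "maxcost skip_init * 1 \<le> maxcost skip_init * ?x" "14 * (m + 1 + 1) \<le> 14 * (2 * ?x)"
    using x by (intro mult_le_mono2; simp)+
  then show "for_cost (NAdd (N ''k'') (NConst 1)) ?z * (k + 1 + 1) + (maxcost skip_init + ((\<Sum>i<m + 1. T_rank * ((k + 1) * (k + 1))) + (10 + ncost (NAdd (N ''m'') (NConst 1))) * (m + 1 + 1)))
    \<le> T_skip * ?x"
    unfolding T_skip_def by (simp add: algebra_simps)
qed

definition T_node :: nat where
  "T_node = maxcost (nset ''m'' (NCell ''l'' (N ''v''))) +
     2 * for_cost (NAdd (N ''k'') (NConst 1)) (RAssign ''D'' (IX (N ''v'') (N ''j'')) (PL (RCell ''s'' (N ''v'')))) + T_skip + 28"

text \<open>Filling the row with the collapsed value does not write \<open>r\<close>, hence the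
  assumption that these cells are still 0.\<close>

lemma runs_node:
  assumes v: "nats s0 ''v'' 0 = v" "nats s0 ''l'' v = m" "nats s0 ''k'' 0 = k" "nats s0 ''d'' v = card (ch v)"
    "reals s0 ''w'' v = pw v" "reals s0 ''s'' v = ps v"
    and X: "X = (\<lambda>u. nats s0 ''T'' (ix k v u))" "\<And>u. u < m \<Longrightarrow> reals s0 ''s'' (X u) = ps (X u)"
    and m: "m \<le> k" and inj: "inj_on X {..<m}" and Xv: "\<And>u. u < m \<Longrightarrow> X u \<noteq> v"
    and z: "\<And>j. j \<le> k \<Longrightarrow> nats s0 ''r'' (ix k v j) = 0"
  shows "runs node_table s0 (T_node * ((m + 1) * (m + 1) * ((k + 1) * (k + 1))))
    (\<lambda>s. node_ok v m X (row s) (\<lambda>j. nats s ''r'' (ix k v j)) (\<lambda>j. nats s ''e'' (ix k v j)) (ptr s) \<and>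
       outside v s0 s \<and> ptr_outside X m s0 s)"
  unfolding node_table_def
proof (rule runs_Seq)
  let ?z = "RAssign ''D'' (IX (N ''v'') (N ''j'')) (PL (RCell ''s'' (N ''v'')))"
  let ?tz = "for_cost (NAdd (N ''k'') (NConst 1)) ?z * (k + 1 + 1)"
  let ?te = "(\<Sum>i<m + 1. T_skip * ((m + 1) * ((k + 1) * (k + 1)))) + (10 + ncost (NAdd (N ''m'') (NConst 1))) * (m + 1 + 1)"
  define s1 where "s1 = upn s0 ''m'' 0 m"
  let ?Q = "\<lambda>s. node_ok v m X (row s) (\<lambda>j. nats s ''r'' (ix k v j)) (\<lambda>j. nats s ''e'' (ix k v j)) (ptr s) \<and>
       outside v s0 s \<and> ptr_outside X m s0 s"
  have env1: "env v m X s1" using v X by (simp add: env_def s1_def)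
  show "runs (nset ''m'' (NCell ''l'' (N ''v''))) s0 (maxcost (nset ''m'' (NCell ''l'' (N ''v'')))) (\<lambda>s. s = s1)"
    by (rule runs_loopfree) (simp_all add: v s1_def)
  fix s' assume "s' = s1"
  show "runs (FOR ''j'' (NAdd (N ''k'') (NConst 1)) ?z ;; FOR ''E'' (NAdd (N ''m'') (NConst 1)) skip_body) s' (?tz + ?te) ?Q"
    unfolding \<open>s' = s1\<close>
  proof (rule runs_Seq)
    let ?I = "\<lambda>i s. (\<forall>j<i. row s v j = plogp (ps v)) \<and> (\<forall>z. (\<forall>j\<le>k. z \<noteq> ix k v j) \<longrightarrow> reals s ''D'' z = reals s0 ''D'' z)"
    show "runs (FOR ''j'' (NAdd (N ''k'') (NConst 1)) ?z) s1 ?tz (?I (k + 1))"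
    proof (rule runs_FOR_loopfree[where I = ?I])
      fix i s assume fr: "frame (FOR ''j'' (NAdd (N ''k'') (NConst 1)) ?z) s1 s"
      have env2: "env v m X s" by (rule env_frame[OF env1 fr]) simp_all
      then show "nval s (NAdd (N ''k'') (NConst 1)) = k + 1" by (simp add: env_def)
      assume a: "i < k + 1" "?I i s" "nats s ''j'' 0 = i"
      have sem: "sem ?z s = upr s ''D'' (ix k v i) (plogp (ps v))" by (simp add: a(3) envD[OF env2])
      have "row (sem ?z s) v j = plogp (ps v)" if "j < Suc i" for j
        unfolding sem using that a by (cases "j = i") (simp_all add: row_def ix_eq_iff)
      then show "?I (Suc i) (sem ?z s)" using a unfolding sem by simp
    qed (simp_all add: s1_def row_def)
    fix s2 assume fr: "frame (FOR ''j'' (NAdd (N ''k'') (NConst 1)) ?z) s1 s2" and I: "?I (k + 1) s2"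
    have env2: "env v m X s2" by (rule env_frame[OF env1 fr]) simp_all
    have eqs: "nats s2 ''r'' = nats s0 ''r''" "nats s2 ''e'' = nats s0 ''e''" "nats s2 ''P'' = nats s0 ''P''"
      by (simp_all add: frame_nats[OF fr] s1_def)
    have out2: "outside v s0 s2" using I eqs by (simp add: outside_def)
    have D: "row s0 (X u) j = row s2 (X u) j" if "u < m" "j \<le> k" for u j
      using outside_row[OF out2 Xv[OF that(1)] that(2)] by simp
    let ?J = "\<lambda>e s. row_ok (row s0) X v (tried m e 0) s \<and> outside v s0 s \<and> ptrs_ok (row s0) X m e 0 s \<and> ptr_outside X m s0 s"
    have "runs (FOR ''E'' (NAdd (N ''m'') (NConst 1)) skip_body) s2 ?te (?J (m + 1))"
    proof (rule runs_FOR[where I = ?J and m = "m + 1" and t = "\<lambda>_. T_skip * ((m + 1) * ((k + 1) * (k + 1)))"])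
      show "?J 0 s2" using I z eqs out2
        by (auto simp: row_ok_def ptrs_ok_def ptr_outside_def)
      show "?J i (upn s ''E'' 0 a)" if "?J i s" for i s a
        using that unfolding row_ok_def outside_def ptrs_ok_def ptr_outside_def ptr_def row_def by simp
      fix e s assume fr: "frame (FOR ''E'' (NAdd (N ''m'') (NConst 1)) skip_body) s2 s"
      have env3: "env v m X s" by (rule env_frame[OF env2 fr]) (simp_all add: node_defs)
      then show "nval s (NAdd (N ''m'') (NConst 1)) = m + 1" by (simp add: env_def)
      assume a: "e < m + 1" "?J e s" "nats s ''E'' 0 = e"
      show "runs skip_body s (T_skip * ((m + 1) * ((k + 1) * (k + 1)))) (?J (Suc e))"
        using runs_skip[OF env3 m inj Xv _ a(3) _ a(2)] a(1) by auto
    qed (simp_all add: node_defs)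
    then show "runs (FOR ''E'' (NAdd (N ''m'') (NConst 1)) skip_body) s2 ?te ?Q"
    proof (rule runs_conseq)
      fix s assume J: "?J (m + 1) s"
      \<comment> \<open>The rows of the children lie outside row \<open>v\<close>; so the invariant,
        which speaks of the initial table, can be read with the final one.\<close>
      have rows: "row s (X u) b = row s0 (X u) b" if "u < m" "b \<le> k" for u b
        using outside_row[of v s0 s "X u" b] J Xv that by blast
      have kn: "knap (row s) X e r j = knap (row s0) X e r j" if "r \<le> m" "j \<le> k" for e r j
        using that rows by (intro knap_cong) auto
      have cn: "cand (row s) X v e r j = cand (row s0) X v e r j" if "r \<le> m" "j \<le> k" for e r j
        using kn[OF that(1), of "j - base v (inc e r)"] that by (simp add: cand_def)
      have mem: "(e, r) \<in> tried m (m + 1) 0 \<longleftrightarrow> e \<le> m \<and> r \<le> m" for e r by (auto simp: tried_def)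
      have "node_ok v m X (row s) (\<lambda>j. nats s ''r'' (ix k v j)) (\<lambda>j. nats s ''e'' (ix k v j)) (ptr s)"
        unfolding node_ok_def
      proof (intro allI impI conjI)
        fix j assume j: "j \<le> k"
        have "tried m (m + 1) 0 = {(e, r). e \<le> m \<and> r \<le> m}" using mem by auto
        then have rok: "row_ok (row s0) X v {(e, r). e \<le> m \<and> r \<le> m} s" using J by simp
        have ok: "plogp (ps v) \<le> row s v j"
          "\<And>e r. e \<le> m \<Longrightarrow> r \<le> m \<Longrightarrow> feas v e r j \<Longrightarrow> cand (row s0) X v e r j \<le> row s v j"
          "nats s ''r'' (ix k v j) = 0 \<and> row s v j = plogp (ps v) \<or>
           (\<exists>e r. e \<le> m \<and> r \<le> m \<and> nats s ''r'' (ix k v j) = Suc r \<and> nats s ''e'' (ix k v j) = e \<and> feas v e r j \<and>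
            row s v j = cand (row s0) X v e r j)"
          using rok[unfolded row_ok_def, rule_format, OF j] by auto
        show "plogp (ps v) \<le> row s v j" by (rule ok)
        show "cand (row s) X v e r j \<le> row s v j" if "e \<le> m" "r \<le> m" "base v (inc e r) + inc e r \<le> j" for e r
          using ok(2)[OF that(1,2)] that cn[OF that(2) j] by (simp add: feas_def)
        show "nats s ''r'' (ix k v j) = 0 \<and> row s v j = plogp (ps v) \<or>
          (\<exists>r\<le>m. nats s ''r'' (ix k v j) = Suc r \<and> nats s ''e'' (ix k v j) \<le> m \<and>
             base v (inc (nats s ''e'' (ix k v j)) r) + inc (nats s ''e'' (ix k v j)) r \<le> j \<and>
             row s v j = cand (row s) X v (nats s ''e'' (ix k v j)) r j)"
          using ok(3) cn j unfolding feas_def by metis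
        fix e r assume a: "e \<le> m" "r < m" "r \<noteq> e" "inc e r < j"
        have g: "good_ptr (row s0) X e r j (ptr s (X r) e j)" using J a j unfolding ptrs_ok_def by auto
        then show "1 \<le> ptr s (X r) e j" "ptr s (X r) e j \<le> j - inc e r" by (auto simp: good_ptr_def)
        then show "knap (row s) X e (Suc r) j = knap (row s) X e r (j - ptr s (X r) e j) + row s (X r) (ptr s (X r) e j)"
          using g kn[of "Suc r" j e] kn[of r "j - ptr s (X r) e j" e] rows[of r "ptr s (X r) e j"] a j
          by (simp add: good_ptr_def del: knap.simps)
      qed
      then show "?Q s" using J by blast
    qed simp
  qed simp
next
  let ?z = "RAssign ''D'' (IX (N ''v'') (N ''j'')) (PL (RCell ''s'' (N ''v'')))"
  let ?x = "(m + 1) * (m + 1) * ((k + 1) * (k + 1))"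
  let ?a = "maxcost (nset ''m'' (NCell ''l'' (N ''v'')))"
  have x: "1 \<le> ?x" "k + 2 \<le> 2 * ?x" "m + 2 \<le> 2 * ?x" by (auto simp: algebra_simps)
  have "for_cost (NAdd (N ''k'') (NConst 1)) ?z * (k + 1 + 1) \<le> for_cost (NAdd (N ''k'') (NConst 1)) ?z * (2 * ?x)"
    "?a * 1 \<le> ?a * ?x" "14 * (m + 1 + 1) \<le> 14 * (2 * ?x)"
    using x by (intro mult_le_mono2; simp)+
  then show "?a + (for_cost (NAdd (N ''k'') (NConst 1)) ?z * (k + 1 + 1) +
     ((\<Sum>i<m + 1. T_skip * ((m + 1) * ((k + 1) * (k + 1)))) + (10 + ncost (NAdd (N ''m'') (NConst 1))) * (m + 1 + 1)))
    \<le> T_node * ?x"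
    unfolding T_node_def by (simp add: algebra_simps)
qed

end

section \<open>Filling all tables\<close>

text \<open>Insertion sort with a carried element \<open>b\<close>: each position keeps an element
  at least as heavy as the one it passes on.\<close>

definition "insert_body =
   If (RLess (RCell ''s'' (N ''b'')) (RCell ''s'' (NCell ''T'' (IX (N ''p'') (N ''R''))))) Skip
     (nset ''u'' (NCell ''T'' (IX (N ''p'') (N ''R''))) ;;
      NAssign ''T'' (IX (N ''p'') (N ''R'')) (N ''b'') ;; nset ''b'' (N ''u''))"

definition "insert_init =
   nset ''p'' (NCell ''parent'' (N ''v'')) ;; nset ''b'' (N ''v'')"

text \<open>The element carried last goes to column \<open>l(p)\<close>. For a full list this is the
  spare column \<open>k\<close>, and the element is dropped because \<open>l(p)\<close> is not
  raised.\<close>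

definition "insert_final =
   NAssign ''T'' (IX (N ''p'') (NCell ''l'' (N ''p''))) (N ''b'') ;;
   If (NLess (NCell ''l'' (N ''p'')) (N ''k''))
     (NAssign ''l'' (N ''p'') (NAdd (NCell ''l'' (N ''p'')) (NConst 1))) Skip"

definition "insert_prog = insert_init ;; FOR ''R'' (NCell ''l'' (N ''p'')) insert_body ;; insert_final"

definition "dp_body =
   nset ''v'' (NCell ''q'' (N ''i'')) ;;
   If (NLess (NConst 0) (NCell ''a'' (N ''v'')))
     (node_table ;; If (Neq (N ''v'') (N ''root'')) Skip insert_prog) Skip"

lemmas insert_defs = insert_body_def insert_init_def insert_final_def insert_prog_def

context summary_dp begin

abbreviation desc :: "nat list \<Rightarrow> bool" where
  "desc \<equiv> sorted_wrt (\<lambda>x y. ps y \<le> ps x)"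

definition list_of :: "store \<Rightarrow> nat \<Rightarrow> nat list" where
  "list_of s p = map (\<lambda>u. nats s ''T'' (ix k p u)) [0..<nats s ''l'' p]"

text \<open>\<open>A\<close> is the part already written and \<open>c\<close> the carried element;
  together they consist of \<open>v\<close> and the first \<open>i\<close> old elements, in sorted
  order.\<close>

lemma insert_step_list:
  assumes "distinct (A @ [c])" "set (A @ [c]) = insert v (set (take i L))" "desc (A @ [c])"
    and L: "distinct L" "desc L" "v \<notin> set L" "i < length L"
  defines "y \<equiv> L ! i"
  shows "ps c < ps y \<Longrightarrow> desc ((A @ [y]) @ [c])" and "\<not> ps c < ps y \<Longrightarrow> desc ((A @ [c]) @ [y])"
    and "y \<notin> set (A @ [c])" and "insert y (set (A @ [c])) = insert v (set (take (Suc i) L))"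
proof -
  have tk: "take (Suc i) L = take i L @ [y]" using L(4) by (simp add: take_Suc_conv_app_nth y_def)
  have "desc (take (Suc i) L)" using L(2) by (rule sorted_wrt_take)
  then have ge: "ps y \<le> ps x" if "x \<in> set (take i L)" for x using that by (simp add: tk sorted_wrt_append)
  have "distinct (take (Suc i) L)" using L(1) by simp
  then have "y \<notin> set (take i L)" unfolding tk by simp
  moreover have "y \<noteq> v" using L(3,4) nth_mem[of i L] by (auto simp: y_def)
  ultimately show "y \<notin> set (A @ [c])" unfolding assms(2) by simp
  show "insert y (set (A @ [c])) = insert v (set (take (Suc i) L))" unfolding assms(2) tk by auto
  show "desc ((A @ [c]) @ [y])" if "\<not> ps c < ps y"
    using assms(3) that by (fastforce simp: sorted_wrt_append)
  show "desc ((A @ [y]) @ [c])" if lt: "ps c < ps y"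
  proof -
    \<comment> \<open>An old element that is being carried is at least as heavy as everything behind
      it, so a lighter \<open>c\<close> must be the new element.\<close>
    have "c \<notin> set (take i L)" using ge[of c] lt by auto
    then have "c = v" using assms(2) by auto
    then have "set A \<subseteq> set (take i L)" using assms(1,2) by auto
    then show ?thesis using assms(3) lt ge by (auto simp: sorted_wrt_append)
  qed
qed

lemma runs_insert:
  assumes st: "nats s0 ''k'' 0 = k" "nats s0 ''v'' 0 = v" "nats s0 ''parent'' v = p"
    and L: "list_of s0 p = L" "nats s0 ''l'' p = m" "m \<le> k" "distinct L" "desc L" "v \<notin> set L"
    and ps: "\<And>x. x \<in> insert v (set L) \<Longrightarrow> reals s0 ''s'' x = ps x"
  shows "runs insert_prog s0 ((maxcost insert_init + maxcost insert_final + for_cost (NCell ''l'' (N ''p'')) insert_body) * (k + 1))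
    (\<lambda>s. \<exists>w. distinct w \<and> desc w \<and> set w = insert v (set L) \<and> list_of s p = take k w \<and>
       (\<forall>p'. p' \<noteq> p \<longrightarrow> nats s ''l'' p' = nats s0 ''l'' p') \<and>
       (\<forall>z. (\<forall>u\<le>k. z \<noteq> ix k p u) \<longrightarrow> nats s ''T'' z = nats s0 ''T'' z))"
    (is "runs _ _ _ ?Q")
  unfolding insert_prog_def
proof (rule runs_Seq)
  let ?b = "for_cost (NCell ''l'' (N ''p'')) insert_body"
  define s1 where "s1 = upn (upn s0 ''p'' 0 p) ''b'' 0 v"
  show "runs insert_init s0 (maxcost insert_init) (\<lambda>s. s = s1)"
    by (rule runs_loopfree) (simp_all add: insert_init_def st s1_def)
  fix s' assume "s' = s1"
  have lenL: "length L = m" and Lnth: "\<And>u. u < m \<Longrightarrow> L ! u = nats s0 ''T'' (ix k p u)"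
    using L(1,2) by (auto simp: list_of_def)
  let ?F = "\<lambda>s i. map (\<lambda>u. nats s ''T'' (ix k p u)) [0..<i] @ [nats s ''b'' 0]"
  let ?I = "\<lambda>i s. distinct (?F s i) \<and> set (?F s i) = insert v (set (take i L)) \<and> desc (?F s i) \<and>
     (\<forall>u. i \<le> u \<and> u < m \<longrightarrow> nats s ''T'' (ix k p u) = L ! u) \<and>
     (\<forall>z. (\<forall>u\<le>k. z \<noteq> ix k p u) \<longrightarrow> nats s ''T'' z = nats s0 ''T'' z)"
  show "runs (FOR ''R'' (NCell ''l'' (N ''p'')) insert_body ;; insert_final) s' (?b * (m + 1) + maxcost insert_final) ?Q"
    unfolding \<open>s' = s1\<close>
  proof (rule runs_Seq)
    show "runs (FOR ''R'' (NCell ''l'' (N ''p'')) insert_body) s1 (?b * (m + 1)) (?I m)"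
    proof (rule runs_FOR_loopfree[where I = ?I and m = m])
      show "?I 0 s1" using Lnth by (simp add: s1_def)
      show "?I i (upn s ''R'' 0 a)" if "?I i s" for i s a using that by simp
      fix i s assume fr: "frame (FOR ''R'' (NCell ''l'' (N ''p'')) insert_body) s1 s"
      have fs: "nats s ''k'' 0 = k" "nats s ''p'' 0 = p" "nats s ''l'' p = m" "reals s ''s'' = reals s0 ''s''"
        using st L by (simp_all add: frame_nats[OF fr] frame_reals[OF fr] insert_body_def s1_def)
      then show "nval s (NCell ''l'' (N ''p'')) = m" by simp
      assume i: "i < m" and I: "?I i s" and R: "nats s ''R'' 0 = i"
      define c where "c = nats s ''b'' 0"
      define A where "A = map (\<lambda>u. nats s ''T'' (ix k p u)) [0..<i]"
      have F: "?F s i = A @ [c]" by (simp add: A_def c_def)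
      have Ti: "nats s ''T'' (ix k p i) = L ! i" using I i by simp
      have I': "distinct (A @ [c])" "set (A @ [c]) = insert v (set (take i L))" "desc (A @ [c])"
        using I unfolding F by blast+
      note stp = insert_step_list[OF I' L(4-6), unfolded lenL, OF i]
      have "c \<in> insert v (set L)" using I'(2) set_take_subset[of i L] by auto
      then have psc: "reals s0 ''s'' c = ps c" by (rule ps)
      have psy: "reals s0 ''s'' (L ! i) = ps (L ! i)" using ps[of "L ! i"] i lenL by simp
      have un: "map (\<lambda>u. nats (sem insert_body s) ''T'' (ix k p u)) [0..<i] = A"
        unfolding A_def using i \<open>m \<le> k\<close>
        by (intro map_cong) (simp_all add: insert_body_def R fs ix_eq_iff)
      show "?I (Suc i) (sem insert_body s)"
      proof (cases "ps c < ps (L ! i)")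
        case True
        have sem: "sem insert_body s = s" using True psc psy by (simp add: insert_body_def R fs Ti c_def[symmetric])
        have F': "?F s (Suc i) = (A @ [L ! i]) @ [c]" by (simp add: A_def c_def Ti)
        show ?thesis unfolding sem F' using stp(1)[OF True] stp(3,4) I' I i by auto
      next
        case False
        have sem: "sem insert_body s = upn (upn (upn s ''u'' 0 (L ! i)) ''T'' (ix k p i) c) ''b'' 0 (L ! i)"
          using False psc psy by (simp add: insert_body_def R fs Ti c_def[symmetric])
        have F': "?F (sem insert_body s) (Suc i) = (A @ [c]) @ [L ! i]" using un by (simp add: sem)
        have "nats (sem insert_body s) ''T'' (ix k p u) = L ! u" if "Suc i \<le> u \<and> u < m" for u
          using I that \<open>m \<le> k\<close> by (simp add: sem ix_eq_iff)
        moreover have "nats (sem insert_body s) ''T'' z = nats s0 ''T'' z" if "\<forall>u\<le>k. z \<noteq> ix k p u" for z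
          using I that i \<open>m \<le> k\<close> by (simp add: sem)
        ultimately show ?thesis unfolding F' using stp(2)[OF False] stp(3,4) I' by auto
      qed
    qed (auto simp: insert_body_def)
    fix s assume fr: "frame (FOR ''R'' (NCell ''l'' (N ''p'')) insert_body) s1 s" and I: "?I m s"
    have fs: "nats s ''k'' 0 = k" "nats s ''p'' 0 = p" "nats s ''l'' = nats s0 ''l''"
      using st L by (simp_all add: frame_nats[OF fr] frame_reals[OF fr] insert_body_def s1_def)
    define w where "w = ?F s m"
    have w: "distinct w" "desc w" "set w = insert v (set L)" "length w = Suc m"
      using I lenL by (auto simp: w_def)
    define s2 where "s2 = sem insert_final s"
    have T2: "nats s2 ''T'' = (nats s ''T'')(ix k p m := nats s ''b'' 0)"
      "nats s2 ''l'' = (nats s0 ''l'')(p := (if m < k then Suc m else m))"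
      using L(2) by (simp_all add: s2_def insert_final_def fs fun_eq_iff)
    have len2: "nats s2 ''l'' p = min k (Suc m)" using T2(2) \<open>m \<le> k\<close> by auto
    have nth2: "nats s2 ''T'' (ix k p u) = w ! u" if "u < Suc m" for u
      using that \<open>m \<le> k\<close> by (cases "u = m") (simp_all add: T2 w_def nth_append ix_eq_iff)
    have "list_of s2 p = take (min k (Suc m)) w"
      by (rule nth_equalityI) (use nth2 in \<open>simp_all add: list_of_def len2 w(4)\<close>)
    moreover have "take (min k (Suc m)) w = take k w" using w(4) by (cases "k \<le> Suc m") (simp_all add: min_def)
    ultimately have "list_of s2 p = take k w" by simp
    moreover have "nats s2 ''T'' z = nats s0 ''T'' z" if "\<forall>u\<le>k. z \<noteq> ix k p u" for z
      using I that \<open>m \<le> k\<close> by (simp add: T2)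
    ultimately have "?Q s2" using w T2 by (intro exI[of _ w]) simp
    then show "runs insert_final s (maxcost insert_final) ?Q"
      by (intro runs_loopfree) (simp_all add: s2_def insert_final_def)
  qed simp
next
  let ?b = "for_cost (NCell ''l'' (N ''p'')) insert_body"
  have "?b * (m + 1) \<le> ?b * (k + 1)" using L(3) by simp
  moreover have "maxcost insert_init * 1 \<le> maxcost insert_init * (k + 1)" "maxcost insert_final * 1 \<le> maxcost insert_final * (k + 1)"
    by (intro mult_le_mono2; simp)+
  ultimately show "maxcost insert_init + (?b * (m + 1) + maxcost insert_final) \<le> (maxcost insert_init + maxcost insert_final + ?b) * (k + 1)"
    by (simp only: add_mult_distrib)
qed

text \<open>Lets finished nodes survive later writes: what counts is the child list, the row of
  \<open>v\<close>, the rows of the listed children and their pointers.\<close>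

lemma node_ok_cong:
  assumes ok: "node_ok v m X D cr ce P" and X: "\<And>u. u < m \<Longrightarrow> X' u = X u"
    and D: "\<And>j. j \<le> k \<Longrightarrow> D' v j = D v j" "\<And>u j. u < m \<Longrightarrow> j \<le> k \<Longrightarrow> D' (X u) j = D (X u) j"
    and c: "\<And>j. j \<le> k \<Longrightarrow> cr' j = cr j" "\<And>j. j \<le> k \<Longrightarrow> ce' j = ce j"
    and P: "\<And>u e j. u < m \<Longrightarrow> e \<le> m \<Longrightarrow> j \<le> k \<Longrightarrow> P' (X u) e j = P (X u) e j"
  shows "node_ok v m X' D' cr' ce' P'"
proof -
  have kn: "knap D' X' e r j = knap D X e r j" if "r \<le> m" "j \<le> k" for e r j
    using that X D by (intro knap_cong) auto
  have cn: "cand D' X' v e r j = cand D X v e r j" if "r \<le> m" "j \<le> k" for e r j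
  proof -
    have "(\<Sum>u\<in>included e r. ps (X' u)) = (\<Sum>u\<in>included e r. ps (X u))"
      using X that by (intro sum.cong) (auto simp: included_def)
    then show ?thesis using kn[OF that(1), of "j - base v (inc e r)"] that by (simp add: cand_def)
  qed
  show ?thesis
    unfolding node_ok_def
  proof (intro allI impI conjI)
    fix j assume j: "j \<le> k"
    note okj = ok[unfolded node_ok_def, rule_format, OF j]
    show "plogp (ps v) \<le> D' v j" using okj D j by simp
    show "cand D' X' v e r j \<le> D' v j" if "e \<le> m" "r \<le> m" "base v (inc e r) + inc e r \<le> j" for e r
      using okj that cn[OF that(2) j] D(1)[OF j] by simp
    have "cr j = 0 \<and> D v j = plogp (ps v) \<or>
       (\<exists>r\<le>m. cr j = Suc r \<and> ce j \<le> m \<and> base v (inc (ce j) r) + inc (ce j) r \<le> j \<and> D v j = cand D X v (ce j) r j)"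
      using okj by blast
    then show "cr' j = 0 \<and> D' v j = plogp (ps v) \<or>
       (\<exists>r\<le>m. cr' j = Suc r \<and> ce' j \<le> m \<and> base v (inc (ce' j) r) + inc (ce' j) r \<le> j \<and> D' v j = cand D' X' v (ce' j) r j)"
      using c[OF j] cn[OF _ j] D(1)[OF j] by auto
    fix e r assume a: "e \<le> m" "r < m" "r \<noteq> e" "inc e r < j"
    have g: "1 \<le> P (X r) e j" "P (X r) e j \<le> j - inc e r"
       "knap D X e (Suc r) j = knap D X e r (j - P (X r) e j) + D (X r) (P (X r) e j)" using okj a by blast+
    have P': "P' (X' r) e j = P (X r) e j" using P[OF a(2,1) j] X[OF a(2)] by simp
    show "1 \<le> P' (X' r) e j" "P' (X' r) e j \<le> j - inc e r" using g P' by simp_all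
    have "P (X r) e j \<le> k" using g j by simp
    then show "knap D' X' e (Suc r) j = knap D' X' e r (j - P' (X' r) e j) + D' (X' r) (P' (X' r) e j)"
      unfolding P' using g(3) kn[of "Suc r" j e] kn[of r "j - P (X r) e j" e] D(2)[OF a(2)] X[OF a(2)] a j
      by (simp del: knap.simps)
  qed
qed


section \<open>The invariant over processed nodes\<close>

definition node_done :: "store \<Rightarrow> nat \<Rightarrow> bool" where
  "node_done s v \<longleftrightarrow> node_ok v (nats s ''l'' v) (\<lambda>u. nats s ''T'' (ix k v u)) (row s)
     (\<lambda>j. nats s ''r'' (ix k v j)) (\<lambda>j. nats s ''e'' (ix k v j)) (ptr s)"

text \<open>\<open>B\<close> is the set of nodes already processed, so the list of \<open>p\<close>
  is final once its children are in \<open>B\<close>. The zero cells of later nodes are the start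
  that \<open>runs_node\<close> asks for.\<close>

definition dp_inv :: "nat set \<Rightarrow> store \<Rightarrow> bool" where
  "dp_inv B s \<longleftrightarrow> (\<forall>v\<in>B. active v \<longrightarrow> node_done s v) \<and>
     (\<forall>p<n. topk (achs p \<inter> B) (list_of s p)) \<and>
     (\<forall>v<n. v \<notin> B \<longrightarrow> (\<forall>j\<le>k. nats s ''r'' (ix k v j) = 0))"

definition width :: "nat \<Rightarrow> nat" where "width v = min k (card (achs v))"

lemma length_list_of [simp]: "length (list_of s p) = nats s ''l'' p"
  by (simp add: list_of_def)

lemma topk_length: "topk A l \<Longrightarrow> finite A \<Longrightarrow> length l = min k (card A)"
  unfolding topk_def by (metis card_mono distinct_card min.absorb1 min.absorb2)

definition data_ok :: "store \<Rightarrow> bool" where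
  "data_ok s \<longleftrightarrow> input_ok s \<and> (\<forall>v<n. 0 < nats s ''a'' v \<longleftrightarrow> active v) \<and> (\<forall>v. nats s ''d'' v = card (ch v)) \<and>
     (\<forall>v<n. reals s ''w'' v = pw v \<and> reals s ''s'' v = ps v) \<and> topo (nats s ''q'')"

lemma data_okD:
  assumes "data_ok s"
  shows "input_ok s" "v < n \<Longrightarrow> 0 < nats s ''a'' v \<longleftrightarrow> active v" "nats s ''d'' v = card (ch v)"
    "v < n \<Longrightarrow> reals s ''w'' v = pw v" "v < n \<Longrightarrow> reals s ''s'' v = ps v" "topo (nats s ''q'')"
  using assms by (auto simp: data_ok_def)

lemma data_ok_frame:
  assumes "data_ok s" "frame c s s'"
    "{''n'', ''root'', ''parent'', ''k'', ''a'', ''d'', ''q''} \<inter> nwrites c = {}"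
    "{''weight'', ''eps'', ''w'', ''s''} \<inter> rwrites c = {}"
  shows "data_ok s'"
  using assms(1,3,4) unfolding data_ok_def input_ok_def
  by (simp add: frame_nats[OF assms(2)] frame_reals[OF assms(2)])

definition T_insert :: nat where
  "T_insert = maxcost insert_init + maxcost insert_final + for_cost (NCell ''l'' (N ''p'')) insert_body"

definition T_dp :: nat where
  "T_dp = maxcost dp_body + T_node + T_insert"

definition dp_time :: "nat \<Rightarrow> nat" where
  "dp_time v = T_dp * (1 + (if active v then (width v + 1)\<^sup>2 * (k + 1)\<^sup>2 else 0))"

lemma topo_new: "topo q \<Longrightarrow> i < n \<Longrightarrow> q i \<notin> q ` {..<i}"
proof
  assume q: "topo q" "i < n" "q i \<in> q ` {..<i}"
  then obtain a where a: "a < i" "q a = q i" by auto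
  then have "a = i" using q(1,2) by (intro inj_onD[of q "{..<n}" a i]) (simp_all add: topo_def)
  then show False using a by simp
qed

text \<open>The children of \<open>v\<close> precede it in the queue, so its list is complete.
  Finished nodes are undisturbed: rows are separate, and pointers are indexed by children, which
  have only one parent.\<close>

lemma runs_node_dp:
  assumes data: "data_ok s" and i: "i < n" "nats s ''v'' 0 = nats s ''q'' i"
    and inv: "dp_inv (nats s ''q'' ` {..<i}) s" and act: "active (nats s ''q'' i)"
  shows "runs node_table s (T_node * ((width (nats s ''q'' i) + 1) * (width (nats s ''q'' i) + 1) * ((k + 1) * (k + 1))))
    (\<lambda>s'. (\<forall>v\<in>nats s ''q'' ` {..<Suc i}. active v \<longrightarrow> node_done s' v) \<and>
      (\<forall>p. list_of s' p = list_of s p) \<and>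
      (\<forall>v<n. v \<notin> nats s ''q'' ` {..<Suc i} \<longrightarrow> (\<forall>j\<le>k. nats s' ''r'' (ix k v j) = 0)))"
proof -
  define q where "q = nats s ''q''"
  define v where "v = q i"
  define B where "B = q ` {..<i}"
  have tp: "topo q" using data_okD(6)[OF data] by (simp add: q_def)
  have vn: "v < n" using act active_lt by (simp add: v_def q_def)
  have vB: "v \<notin> B" using topo_new[OF tp i(1)] by (simp add: v_def B_def)
  have chB: "ch v \<subseteq> B" using tp i by (simp add: topo_def v_def B_def)
  have inv': "dp_inv B s" using inv by (simp add: B_def q_def)
  define m where "m = nats s ''l'' v"
  define X where "X = (\<lambda>u. nats s ''T'' (ix k v u))"
  have "achs v \<inter> B = achs v" using chB achs_subset by blast
  then have top: "topk (achs v) (map X [0..<m])"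
    using inv' vn unfolding dp_inv_def list_of_def m_def X_def by metis
  have mw: "m = width v" using topk_length[OF top] by (simp add: width_def)
  have mk: "m \<le> k" using mw by (simp add: width_def)
  have inj: "inj_on X {..<m}" using top by (simp add: topk_def distinct_map atLeast0LessThan)
  have Xa: "X u \<in> achs v" if "u < m" for u using top that by (auto simp: topk_def)
  have Xc: "X u \<in> ch v" if "u < m" for u using Xa[OF that] achs_subset by blast
  have Xv: "X u \<noteq> v" if "u < m" for u
  proof
    assume "X u = v"
    then show False using Xc[OF that] not_in_sub_ch[of v v] sub_self[OF vn] by simp
  qed
  note inp = input_okD[OF data_okD(1)[OF data]]
  have "runs node_table s (T_node * ((m + 1) * (m + 1) * ((k + 1) * (k + 1))))
    (\<lambda>s'. node_ok v m X (row s') (\<lambda>j. nats s' ''r'' (ix k v j)) (\<lambda>j. nats s' ''e'' (ix k v j)) (ptr s') \<and>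
       outside v s s' \<and> ptr_outside X m s s')"
  proof (rule runs_node[OF _ _ _ _ _ _ X_def _ mk inj Xv])
    show "nats s ''r'' (ix k v j) = 0" if "j \<le> k" for j
      using inv' vn vB that by (simp add: dp_inv_def)
    show "reals s ''s'' (X u) = ps (X u)" if "u < m" for u
      using data_okD(5)[OF data] ch_lt[OF Xc[OF that]] by simp
  qed (use i inp data_okD[OF data] vn in \<open>simp_all add: v_def q_def m_def\<close>)
  then show ?thesis
    unfolding q_def[symmetric] v_def[symmetric] mw[symmetric] image_lessThan_Suc B_def[symmetric]
  proof (rule runs_conseq)
    fix s' assume fr: "frame node_table s s'" and Q: "node_ok v m X (row s') (\<lambda>j. nats s' ''r'' (ix k v j)) (\<lambda>j. nats s' ''e'' (ix k v j)) (ptr s') \<and>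
       outside v s s' \<and> ptr_outside X m s s'"
    have eqs: "nats s' ''T'' = nats s ''T''" "nats s' ''l'' = nats s ''l''"
      by (simp_all add: frame_nats[OF fr] node_defs)
    have out: "outside v s s'" and pout: "ptr_outside X m s s'" using Q by auto
    have "node_done s' v" unfolding node_done_def using Q by (simp add: eqs m_def X_def)
    moreover have "node_done s' v'" if v': "v' \<in> B" "active v'" for v'
    proof -
      have v'n: "v' < n" and nv: "v' \<noteq> v" using v' active_lt vB by auto
      have t': "topk (achs v' \<inter> B) (list_of s v')" using inv' v'n by (simp add: dp_inv_def)
      then have l': "nats s ''l'' v' \<le> k" by (auto simp: topk_def)
      have X': "nats s ''T'' (ix k v' u) \<in> achs v' \<inter> B" if "u < nats s ''l'' v'" for u
        using t' that by (auto simp: topk_def list_of_def)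
      have ok: "node_done s v'" using inv' v' by (simp add: dp_inv_def)
      show ?thesis
        unfolding node_done_def eqs
      proof (rule node_ok_cong[OF ok[unfolded node_done_def]])
        show "row s' v' j = row s v' j" if "j \<le> k" for j by (rule outside_row[OF out nv that])
        show "row s' (nats s ''T'' (ix k v' u)) j = row s (nats s ''T'' (ix k v' u)) j" if "u < nats s ''l'' v'" "j \<le> k" for u j
          using X'[OF that(1)] vB by (intro outside_row[OF out _ that(2)]) auto
        show "nats s' ''r'' (ix k v' j) = nats s ''r'' (ix k v' j)" "nats s' ''e'' (ix k v' j) = nats s ''e'' (ix k v' j)" if "j \<le> k" for j
          using out that nv by (simp_all add: outside_def ix_eq_iff)
        show "ptr s' (nats s ''T'' (ix k v' u)) e j = ptr s (nats s ''T'' (ix k v' u)) e j" if "u < nats s ''l'' v'" "e \<le> nats s ''l'' v'" "j \<le> k" for u e j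
        proof -
          have "nats s ''T'' (ix k v' u) \<noteq> X u'" if "u' < m" for u'
            using X'[OF \<open>u < _\<close>] Xc[OF that] nv achs_subset[of v'] by (auto simp: ch_iff)
          then show ?thesis using pout that l' mk by (simp add: ptr_outside_def ptr_def ix_eq_iff)
        qed
      qed simp
    qed
    moreover have "nats s' ''r'' (ix k v' j) = 0" if "v' < n" "v' \<notin> insert v B" "j \<le> k" for v' j
      using out inv' that by (simp add: outside_def ix_eq_iff dp_inv_def)
    ultimately show "(\<forall>v\<in>insert v B. active v \<longrightarrow> node_done s' v) \<and> (\<forall>p. list_of s' p = list_of s p) \<and>
      (\<forall>v'<n. v' \<notin> insert v B \<longrightarrow> (\<forall>j\<le>k. nats s' ''r'' (ix k v' j) = 0))"
      by (auto simp: list_of_def eqs)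
  qed simp
qed

text \<open>Inserting \<open>v\<close> changes the child list of its parent; as the parent comes
  later, no finished node is affected.\<close>

lemma par_not_done:
  assumes tp: "topo q" and i: "i < n" and v: "q i \<noteq> rt"
  shows "par (q i) \<notin> q ` {..<Suc i}"
proof
  assume "par (q i) \<in> q ` {..<Suc i}"
  then obtain a where a: "a \<le> i" "q a = par (q i)" by (auto simp: less_Suc_eq_le)
  have "q i \<in> q ` {..<n}" using i by simp
  then have "q i < n" using tp by (auto simp: topo_def)
  then have "q i \<in> ch (q a)" using v a by (simp add: ch_iff)
  then have "q i \<in> q ` {..<a}" using tp a i unfolding topo_def by (meson le_less_trans subsetD)
  then obtain b where "b < a" "q b = q i" by auto
  then show False using tp a(1) i inj_onD[of q "{..<n}" b i] by (simp add: topo_def)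
qed

lemma runs_insert_dp:
  assumes data: "data_ok s" and i: "i < n" "nats s ''v'' 0 = nats s ''q'' i"
    and dn: "\<forall>v\<in>nats s ''q'' ` {..<Suc i}. active v \<longrightarrow> node_done s v"
    and lists: "\<forall>p<n. topk (achs p \<inter> nats s ''q'' ` {..<i}) (list_of s p)"
    and zero: "\<forall>v<n. v \<notin> nats s ''q'' ` {..<Suc i} \<longrightarrow> (\<forall>j\<le>k. nats s ''r'' (ix k v j) = 0)"
    and act: "active (nats s ''q'' i)" and nr: "nats s ''q'' i \<noteq> rt"
  shows "runs insert_prog s (T_insert * (k + 1)) (dp_inv (nats s ''q'' ` {..<Suc i}))"
proof -
  define q where "q = nats s ''q''"
  define v where "v = q i"
  define p where "p = par v"
  define B where "B = q ` {..<i}"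
  have tp: "topo q" using data_okD(6)[OF data] by (simp add: q_def)
  have vn: "v < n" using act active_lt by (simp add: v_def q_def)
  have pn: "p < n" using par_lt[OF vn] nr by (simp add: p_def v_def q_def)
  have vB: "v \<notin> B" using topo_new[OF tp i(1)] by (simp add: v_def B_def)
  have pB: "p \<notin> insert v B" using par_not_done[OF tp i(1)] nr by (simp add: p_def v_def q_def B_def image_lessThan_Suc)
  have va: "v \<in> achs p" using act nr vn by (simp add: achs_def ch_iff p_def v_def q_def)
  have va': "v \<notin> achs p'" if "p' \<noteq> p" for p' using that by (auto simp: achs_def ch_iff p_def)
  note inp = input_okD[OF data_okD(1)[OF data]]
  have tk: "topk (achs p' \<inter> B) (list_of s p')" if "p' < n" for p' using lists that by (simp add: B_def q_def)
  note tkp = tk[OF pn, unfolded topk_def]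
  have "runs insert_prog s (T_insert * (k + 1))
    (\<lambda>s'. \<exists>w. distinct w \<and> desc w \<and> set w = insert v (set (list_of s p)) \<and> list_of s' p = take k w \<and>
       (\<forall>p'. p' \<noteq> p \<longrightarrow> nats s' ''l'' p' = nats s ''l'' p') \<and>
       (\<forall>z. (\<forall>u\<le>k. z \<noteq> ix k p u) \<longrightarrow> nats s' ''T'' z = nats s ''T'' z))"
    unfolding T_insert_def
  proof (rule runs_insert[OF inp(3) _ _ refl refl])
    show "nats s ''v'' 0 = v" using i by (simp add: v_def q_def)
    show "nats s ''parent'' v = p" using inp(4)[OF vn] nr by (simp add: p_def v_def q_def)
    show "nats s ''l'' p \<le> k" "distinct (list_of s p)" "desc (list_of s p)" "v \<notin> set (list_of s p)"
      using tkp vB by auto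
    show "reals s ''s'' x = ps x" if "x \<in> insert v (set (list_of s p))" for x
    proof -
      have "x < n" using that tkp vn ch_lt by (auto simp: achs_def)
      then show ?thesis by (rule data_okD(5)[OF data])
    qed
  qed
  then show ?thesis
    unfolding q_def[symmetric] image_lessThan_Suc v_def[symmetric] B_def[symmetric]
  proof (rule runs_conseq)
    fix s' assume fr: "frame insert_prog s s'"
      and "\<exists>w. distinct w \<and> desc w \<and> set w = insert v (set (list_of s p)) \<and> list_of s' p = take k w \<and>
       (\<forall>p'. p' \<noteq> p \<longrightarrow> nats s' ''l'' p' = nats s ''l'' p') \<and>
       (\<forall>z. (\<forall>u\<le>k. z \<noteq> ix k p u) \<longrightarrow> nats s' ''T'' z = nats s ''T'' z)"
    then obtain w where w: "distinct w" "desc w" "set w = insert v (set (list_of s p))" "list_of s' p = take k w"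
      and l': "\<And>p'. p' \<noteq> p \<Longrightarrow> nats s' ''l'' p' = nats s ''l'' p'"
      and T': "\<And>z. (\<forall>u\<le>k. z \<noteq> ix k p u) \<Longrightarrow> nats s' ''T'' z = nats s ''T'' z" by blast
    have eqs: "row s' = row s" "ptr s' = ptr s" "nats s' ''r'' = nats s ''r''" "nats s' ''e'' = nats s ''e''"
      by (simp_all add: row_def ptr_def fun_eq_iff frame_nats[OF fr] frame_reals[OF fr] insert_defs)
    have Trow: "nats s' ''T'' (ix k p' u) = nats s ''T'' (ix k p' u)" if "p' \<noteq> p" "u \<le> k" for p' u
      using that by (intro T') (simp add: ix_eq_iff)
    have lk: "nats s ''l'' p' \<le> k" if "p' < n" for p' using tk[OF that] by (simp add: topk_def)
    have dn': "\<forall>v\<in>insert v B. active v \<longrightarrow> node_done s v" using dn by (simp add: image_lessThan_Suc q_def B_def v_def)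
    have "node_done s' v'" if v': "v' \<in> insert v B" "active v'" for v'
    proof -
      have np: "v' \<noteq> p" "v' < n" using v' pB active_lt by auto
      have "node_done s v'" using dn' v' by blast
      then show ?thesis
        unfolding node_done_def eqs l'[OF np(1)]
        by (rule node_ok_cong) (use Trow[OF np(1)] lk[OF np(2)] in auto)
    qed
    moreover have "topk (achs p' \<inter> insert v B) (list_of s' p')" if p': "p' < n" for p'
    proof (cases "p' = p")
      case True
      have "topk (insert v (achs p \<inter> B)) (take k w)"
        by (rule topk_insert[OF tk[OF pn] _ w(1,3,2)]) (use vB in auto)
      then show ?thesis using True w(4) va by simp
    next
      case False
      have "list_of s' p' = list_of s p'" using Trow[OF False] lk[OF p'] l'[OF False] by (simp add: list_of_def)
      then show ?thesis using tk[OF p'] va'[OF False] by simp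
    qed
    moreover have "\<forall>v'<n. v' \<notin> insert v B \<longrightarrow> (\<forall>j\<le>k. nats s' ''r'' (ix k v' j) = 0)"
      using zero unfolding eqs by (simp add: image_lessThan_Suc q_def B_def v_def)
    ultimately show "dp_inv (insert v B) s'" by (simp add: dp_inv_def)
  qed simp
qed

lemma runs_dp_step:
  assumes data: "data_ok s" and i: "i < n" "nats s ''i'' 0 = i" and inv: "dp_inv (nats s ''q'' ` {..<i}) s"
  shows "runs dp_body s (dp_time (nats s ''q'' i)) (\<lambda>s'. dp_inv (nats s ''q'' ` {..<Suc i}) s')"
proof -
  define q where "q = nats s ''q''"
  define v where "v = q i"
  have tp: "topo q" using data_okD(6)[OF data] by (simp add: q_def)
  have "v \<in> q ` {..<n}" using i by (simp add: v_def)
  then have vn: "v < n" using tp by (auto simp: topo_def)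
  define s1 where "s1 = upn s ''v'' 0 v"
  have data1: "data_ok s1" using data by (simp add: data_ok_def input_ok_def s1_def)
  have inv1: "dp_inv (q ` {..<i}) s1" using inv
    by (simp add: dp_inv_def node_done_def s1_def q_def list_of_def row_def[abs_def] ptr_def[abs_def])
  have q1: "nats s1 ''q'' = q" by (simp add: s1_def q_def)
  let ?x = "(width v + 1) * (width v + 1) * ((k + 1) * (k + 1))"
  let ?t = "if active v then T_node * ?x + (T_insert * (k + 1) + 1) else 1"
  let ?ib = "If (Neq (N ''v'') (N ''root'')) Skip insert_prog"
  let ?bt = "1 + bcost (Neq (N ''v'') (N ''root''))"
  have "runs dp_body s (maxcost (nset ''v'' (NCell ''q'' (N ''i''))) +
     (1 + bcost (NLess (NConst 0) (NCell ''a'' (N ''v''))) + (?t + ?bt))) (dp_inv (q ` {..<Suc i}))"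
    unfolding dp_body_def
  proof (rule runs_Seq)
    show "runs (nset ''v'' (NCell ''q'' (N ''i''))) s (maxcost (nset ''v'' (NCell ''q'' (N ''i'')))) (\<lambda>s. s = s1)"
      by (rule runs_loopfree) (simp_all add: i s1_def v_def q_def)
    fix s' assume "s' = s1"
    show "runs (If (NLess (NConst 0) (NCell ''a'' (N ''v''))) (node_table ;; ?ib) Skip) s'
       (1 + bcost (NLess (NConst 0) (NCell ''a'' (N ''v''))) + (?t + ?bt)) (dp_inv (q ` {..<Suc i}))"
      unfolding \<open>s' = s1\<close>
    proof (rule runs_If)
      assume "bval s1 (NLess (NConst 0) (NCell ''a'' (N ''v'')))"
      then have act: "active v" using data_okD(2)[OF data1 vn] by (simp add: s1_def)
      show "runs (node_table ;; ?ib) s1 (?t + ?bt) (dp_inv (q ` {..<Suc i}))"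
      proof (rule runs_Seq)
        show "runs node_table s1 (T_node * ?x) (\<lambda>s'. (\<forall>v\<in>q ` {..<Suc i}. active v \<longrightarrow> node_done s' v) \<and>
          (\<forall>p. list_of s' p = list_of s1 p) \<and>
          (\<forall>v<n. v \<notin> q ` {..<Suc i} \<longrightarrow> (\<forall>j\<le>k. nats s' ''r'' (ix k v j) = 0)))"
          using runs_node_dp[OF data1 i(1), unfolded q1, folded v_def] inv1 act by (simp add: s1_def)
        fix s2 assume fr: "frame node_table s1 s2" and Q: "(\<forall>v\<in>q ` {..<Suc i}. active v \<longrightarrow> node_done s2 v) \<and>
          (\<forall>p. list_of s2 p = list_of s1 p) \<and>
          (\<forall>v<n. v \<notin> q ` {..<Suc i} \<longrightarrow> (\<forall>j\<le>k. nats s2 ''r'' (ix k v j) = 0))"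
        have data2: "data_ok s2" by (rule data_ok_frame[OF data1 fr]) (simp_all add: node_defs)
        have f2: "nats s2 ''v'' 0 = v" "nats s2 ''q'' = q"
          using q1 by (simp_all add: frame_nats[OF fr] node_defs s1_def)
        have lists: "\<forall>p<n. topk (achs p \<inter> q ` {..<i}) (list_of s2 p)" using inv1 Q by (simp add: dp_inv_def)
        show "runs ?ib s2 (?bt + (T_insert * (k + 1) + 1)) (dp_inv (q ` {..<Suc i}))"
        proof (rule runs_If)
          assume "bval s2 (Neq (N ''v'') (N ''root''))"
          then have "v = rt" using f2 input_okD(2)[OF data_okD(1)[OF data2]] by simp
          then have "achs p \<inter> q ` {..<Suc i} = achs p \<inter> q ` {..<i}" for p
            using root_not_ch by (auto simp: image_lessThan_Suc v_def[symmetric] achs_def)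
          then have "dp_inv (q ` {..<Suc i}) s2" using Q lists by (simp add: dp_inv_def)
          then show "runs Skip s2 (T_insert * (k + 1) + 1) (dp_inv (q ` {..<Suc i}))"
            by (intro runs_loopfree) auto
        next
          assume "\<not> bval s2 (Neq (N ''v'') (N ''root''))"
          then have "v \<noteq> rt" using f2 input_okD(2)[OF data_okD(1)[OF data2]] by simp
          then have "runs insert_prog s2 (T_insert * (k + 1)) (dp_inv (q ` {..<Suc i}))"
            using runs_insert_dp[OF data2 i(1), unfolded f2(2), folded v_def] f2(1) Q lists act by blast
          then show "runs insert_prog s2 (T_insert * (k + 1) + 1) (dp_inv (q ` {..<Suc i}))"
            by (rule runs_conseq) simp_all
        qed simp
      qed (use act in simp)
    next
      assume "\<not> bval s1 (NLess (NConst 0) (NCell ''a'' (N ''v'')))"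
      then have act: "\<not> active v" using data_okD(2)[OF data1 vn] by (simp add: s1_def)
      then have "achs p \<inter> q ` {..<Suc i} = achs p \<inter> q ` {..<i}" for p
        by (auto simp: image_lessThan_Suc v_def[symmetric] achs_def)
      then have "dp_inv (q ` {..<Suc i}) s1" using inv1 act
        by (auto simp: dp_inv_def image_lessThan_Suc v_def[symmetric])
      then show "runs Skip s1 (?t + ?bt) (dp_inv (q ` {..<Suc i}))"
        using act by (intro runs_loopfree) auto
    qed simp
  qed simp
  then show ?thesis
    unfolding q_def[symmetric] v_def[symmetric]
  proof (rule runs_conseq)
    let ?c = "maxcost (nset ''v'' (NCell ''q'' (N ''i''))) + (1 + bcost (NLess (NConst 0) (NCell ''a'' (N ''v''))) + (1 + ?bt))"
    have c: "?c \<le> maxcost dp_body" by (simp add: dp_body_def)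
    show "maxcost (nset ''v'' (NCell ''q'' (N ''i''))) +
     (1 + bcost (NLess (NConst 0) (NCell ''a'' (N ''v''))) + (?t + ?bt)) \<le> dp_time v"
    proof (cases "active v")
      case False
      then show ?thesis using c by (simp add: dp_time_def T_dp_def)
    next
      case True
      define x where "x = ?x"
      have x: "k + 1 \<le> x" "1 \<le> x" by (simp_all add: x_def)
      have "T_insert * (k + 1) \<le> T_insert * x" using x(1) by (rule mult_le_mono2)
      moreover have "dp_time v = T_dp + (maxcost dp_body * x + T_node * x + T_insert * x)"
        using True by (simp add: dp_time_def T_dp_def x_def add_mult_distrib[symmetric] distrib_left[symmetric] power2_eq_square)
      moreover have "1 * maxcost dp_body \<le> x * maxcost dp_body" using x(2) by (rule mult_le_mono1)
      ultimately show ?thesis using True c x_def[symmetric] unfolding T_dp_def by simp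
    qed
  qed simp
qed

lemma runs_dp:
  assumes data: "data_ok s0" and z: "\<And>p. nats s0 ''l'' p = 0" "\<And>z. nats s0 ''r'' z = 0"
  shows "runs (FOR ''i'' (N ''n'') dp_body) s0 ((\<Sum>v<n. dp_time v) + 12 * (n + 1))
    (\<lambda>s. \<forall>v. active v \<longrightarrow> node_done s v \<and> topk (achs v) (list_of s v))"
proof -
  define q where "q = nats s0 ''q''"
  have tp: "topo q" using data_okD(6)[OF data] by (simp add: q_def)
  have "runs (FOR ''i'' (N ''n'') dp_body) s0 ((\<Sum>v<n. dp_time v) + 12 * (n + 1)) (\<lambda>s. dp_inv (q ` {..<n}) s)"
  proof (rule runs_FOR[where I = "\<lambda>i s. dp_inv (q ` {..<i}) s" and t = "\<lambda>i. dp_time (q i)"])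
    show "dp_inv (q ` {..<0}) s0" using z by (simp add: dp_inv_def topk_def list_of_def)
    show "dp_inv (q ` {..<i}) (upn s ''i'' 0 a)" if "dp_inv (q ` {..<i}) s" for i s a
      using that by (simp add: dp_inv_def node_done_def list_of_def row_def[abs_def] ptr_def[abs_def])
    fix i s assume fr: "frame (FOR ''i'' (N ''n'') dp_body) s0 s"
    have data': "data_ok s" by (rule data_ok_frame[OF data fr]) (simp_all add: dp_body_def insert_defs node_defs)
    have qs: "nats s ''q'' = q" by (simp add: q_def frame_nats[OF fr] dp_body_def insert_defs node_defs)
    show "nval s (N ''n'') = n" using input_okD(1)[OF data_okD(1)[OF data']] by simp
    assume "i < n" "dp_inv (q ` {..<i}) s" "nats s ''i'' 0 = i"
    then show "runs dp_body s (dp_time (q i)) (dp_inv (q ` {..<Suc i}))"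
      using runs_dp_step[OF data', unfolded qs] by blast
  next
    have "(\<Sum>i<n. dp_time (q i)) = (\<Sum>v<n. dp_time v)"
      using tp sum.reindex[of q "{..<n}" dp_time] by (simp add: topo_def o_def)
    then show "(\<Sum>i<n. dp_time (q i)) + (10 + ncost (N ''n'')) * (n + 1) \<le> (\<Sum>v<n. dp_time v) + 12 * (n + 1)"
      by simp
  qed (simp add: dp_body_def insert_defs node_defs)
  then show ?thesis
  proof (rule runs_conseq)
    fix s assume I: "dp_inv (q ` {..<n}) s"
    have qn: "q ` {..<n} = {..<n}" using tp by (simp add: topo_def)
    have "achs v \<inter> {..<n} = achs v" for v using achs_subset ch_lt by blast
    then show "\<forall>v. active v \<longrightarrow> node_done s v \<and> topk (achs v) (list_of s v)"
      using I unfolding dp_inv_def qn using active_lt by auto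
  qed simp
qed

end

section \<open>Backtracking\<close>

definition "back_init = NAssign ''o'' (N ''root'') (NConst 1) ;; NAssign ''J'' (N ''root'') (N ''k'') ;; nset ''c'' (NConst 1)"

text \<open>\<open>o\<close> and \<open>x\<close> mark the sets \<open>own\<close> and \<open>ex\<close>, \<open>J\<close> is the number of nodes granted to a subtree, \<open>O(p)\<close> the number
  of children of \<open>p\<close> in its \<open>other\<close> node, and \<open>c\<close> the size of the summary tree.\<close>

definition "expand_init =
   nset ''m'' (NSub (NCell ''r'' (IX (N ''v'') (NCell ''J'' (N ''v'')))) (NConst 1)) ;;
   nset ''E'' (NCell ''e'' (IX (N ''v'') (NCell ''J'' (N ''v'')))) ;;
   If (NLess (N ''E'') (N ''m'')) (nset ''C'' (NSub (N ''m'') (NConst 1))) (nset ''C'' (N ''m'')) ;;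
   If (NLess (N ''C'') (NCell ''d'' (N ''v''))) (nset ''B'' (NConst 2)) (nset ''B'' (NConst 1)) ;;
   NAssign ''x'' (N ''v'') (NConst 1) ;;
   NAssign ''O'' (N ''v'') (NSub (NCell ''d'' (N ''v'')) (N ''C'')) ;;
   nset ''c'' (NAdd (N ''c'') (NAdd (N ''C'') (NSub (N ''B'') (NConst 1)))) ;;
   nset ''u'' (NSub (NCell ''J'' (N ''v'')) (N ''B''))"

text \<open>Ranks are served from the last to the first, since \<open>P\<close> at rank
  \<open>b\<close> gives the share of that rank in the total left for the ranks up to
  \<open>b\<close>.\<close>

definition "alloc_body =
   nset ''b'' (NSub (NSub (N ''m'') (NConst 1)) (N ''R'')) ;;
   If (Neq (N ''b'') (N ''E'')) Skip
     (nset ''X'' (NCell ''T'' (IX (N ''v'') (N ''b''))) ;;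
      NAssign ''o'' (N ''X'') (NConst 1) ;;
      NAssign ''J'' (N ''X'') (NCell ''P'' (IX (IX (N ''X'') (N ''E'')) (N ''u''))) ;;
      nset ''u'' (NSub (N ''u'') (NCell ''J'' (N ''X''))))"

definition "expand_prog = expand_init ;; FOR ''R'' (N ''m'') alloc_body"

definition "back_body =
   nset ''v'' (NCell ''q'' (NSub (NSub (N ''n'') (NConst 1)) (N ''i''))) ;;
   If (BAnd (BAnd (NLess (NConst 0) (NCell ''o'' (N ''v''))) (NLess (NConst 0) (NCell ''a'' (N ''v''))))
            (NLess (NConst 0) (NCell ''r'' (IX (N ''v'') (NCell ''J'' (N ''v''))))))
     expand_prog Skip"

lemmas back_defs = expand_init_def alloc_body_def expand_prog_def back_body_def

context summary_dp begin

text \<open>\<open>A\<close> contains the ranks already served. The remainder \<open>u\<close>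
  belongs to the \<open>knap\<close> problem of the ranks below \<open>t\<close>, which is trivial
  at \<open>t = 0\<close>.\<close>

definition alloc_inv :: "(nat \<Rightarrow> nat \<Rightarrow> real) \<Rightarrow> (nat \<Rightarrow> nat) \<Rightarrow> nat \<Rightarrow> nat \<Rightarrow> nat \<Rightarrow> store \<Rightarrow> nat \<Rightarrow> store \<Rightarrow> bool" where
  "alloc_inv D X e r t0 s0 t s \<longleftrightarrow> (let A = included e r \<inter> {t..} in
     inc e t \<le> nats s ''u'' 0 \<and> (\<Sum>u\<in>A. nats s ''J'' (X u)) + nats s ''u'' 0 = t0 \<and>
     knap D X e r t0 = knap D X e t (nats s ''u'' 0) + (\<Sum>u\<in>A. D (X u) (nats s ''J'' (X u))) \<and>
     (\<forall>u\<in>A. 1 \<le> nats s ''J'' (X u)) \<and>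
     (\<forall>x. nats s ''o'' x = (if x \<in> X ` A then 1 else nats s0 ''o'' x)) \<and>
     (\<forall>x. x \<notin> X ` A \<longrightarrow> nats s ''J'' x = nats s0 ''J'' x))"

lemma included_step:
  "t < r \<Longrightarrow> included e r \<inter> {t..} = (if t = e then included e r \<inter> {Suc t..} else insert t (included e r \<inter> {Suc t..}))"
  by (auto simp: included_def)

lemma runs_alloc:
  assumes st: "nats s0 ''k'' 0 = k" "nats s0 ''v'' 0 = v" "nats s0 ''m'' 0 = r" "nats s0 ''E'' 0 = e" "nats s0 ''u'' 0 = t0" "t0 \<le> k"
    and X: "X = (\<lambda>u. nats s0 ''T'' (ix k v u))" "inj_on X {..<m}" "r \<le> m" "e \<le> m" and t0: "inc e r \<le> t0"
    and P: "\<And>u j. u < r \<Longrightarrow> u \<noteq> e \<Longrightarrow> inc e u < j \<Longrightarrow> j \<le> k \<Longrightarrow> good_ptr D X e u j (ptr s0 (X u) e j)"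
  shows "runs (FOR ''R'' (N ''m'') alloc_body) s0 (for_cost (N ''m'') alloc_body * (r + 1))
    (\<lambda>s. alloc_inv D X e r t0 s0 0 s)"
proof -
  have "runs (FOR ''R'' (N ''m'') alloc_body) s0 (for_cost (N ''m'') alloc_body * (r + 1))
    (\<lambda>s. alloc_inv D X e r t0 s0 (r - r) s)"
  proof (rule runs_FOR_loopfree[where I = "\<lambda>i. alloc_inv D X e r t0 s0 (r - i)" and m = r])
    have "included e r \<inter> {r..} = {}" by (auto simp: included_def)
    then show "alloc_inv D X e r t0 s0 (r - 0) s0" using st t0 by (simp add: alloc_inv_def)
    show "alloc_inv D X e r t0 s0 (r - i) (upn s ''R'' 0 a)" if "alloc_inv D X e r t0 s0 (r - i) s" for i s a
      using that by (simp add: alloc_inv_def)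
    fix i s assume fr: "frame (FOR ''R'' (N ''m'') alloc_body) s0 s"
    have fs: "nats s ''k'' 0 = k" "nats s ''v'' 0 = v" "nats s ''m'' 0 = r" "nats s ''E'' 0 = e" "nats s ''T'' = nats s0 ''T''" "nats s ''P'' = nats s0 ''P''"
      using st by (simp_all add: frame_nats[OF fr] alloc_body_def)
    then show "nval s (N ''m'') = r" by simp
    assume i: "i < r" and I: "alloc_inv D X e r t0 s0 (r - i) s" and R: "nats s ''R'' 0 = i"
    define t where "t = r - Suc i"
    have t: "r - i = Suc t" "t < r" using i by (auto simp: t_def)
    define u where "u = nats s ''u'' 0"
    define A where "A = included e r \<inter> {Suc t..}"
    have finA: "finite A" by (simp add: A_def)
    have tA: "t \<notin> A" by (simp add: A_def)
    have inv: "inc e (Suc t) \<le> u" "(\<Sum>w\<in>A. nats s ''J'' (X w)) + u = t0"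
      "knap D X e r t0 = knap D X e (Suc t) u + (\<Sum>w\<in>A. D (X w) (nats s ''J'' (X w)))"
      "\<forall>w\<in>A. 1 \<le> nats s ''J'' (X w)"
      "\<forall>x. nats s ''o'' x = (if x \<in> X ` A then 1 else nats s0 ''o'' x)"
      "\<forall>x. x \<notin> X ` A \<longrightarrow> nats s ''J'' x = nats s0 ''J'' x"
      using I unfolding alloc_inv_def t(1) A_def u_def Let_def by blast+
    have uk: "u \<le> k" using inv(2) st(6) by simp
    show "alloc_inv D X e r t0 s0 (r - Suc i) (sem alloc_body s)"
    proof (cases "t = e")
      case True
      have sem: "sem alloc_body s = upn s ''b'' 0 t" using True by (simp add: alloc_body_def fs R t_def)
      have eA: "included e r \<inter> {t..} = A" using included_step[OF t(2), of e] True by (simp add: A_def)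
      have "inc e t \<le> u" "knap D X e (Suc t) u = knap D X e t u" using inv(1) True by (simp_all add: inc_Suc)
      then show ?thesis
        unfolding sem alloc_inv_def t_def[symmetric] eA Let_def using inv(2-6) by (simp add: u_def[symmetric])
    next
      case False
      define p where "p = ptr s0 (X t) e u"
      define s2 where "s2 = upn (upn (upn (upn (upn s ''b'' 0 t) ''X'' 0 (X t)) ''o'' (X t) 1) ''J'' (X t) p) ''u'' 0 (u - p)"
      have sem: "sem alloc_body s = s2"
        using False by (simp add: alloc_body_def fs R t_def s2_def p_def ptr_def X(1) u_def)
      have "inc e t < u" using inv(1) False by (simp add: inc_Suc)
      then have "good_ptr D X e t u p" unfolding p_def using False t(2) uk by (intro P) auto
      then have p: "1 \<le> p" "p \<le> u - inc e t" "knap D X e (Suc t) u = knap D X e t (u - p) + D (X t) p"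
        by (auto simp: good_ptr_def)
      have Xt: "X w \<noteq> X t" if "w \<in> A" for w
        using that t(2) inj_onD[OF X(2), of w t] tA X(3) by (auto simp: A_def included_def)
      have J2: "nats s2 ''J'' (X w) = nats s ''J'' (X w)" if "w \<in> A" for w using Xt[OF that] by (simp add: s2_def)
      have o2: "nats s2 ''o'' x = (if x \<in> X ` insert t A then 1 else nats s0 ''o'' x)" for x
        using inv(5) by (simp add: s2_def)
      have Jo: "nats s2 ''J'' x = nats s0 ''J'' x" if "x \<notin> X ` insert t A" for x
        using inv(6) that by (simp add: s2_def)
      have sums: "(\<Sum>w\<in>insert t A. nats s2 ''J'' (X w)) = p + (\<Sum>w\<in>A. nats s ''J'' (X w))"
        "(\<Sum>w\<in>insert t A. D (X w) (nats s2 ''J'' (X w))) = D (X t) p + (\<Sum>w\<in>A. D (X w) (nats s ''J'' (X w)))"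
        using tA finA J2 by (simp_all add: s2_def[THEN arg_cong, of "\<lambda>s. nats s ''J'' (X t)"])
      have u2: "nats s2 ''u'' 0 = u - p" by (simp add: s2_def)
      have Jt: "nats s2 ''J'' (X t) = p" by (simp add: s2_def)
      have eA: "included e r \<inter> {t..} = insert t A" using included_step[OF t(2), of e] False by (simp add: A_def)
      show ?thesis
        unfolding sem alloc_inv_def t_def[symmetric] eA Let_def u2 sums
        using p inv(1-4) \<open>inc e t < u\<close> J2 Jt o2 Jo by (auto simp del: knap.simps)
    qed
  qed (simp_all add: alloc_body_def)
  then show ?thesis by simp
qed

definition T_expand :: nat where
  "T_expand = maxcost expand_init + for_cost (N ''m'') alloc_body"

lemma runs_expand:
  assumes data: "data_ok s" and v: "nats s ''v'' 0 = v" "v < n"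
    and dn: "node_done s v" and top: "topk (achs v) (list_of s v)"
    and j: "nats s ''J'' v = j" "j \<le> k" and r: "nats s ''r'' (ix k v j) \<noteq> 0"
  shows "runs expand_prog s (T_expand * (k + 1))
    (\<lambda>s'. \<exists>I b. option_of v j I b \<and> row s v j = optval (row s) v I b \<and>
       (\<forall>x. nats s' ''o'' x = (if x \<in> I then 1 else nats s ''o'' x)) \<and>
       (\<forall>x. nats s' ''J'' x = (if x \<in> I then b x else nats s ''J'' x)) \<and>
       nats s' ''x'' = (nats s ''x'')(v := 1) \<and> nats s' ''O'' = (nats s ''O'')(v := card (ch v) - card I) \<and>
       nats s' ''c'' 0 = nats s ''c'' 0 + card I + (if I = ch v then 0 else 1))" (is "runs _ _ _ ?Q")
proof -
  define m where "m = nats s ''l'' v"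
  define X where "X = (\<lambda>u. nats s ''T'' (ix k v u))"
  define e where "e = nats s ''e'' (ix k v j)"
  have ok: "node_ok v m X (row s) (\<lambda>j. nats s ''r'' (ix k v j)) (\<lambda>j. nats s ''e'' (ix k v j)) (ptr s)"
    using dn by (simp add: node_done_def m_def X_def)
  obtain r' where r': "r' \<le> m" "nats s ''r'' (ix k v j) = Suc r'" "e \<le> m" "base v (inc e r') + inc e r' \<le> j"
    "row s v j = cand (row s) X v e r' j"
    using ok[unfolded node_ok_def, rule_format, OF j(2)] r unfolding e_def by auto
  have top': "topk (achs v) (map X [0..<m])" using top by (simp add: list_of_def m_def X_def)
  have mk: "m \<le> k" using top' by (simp add: topk_def)
  have inj: "inj_on X {..<m}" using top' by (simp add: topk_def distinct_map atLeast0LessThan)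
  have inji: "inj_on X (included e r')" using inj by (rule inj_on_subset) (use r' in \<open>auto simp: included_def\<close>)
  define I where "I = X ` included e r'"
  have Ia: "I \<subseteq> achs v" using top' r' by (auto simp: I_def topk_def included_def)
  have cI: "card I = inc e r'" using card_image[OF inji] card_included by (simp add: I_def)
  have Ich: "I \<subseteq> ch v" using Ia achs_subset by blast
  have Ieq: "I = ch v \<longleftrightarrow> \<not> inc e r' < card (ch v)"
    using card_subset_eq[OF finite_ch Ich] card_mono[OF finite_ch Ich] cI by auto
  note inp = input_okD[OF data_okD(1)[OF data]]
  define t0 where "t0 = j - base v (inc e r')"
  define s1 where "s1 = sem expand_init s"
  have ince: "(if e < r' then r' - Suc 0 else r') = inc e r'" by (simp add: inc_def)
  have s1: "nats s1 = (nats s)(''m'' := (nats s ''m'')(0 := r'), ''E'' := (nats s ''E'')(0 := e), ''C'' := (nats s ''C'')(0 := inc e r'),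
     ''B'' := (nats s ''B'')(0 := base v (inc e r')), ''x'' := (nats s ''x'')(v := 1), ''O'' := (nats s ''O'')(v := card (ch v) - inc e r'),
     ''c'' := (nats s ''c'')(0 := nats s ''c'' 0 + (inc e r' + (base v (inc e r') - 1))), ''u'' := (nats s ''u'')(0 := t0))"
    using r'(2) by (cases "e < r'"; cases "inc e r' < card (ch v)")
      (simp_all add: s1_def expand_init_def v j inp data_okD[OF data] e_def[symmetric] inc_def base_def t0_def fun_eq_iff)
  have alloc: "runs (FOR ''R'' (N ''m'') alloc_body) s1 (for_cost (N ''m'') alloc_body * (r' + 1)) (alloc_inv (row s) X e r' t0 s1 0)"
  proof (rule runs_alloc[where v = v and m = m])
    show "good_ptr (row s) X e u i (ptr s1 (X u) e i)" if "u < r'" "u \<noteq> e" "inc e u < i" "i \<le> k" for u i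
    proof -
      have "ptr s1 (X u) e i = ptr s (X u) e i" by (simp add: ptr_def s1)
      then show ?thesis using ok[unfolded node_ok_def, rule_format, OF that(4)] r' that unfolding good_ptr_def by auto
    qed
  qed (use r' inj inp j v in \<open>simp_all add: s1 X_def t0_def\<close>)
  have main: "?Q s'" if inv: "alloc_inv (row s) X e r' t0 s1 0 s'" and fr: "frame (FOR ''R'' (N ''m'') alloc_body) s1 s'" for s'
  proof -
    have A: "included e r' \<inter> {0..} = included e r'" by auto
    define u where "u = nats s' ''u'' 0"
    have inv': "(\<Sum>w\<in>included e r'. nats s' ''J'' (X w)) + u = t0"
      "knap (row s) X e r' t0 = (\<Sum>w\<in>included e r'. row s (X w) (nats s' ''J'' (X w)))"
      "\<forall>w\<in>included e r'. 1 \<le> nats s' ''J'' (X w)"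
      "\<And>x. nats s' ''o'' x = (if x \<in> I then 1 else nats s1 ''o'' x)"
      "\<And>x. x \<notin> I \<Longrightarrow> nats s' ''J'' x = nats s1 ''J'' x"
      using inv unfolding alloc_inv_def Let_def A I_def u_def[symmetric] by simp_all
    define b where "b = nats s' ''J''"
    have sumI: "(\<Sum>x\<in>I. f x) = (\<Sum>w\<in>included e r'. f (X w))" for f :: "nat \<Rightarrow> 'z::comm_monoid_add"
      unfolding I_def using sum.reindex[OF inji, of f] by simp
    have cost: "optcost v I b \<le> j"
      using inv'(1) r'(4) Ieq unfolding optcost_def sumI[of b] by (auto simp: b_def t0_def base_def)
    have opt: "option_of v j I b"
      using Ia cost inv'(3) by (auto simp: option_of_def b_def I_def)
    have val: "row s v j = optval (row s) v I b"
      unfolding r'(5) cand_def optval_def sumI t0_def[symmetric] inv'(2) b_def by (simp only: sumI)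
    have fs: "nats s' ''x'' = (nats s ''x'')(v := 1)" "nats s' ''O'' = (nats s ''O'')(v := card (ch v) - card I)"
      "nats s' ''c'' 0 = nats s ''c'' 0 + card I + (if I = ch v then 0 else 1)"
      by (simp_all add: frame_nats[OF fr] alloc_body_def s1 cI Ieq base_def)
    show ?thesis
      using opt val fs inv'(4,5) by (intro exI[of _ I] exI[of _ b]) (simp add: b_def s1)
  qed
  have "runs expand_prog s (maxcost expand_init + for_cost (N ''m'') alloc_body * (r' + 1)) ?Q"
    unfolding expand_prog_def
  proof (rule runs_Seq)
    show "runs expand_init s (maxcost expand_init) (\<lambda>s. s = s1)"
      by (rule runs_loopfree) (simp_all add: expand_init_def s1_def)
    show "runs (FOR ''R'' (N ''m'') alloc_body) s' (for_cost (N ''m'') alloc_body * (r' + 1)) ?Q" if "s' = s1" for s'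
      unfolding that using alloc by (rule runs_conseq) (use main in auto)
  qed simp
  then show ?thesis
  proof (rule runs_conseq)
    have "maxcost expand_init * 1 \<le> maxcost expand_init * (k + 1)"
      "for_cost (N ''m'') alloc_body * (r' + 1) \<le> for_cost (N ''m'') alloc_body * (k + 1)"
      using r'(1) mk by (intro mult_le_mono2; simp)+
    then show "maxcost expand_init + for_cost (N ''m'') alloc_body * (r' + 1) \<le> T_expand * (k + 1)"
      by (simp only: T_expand_def add_mult_distrib)
  qed
qed

definition exset :: "store \<Rightarrow> nat set" where "exset s = {v. v < n \<and> 0 < nats s ''x'' v}"
definition ownset :: "store \<Rightarrow> nat set" where "ownset s = {v. v < n \<and> 0 < nats s ''o'' v}"

definition others_ok :: "store \<Rightarrow> bool" where
  "others_ok s \<longleftrightarrow> (\<forall>p\<in>exset s. nats s ''O'' p = card (ch p - ownset s))"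

text \<open>The mixed value equals the entry of the root throughout. The mixed count may fall below
  \<open>k\<close>, as options need not use up their budgets; this is why a refinement
  follows.\<close>

definition back_inv :: "nat set \<Rightarrow> store \<Rightarrow> bool" where
  "back_inv B s \<longleftrightarrow> config (exset s) (ownset s) \<and> exset s \<subseteq> B \<and>
     (\<forall>v\<in>ownset s - B. 1 \<le> nats s ''J'' v \<and> nats s ''J'' v \<le> k) \<and>
     mixed_value (row s) B (exset s) (ownset s) (nats s ''J'') = DX (row s) rt k \<and>
     mixed_count B (exset s) (ownset s) (nats s ''J'') \<le> k \<and>
     nats s ''c'' 0 = config_count (exset s) (ownset s) \<and> others_ok s"

definition dp_done :: "store \<Rightarrow> bool" where
  "dp_done s \<longleftrightarrow> data_ok s \<and> (\<forall>v. active v \<longrightarrow> node_done s v \<and> topk (achs v) (list_of s v))"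

lemma dp_done_frame:
  assumes "dp_done s" "frame c s s'"
    "{''n'', ''root'', ''parent'', ''k'', ''a'', ''d'', ''q'', ''l'', ''T'', ''r'', ''e'', ''P''} \<inter> nwrites c = {}"
    "{''weight'', ''eps'', ''w'', ''s'', ''D''} \<inter> rwrites c = {}"
  shows "dp_done s'" "row s' = row s"
proof -
  have "data_ok s'" by (rule data_ok_frame[OF _ assms(2)]) (use assms in \<open>auto simp: dp_done_def\<close>)
  moreover show "row s' = row s" using assms(4) by (simp add: row_def fun_eq_iff frame_reals[OF assms(2)])
  moreover have "ptr s' = ptr s" using assms(3) by (simp add: ptr_def fun_eq_iff frame_nats[OF assms(2)])
  ultimately show "dp_done s'" using assms(1,3)
    by (simp add: dp_done_def node_done_def list_of_def frame_nats[OF assms(2)])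
qed

definition back_time :: "nat \<Rightarrow> nat" where
  "back_time v = maxcost back_body + 1 + (if active v then T_expand * (k + 1) else 0)"

text \<open>Either \<open>v\<close> is not in \<open>own\<close>, or it is inactive, or its entry
  was attained by collapsing; in the last two cases the value it stands for is already that of its
  collapsed subtree.\<close>

lemma back_step_skip:
  assumes s: "dp_done s" and v: "v < n" "v \<notin> B" and inv: "back_inv B s"
    and skip: "\<not> (0 < nats s ''o'' v \<and> active v \<and> 0 < nats s ''r'' (ix k v (nats s ''J'' v)))"
  shows "back_inv (insert v B) s"
proof (cases "v \<in> ownset s")
  case False
  then show ?thesis using inv unfolding back_inv_def mixed_skip[OF False] by auto
next
  case True
  have cf: "config (exset s) (ownset s)" and ex: "exset s \<subseteq> B" and J: "1 \<le> nats s ''J'' v" "nats s ''J'' v \<le> k"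
    using inv True v by (auto simp: back_inv_def)
  have "DX (row s) v (nats s ''J'' v) = plogp (ps v)"
  proof (cases "active v")
    case act: True
    then have "nats s ''r'' (ix k v (nats s ''J'' v)) = 0" using skip True by (simp add: ownset_def)
    moreover have "node_done s v" using s act by (simp add: dp_done_def)
    ultimately show ?thesis using J(2) act unfolding node_done_def node_ok_def DX_def by auto
  qed (simp add: DX_def)
  then have mc: "mixed_value (row s) (insert v B) (exset s) (ownset s) (nats s ''J'') = mixed_value (row s) B (exset s) (ownset s) (nats s ''J'')"
    "mixed_count (insert v B) (exset s) (ownset s) (nats s ''J'') \<le> mixed_count B (exset s) (ownset s) (nats s ''J'')"
    using mixed_collapse[OF cf True v(2), of "nats s ''J''" "row s"] ex v J(1) by auto
  show ?thesis using inv mc unfolding back_inv_def by auto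
qed

text \<open>Children come later than \<open>v\<close> in this order, so the nodes added to
  \<open>own\<close> are unprocessed and still stand for their rows.\<close>

lemma back_step_expand:
  assumes v: "v < n" "v \<notin> B" "active v" and inv: "back_inv B s" and own: "0 < nats s ''o'' v"
    and later: "\<And>x. x \<in> ch v \<Longrightarrow> x \<notin> insert v B"
    and opt: "option_of v (nats s ''J'' v) I b" and val: "row s v (nats s ''J'' v) = optval (row s) v I b"
    and s': "row s' = row s" "\<forall>x. nats s' ''o'' x = (if x \<in> I then 1 else nats s ''o'' x)"
      "\<forall>x. nats s' ''J'' x = (if x \<in> I then b x else nats s ''J'' x)"
      "nats s' ''x'' = (nats s ''x'')(v := 1)" "nats s' ''O'' = (nats s ''O'')(v := card (ch v) - card I)"
      "nats s' ''c'' 0 = nats s ''c'' 0 + card I + (if I = ch v then 0 else 1)"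
  shows "back_inv (insert v B) s'"
proof -
  have I: "I \<subseteq> ch v" "\<forall>x\<in>I. 1 \<le> b x" "optcost v I b \<le> nats s ''J'' v"
    using opt achs_subset by (auto simp: option_of_def)
  have fin: "finite I" using finite_subset[OF I(1) finite_ch] .
  have In: "x < n" if "x \<in> I" for x using I(1) that ch_lt by blast
  have cf: "config (exset s) (ownset s)" and ex: "exset s \<subseteq> B" using inv by (auto simp: back_inv_def)
  have vo: "v \<in> ownset s" using own v by (simp add: ownset_def)
  have vex: "v \<in> ownset s - exset s" using vo ex v by blast
  have Jv: "nats s ''J'' v \<le> k" using inv vo v by (auto simp: back_inv_def)
  have exs: "exset s' = insert v (exset s)" using s'(4) v by (auto simp: exset_def)
  have owns: "ownset s' = ownset s \<union> I" using s'(2) In by (auto simp: ownset_def)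
  note ce = count_expand[OF cf vex I(1)]
  have J1: "nats s' ''J'' x = b x" if "x \<in> I" for x using s'(3) that by simp
  have J2: "nats s' ''J'' x = nats s ''J'' x" if "x \<in> ownset s" for x using s'(3) that ce(5) by auto
  have dnI: "x \<notin> insert v B" if "x \<in> I" for x using later I(1) that by blast
  note me = mixed_expand[where D = "row s", OF cf vo v(2,3) ex opt val dnI J1 J2]
  have bk: "b x \<le> k" if "x \<in> I" for x
  proof -
    have "b x \<le> sum b I" using that fin by (intro member_le_sum) auto
    then show ?thesis using I(3) Jv by (simp add: optcost_def split: if_splits)
  qed
  have "config (exset s') (ownset s')" unfolding exs owns by (rule ce(1))
  moreover have "exset s' \<subseteq> insert v B" using ex by (auto simp: exs)
  moreover have "\<forall>x\<in>ownset s' - insert v B. 1 \<le> nats s' ''J'' x \<and> nats s' ''J'' x \<le> k"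
    using inv I(2) bk J1 J2 by (auto simp: owns back_inv_def)
  moreover have "mixed_value (row s') (insert v B) (exset s') (ownset s') (nats s' ''J'') = DX (row s') rt k"
    unfolding exs owns s'(1) using me(1) inv by (simp add: back_inv_def)
  moreover have "mixed_count (insert v B) (exset s') (ownset s') (nats s' ''J'') \<le> k"
    unfolding exs owns using me(2) inv by (simp add: back_inv_def)
  moreover have "nats s' ''c'' 0 = config_count (exset s') (ownset s')"
    unfolding exs owns config_count_expand[OF cf vex I(1)] s'(6) using inv by (simp add: back_inv_def)
  moreover have "others_ok s'"
    unfolding others_ok_def
  proof
    fix p assume "p \<in> exset s'"
    then consider "p = v" | "p \<in> exset s" "p \<noteq> v" unfolding exs by blast
    then show "nats s' ''O'' p = card (ch p - ownset s')"
    proof cases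
      case 1
      then show ?thesis using s'(5) ce(3) card_Diff_subset[OF fin I(1)] by (simp add: owns)
    next
      case 2
      then show ?thesis using s'(5) ce(4) inv by (simp add: owns back_inv_def others_ok_def)
    qed
  qed
  ultimately show ?thesis by (simp add: back_inv_def)
qed

lemma runs_back_step:
  assumes s: "dp_done s" and i: "i < n" "nats s ''i'' 0 = i"
    and inv: "back_inv (rev_order (nats s ''q'') ` {..<i}) s"
  shows "runs back_body s (back_time (rev_order (nats s ''q'') i)) (\<lambda>s'. back_inv (rev_order (nats s ''q'') ` {..<Suc i}) s')"
proof -
  define q where "q = rev_order (nats s ''q'')"
  define v where "v = q i"
  define B where "B = q ` {..<i}"
  have data: "data_ok s" using s by (simp add: dp_done_def)
  have tp: "topo (nats s ''q'')" using data_okD(6)[OF data] .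
  have vn: "v < n" using rev_order_lt[OF tp i(1)] by (simp add: v_def q_def)
  have vB: "v \<notin> B" using rev_order_new[OF tp i(1)] by (simp add: v_def q_def B_def)
  define s1 where "s1 = upn s ''v'' 0 v"
  have fr1: "frame (nset ''v'' (NConst v)) s s1" by (simp add: frame_def s1_def)
  have s1': "dp_done s1" "row s1 = row s" using dp_done_frame[OF s fr1] by simp_all
  have inv1: "back_inv B s1" using inv s1'(2)
    by (simp add: back_inv_def exset_def ownset_def others_ok_def s1_def B_def q_def)
  have data1: "data_ok s1" using s1'(1) by (simp add: dp_done_def)
  note inp = input_okD[OF data_okD(1)[OF data1]]
  let ?g = "BAnd (BAnd (NLess (NConst 0) (NCell ''o'' (N ''v''))) (NLess (NConst 0) (NCell ''a'' (N ''v''))))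
            (NLess (NConst 0) (NCell ''r'' (IX (N ''v'') (NCell ''J'' (N ''v'')))))"
  let ?t = "if active v then T_expand * (k + 1) + 1 else 1"
  have g: "bval s1 ?g \<longleftrightarrow> 0 < nats s1 ''o'' v \<and> active v \<and> 0 < nats s1 ''r'' (ix k v (nats s1 ''J'' v))"
    using data_okD(2)[OF data1 vn] inp(3) by (simp add: s1_def)
  have "runs back_body s (maxcost (nset ''v'' (NCell ''q'' (NSub (NSub (N ''n'') (NConst 1)) (N ''i'')))) + (1 + bcost ?g + ?t)) (back_inv (insert v B))"
    unfolding back_body_def
  proof (rule runs_Seq)
    show "runs (nset ''v'' (NCell ''q'' (NSub (NSub (N ''n'') (NConst 1)) (N ''i'')))) s
      (maxcost (nset ''v'' (NCell ''q'' (NSub (NSub (N ''n'') (NConst 1)) (N ''i''))))) (\<lambda>s. s = s1)"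
      by (rule runs_loopfree)
        (simp_all add: i input_okD(1)[OF data_okD(1)[OF data]] s1_def v_def q_def rev_order_def)
    fix s' assume "s' = s1"
    show "runs (If ?g expand_prog Skip) s' (1 + bcost ?g + ?t) (back_inv (insert v B))"
      unfolding \<open>s' = s1\<close>
    proof (rule runs_If)
      assume "bval s1 ?g"
      then have gg: "0 < nats s1 ''o'' v" "active v" "0 < nats s1 ''r'' (ix k v (nats s1 ''J'' v))" unfolding g by auto
      have "v \<in> ownset s1 - B" using gg vn vB by (simp add: ownset_def)
      then have Jk: "nats s1 ''J'' v \<le> k" using inv1 by (auto simp: back_inv_def)
      have later: "x \<notin> insert v B" if "x \<in> ch v" for x
        using rev_order_ch_later[OF tp i(1)] that by (simp add: v_def q_def B_def)
      have "runs expand_prog s1 (T_expand * (k + 1))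
        (\<lambda>s'. \<exists>I b. option_of v (nats s1 ''J'' v) I b \<and> row s1 v (nats s1 ''J'' v) = optval (row s1) v I b \<and>
         (\<forall>x. nats s' ''o'' x = (if x \<in> I then 1 else nats s1 ''o'' x)) \<and>
         (\<forall>x. nats s' ''J'' x = (if x \<in> I then b x else nats s1 ''J'' x)) \<and>
         nats s' ''x'' = (nats s1 ''x'')(v := 1) \<and> nats s' ''O'' = (nats s1 ''O'')(v := card (ch v) - card I) \<and>
         nats s' ''c'' 0 = nats s1 ''c'' 0 + card I + (if I = ch v then 0 else 1))"
        using s1'(1) gg by (intro runs_expand[OF data1 _ vn _ _ refl Jk]) (auto simp: dp_done_def s1_def)
      then show "runs expand_prog s1 ?t (back_inv (insert v B))"
      proof (rule runs_conseq)
        fix s2 assume fr: "frame expand_prog s1 s2" and "\<exists>I b. option_of v (nats s1 ''J'' v) I b \<and> row s1 v (nats s1 ''J'' v) = optval (row s1) v I b \<and>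
         (\<forall>x. nats s2 ''o'' x = (if x \<in> I then 1 else nats s1 ''o'' x)) \<and>
         (\<forall>x. nats s2 ''J'' x = (if x \<in> I then b x else nats s1 ''J'' x)) \<and>
         nats s2 ''x'' = (nats s1 ''x'')(v := 1) \<and> nats s2 ''O'' = (nats s1 ''O'')(v := card (ch v) - card I) \<and>
         nats s2 ''c'' 0 = nats s1 ''c'' 0 + card I + (if I = ch v then 0 else 1)"
        moreover have "row s2 = row s1" by (rule dp_done_frame[OF s1'(1) fr]) (simp_all add: back_defs)
        ultimately show "back_inv (insert v B) s2"
          using back_step_expand[OF vn vB gg(2) inv1 gg(1) later] by blast
      qed (use gg in simp)
    next
      assume "\<not> bval s1 ?g"
      then have "back_inv (insert v B) s1" unfolding g by (rule back_step_skip[OF s1'(1) vn vB inv1])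
      then show "runs Skip s1 ?t (back_inv (insert v B))" by (intro runs_loopfree) auto
    qed simp
  qed simp
  then show ?thesis
    unfolding q_def[symmetric] image_lessThan_Suc v_def[symmetric] B_def[symmetric]
  proof (rule runs_conseq)
    show "maxcost (nset ''v'' (NCell ''q'' (NSub (NSub (N ''n'') (NConst 1)) (N ''i'')))) + (1 + bcost ?g + ?t) \<le> back_time v"
      by (simp add: back_time_def back_body_def)
  qed
qed

lemma runs_back:
  assumes s: "dp_done s0" and z: "\<And>v. nats s0 ''o'' v = 0" "\<And>v. nats s0 ''x'' v = 0"
  shows "runs (back_init ;; FOR ''i'' (N ''n'') back_body) s0 (maxcost back_init + ((\<Sum>v<n. back_time v) + 12 * (n + 1)))
    (\<lambda>s. config (exset s) (ownset s) \<and> config_value (exset s) (ownset s) = DX (row s0) rt k \<and>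
      nats s ''c'' 0 = config_count (exset s) (ownset s) \<and> config_count (exset s) (ownset s) \<le> k \<and> others_ok s)"
proof (rule runs_Seq)
  have data0: "data_ok s0" using s by (simp add: dp_done_def)
  note inp = input_okD[OF data_okD(1)[OF data0]]
  define q where "q = rev_order (nats s0 ''q'')"
  have tp: "topo (nats s0 ''q'')" using data_okD(6)[OF data0] .
  show "runs back_init s0 (maxcost back_init) (\<lambda>s. s = sem back_init s0)"
    by (rule runs_loopfree) (simp_all add: back_init_def)
  fix s' assume "s' = sem back_init s0"
  then have s1: "s' = upn (upn (upn s0 ''o'' rt 1) ''J'' rt k) ''c'' 0 1" by (simp add: back_init_def inp)
  have fr1: "frame back_init s0 s'" by (simp add: frame_def s1 back_init_def)
  have s1d: "dp_done s'" "row s' = row s0" using dp_done_frame[OF s fr1] by (simp_all add: back_init_def)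
  have sets: "exset s' = {}" "ownset s' = {rt}" using z by (auto simp: exset_def ownset_def s1)
  have init: "back_inv {} s'"
    unfolding back_inv_def sets others_ok_def s1d(2)
    using k_pos by (simp add: config_def mixed_value_def mixed_count_def config_count_def s1)
  have "runs (FOR ''i'' (N ''n'') back_body) s' ((\<Sum>v<n. back_time v) + 12 * (n + 1)) (\<lambda>s. back_inv (q ` {..<n}) s)"
  proof (rule runs_FOR[where I = "\<lambda>i s. back_inv (q ` {..<i}) s" and t = "\<lambda>i. back_time (q i)"])
    show "back_inv (q ` {..<0}) s'" using init by simp
    show "back_inv (q ` {..<i}) (upn s ''i'' 0 a)" if "back_inv (q ` {..<i}) s" for i s a
      using that by (simp add: back_inv_def exset_def ownset_def others_ok_def row_def[abs_def])
    fix i s assume fr: "frame (FOR ''i'' (N ''n'') back_body) s' s"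
    have sd: "dp_done s" by (rule dp_done_frame[OF s1d(1) fr]) (simp_all add: back_defs)
    then have data: "data_ok s" by (simp add: dp_done_def)
    then show "nval s (N ''n'') = n" using input_okD(1)[OF data_okD(1)[OF data]] by simp
    have qs: "rev_order (nats s ''q'') = q" by (simp add: q_def frame_nats[OF fr] back_defs s1)
    assume "i < n" "back_inv (q ` {..<i}) s" "nats s ''i'' 0 = i"
    then show "runs back_body s (back_time (q i)) (back_inv (q ` {..<Suc i}))"
      using runs_back_step[OF sd, unfolded qs] by blast
  next
    have "(\<Sum>i<n. back_time (q i)) = (\<Sum>v<n. back_time v)"
      using topo_rev(1,2)[OF tp] sum.reindex[of q "{..<n}" back_time] by (simp add: q_def o_def)
    then show "(\<Sum>i<n. back_time (q i)) + (10 + ncost (N ''n'')) * (n + 1) \<le> (\<Sum>v<n. back_time v) + 12 * (n + 1)"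
      by simp
  qed (simp add: back_defs)
  then show "runs (FOR ''i'' (N ''n'') back_body) s' ((\<Sum>v<n. back_time v) + 12 * (n + 1))
    (\<lambda>s. config (exset s) (ownset s) \<and> config_value (exset s) (ownset s) = DX (row s0) rt k \<and>
      nats s ''c'' 0 = config_count (exset s) (ownset s) \<and> config_count (exset s) (ownset s) \<le> k \<and> others_ok s)"
  proof (rule runs_conseq)
    fix s assume fr: "frame (FOR ''i'' (N ''n'') back_body) s' s" and I: "back_inv (q ` {..<n}) s"
    have rows: "row s = row s0" using dp_done_frame(2)[OF s1d(1) fr] s1d(2) by (simp add: back_defs)
    have "ownset s \<subseteq> q ` {..<n}" using topo_rev(2)[OF tp] by (auto simp: ownset_def q_def)
    note md = mixed_done[OF this]
    show "config (exset s) (ownset s) \<and> config_value (exset s) (ownset s) = DX (row s0) rt k \<and>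
      nats s ''c'' 0 = config_count (exset s) (ownset s) \<and> config_count (exset s) (ownset s) \<le> k \<and> others_ok s"
      using I unfolding back_inv_def md rows by blast
  qed simp
qed simp

end

section \<open>Refinement to exactly k nodes\<close>

text \<open>Taking a child out of \<open>other\<close>, or splitting off the root of a collapsed subtree, adds at most one
  node and never decreases the entropy.\<close>

definition "refine_split =
   If (BAnd (BAnd (Neq (NCell ''o'' (N ''v'')) (NConst 0)) (NLess (NConst 0) (NCell ''x'' (N ''p''))))
            (BNot (BAnd (BNot (NLess (N ''c'') (N ''k''))) (NLess (NConst 1) (NCell ''O'' (N ''p''))))))
     (If (NLess (NConst 1) (NCell ''O'' (N ''p''))) (nset ''c'' (NAdd (N ''c'') (NConst 1))) Skip ;;
      NAssign ''O'' (N ''p'') (NSub (NCell ''O'' (N ''p'')) (NConst 1)) ;;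
      NAssign ''o'' (N ''v'') (NConst 1)) Skip"

definition "refine_expand =
   If (BAnd (BAnd (NLess (NConst 0) (NCell ''o'' (N ''v''))) (Neq (NCell ''x'' (N ''v'')) (NConst 0))) (NLess (N ''c'') (N ''k'')))
     (NAssign ''x'' (N ''v'') (NConst 1) ;; NAssign ''O'' (N ''v'') (NCell ''d'' (N ''v'')) ;;
      If (NLess (NConst 0) (NCell ''d'' (N ''v''))) (nset ''c'' (NAdd (N ''c'') (NConst 1))) Skip) Skip"

definition "refine_body =
   nset ''v'' (NCell ''q'' (NSub (NSub (N ''n'') (NConst 1)) (N ''i''))) ;;
   nset ''p'' (NCell ''parent'' (N ''v'')) ;;
   refine_split ;; refine_expand"

lemmas refine_defs = refine_split_def refine_expand_def refine_body_def

context summary_dp begin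

definition refine_inv :: "real \<Rightarrow> store \<Rightarrow> bool" where
  "refine_inv V s \<longleftrightarrow> config (exset s) (ownset s) \<and> V \<le> config_value (exset s) (ownset s) \<and>
     nats s ''c'' 0 = config_count (exset s) (ownset s) \<and> config_count (exset s) (ownset s) \<le> k \<and> others_ok s"

text \<open>The guard lets the only remaining child leave \<open>other\<close> even at
  \<open>c = k\<close>, because the count does not change then.\<close>

lemma refine_split_step:
  assumes data: "data_ok s" and v: "nats s ''v'' 0 = v" "v < n" and p: "nats s ''p'' 0 = (if v = rt then rt else par v)"
    and inv: "refine_inv V s"
  shows "refine_inv V (sem refine_split s)" "exset (sem refine_split s) = exset s"
    "nats s ''c'' 0 < k \<Longrightarrow> v = rt \<or> par v \<in> exset s \<Longrightarrow> v \<in> ownset (sem refine_split s)"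
    "nats s ''c'' 0 \<le> nats (sem refine_split s) ''c'' 0"
proof -
  let ?c = "nats s ''c'' 0" and ?p = "nats s ''p'' 0"
  have k: "nats s ''k'' 0 = k" using input_okD(3)[OF data_okD(1)[OF data]] .
  have cf: "config (exset s) (ownset s)" using inv by (simp add: refine_inv_def)
  have rto: "rt \<in> ownset s" using cf by (simp add: config_def)
  let ?g = "nats s ''o'' v = 0 \<and> 0 < nats s ''x'' ?p \<and> (?c < k \<or> nats s ''O'' ?p \<le> 1)"
  define s2 where "s2 = upn (upn (if 1 < nats s ''O'' ?p then upn s ''c'' 0 (?c + 1) else s) ''O'' ?p (nats s ''O'' ?p - 1)) ''o'' v 1"
  have sem: "sem refine_split s = (if ?g then s2 else s)"
  proof -
    have "bval s (BAnd (BAnd (Neq (NCell ''o'' (N ''v'')) (NConst 0)) (NLess (NConst 0) (NCell ''x'' (N ''p''))))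
            (BNot (BAnd (BNot (NLess (N ''c'') (N ''k''))) (NLess (NConst 1) (NCell ''O'' (N ''p'')))))) \<longleftrightarrow> ?g"
      by (simp add: v k) linarith
    then show ?thesis
      unfolding refine_split_def sem.simps(5) s2_def by (auto simp: v)
  qed
  have "refine_inv V (sem refine_split s) \<and> exset (sem refine_split s) = exset s \<and>
    (?c < k \<longrightarrow> v = rt \<or> par v \<in> exset s \<longrightarrow> v \<in> ownset (sem refine_split s)) \<and> ?c \<le> nats (sem refine_split s) ''c'' 0"
  proof (cases ?g)
    case False
    have "v \<in> ownset s" if "?c < k" "v = rt \<or> par v \<in> exset s"
    proof (cases "v = rt")
      case False
      then show ?thesis using \<open>\<not> ?g\<close> that v p by (auto simp: exset_def ownset_def)
    qed (use rto in simp)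
    then show ?thesis unfolding sem if_not_P[OF False] using inv by auto
  next
    case True
    have vo: "v \<notin> ownset s" using True by (simp add: ownset_def)
    then have nr: "v \<noteq> rt" using rto by auto
    then have pv: "?p = par v" "par v < n" using p par_lt v by auto
    then have pe: "par v \<in> exset s" using True by (simp add: exset_def)
    have vch: "v \<in> ch (par v) - ownset s" using vo v nr by (simp add: ch_iff)
    note so = split_other[OF cf vch pe]
    have O: "nats s ''O'' (par v) = card (ch (par v) - ownset s)" using inv pe by (simp add: refine_inv_def others_ok_def)
    have one: "ch (par v) - ownset s = {v} \<longleftrightarrow> \<not> 1 < nats s ''O'' (par v)"
    proof -
      have "card (ch (par v) - ownset s) \<le> 1 \<longleftrightarrow> ch (par v) - ownset s = {v}"
        using vch card_le_Suc0_iff_eq[of "ch (par v) - ownset s"] by auto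
      then show ?thesis using O by linarith
    qed
    have ex2: "exset s2 = exset s" by (simp add: exset_def s2_def)
    have ow2: "ownset s2 = insert v (ownset s)" using v by (auto simp: ownset_def s2_def)
    have c2: "nats s2 ''c'' 0 = ?c + (if ch (par v) - ownset s = {v} then 0 else 1)"
      unfolding one by (simp add: s2_def pv)
    have ck: "nats s2 ''c'' 0 \<le> k"
    proof (cases "ch (par v) - ownset s = {v}")
      case True
      then show ?thesis using c2 inv by (simp add: refine_inv_def)
    next
      case False
      then have "?c < k" using \<open>?g\<close> one pv by auto
      then show ?thesis using c2 by simp
    qed
    have "others_ok s2"
      unfolding others_ok_def ex2 ow2
    proof
      fix u assume u: "u \<in> exset s"
      show "nats s2 ''O'' u = card (ch u - insert v (ownset s))"
      proof (cases "u = par v")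
        case True
        have "ch (par v) - insert v (ownset s) = ch (par v) - ownset s - {v}" by blast
        then show ?thesis using True O vch by (simp add: s2_def pv)
      next
        case False
        have "ch u - insert v (ownset s) = ch u - ownset s" using False by (auto simp: ch_iff)
        then show ?thesis using False u inv by (simp add: s2_def pv refine_inv_def others_ok_def)
      qed
    qed
    then have "refine_inv V s2"
      unfolding refine_inv_def ex2 ow2 using so c2 ck inv by (auto simp: refine_inv_def)
    then show ?thesis unfolding sem if_P[OF True] using ex2 ow2 c2 by simp
  qed
  then show "refine_inv V (sem refine_split s)" "exset (sem refine_split s) = exset s"
    "nats s ''c'' 0 < k \<Longrightarrow> v = rt \<or> par v \<in> exset s \<Longrightarrow> v \<in> ownset (sem refine_split s)"
    "nats s ''c'' 0 \<le> nats (sem refine_split s) ''c'' 0" by blast+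
qed

lemma refine_expand_step:
  assumes data: "data_ok s" and v: "nats s ''v'' 0 = v" "v < n"
    and inv: "refine_inv V s"
  shows "refine_inv V (sem refine_expand s)" "exset s \<subseteq> exset (sem refine_expand s)"
    "nats s ''c'' 0 < k \<Longrightarrow> v \<in> ownset s \<Longrightarrow> v \<in> exset (sem refine_expand s)"
    "nats s ''c'' 0 \<le> nats (sem refine_expand s) ''c'' 0"
proof -
  let ?c = "nats s ''c'' 0"
  have k: "nats s ''k'' 0 = k" using input_okD(3)[OF data_okD(1)[OF data]] .
  have cf: "config (exset s) (ownset s)" using inv by (simp add: refine_inv_def)
  have d: "nats s ''d'' v = card (ch v)" using data_okD(3)[OF data] .
  let ?g = "0 < nats s ''o'' v \<and> nats s ''x'' v = 0 \<and> ?c < k"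
  define s2 where "s2 = (let s' = upn (upn s ''x'' v 1) ''O'' v (card (ch v)) in if ch v = {} then s' else upn s' ''c'' 0 (?c + 1))"
  have sem: "sem refine_expand s = (if ?g then s2 else s)"
    by (simp add: refine_expand_def v k d s2_def Let_def card_gt_0_iff)
  have "refine_inv V (sem refine_expand s) \<and> exset s \<subseteq> exset (sem refine_expand s) \<and>
    (?c < k \<longrightarrow> v \<in> ownset s \<longrightarrow> v \<in> exset (sem refine_expand s)) \<and> ?c \<le> nats (sem refine_expand s) ''c'' 0"
  proof (cases ?g)
    case False
    have "v \<in> exset s" if "?c < k" "v \<in> ownset s"
      using False that v by (simp add: exset_def ownset_def)
    then show ?thesis unfolding sem if_not_P[OF False] using inv by auto
  next
    case True
    have vo: "v \<in> ownset s - exset s" using True v by (simp add: exset_def ownset_def)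
    note eo = expand_own[OF cf vo]
    have ex2: "exset s2 = insert v (exset s)" using v by (auto simp: exset_def s2_def Let_def)
    have ow2: "ownset s2 = ownset s" by (simp add: ownset_def s2_def Let_def)
    have c2: "nats s2 ''c'' 0 = ?c + (if ch v = {} then 0 else 1)" by (simp add: s2_def Let_def)
    have "others_ok s2"
      unfolding others_ok_def ex2 ow2
    proof
      fix u assume u: "u \<in> insert v (exset s)"
      show "nats s2 ''O'' u = card (ch u - ownset s)"
      proof (cases "u = v")
        case True
        then show ?thesis using eo(4) by (simp add: s2_def Let_def)
      next
        case False
        then show ?thesis using u inv by (simp add: s2_def Let_def refine_inv_def others_ok_def)
      qed
    qed
    then have "refine_inv V s2"
      unfolding refine_inv_def ex2 ow2 using eo c2 True inv by (auto simp: refine_inv_def)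
    then show ?thesis unfolding sem if_P[OF True] using ex2 c2 by auto
  qed
  then show "refine_inv V (sem refine_expand s)" "exset s \<subseteq> exset (sem refine_expand s)"
    "nats s ''c'' 0 < k \<Longrightarrow> v \<in> ownset s \<Longrightarrow> v \<in> exset (sem refine_expand s)"
    "nats s ''c'' 0 \<le> nats (sem refine_expand s) ''c'' 0" by blast+
qed

text \<open>The count never falls. If it ended below \<open>k\<close>, it was below \<open>k\<close>
  all the time, so every node was split off and the count is at least \<open>n\<close>, against
  \<open>k \<le> n\<close>.\<close>

lemma runs_refine:
  assumes data: "data_ok s0" and inv: "refine_inv V s0" and kn: "k \<le> n"
  shows "runs (FOR ''i'' (N ''n'') refine_body) s0 (for_cost (N ''n'') refine_body * (n + 1))
    (\<lambda>s. refine_inv V s \<and> config_count (exset s) (ownset s) = k)"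
proof -
  define q where "q = rev_order (nats s0 ''q'')"
  have tp: "topo (nats s0 ''q'')" using data_okD(6)[OF data] .
  let ?I = "\<lambda>i s. refine_inv V s \<and> (nats s ''c'' 0 < k \<longrightarrow> q ` {..<i} \<subseteq> exset s)"
  have "runs (FOR ''i'' (N ''n'') refine_body) s0 (for_cost (N ''n'') refine_body * (n + 1)) (?I n)"
  proof (rule runs_FOR_loopfree[where I = ?I])
    show "?I 0 s0" using inv by simp
    show "?I i (upn s ''i'' 0 a)" if "?I i s" for i s a
      using that by (simp add: refine_inv_def exset_def ownset_def others_ok_def)
    fix i s assume fr: "frame (FOR ''i'' (N ''n'') refine_body) s0 s"
    have data': "data_ok s" by (rule data_ok_frame[OF data fr]) (simp_all add: refine_defs)
    note inp = input_okD[OF data_okD(1)[OF data']]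
    show "nval s (N ''n'') = n" using inp(1) by simp
    have qs: "nats s ''q'' = nats s0 ''q''" by (simp add: frame_nats[OF fr] refine_defs)
    assume i: "i < n" "nats s ''i'' 0 = i" and I: "?I i s"
    define v where "v = q i"
    have vn: "v < n" using rev_order_lt[OF tp i(1)] by (simp add: v_def q_def)
    define s1 where "s1 = upn (upn s ''v'' 0 v) ''p'' 0 (if v = rt then rt else par v)"
    have qv: "nats s0 ''q'' (n - Suc i) = v" by (simp add: v_def q_def rev_order_def)
    define s2 where "s2 = sem refine_split s1"
    have sem: "sem refine_body s = sem refine_expand s2"
      using inp(4)[OF vn] by (simp add: refine_body_def inp(1,5) i qs qv s1_def s2_def)
    have data1: "data_ok s1" using data' by (simp add: data_ok_def input_ok_def s1_def)
    have ex1: "exset s1 = exset s" "nats s1 ''c'' = nats s ''c''" by (simp_all add: exset_def s1_def)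
    have inv1: "refine_inv V s1" using I by (simp add: refine_inv_def exset_def ownset_def others_ok_def s1_def)
    have v1: "nats s1 ''v'' 0 = v" by (simp add: s1_def)
    have p1: "nats s1 ''p'' 0 = (if v = rt then rt else par v)" by (simp add: s1_def)
    note sp = refine_split_step[OF data1 v1 vn p1 inv1, folded s2_def]
    have v2: "nats s2 ''v'' 0 = v" using v1 by (simp add: s2_def refine_split_def)
    have data2: "data_ok s2" using data1 by (simp add: data_ok_def input_ok_def s2_def refine_split_def)
    note ep = refine_expand_step[OF data2 v2 vn sp(1)]
    have "q ` {..<Suc i} \<subseteq> exset (sem refine_expand s2)" if "nats (sem refine_expand s2) ''c'' 0 < k"
    proof -
      have c: "nats s2 ''c'' 0 < k" "nats s1 ''c'' 0 < k" using that ep(4) sp(4) by auto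
      then have B: "q ` {..<i} \<subseteq> exset s" using I ex1 by simp
      have "v = rt \<or> par v \<in> exset s1" using topo_rev(3)[OF tp i(1)] B ex1 by (auto simp: v_def q_def)
      then have "v \<in> ownset s2" using sp(3) c by blast
      then have "v \<in> exset (sem refine_expand s2)" using ep(3) c by blast
      then show ?thesis using B ep(2) sp(2) ex1 by (auto simp: image_lessThan_Suc v_def)
    qed
    then show "?I (Suc i) (sem refine_body s)" unfolding sem using ep(1) by blast
  qed (simp_all add: refine_defs)
  then show ?thesis
  proof (rule runs_conseq)
    fix s assume I: "?I n s"
    have "\<not> nats s ''c'' 0 < k"
    proof
      assume "nats s ''c'' 0 < k"
      then have ex: "{..<n} \<subseteq> exset s" using I topo_rev(2)[OF tp] by (simp add: q_def)
      have cf: "config (exset s) (ownset s)" using I by (simp add: refine_inv_def)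
      then have "ownset s = {..<n}" using ex by (auto simp: config_def)
      then have "n \<le> config_count (exset s) (ownset s)" using full_count cf by simp
      then show False using I \<open>nats s ''c'' 0 < k\<close> kn by (simp add: refine_inv_def)
    qed
    then show "refine_inv V s \<and> config_count (exset s) (ownset s) = k" using I by (auto simp: refine_inv_def)
  qed simp
qed

end

section \<open>Labelling\<close>

text \<open>\<open>y(p)\<close> is the number of the \<open>other\<close> node of \<open>p\<close>; 0 stands for a number not yet assigned, which is
  unambiguous because the summary-tree node 0 is the root.\<close>

definition "label_body =
   nset ''v'' (NCell ''q'' (NSub (NSub (N ''n'') (NConst 1)) (N ''i''))) ;;
   nset ''p'' (NCell ''parent'' (N ''v'')) ;;
   If (Neq (N ''v'') (N ''root'')) Skip
     (If (NLess (NConst 0) (NCell ''x'' (N ''p'')))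
        (If (NLess (NConst 0) (NCell ''o'' (N ''v'')))
           (NAssign ''label'' (N ''v'') (N ''f'') ;;
            NAssign ''sparent'' (N ''f'') (NCell ''label'' (N ''p'')) ;; nset ''f'' (NAdd (N ''f'') (NConst 1)))
           (If (Neq (NCell ''y'' (N ''p'')) (NConst 0))
              (NAssign ''y'' (N ''p'') (N ''f'') ;;
               NAssign ''sparent'' (N ''f'') (NCell ''label'' (N ''p'')) ;; nset ''f'' (NAdd (N ''f'') (NConst 1))) Skip ;;
            NAssign ''label'' (N ''v'') (NCell ''y'' (N ''p''))))
        (NAssign ''label'' (N ''v'') (NCell ''label'' (N ''p''))))"

context summary_dp begin

text \<open>The root has label 0 from the start, before it is visited, hence
  \<open>insert rt B\<close>. Requiring that the tops use exactly the labels below \<open>f\<close>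
  makes \<open>f\<close> the number of nodes in the end.\<close>

definition label_inv :: "nat set \<Rightarrow> nat set \<Rightarrow> nat set \<Rightarrow> nat \<Rightarrow> (nat \<Rightarrow> nat) \<Rightarrow> (nat \<Rightarrow> nat) \<Rightarrow> (nat \<Rightarrow> nat) \<Rightarrow> bool" where
  "label_inv ex own B f lab sp y \<longleftrightarrow> 1 \<le> f \<and> lab rt = 0 \<and>
     lab ` {t \<in> insert rt B. is_top ex t} = {..<f} \<and> (\<forall>v\<in>insert rt B. lab v < f) \<and>
     (\<forall>v\<in>B. v \<noteq> rt \<longrightarrow> (if par v \<in> ex then sp (lab v) = lab (par v) else lab v = lab (par v))) \<and>
     (\<forall>t\<in>insert rt B. \<forall>u\<in>insert rt B. is_top ex t \<longrightarrow> is_top ex u \<longrightarrow> (lab t = lab u \<longleftrightarrow> key own t = key own u)) \<and>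
     (\<forall>p. if y p = 0 then \<forall>t\<in>insert rt B. is_top ex t \<longrightarrow> key own t \<noteq> Inr p
          else \<exists>t\<in>insert rt B. is_top ex t \<and> key own t = Inr p \<and> lab t = y p)"

lemma label_invD:
  assumes "label_inv ex own B f lab sp y"
  shows "1 \<le> f" "lab rt = 0" "lab ` {t \<in> insert rt B. is_top ex t} = {..<f}" "\<And>v. v \<in> insert rt B \<Longrightarrow> lab v < f"
    "\<And>v. v \<in> B \<Longrightarrow> v \<noteq> rt \<Longrightarrow> (if par v \<in> ex then sp (lab v) = lab (par v) else lab v = lab (par v))"
    "\<And>t u. t \<in> insert rt B \<Longrightarrow> u \<in> insert rt B \<Longrightarrow> is_top ex t \<Longrightarrow> is_top ex u \<Longrightarrow> lab t = lab u \<longleftrightarrow> key own t = key own u"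
    "\<And>p t. y p = 0 \<Longrightarrow> t \<in> insert rt B \<Longrightarrow> is_top ex t \<Longrightarrow> key own t \<noteq> Inr p"
    "\<And>p. y p \<noteq> 0 \<Longrightarrow> \<exists>t\<in>insert rt B. is_top ex t \<and> key own t = Inr p \<and> lab t = y p"
proof -
  note a = assms[unfolded label_inv_def]
  show "1 \<le> f" "lab rt = 0" "lab ` {t \<in> insert rt B. is_top ex t} = {..<f}"
    using a by - (elim conjE, assumption)+
  have b: "\<forall>v\<in>insert rt B. lab v < f"
    "\<forall>v\<in>B. v \<noteq> rt \<longrightarrow> (if par v \<in> ex then sp (lab v) = lab (par v) else lab v = lab (par v))"
    "\<forall>t\<in>insert rt B. \<forall>u\<in>insert rt B. is_top ex t \<longrightarrow> is_top ex u \<longrightarrow> (lab t = lab u \<longleftrightarrow> key own t = key own u)"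
    using a by - (elim conjE, assumption)+
  show "\<And>v. v \<in> insert rt B \<Longrightarrow> lab v < f" by (rule b(1)[rule_format])
  show "\<And>v. v \<in> B \<Longrightarrow> v \<noteq> rt \<Longrightarrow> (if par v \<in> ex then sp (lab v) = lab (par v) else lab v = lab (par v))"
    by (rule b(2)[rule_format])
  show "\<And>t u. t \<in> insert rt B \<Longrightarrow> u \<in> insert rt B \<Longrightarrow> is_top ex t \<Longrightarrow> is_top ex u \<Longrightarrow> lab t = lab u \<longleftrightarrow> key own t = key own u"
    by (rule b(3)[rule_format])
  have Y: "\<forall>p. if y p = 0 then \<forall>t\<in>insert rt B. is_top ex t \<longrightarrow> key own t \<noteq> Inr p
          else \<exists>t\<in>insert rt B. is_top ex t \<and> key own t = Inr p \<and> lab t = y p"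
    using a by - (elim conjE, assumption)+
  show "\<And>p t. y p = 0 \<Longrightarrow> t \<in> insert rt B \<Longrightarrow> is_top ex t \<Longrightarrow> key own t \<noteq> Inr p"
    using Y by (metis (full_types))
  show "\<exists>t\<in>insert rt B. is_top ex t \<and> key own t = Inr p \<and> lab t = y p" if "y p \<noteq> 0" for p
    using Y[THEN spec, of p] that by (simp only: if_False)
qed

text \<open>Covers a node of \<open>own\<close> and the first child that opens an
  \<open>other\<close> node: in both cases the key is new and receives the number
  \<open>f\<close>.\<close>

lemma label_new:
  assumes cf: "config ex own" and inv: "label_inv ex own B f lab sp y"
    and v: "v < n" "v \<noteq> rt" "v \<notin> B" and p: "par v \<in> insert rt B" "par v \<in> ex"
    and closed: "\<And>u. u \<in> B \<Longrightarrow> u \<noteq> rt \<Longrightarrow> par u \<in> insert rt B"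
    and new: "\<And>t. t \<in> insert rt B \<Longrightarrow> is_top ex t \<Longrightarrow> key own t \<noteq> key own v"
    and y': "y' = (if v \<in> own then y else y(par v := f))"
  shows "label_inv ex own (insert v B) (Suc f) (lab(v := f)) (sp(f := lab (par v))) y'"
proof -
  note D = label_invD[OF inv]
  have vt: "is_top ex v" using v p by (simp add: is_top_def)
  have nv: "u \<noteq> v" if "u \<in> insert rt B" for u using that v by auto
  have l: "(lab(v := f)) u = lab u" if "u \<in> insert rt B" for u using nv[OF that] by simp
  have "{t \<in> insert rt (insert v B). is_top ex t} = insert v {t \<in> insert rt B. is_top ex t}" using vt by auto
  then have 1: "(lab(v := f)) ` {t \<in> insert rt (insert v B). is_top ex t} = insert f {..<f}"
  proof -
    have "(lab(v := f)) ` {t \<in> insert rt B. is_top ex t} = lab ` {t \<in> insert rt B. is_top ex t}"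
      using l by (intro image_cong) auto
    then show ?thesis using D(3) \<open>{t \<in> insert rt (insert v B). is_top ex t} = _\<close>
      by (simp only: image_insert fun_upd_same)
  qed
  have 2: "(lab(v := f)) t < Suc f" if "t \<in> insert rt (insert v B)" for t
  proof (cases "t = v")
    case False
    then have "t \<in> insert rt B" using that by auto
    then show ?thesis unfolding l[OF \<open>t \<in> insert rt B\<close>] using D(4) less_SucI by blast
  qed simp
  have 3: "if par u \<in> ex then (sp(f := lab (par v))) ((lab(v := f)) u) = (lab(v := f)) (par u) else (lab(v := f)) u = (lab(v := f)) (par u)"
    if "u \<in> insert v B" "u \<noteq> rt" for u
  proof (cases "u = v")
    case True
    then show ?thesis using p l[OF p(1)] by simp
  next
    case False
    then have u: "u \<in> B" using that by simp
    have "lab u \<noteq> f" using D(4)[of u] u by simp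
    then show ?thesis using D(5)[OF u that(2)] l[of u] l[OF closed[OF u that(2)]] u by simp
  qed
  have 4: "(lab(v := f)) t = (lab(v := f)) u \<longleftrightarrow> key own t = key own u"
    if tu: "t \<in> insert rt (insert v B)" "u \<in> insert rt (insert v B)" "is_top ex t" "is_top ex u" for t u
  proof -
    have ne: "lab w \<noteq> f \<and> key own w \<noteq> key own v" if "w \<in> insert rt B" "is_top ex w" for w
      using D(4)[OF that(1)] new[OF that] by simp
    consider "t = v" "u = v" | "t = v" "u \<in> insert rt B" | "t \<in> insert rt B" "u = v" | "t \<in> insert rt B" "u \<in> insert rt B"
      using tu by blast
    then show ?thesis
    proof cases
      case 2
      then show ?thesis using l[OF 2(2)] ne[OF 2(2) tu(4)] by (simp add: eq_commute[of f] eq_commute[of "key own v"])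
    next
      case 3
      then show ?thesis using l[OF 3(1)] ne[OF 3(1) tu(3)] by simp
    next
      case 4
      then show ?thesis using l[OF 4(1)] l[OF 4(2)] D(6)[OF 4 tu(3,4)] by simp
    qed simp
  qed
  have 5: "if y' q = 0 then \<forall>t\<in>insert rt (insert v B). is_top ex t \<longrightarrow> key own t \<noteq> Inr q
          else \<exists>t\<in>insert rt (insert v B). is_top ex t \<and> key own t = Inr q \<and> (lab(v := f)) t = y' q" for q
  proof (cases "v \<in> own \<or> q \<noteq> par v")
    case True
    then have yq: "y' q = y q" and kv: "key own v \<noteq> Inr q" by (auto simp: y' key_def)
    show ?thesis
    proof (cases "y q = 0")
      case True
      then show ?thesis using D(7)[OF True] kv yq by auto
    next
      case False
      obtain t where t: "t \<in> insert rt B" "is_top ex t" "key own t = Inr q" "lab t = y q" using D(8)[OF False] by blast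
      have "t \<in> insert rt (insert v B) \<and> is_top ex t \<and> key own t = Inr q \<and> (lab(v := f)) t = y' q"
        using t l[OF t(1)] yq by auto
      moreover have "y' q \<noteq> 0" using False yq by simp
      ultimately show ?thesis by (subst if_not_P) blast+
    qed
  next
    case False
    then have "y' q = f" "key own v = Inr q" by (auto simp: y' key_def)
    then show ?thesis using D(1) vt by auto
  qed
  have "(lab(v := f)) rt = 0" using l[of rt] D(2) by simp
  then show ?thesis
    unfolding label_inv_def lessThan_Suc
    by (intro conjI ballI allI impI 1 2 3 4 5) simp_all
qed

lemma label_root: "label_inv ex own (insert rt B) f lab sp y = label_inv ex own B f lab sp y"
proof -
  have e: "(\<forall>v\<in>insert rt B. v \<noteq> rt \<longrightarrow> Q v) \<longleftrightarrow> (\<forall>v\<in>B. v \<noteq> rt \<longrightarrow> Q v)" for Q by blast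
  show ?thesis unfolding label_inv_def insert_absorb2 e ..
qed

text \<open>Such a node is not a top, so it adds no key and the counter stays.\<close>

lemma label_merged:
  assumes inv: "label_inv ex own B f lab sp y"
    and v: "v < n" "v \<noteq> rt" "v \<notin> B" and p: "par v \<in> insert rt B" "par v \<notin> ex"
    and closed: "\<And>u. u \<in> B \<Longrightarrow> u \<noteq> rt \<Longrightarrow> par u \<in> insert rt B"
  shows "label_inv ex own (insert v B) f (lab(v := lab (par v))) sp y"
proof -
  note D = label_invD[OF inv]
  let ?l = "lab(v := lab (par v))"
  have nt: "\<not> is_top ex v" using v p by (simp add: is_top_def)
  have l: "?l u = lab u" if "u \<in> insert rt B" for u using that v by auto
  have tops: "t \<in> insert rt (insert v B) \<and> is_top ex t \<longleftrightarrow> t \<in> insert rt B \<and> is_top ex t" for t using nt by auto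
  have 1: "?l ` {t \<in> insert rt (insert v B). is_top ex t} = {..<f}"
    unfolding tops D(3)[symmetric] using l by (intro image_cong) auto
  have 2: "?l t < f" if "t \<in> insert rt (insert v B)" for t
    using that D(4)[of t] D(4)[OF p(1)] by (cases "t = v") auto
  have 3: "if par u \<in> ex then sp (?l u) = ?l (par u) else ?l u = ?l (par u)"
    if "u \<in> insert v B" "u \<noteq> rt" for u
  proof (cases "u = v")
    case True
    then show ?thesis using p l[OF p(1)] by simp
  next
    case False
    then have u: "u \<in> B" using that by simp
    then show ?thesis using D(5)[OF u that(2)] l[of u] l[OF closed[OF u that(2)]] by simp
  qed
  have 4: "?l t = ?l u \<longleftrightarrow> key own t = key own u"
    if tu: "t \<in> insert rt (insert v B)" "u \<in> insert rt (insert v B)" "is_top ex t" "is_top ex u" for t u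
  proof -
    have "t \<in> insert rt B" "u \<in> insert rt B" using tu tops by blast+
    then show ?thesis using D(6)[of t u] l[of t] l[of u] tu by simp
  qed
  have 5: "if y q = 0 then \<forall>t\<in>insert rt (insert v B). is_top ex t \<longrightarrow> key own t \<noteq> Inr q
          else \<exists>t\<in>insert rt (insert v B). is_top ex t \<and> key own t = Inr q \<and> ?l t = y q" for q
  proof (cases "y q = 0")
    case True
    then show ?thesis using D(7)[OF True] tops by auto
  next
    case False
    obtain t where t: "t \<in> insert rt B" "is_top ex t" "key own t = Inr q" "lab t = y q" using D(8)[OF False] by blast
    then have "t \<in> insert rt (insert v B) \<and> is_top ex t \<and> key own t = Inr q \<and> ?l t = y q"
      using l[OF t(1)] by auto
    then show ?thesis unfolding if_not_P[OF False] by blast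
  qed
  have "?l rt = 0" using l[of rt] D(2) by simp
  then show ?thesis
    unfolding label_inv_def by (intro conjI ballI allI impI 1 2 3 4 5) (use D(1) in simp_all)
qed

text \<open>Here \<open>v\<close> joins the node \<open>other\<close> of its parent, which is represented by \<open>t\<close>.\<close>

lemma label_join:
  assumes inv: "label_inv ex own B f lab sp y"
    and v: "v < n" "v \<noteq> rt" "v \<notin> B" and p: "par v \<in> insert rt B" "par v \<in> ex" "v \<notin> own" and yp: "y (par v) \<noteq> 0"
    and closed: "\<And>u. u \<in> B \<Longrightarrow> u \<noteq> rt \<Longrightarrow> par u \<in> insert rt B" and rto: "rt \<in> own"
  shows "label_inv ex own (insert v B) f (lab(v := y (par v))) sp y"
proof -
  note D = label_invD[OF inv]
  let ?l = "lab(v := y (par v))"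
  obtain t0 where t0: "t0 \<in> insert rt B" "is_top ex t0" "key own t0 = Inr (par v)" "lab t0 = y (par v)" using D(8)[OF yp] by blast
  have kv: "key own v = key own t0" using t0 p by (simp add: key_def)
  have t0': "t0 \<noteq> rt" "t0 \<in> B" "par t0 = par v"
    using t0(1,3) rto by (auto simp: key_def split: if_splits)
  have vt: "is_top ex v" using v p by (simp add: is_top_def)
  have l: "?l u = lab u" if "u \<in> insert rt B" for u using that v by auto
  have lv: "?l v = lab t0" using t0 by simp
  have t0l: "lab t0 < f" using D(4)[OF t0(1)] .
  have 1: "?l ` {t \<in> insert rt (insert v B). is_top ex t} = {..<f}"
  proof -
    have "{t \<in> insert rt (insert v B). is_top ex t} = insert v {t \<in> insert rt B. is_top ex t}" using vt by auto
    moreover have "?l ` {t \<in> insert rt B. is_top ex t} = lab ` {t \<in> insert rt B. is_top ex t}"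
      using l by (intro image_cong) auto
    ultimately have "?l ` {t \<in> insert rt (insert v B). is_top ex t} = insert (lab t0) {..<f}"
      using D(3) lv by (simp only: image_insert)
    then show ?thesis using t0l by auto
  qed
  have 2: "?l t < f" if "t \<in> insert rt (insert v B)" for t
    using that D(4)[of t] t0l t0(4) by (cases "t = v") auto
  have 3: "if par u \<in> ex then sp (?l u) = ?l (par u) else ?l u = ?l (par u)"
    if "u \<in> insert v B" "u \<noteq> rt" for u
  proof (cases "u = v")
    case True
    moreover have "par v \<noteq> v" using v p by auto
    ultimately show ?thesis using p D(5)[OF t0'(2,1)] lv t0'(3) by simp
  next
    case False
    then have u: "u \<in> B" using that by simp
    then show ?thesis using D(5)[OF u that(2)] l[of u] l[OF closed[OF u that(2)]] by simp
  qed
  \<comment> \<open>\<open>v\<close> shares key and label with the representative, so statements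
    about tops reduce to the tops labelled before.\<close>
  have rep: "\<exists>t'\<in>insert rt B. is_top ex t' \<and> ?l t = lab t' \<and> key own t = key own t'"
    if "t \<in> insert rt (insert v B)" "is_top ex t" for t
  proof (cases "t = v")
    case True
    then show ?thesis using t0 lv kv by blast
  next
    case False
    then have "t \<in> insert rt B" using that by auto
    then show ?thesis using l that by blast
  qed
  have 4: "?l t = ?l u \<longleftrightarrow> key own t = key own u"
    if tu: "t \<in> insert rt (insert v B)" "u \<in> insert rt (insert v B)" "is_top ex t" "is_top ex u" for t u
  proof -
    obtain t' where t': "t' \<in> insert rt B" "is_top ex t'" "?l t = lab t'" "key own t = key own t'"
      using rep[OF tu(1,3)] by blast
    obtain u' where u': "u' \<in> insert rt B" "is_top ex u'" "?l u = lab u'" "key own u = key own u'"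
      using rep[OF tu(2,4)] by blast
    show ?thesis unfolding t'(3,4) u'(3,4) by (rule D(6)[OF t'(1) u'(1) t'(2) u'(2)])
  qed
  have 5: "if y q = 0 then \<forall>t\<in>insert rt (insert v B). is_top ex t \<longrightarrow> key own t \<noteq> Inr q
          else \<exists>t\<in>insert rt (insert v B). is_top ex t \<and> key own t = Inr q \<and> ?l t = y q" for q
  proof (cases "y q = 0")
    case True
    have "key own t \<noteq> Inr q" if t: "t \<in> insert rt (insert v B)" "is_top ex t" for t
    proof -
      obtain t' where t': "t' \<in> insert rt B" "is_top ex t'" "key own t = key own t'" using rep[OF t] by blast
      show ?thesis unfolding t'(3) by (rule D(7)[OF True t'(1,2)])
    qed
    then show ?thesis unfolding if_P[OF True] by blast
  next
    case False
    obtain t where t: "t \<in> insert rt B" "is_top ex t" "key own t = Inr q" "lab t = y q" using D(8)[OF False] by blast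
    then have "t \<in> insert rt (insert v B) \<and> is_top ex t \<and> key own t = Inr q \<and> ?l t = y q"
      using l[OF t(1)] by auto
    then show ?thesis unfolding if_not_P[OF False] by blast
  qed
  have "?l rt = 0" using l[of rt] D(2) by simp
  then show ?thesis
    unfolding label_inv_def by (intro conjI ballI allI impI 1 2 3 4 5) (use D(1) in simp_all)
qed

text \<open>Labels and keys of the tops correspond one to one, and the keys are the nodes of
  \<open>own\<close> together with the parents whose \<open>other\<close> node is nonempty.\<close>

lemma label_final:
  assumes cf: "config ex own" and inv: "label_inv ex own {..<n} f lab sp y"
  shows "f = config_count ex own" and "labelling ex own f lab sp"
proof -
  note D = label_invD[OF inv]
  have rtn: "insert rt {..<n} = {..<n}" by auto
  let ?tops = "{t. t < n \<and> is_top ex t}"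
  have tops: "lab ` ?tops = {..<f}" using D(3) unfolding rtn by simp
  have eq: "lab t = lab u \<longleftrightarrow> key own t = key own u" if "is_top ex t" "is_top ex u" for t u
    using D(6)[of t u] that by (simp add: is_top_def)
  have cfD: "rt \<in> own" "own \<subseteq> {..<n}" "\<And>v. v \<in> own \<Longrightarrow> v \<noteq> rt \<Longrightarrow> par v \<in> ex" using cf by (auto simp: config_def)
  have keys: "key own ` ?tops = Inl ` own \<union> Inr ` {p \<in> ex. ch p - own \<noteq> {}}" (is "_ = ?K")
  proof (intro equalityI subsetI)
    fix x assume "x \<in> key own ` ?tops"
    then obtain t where t: "t < n" "is_top ex t" "x = key own t" by auto
    show "x \<in> ?K"
    proof (cases "t \<in> own")
      case False
      then have "t \<noteq> rt" using cfD by auto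
      then have "par t \<in> ex" "t \<in> ch (par t) - own" using t False by (auto simp: is_top_def ch_iff)
      then show ?thesis using t(3) False by (auto simp: key_def)
    qed (use t in \<open>simp add: key_def\<close>)
  next
    fix x assume "x \<in> ?K"
    then consider v where "v \<in> own" "x = Inl v" | p t where "p \<in> ex" "t \<in> ch p - own" "x = Inr p" by blast
    then show "x \<in> key own ` ?tops"
    proof cases
      case 1
      then show ?thesis using cfD by (intro image_eqI[of _ _ v]) (auto simp: key_def is_top_def)
    next
      case 2
      then show ?thesis by (intro image_eqI[of _ _ t]) (auto simp: key_def is_top_def ch_iff)
    qed
  qed
  have "card (lab ` ?tops) = card (key own ` ?tops)"
  proof -
    define g where "g = (\<lambda>x. lab (SOME t. t \<in> ?tops \<and> key own t = x))"
    have g: "g (key own t) = lab t" if "t \<in> ?tops" for t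
    proof -
      have "\<exists>u. u \<in> ?tops \<and> key own u = key own t" using that by blast
      then have "(SOME u. u \<in> ?tops \<and> key own u = key own t) \<in> ?tops \<and> key own (SOME u. u \<in> ?tops \<and> key own u = key own t) = key own t"
        by (rule someI_ex)
      then show ?thesis unfolding g_def using eq that by blast
    qed
    have "inj_on g (key own ` ?tops)"
    proof (rule inj_onI)
      fix x x' assume "x \<in> key own ` ?tops" "x' \<in> key own ` ?tops" and xx: "g x = g x'"
      then obtain t t' where t: "t \<in> ?tops" "x = key own t" "t' \<in> ?tops" "x' = key own t'" by blast
      then have "lab t = lab t'" using xx g by simp
      then show "x = x'" using eq[of t t'] t by simp
    qed
    moreover have "g ` key own ` ?tops = lab ` ?tops" unfolding image_image using g by (intro image_cong) auto
    ultimately show ?thesis using card_image[of g "key own ` ?tops"] by simp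
  qed
  also have "\<dots> = card own + card {p \<in> ex. ch p - own \<noteq> {}}"
    unfolding keys using finite_config[OF cf] by (subst card_Un_disjoint) (auto simp: card_image)
  finally show "f = config_count ex own" using tops by (simp add: config_count_def)
  have "lab ` {..<n} = {..<f}"
  proof
    show "lab ` {..<n} \<subseteq> {..<f}" using D(4) by auto
    show "{..<f} \<subseteq> lab ` {..<n}" unfolding tops[symmetric] by auto
  qed
  then show "labelling ex own f lab sp"
    unfolding labelling_def using D(2,5) eq by auto
qed

lemma runs_label:
  assumes data: "data_ok s0" and cf: "config (exset s0) (ownset s0)"
    and z: "\<And>v. nats s0 ''label'' v = 0" "\<And>v. nats s0 ''y'' v = 0" "nats s0 ''f'' 0 = 1"
  shows "runs (FOR ''i'' (N ''n'') label_body) s0 (for_cost (N ''n'') label_body * (n + 1))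
    (\<lambda>s. labelling (exset s0) (ownset s0) (config_count (exset s0) (ownset s0)) (nats s ''label'') (nats s ''sparent''))"
proof -
  define q where "q = rev_order (nats s0 ''q'')"
  have tp: "topo (nats s0 ''q'')" using data_okD(6)[OF data] .
  define ex own where "ex = exset s0" and "own = ownset s0"
  have cf': "config ex own" using cf by (simp add: ex_def own_def)
  have rto: "rt \<in> own" using cf' by (simp add: config_def)
  let ?I = "\<lambda>i s. label_inv ex own (q ` {..<i}) (nats s ''f'' 0) (nats s ''label'') (nats s ''sparent'') (nats s ''y'')"
  have "runs (FOR ''i'' (N ''n'') label_body) s0 (for_cost (N ''n'') label_body * (n + 1)) (?I n)"
  proof (rule runs_FOR_loopfree[where I = ?I])
    \<comment> \<open>Before the first round the only labelled top is the root, with the initial 0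
      as its label.\<close>
    have "{t. t = rt \<and> is_top ex t} = {rt}" by (auto simp: is_top_def)
    then show "?I 0 s0" using z rto by (auto simp: label_inv_def key_def is_top_def)
    show "?I i (upn s ''i'' 0 a)" if "?I i s" for i s a using that by simp
    fix i s assume fr: "frame (FOR ''i'' (N ''n'') label_body) s0 s"
    have data': "data_ok s" by (rule data_ok_frame[OF data fr]) (simp_all add: label_body_def)
    note inp = input_okD[OF data_okD(1)[OF data']]
    show "nval s (N ''n'') = n" using inp(1) by simp
    have st: "nats s ''q'' = nats s0 ''q''" "nats s ''x'' = nats s0 ''x''" "nats s ''o'' = nats s0 ''o''"
      by (simp_all add: frame_nats[OF fr] label_body_def)
    assume i: "i < n" "nats s ''i'' 0 = i" and I: "?I i s"
    define v where "v = q i"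
    define B where "B = q ` {..<i}"
    have vn: "v < n" using rev_order_lt[OF tp i(1)] by (simp add: v_def q_def)
    have vB: "v \<notin> B" using rev_order_new[OF tp i(1)] by (simp add: v_def q_def B_def)
    have qv: "nats s0 ''q'' (n - Suc i) = v" by (simp add: v_def q_def rev_order_def)
    have I': "label_inv ex own B (nats s ''f'' 0) (nats s ''label'') (nats s ''sparent'') (nats s ''y'')" using I by (simp add: B_def)
    note D = label_invD[OF I']
    have closed: "par u \<in> insert rt B" if u: "u \<in> B" "u \<noteq> rt" for u
    proof -
      obtain a where a: "a < i" "u = q a" using u(1) by (auto simp: B_def)
      have "par u \<in> q ` {..<a}" using topo_rev(3)[OF tp, of a] a i u(2) by (simp add: q_def)
      then show ?thesis using a(1) by (auto simp: B_def)
    qed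
    have goal: "?I (Suc i) (sem label_body s) \<longleftrightarrow> label_inv ex own (insert v B) (nats (sem label_body s) ''f'' 0) (nats (sem label_body s) ''label'') (nats (sem label_body s) ''sparent'') (nats (sem label_body s) ''y'')"
      by (simp add: image_lessThan_Suc v_def B_def)
    show "?I (Suc i) (sem label_body s)"
      unfolding goal
    proof (cases "v = rt")
      case True
      have sem: "sem label_body s = upn (upn s ''v'' 0 v) ''p'' 0 rt"
        using True by (simp add: label_body_def i inp st qv)
      show "label_inv ex own (insert v B) (nats (sem label_body s) ''f'' 0) (nats (sem label_body s) ''label'') (nats (sem label_body s) ''sparent'') (nats (sem label_body s) ''y'')"
        using I' unfolding sem True label_root by simp
    next
      case False
      have pB: "par v \<in> insert rt B" using topo_rev(3)[OF tp i(1)] False by (simp add: v_def q_def B_def)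
      have pn: "par v < n" using par_lt vn False by simp
      have pex: "0 < nats s0 ''x'' (par v) \<longleftrightarrow> par v \<in> ex" using pn by (simp add: ex_def exset_def)
      have vow: "0 < nats s0 ''o'' v \<longleftrightarrow> v \<in> own" using vn by (simp add: own_def ownset_def)
      define f where "f = nats s ''f'' 0"
      define s1 where "s1 = upn (upn s ''v'' 0 v) ''p'' 0 (par v)"
      let ?l = "nats s ''label'' (par v)"
      have pv: "par v \<noteq> v" using vB pB False by auto
      have sem: "sem label_body s = (if par v \<in> ex
          then if v \<in> own then upn (upn (upn s1 ''label'' v f) ''sparent'' f ?l) ''f'' 0 (Suc f)
            else if nats s ''y'' (par v) = 0
              then upn (upn (upn (upn s1 ''y'' (par v) f) ''sparent'' f ?l) ''f'' 0 (Suc f)) ''label'' v f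
              else upn s1 ''label'' v (nats s ''y'' (par v))
          else upn s1 ''label'' v ?l)"
        using False inp(4)[OF vn False] pv
        by (simp add: label_body_def i inp(1,2) st qv pex vow s1_def f_def)
      show "label_inv ex own (insert v B) (nats (sem label_body s) ''f'' 0) (nats (sem label_body s) ''label'') (nats (sem label_body s) ''sparent'') (nats (sem label_body s) ''y'')"
      proof (cases "par v \<in> ex")
        case ne: False
        show ?thesis unfolding sem using label_merged[OF I' vn False vB pB ne closed] ne by (simp add: s1_def)
      next
        case pe: True
        show ?thesis
        proof (cases "v \<in> own \<or> nats s ''y'' (par v) = 0")
          case True
          have new: "key own t \<noteq> key own v" if "t \<in> insert rt B" "is_top ex t" for t
          proof (cases "v \<in> own")
            case vo: True
            have "t \<noteq> v" using that(1) vB False by auto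
            then show ?thesis using vo by (simp add: key_def)
          next
            case vo: False
            then have "key own t \<noteq> Inr (par v)" using D(7)[OF _ that] True by blast
            then show ?thesis using vo by (simp add: key_def)
          qed
          show ?thesis
            unfolding sem using True pe label_new[OF cf' I' vn False vB pB pe closed new refl]
            by (auto simp: s1_def f_def)
        next
          case yp: False
          then show ?thesis
            unfolding sem using pe label_join[OF I' vn False vB pB pe _ _ closed rto] by (simp add: s1_def f_def)
        qed
      qed
    qed
  qed (simp_all add: label_body_def)
  then show ?thesis
  proof (rule runs_conseq)
    fix s assume "?I n s"
    then have "label_inv ex own {..<n} (nats s ''f'' 0) (nats s ''label'') (nats s ''sparent'') (nats s ''y'')"
      using topo_rev(2)[OF tp] by (simp add: q_def)
    from label_final[OF cf' this]
    show "labelling (exset s0) (ownset s0) (config_count (exset s0) (ownset s0)) (nats s ''label'') (nats s ''sparent'')"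
      by (simp add: ex_def own_def)
  qed simp
qed

end

section \<open>The whole program\<close>

definition summary_prog :: com where
  "summary_prog =
    FOR ''i'' (N ''n'') count_body ;; FOR ''i'' (N ''n'') leaf_body ;; FOR ''i'' (N ''n'') peel_body ;;
    FOR ''i'' (N ''n'') depth_body ;; FOR ''i'' (N ''n'') dp_body ;;
    (back_init ;; FOR ''i'' (N ''n'') back_body) ;;
    FOR ''i'' (N ''n'') refine_body ;; nset ''f'' (NConst 1) ;; FOR ''i'' (N ''n'') label_body"

lemmas prog_defs = count_body_def leaf_body_def peel_body_def depth_body_def dp_body_def insert_defs node_defs
  back_init_def back_defs refine_defs label_body_def

definition scan_cost :: nat where
  "scan_cost = for_cost (N ''n'') count_body + for_cost (N ''n'') leaf_body + for_cost (N ''n'') peel_body +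
     for_cost (N ''n'') depth_body + for_cost (N ''n'') refine_body + for_cost (N ''n'') label_body +
     maxcost back_init + maxcost back_body + 40"

context summary_dp begin

definition prog_time :: nat where
  "prog_time = scan_cost * (n + 1) + (\<Sum>v<n. dp_time v) + (\<Sum>v<n. back_time v)"

lemma input_ok_frame:
  assumes "input_ok s" "frame c s s'"
    "{''n'', ''root'', ''parent'', ''k''} \<inter> nwrites c = {}" "{''weight'', ''eps''} \<inter> rwrites c = {}"
  shows "input_ok s'"
  using assms(1,3,4) unfolding input_ok_def
  by (simp add: frame_nats[OF assms(2)] frame_reals[OF assms(2)])

text \<open>The continuation \<open>c\<close> is a parameter because \<open>;;\<close> associates to
  the right, so these four loops are not a subprogram of their own.\<close>

lemma runs_order:
  assumes inp: "input_ok s0"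
    and z: "\<And>v. nats s0 ''d'' v = 0" "reals s0 ''W'' 0 = 0" "nats s0 ''t'' 0 = 0" "\<And>v. nats s0 ''g'' v = 0"
      "\<And>v. nats s0 ''h'' v = 0" "\<And>v. nats s0 ''a'' v = 0"
    and tail: "\<And>s. data_ok s \<Longrightarrow>
       frame (FOR ''i'' (N ''n'') count_body ;; FOR ''i'' (N ''n'') leaf_body ;; FOR ''i'' (N ''n'') peel_body ;;
          FOR ''i'' (N ''n'') depth_body) s0 s \<Longrightarrow> runs c s u Q"
  shows "runs (FOR ''i'' (N ''n'') count_body ;; FOR ''i'' (N ''n'') leaf_body ;; FOR ''i'' (N ''n'') peel_body ;;
      FOR ''i'' (N ''n'') depth_body ;; c) s0
    ((for_cost (N ''n'') count_body + for_cost (N ''n'') leaf_body + for_cost (N ''n'') peel_body + for_cost (N ''n'') depth_body) * (n + 1) + u) Q"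
proof -
  let ?f = "\<lambda>b. FOR ''i'' (N ''n'') b" and ?t = "\<lambda>b. for_cost (N ''n'') b * (n + 1)"
  have "runs (?f count_body ;; ?f leaf_body ;; ?f peel_body ;; ?f depth_body ;; c) s0
    (?t count_body + (?t leaf_body + (?t peel_body + (?t depth_body + u)))) Q"
  proof (rule runs_Seq[OF runs_count[OF inp z(1,2)]])
    fix s1 assume f1: "frame (?f count_body) s0 s1" and Q1: "(\<forall>p. nats s1 ''d'' p = card (ch p)) \<and> reals s1 ''W'' 0 = total_weight T"
    have i1: "input_ok s1" by (rule input_ok_frame[OF inp f1]) (simp_all add: count_body_def)
    have z1: "nats s1 ''t'' 0 = 0" using z by (simp add: frame_nats[OF f1] count_body_def)
    show "runs (?f leaf_body ;; ?f peel_body ;; ?f depth_body ;; c) s1 (?t leaf_body + (?t peel_body + (?t depth_body + u))) Q"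
    proof (rule runs_Seq[OF runs_leaf[OF i1 _ _ z1]])
      fix s2 assume f2: "frame (?f leaf_body) s1 s2" and
        "\<exists>t\<le>n. nats s2 ''t'' 0 = t \<and> inj_on (nats s2 ''q'') {..<t} \<and> nats s2 ''q'' ` {..<t} = {v. v < n \<and> ch v = {}} \<and>
          (\<forall>v<n. reals s2 ''w'' v = pw v \<and> reals s2 ''s'' v = pw v)"
      then obtain t where t: "t \<le> n" "nats s2 ''t'' 0 = t" "inj_on (nats s2 ''q'') {..<t}"
        "nats s2 ''q'' ` {..<t} = {v. v < n \<and> ch v = {}}" "\<And>v. v < n \<Longrightarrow> reals s2 ''w'' v = pw v"
        "\<And>v. v < n \<Longrightarrow> reals s2 ''s'' v = pw v" by blast
      have i2: "input_ok s2" by (rule input_ok_frame[OF i1 f2]) (simp_all add: leaf_body_def)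
      have d2: "nats s2 ''d'' p = card (ch p)" for p using Q1 by (simp add: frame_nats[OF f2] leaf_body_def)
      have z2: "nats s2 ''g'' p = 0" for p using z by (simp add: frame_nats[OF f2] frame_nats[OF f1] leaf_body_def count_body_def)
      show "runs (?f peel_body ;; ?f depth_body ;; c) s2 (?t peel_body + (?t depth_body + u)) Q"
      proof (rule runs_Seq[OF runs_peel[OF i2 d2 z2 t(1-4,6)]])
        fix s3 assume f3: "frame (?f peel_body) s2 s3" and Q3: "topo (nats s3 ''q'') \<and> (\<forall>v<n. reals s3 ''s'' v = ps v)"
        have i3: "input_ok s3" by (rule input_ok_frame[OF i2 f3]) (simp_all add: peel_body_def)
        have z3: "nats s3 ''h'' p = 0" "nats s3 ''a'' p = 0" for p using z
          by (simp_all add: frame_nats[OF f3] frame_nats[OF f2] frame_nats[OF f1] leaf_body_def count_body_def peel_body_def)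
        show "runs (?f depth_body ;; c) s3 (?t depth_body + u) Q"
        proof (rule runs_Seq[OF runs_depth[OF i3 _ _ z3]])
          fix s4 assume f4: "frame (?f depth_body) s3 s4" and Q4: "\<forall>v<n. (0 < nats s4 ''a'' v) = active v"
          have i4: "input_ok s4" by (rule input_ok_frame[OF i3 f4]) (simp_all add: depth_body_def)
          have "data_ok s4" unfolding data_ok_def using i4 Q4 Q3 d2 t(5)
            by (simp add: frame_nats[OF f4] frame_nats[OF f3] frame_reals[OF f4] frame_reals[OF f3] depth_body_def peel_body_def)
          moreover have "frame (?f count_body ;; ?f leaf_body ;; ?f peel_body ;; ?f depth_body) s0 s4"
            using f1 f2 f3 f4 by (simp add: frame_def)
          ultimately show "runs c s4 u Q" by (rule tail)
        qed (use Q3 in simp_all)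
      qed simp_all
    qed (use Q1 in auto)
  qed simp
  then show ?thesis by (rule runs_conseq) (simp_all add: add_mult_distrib)
qed

section \<open>Error bound and total running time\<close>

definition output_ok :: "store \<Rightarrow> bool" where
  "output_ok s \<longleftrightarrow> output_summary n k s \<in> k_summary_trees T k \<and>
     \<bar>entropy T (output_summary n k s) - max_entropy T k\<bar> \<le> \<epsilon>"

text \<open>The output is itself a \<open>k\<close>-node summary tree, so the maximum exists and is
  not below its entropy. The other direction applies \<open>entropy_le_DX\<close> to a tree of
  maximum entropy.\<close>

lemma output_okI:
  assumes s: "dp_done s0" and cf: "config ex own" and cnt: "config_count ex own = k"
    and val: "DX (row s0) rt k \<le> config_value ex own"
    and lab: "labelling ex own k (nats s ''label'') (nats s ''sparent'')"
  shows "output_ok s"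
proof -
  interpret labelled_config T ex own k "nats s ''label''" "nats s ''sparent''"
    by unfold_locales (use cf lab in auto)
  have out: "output_summary n k s = summ rt" by (rule summ_root) simp_all
  have mem: "summ rt \<in> k_summary_trees T k"
    using summary_summ[of rt] root_own card_summ by (simp add: k_summary_trees_def summary_tree_def)
  have ent: "entropy T (summ rt) = config_value ex own" by (rule entropy_summ)
  have tab: "node_attained (row s0) v \<and> (\<exists>ys. desc_list (achs v) ys \<and> near_upper (row s0) v ys)" if "active v" for v
    using node_ok_spec[OF active_lt[OF that]] s that unfolding dp_done_def node_done_def list_of_def by blast
  let ?E = "entropy T ` k_summary_trees T k"
  have fin: "finite ?E" using finite_k_summary_trees by simp
  have "Max ?E \<in> ?E" using mem fin by (intro Max_in) auto
  then obtain S where S: "S \<in> k_summary_trees T k" "max_entropy T k = entropy T S" by (auto simp: max_entropy_def)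
  have "max_entropy T k \<le> entropy T (summ rt) + \<epsilon>"
    using entropy_le_DX[OF tab S(1)] val ent S(2) by simp
  moreover have "entropy T (summ rt) \<le> max_entropy T k"
    unfolding max_entropy_def using fin mem by (intro Max_ge) auto
  ultimately show ?thesis using mem eps_pos by (simp add: output_ok_def out)
qed

lemma runs_summary_prog:
  assumes kn: "k \<le> n"
  shows "runs summary_prog (input_store T K k \<epsilon>) prog_time output_ok"
proof -
  let ?f = "\<lambda>b. FOR ''i'' (N ''n'') b" and ?t = "\<lambda>b. for_cost (N ''n'') b * (n + 1)"
  let ?s0 = "input_store T K k \<epsilon>"
  let ?tb = "maxcost back_init + ((\<Sum>v<n. back_time v) + 12 * (n + 1))"
  let ?td = "(\<Sum>v<n. dp_time v) + 12 * (n + 1)"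
  have inp: "input_ok ?s0" by (simp add: input_ok_def input_store_def)
  have "runs summary_prog ?s0
    ((for_cost (N ''n'') count_body + for_cost (N ''n'') leaf_body + for_cost (N ''n'') peel_body + for_cost (N ''n'') depth_body) * (n + 1) +
     (?td + (?tb + (?t refine_body + (3 + ?t label_body))))) output_ok"
    unfolding summary_prog_def
  proof (rule runs_order[OF inp])
    fix s1 assume data1: "data_ok s1" and f1: "frame (?f count_body ;; ?f leaf_body ;; ?f peel_body ;; ?f depth_body) ?s0 s1"
    have z1: "nats s1 ''l'' p = 0" "nats s1 ''r'' p = 0" "nats s1 ''o'' p = 0" "nats s1 ''x'' p = 0" "nats s1 ''label'' p = 0" "nats s1 ''y'' p = 0" for p
      by (simp_all add: frame_nats[OF f1] prog_defs input_store_def)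
    show "runs (?f dp_body ;; (back_init ;; ?f back_body) ;; ?f refine_body ;; nset ''f'' (NConst 1) ;; ?f label_body) s1
       (?td + (?tb + (?t refine_body + (3 + ?t label_body)))) output_ok"
    proof (rule runs_Seq[OF runs_dp[OF data1 z1(1,2)]])
      fix s2 assume f2: "frame (?f dp_body) s1 s2" and Q2: "\<forall>v. active v \<longrightarrow> node_done s2 v \<and> topk (achs v) (list_of s2 v)"
      have "data_ok s2" by (rule data_ok_frame[OF data1 f2]) (simp_all add: prog_defs)
      then have done2: "dp_done s2" using Q2 by (simp add: dp_done_def)
      have z2: "nats s2 ''o'' p = 0" "nats s2 ''x'' p = 0" "nats s2 ''label'' p = 0" "nats s2 ''y'' p = 0" for p
        using z1 by (simp_all add: frame_nats[OF f2] prog_defs)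
      show "runs ((back_init ;; ?f back_body) ;; ?f refine_body ;; nset ''f'' (NConst 1) ;; ?f label_body) s2
         (?tb + (?t refine_body + (3 + ?t label_body))) output_ok"
      proof (rule runs_Seq[OF runs_back[OF done2 z2(1,2)]])
        fix s3 assume f3: "frame (back_init ;; ?f back_body) s2 s3" and Q3: "config (exset s3) (ownset s3) \<and>
           config_value (exset s3) (ownset s3) = DX (row s2) rt k \<and> nats s3 ''c'' 0 = config_count (exset s3) (ownset s3) \<and>
           config_count (exset s3) (ownset s3) \<le> k \<and> others_ok s3"
        have data3: "data_ok s3" using dp_done_frame(1)[OF done2 f3] by (simp add: prog_defs dp_done_def)
        have inv3: "refine_inv (DX (row s2) rt k) s3" using Q3 by (simp add: refine_inv_def)
        show "runs (?f refine_body ;; nset ''f'' (NConst 1) ;; ?f label_body) s3 (?t refine_body + (3 + ?t label_body)) output_ok"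
        proof (rule runs_Seq[OF runs_refine[OF data3 inv3 kn]])
          fix s4 assume f4: "frame (?f refine_body) s3 s4" and
            Q4: "refine_inv (DX (row s2) rt k) s4 \<and> config_count (exset s4) (ownset s4) = k"
          have data4: "data_ok s4" by (rule data_ok_frame[OF data3 f4]) (simp_all add: prog_defs)
          have z4: "nats s4 ''label'' p = 0" "nats s4 ''y'' p = 0" for p
            using z2 by (simp_all add: frame_nats[OF f4] frame_nats[OF f3] prog_defs)
          show "runs (nset ''f'' (NConst 1) ;; ?f label_body) s4 (3 + ?t label_body) output_ok"
          proof (rule runs_Seq)
            show "runs (nset ''f'' (NConst 1)) s4 3 (\<lambda>s. s = upn s4 ''f'' 0 1)" by (rule runs_loopfree) simp_all
            fix s5 assume s5: "s5 = upn s4 ''f'' 0 1"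
            have sets: "exset s5 = exset s4" "ownset s5 = ownset s4" by (simp_all add: exset_def ownset_def s5)
            have data5: "data_ok s5" using data4 by (simp add: data_ok_def input_ok_def s5)
            have cf: "config (exset s5) (ownset s5)" using Q4 by (simp add: sets refine_inv_def)
            show "runs (?f label_body) s5 (?t label_body) output_ok"
            proof (rule runs_conseq[OF runs_label[OF data5 cf]])
              fix s :: store assume "labelling (exset s5) (ownset s5) (config_count (exset s5) (ownset s5)) (nats s ''label'') (nats s ''sparent'')"
              then show "output_ok s"
                using Q4 by (intro output_okI[OF done2]) (auto simp: sets refine_inv_def)
            qed (use z4 in \<open>simp_all add: s5\<close>)
          qed simp
        qed simp
      qed simp
    qed simp
  qed (simp_all add: input_store_def)
  then show ?thesis
    by (rule runs_conseq) (simp_all add: prog_time_def scan_cost_def algebra_simps)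
qed

text \<open>Additive constants are absorbed by \<open>n \<ge> 1\<close>, and
  \<open>k + 1 \<le> 2 * k\<close> turns the factor 12 of \<open>sum_square_bound\<close> into
  48.\<close>

lemma prog_time_bound:
  assumes "k \<le> K"
  shows "real prog_time \<le> real (2 * scan_cost + T_dp + maxcost back_body + 1) * real n +
    real (48 * (T_dp + T_expand)) * (heavy_bound (real K / \<epsilon>) * real K ^ 3)"
proof -
  let ?S = "\<Sum>v\<in>Collect active. (width v + 1)\<^sup>2"
  let ?H = "heavy_bound (real K / \<epsilon>)"
  have If: "(\<Sum>v<n. if active v then g v else 0) = (\<Sum>v\<in>Collect active. g v)" for g :: "nat \<Rightarrow> nat"
  proof -
    have "{..<n} \<inter> Collect active = Collect active" using active_lt by auto
    then show ?thesis by (simp add: sum.If_cases)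
  qed
  have dp: "(\<Sum>v<n. dp_time v) = T_dp * n + T_dp * (?S * (k + 1)\<^sup>2)"
    unfolding dp_time_def sum_distrib_left[symmetric] sum.distrib If by (simp add: sum_distrib_right distrib_left)
  have "card (Collect active) \<le> ?S"
    using sum_mono[of "Collect active" "\<lambda>_. 1::nat" "\<lambda>v. (width v + 1)\<^sup>2"] by simp
  then have "card (Collect active) * (k + 1) \<le> ?S * (k + 1)\<^sup>2"
    by (rule mult_le_mono) (simp add: power2_eq_square)
  then have "T_expand * (card (Collect active) * (k + 1)) \<le> T_expand * (?S * (k + 1)\<^sup>2)" by (rule mult_le_mono2)
  then have bk: "(\<Sum>v<n. back_time v) \<le> (maxcost back_body + 1) * n + T_expand * (?S * (k + 1)\<^sup>2)"
    unfolding back_time_def sum.distrib If by (simp add: algebra_simps)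
  have "scan_cost * (n + 1) \<le> scan_cost * (2 * n)" using root_lt by (intro mult_le_mono2) linarith
  then have P: "prog_time \<le> (2 * scan_cost + T_dp + maxcost back_body + 1) * n + (T_dp + T_expand) * (?S * (k + 1)\<^sup>2)"
    unfolding prog_time_def dp using bk by (simp only: distrib_left mult_1_right add_mult_distrib mult.assoc mult.left_commute[of scan_cost] mult_2 mult_1)
  have "real ?S * real ((k + 1)\<^sup>2) \<le> (12 * real k * ?H) * (4 * real k ^ 2)"
  proof (rule mult_mono)
    show "real ?S \<le> 12 * real k * ?H" by (rule sum_square_bound[OF assms]) (auto simp: width_def)
    have "(k + 1)\<^sup>2 \<le> (2 * k)\<^sup>2" using k_pos by (intro power_mono) auto
    then show "real ((k + 1)\<^sup>2) \<le> 4 * real k ^ 2" using of_nat_mono[of "(k + 1)\<^sup>2" "(2 * k)\<^sup>2", where 'a = real]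
      by (simp add: power_mult_distrib)
  qed (use heavy_bound_ge[of "real K / \<epsilon>"] in auto)
  also have "(12 * real k * ?H) * (4 * real k ^ 2) = 48 * (?H * real k ^ 3)"
    by (simp add: power2_eq_square power3_eq_cube)
  also have "\<dots> \<le> 48 * (?H * real K ^ 3)"
    using assms heavy_bound_ge[of "real K / \<epsilon>"] by (intro mult_left_mono power_mono) auto
  finally have S: "real ?S * real ((k + 1)\<^sup>2) \<le> 48 * (?H * real K ^ 3)" .
  have "real prog_time \<le> real ((2 * scan_cost + T_dp + maxcost back_body + 1) * n + (T_dp + T_expand) * (?S * (k + 1)\<^sup>2))"
    by (rule of_nat_mono[OF P])
  also have "\<dots> = real (2 * scan_cost + T_dp + maxcost back_body + 1) * real n + real (T_dp + T_expand) * (real ?S * real ((k + 1)\<^sup>2))"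
    by (simp only: of_nat_add of_nat_mult)
  finally show ?thesis
    using mult_left_mono[OF S, of "real (T_dp + T_expand)"] by (simp add: algebra_simps)
qed

end

theorem theorem4:
  "\<exists>(prog :: com) (W\<^sub>0 :: nat \<Rightarrow> real \<Rightarrow> nat) (C :: real).
     (\<forall>K \<epsilon>. 1 \<le> K \<longrightarrow> 0 < \<epsilon> \<longrightarrow>
        real (W\<^sub>0 K \<epsilon>) \<le> C * max 1 (real K / \<epsilon> * log 2 (real K / \<epsilon>))) \<and>
     (\<forall>(T :: wtree) (K :: nat) (k :: nat) (\<epsilon> :: real).
        rooted_tree T \<longrightarrow>
        (\<forall>v < node_count T. 0 \<le> weight T v) \<longrightarrow>
        0 < total_weight T \<longrightarrow>
        1 \<le> K \<longrightarrow> 0 < \<epsilon> \<longrightarrow>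
        1 \<le> k \<longrightarrow> k \<le> K \<longrightarrow> k \<le> node_count T \<longrightarrow>
        (\<exists>t s. exec prog (input_store T K k \<epsilon>) t s \<and>
               real t \<le> C * (real (node_count T) + real (W\<^sub>0 K \<epsilon>) * real K ^ 3) \<and>
               output_summary (node_count T) k s \<in> k_summary_trees T k \<and>
               \<bar>entropy T (output_summary (node_count T) k s) - max_entropy T k\<bar> \<le> \<epsilon>))"
proof -
  define W where "W K \<epsilon> = nat \<lceil>heavy_bound (real K / \<epsilon>)\<rceil>" for K :: nat and \<epsilon> :: real
  \<comment> \<open>\<open>T_dp\<close> and \<open>T_expand\<close> depend only on the program text
    and carry no locale parameters, so the constant is the same for all inputs.\<close>
  define a where "a = real (2 * scan_cost + summary_dp.T_dp + maxcost back_body + 1)"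
  define b where "b = real (48 * (summary_dp.T_dp + summary_dp.T_expand))"
  \<comment> \<open>17 is the 16 of \<open>heavy_bound\<close> plus 1 for rounding up to a natural
    number.\<close>
  define C where "C = 17 + a + b"
  have ab: "0 \<le> a" "0 \<le> b" by (simp_all add: a_def b_def)
  have W_le: "real (W K \<epsilon>) \<le> C * max 1 (real K / \<epsilon> * log 2 (real K / \<epsilon>))" for K \<epsilon>
  proof -
    let ?m = "max 1 (real K / \<epsilon> * log 2 (real K / \<epsilon>))"
    have "real (W K \<epsilon>) \<le> heavy_bound (real K / \<epsilon>) + 1"
      using heavy_bound_ge[of "real K / \<epsilon>"] by (simp add: W_def)
    also have "\<dots> \<le> 17 * ?m" by (simp add: heavy_bound_def)
    also have "\<dots> \<le> C * ?m" using ab by (intro mult_right_mono) (auto simp: C_def)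
    finally show ?thesis .
  qed
  have run: "\<exists>t s. exec summary_prog (input_store T K k \<epsilon>) t s \<and>
       real t \<le> C * (real (node_count T) + real (W K \<epsilon>) * real K ^ 3) \<and>
       output_summary (node_count T) k s \<in> k_summary_trees T k \<and>
       \<bar>entropy T (output_summary (node_count T) k s) - max_entropy T k\<bar> \<le> \<epsilon>"
    if "rooted_tree T" "\<forall>v < node_count T. 0 \<le> weight T v" "0 < total_weight T" "0 < \<epsilon>"
      "1 \<le> k" "k \<le> K" "k \<le> node_count T" for T K k \<epsilon>
  proof -
    note kK = that(6) and kn = that(7)
    interpret summary_dp T k \<epsilon> by unfold_locales (use that in auto)
    obtain t s where ts: "exec summary_prog (input_store T K k \<epsilon>) t s" "t \<le> prog_time" "output_ok s"
      using runs_summary_prog[OF kn] unfolding runs_def by blast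
    have "heavy_bound (real K / \<epsilon>) \<le> real (W K \<epsilon>)"
      unfolding W_def by (rule real_nat_ceiling_ge)
    then have "b * (heavy_bound (real K / \<epsilon>) * real K ^ 3) \<le> b * (real (W K \<epsilon>) * real K ^ 3)"
      using ab by (intro mult_left_mono mult_right_mono) auto
    then have "real t \<le> a * real n + b * (real (W K \<epsilon>) * real K ^ 3)"
      using prog_time_bound[OF kK] of_nat_mono[OF ts(2), where 'a = real] unfolding a_def b_def by linarith
    also have "\<dots> \<le> C * real n + C * (real (W K \<epsilon>) * real K ^ 3)"
      using ab by (intro add_mono mult_right_mono) (auto simp: C_def)
    finally show ?thesis using ts by (auto simp: output_ok_def distrib_left)
  qed
  show ?thesis
    by (rule exI[of _ summary_prog], rule exI[of _ W], rule exI[of _ C]) (use W_le run in blast)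
qed

end
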